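(* There is a universal constant $C>0$ such that, with $$\alpha(r,\varepsilon):=\exp\left(C\,\frac{\log(1/\varepsilon)\,\bigl(r+\sqrt{\log(1/\varepsilon)}\bigr)^4}{\varepsilon^2}\right),$$ the following holds. Let $r\ge 1$, let $0<\varepsilon<1/2$, and let $f:\mathbb{R}^n\to\{0,1\}$ be an unknown Boolean function. There is an algorithm which, given access to independent labeled examples $(x,f(x))$ with $x\sim N(0,I_n)$, runs in time $$n^{O\left(\log(\alpha(r,\varepsilon/2))/\varepsilon^4\right)}=n^{\widetilde{O}(r^4/\varepsilon^6)}$$ and, with probability $9/10$, outputs a hypothesis $h:\mathbb{R}^n\to\{0,1\}$ satisfying $$\mathrm{dist}_{\mathrm{G}}(f,h)\le \mathrm{OPT}_r(f)+\varepsilon.$$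
   Context: For Boolean functions $f,h:\mathbb{R}^n\to\{0,1\}$, $\mathrm{dist}_{\mathrm{G}}(f,h):=\Pr_{g\sim N(0,I_n)}[f(g)\ne h(g)]$. A convex set $K\subseteq\mathbb{R}^n$ has geometric width at most $r$ if $K=\bigcap_{t\in T}\{x: t\cdot x\le r_t\}$ for some $T\subseteq\mathbb{S}^{n-1}$ and reals $|r_t|\le r$. $\mathrm{Conv}(r)$ is the class of indicator functions of convex sets in $\mathbb{R}^n$ of geometric width at most $r$, and $\mathrm{OPT}_r(f):=\inf_{h\in\mathrm{Conv}(r)}\mathrm{dist}_{\mathrm{G}}(f,h)$. The algorithm knows $n,r,\varepsilon$ but not $f$ (the same algorithm works for every $f$). The $O(\cdot)$ hides a universal constant and $\widetilde{O}(\cdot)$ additionally hides polylogarithmic factors.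
   Formalization: For n = 1 the stated time bound equals 1, in which no algorithm can learn even half-lines to accuracy ε; the formal statement takes max(n,2) as the base of the time bound, which changes nothing for n ≥ 2, and assumes n ≥ 1. *)

theory Defs
  imports "HOL-Probability.Probability"
begin

section \<open>Gaussian space\<close>

text \<open>The dimension is an input of the algorithm, so it has to be a term: vectors of
  \<open>\<real>\<^sup>n\<close> are functions on \<^term>\<open>{..<n}\<close>, extended by \<^const>\<open>undefined\<close>.
  Functions to \<open>{0,1}\<close> are predicates.\<close>

type_synonym vect = "nat \<Rightarrow> real"

definition Rn :: "nat \<Rightarrow> vect set" where
  "Rn n = ({..<n} \<rightarrow>\<^sub>E UNIV)"

definition dotp :: "nat \<Rightarrow> vect \<Rightarrow> vect \<Rightarrow> real" where
  "dotp n x y = (\<Sum>i<n. x i * y i)"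

definition gauss :: "nat \<Rightarrow> vect measure" where
  "gauss n = Pi\<^sub>M {..<n} (\<lambda>_. density lborel (\<lambda>x. ennreal (std_normal_density x)))"

definition dist_G :: "nat \<Rightarrow> (vect \<Rightarrow> bool) \<Rightarrow> (vect \<Rightarrow> bool) \<Rightarrow> real" where
  "dist_G n f h = measure (gauss n) {x \<in> space (gauss n). f x \<noteq> h x}"

abbreviation boolean_function :: "nat \<Rightarrow> (vect \<Rightarrow> bool) \<Rightarrow> bool" where
  "boolean_function n f \<equiv> f \<in> measurable (gauss n) (count_space UNIV)"


section \<open>Convex sets of bounded geometric width\<close>

definition convex_Rn :: "nat \<Rightarrow> vect set \<Rightarrow> bool" where
  "convex_Rn n K \<longleftrightarrow> K \<subseteq> Rn n \<and>
     (\<forall>x\<in>K. \<forall>y\<in>K. \<forall>u v. 0 \<le> u \<and> 0 \<le> v \<and> u + v = 1 \<longrightarrow>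
        (\<lambda>i\<in>{..<n}. u * x i + v * y i) \<in> K)"

definition unit_sphere :: "nat \<Rightarrow> vect set" where
  "unit_sphere n = {t \<in> Rn n. L2_set t {..<n} = 1}"

definition geometric_width_le :: "nat \<Rightarrow> real \<Rightarrow> vect set \<Rightarrow> bool" where
  "geometric_width_le n r K \<longleftrightarrow>
     (\<exists>T b. T \<subseteq> unit_sphere n \<and> (\<forall>t\<in>T. \<bar>b t\<bar> \<le> r) \<and>
        K = {x \<in> Rn n. \<forall>t\<in>T. dotp n t x \<le> b t})"

definition Conv :: "nat \<Rightarrow> real \<Rightarrow> (vect \<Rightarrow> bool) set" where
  "Conv n r = {(\<lambda>x. x \<in> K) | K. convex_Rn n K \<and> geometric_width_le n r K}"

text \<open>The infimum is over a nonempty set (\<open>T = {}\<close> is allowed) that is bounded below by 0.\<close>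

definition OPT :: "nat \<Rightarrow> real \<Rightarrow> (vect \<Rightarrow> bool) \<Rightarrow> real" where
  "OPT n r f = (INF h\<in>Conv n r. dist_G n f h)"

definition alpha :: "real \<Rightarrow> real \<Rightarrow> real \<Rightarrow> real" where
  "alpha C r \<epsilon> = exp (C * (ln (1 / \<epsilon>) * (r + sqrt (ln (1 / \<epsilon>))) ^ 4 / \<epsilon>\<^sup>2))"


section \<open>Algorithms: programs for a real RAM with access to labeled examples\<close>

text \<open>The usual unit-cost real RAM, presented as a while language. There are two unbounded
  arrays, one of natural numbers (used for counting and for indirect addressing) and one of
  reals. Reals can be added, subtracted, multiplied, divided and compared, but not rounded;
  naturals can only be added, subtracted (truncating) and compared, so that in \<open>t\<close> steps
  their length grows by \<open>O(t)\<close> bits at most. Program constants are rational.\<close>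

datatype nexp =
    NConst nat
  | NLoad nexp
  | NAdd nexp nexp
  | NSub nexp nexp

datatype rexp =
    RConst rat
  | RLoad nexp
  | RNat nexp
  | RAdd rexp rexp
  | RSub rexp rexp
  | RMul rexp rexp
  | RDiv rexp rexp

datatype bexp =
    NLess nexp nexp
  | RLess rexp rexp
  | BNot bexp
  | BAnd bexp bexp

datatype cmd =
    Skip
  | NStore nexp nexp
  | RStore nexp rexp
  | Draw nexp
  | Seq cmd cmd
  | Ite bexp cmd cmd
  | While bexp cmd

record store =
  nmem :: "nat \<Rightarrow> nat"
  rmem :: "nat \<Rightarrow> real"
  drawn :: nat

primrec nval :: "store \<Rightarrow> nexp \<Rightarrow> nat" where
  "nval s (NConst k) = k"
| "nval s (NLoad a) = nmem s (nval s a)"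
| "nval s (NAdd a b) = nval s a + nval s b"
| "nval s (NSub a b) = nval s a - nval s b"

primrec rval :: "store \<Rightarrow> rexp \<Rightarrow> real" where
  "rval s (RConst q) = of_rat q"
| "rval s (RLoad a) = rmem s (nval s a)"
| "rval s (RNat a) = real (nval s a)"
| "rval s (RAdd a b) = rval s a + rval s b"
| "rval s (RSub a b) = rval s a - rval s b"
| "rval s (RMul a b) = rval s a * rval s b"
| "rval s (RDiv a b) = rval s a / rval s b"

primrec bval :: "store \<Rightarrow> bexp \<Rightarrow> bool" where
  "bval s (NLess a b) \<longleftrightarrow> nval s a < nval s b"
| "bval s (RLess a b) \<longleftrightarrow> rval s a < rval s b"
| "bval s (BNot a) \<longleftrightarrow> \<not> bval s a"
| "bval s (BAnd a b) \<longleftrightarrow> bval s a \<and> bval s b"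

primrec ncost :: "nexp \<Rightarrow> nat" where
  "ncost (NConst k) = 1"
| "ncost (NLoad a) = 1 + ncost a"
| "ncost (NAdd a b) = 1 + ncost a + ncost b"
| "ncost (NSub a b) = 1 + ncost a + ncost b"

primrec rcost :: "rexp \<Rightarrow> nat" where
  "rcost (RConst q) = 1"
| "rcost (RLoad a) = 1 + ncost a"
| "rcost (RNat a) = 1 + ncost a"
| "rcost (RAdd a b) = 1 + rcost a + rcost b"
| "rcost (RSub a b) = 1 + rcost a + rcost b"
| "rcost (RMul a b) = 1 + rcost a + rcost b"
| "rcost (RDiv a b) = 1 + rcost a + rcost b"

primrec bcost :: "bexp \<Rightarrow> nat" where
  "bcost (NLess a b) = 1 + ncost a + ncost b"
| "bcost (RLess a b) = 1 + rcost a + rcost b"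
| "bcost (BNot a) = 1 + bcost a"
| "bcost (BAnd a b) = 1 + bcost a + bcost b"

text \<open>Writing an example \<open>(x,y)\<close> to address \<open>k\<close>: the coordinates of \<open>x\<close> go to the real cells
  \<open>k,\<dots>,k+n-1\<close> and the label to cell \<open>k+n\<close>.\<close>

definition put_example :: "nat \<Rightarrow> nat \<Rightarrow> vect \<times> bool \<Rightarrow> (nat \<Rightarrow> real) \<Rightarrow> (nat \<Rightarrow> real)" where
  "put_example n k e m =
     (\<lambda>j. if k \<le> j \<and> j < k + n then fst e (j - k)
          else if j = k + n then of_bool (snd e)
          else m j)"

text \<open>\<open>exec n S c s t s'\<close>: with examples from \<open>\<real>\<^sup>n\<close> supplied by the stream \<open>S\<close>, the program
  \<open>c\<close> started in \<open>s\<close> halts in \<open>s'\<close> after exactly \<open>t\<close> time units. Every operation costs one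
  unit; drawing an example also costs one unit per real number received.\<close>

inductive exec ::
  "nat \<Rightarrow> (nat \<Rightarrow> vect \<times> bool) \<Rightarrow> cmd \<Rightarrow> store \<Rightarrow> nat \<Rightarrow> store \<Rightarrow> bool"
  for n :: nat and S :: "nat \<Rightarrow> vect \<times> bool"
where
  Skip: "exec n S Skip s 1 s"
| NStore: "exec n S (NStore a e) s (1 + ncost a + ncost e)
             (s\<lparr>nmem := (nmem s)(nval s a := nval s e)\<rparr>)"
| RStore: "exec n S (RStore a e) s (1 + ncost a + rcost e)
             (s\<lparr>rmem := (rmem s)(nval s a := rval s e)\<rparr>)"
| Draw: "exec n S (Draw a) s (1 + ncost a + (n + 1))
           (s\<lparr>rmem := put_example n (nval s a) (S (drawn s)) (rmem s), drawn := drawn s + 1\<rparr>)"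
| Seq: "exec n S c s t s' \<Longrightarrow> exec n S d s' t' s'' \<Longrightarrow> exec n S (Seq c d) s (t + t') s''"
| IteTrue: "bval s b \<Longrightarrow> exec n S c s t s' \<Longrightarrow> exec n S (Ite b c d) s (1 + bcost b + t) s'"
| IteFalse: "\<not> bval s b \<Longrightarrow> exec n S d s t s' \<Longrightarrow> exec n S (Ite b c d) s (1 + bcost b + t) s'"
| WhileFalse: "\<not> bval s b \<Longrightarrow> exec n S (While b c) s (1 + bcost b) s"
| WhileTrue: "bval s b \<Longrightarrow> exec n S c s t s' \<Longrightarrow> exec n S (While b c) s' t' s'' \<Longrightarrow>
                exec n S (While b c) s (1 + bcost b + t + t') s''"

inductive_cases exec_SkipE: "exec n S Skip s t s'"
  and exec_NStoreE: "exec n S (NStore a e) s t s'"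
  and exec_RStoreE: "exec n S (RStore a e) s t s'"
  and exec_DrawE: "exec n S (Draw a) s t s'"
  and exec_SeqE: "exec n S (Seq c d) s t s'"
  and exec_IteE: "exec n S (Ite b c d) s t s'"
  and exec_WhileE: "exec n S (While b c) s t s'"

lemma exec_deterministic:
  "exec n S c s t s' \<Longrightarrow> exec n S c s u s'' \<Longrightarrow> u = t \<and> s'' = s'"
proof (induction arbitrary: u s'' rule: exec.induct)
  case (Seq c s t s' d t' s3)
  from Seq.prems obtain t1 r1 t2 where "exec n S c s t1 r1" "exec n S d r1 t2 s''" "u = t1 + t2"
    by (rule exec_SeqE)
  then show ?case using Seq.IH by metis
next
  case (IteTrue s b c t s' d)
  from IteTrue.prems obtain t1 where "exec n S c s t1 s''" "u = 1 + bcost b + t1"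
    by (rule exec_IteE) (use IteTrue.hyps in simp_all)
  then show ?case using IteTrue.IH by metis
next
  case (IteFalse s b d t s' c)
  from IteFalse.prems obtain t1 where "exec n S d s t1 s''" "u = 1 + bcost b + t1"
    by (rule exec_IteE) (use IteFalse.hyps in simp_all)
  then show ?case using IteFalse.IH by metis
next
  case (WhileFalse s b c)
  from WhileFalse.prems show ?case
    by (rule exec_WhileE) (use WhileFalse.hyps in simp_all)
next
  case (WhileTrue s b c t s' t' s3)
  from WhileTrue.prems obtain t1 r1 t2
    where "exec n S c s t1 r1" "exec n S (While b c) r1 t2 s''" "u = 1 + bcost b + t1 + t2"
    by (rule exec_WhileE) (use WhileTrue.hyps in simp_all)
  then show ?case using WhileTrue.IH by metis
qed (auto elim: exec_SkipE exec_NStoreE exec_RStoreE exec_DrawE)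


section \<open>Learning from random examples\<close>

definition sample_space :: "nat \<Rightarrow> (nat \<Rightarrow> vect) measure" where
  "sample_space n = Pi\<^sub>M UNIV (\<lambda>_. gauss n)"

definition labeled_by :: "(vect \<Rightarrow> bool) \<Rightarrow> (nat \<Rightarrow> vect) \<Rightarrow> nat \<Rightarrow> vect \<times> bool" where
  "labeled_by f \<omega> i = (\<omega> i, f (\<omega> i))"

definition initial_store :: "nat \<Rightarrow> real \<Rightarrow> real \<Rightarrow> store" where
  "initial_store n r \<epsilon> =
     \<lparr>nmem = (\<lambda>_. 0)(0 := n), rmem = (\<lambda>_. 0)(0 := r, 1 := \<epsilon>), drawn = 0\<rparr>"

definition trained ::
  "nat \<Rightarrow> real \<Rightarrow> real \<Rightarrow> (vect \<Rightarrow> bool) \<Rightarrow> (nat \<Rightarrow> vect) \<Rightarrow> cmd \<Rightarrow> nat \<Rightarrow> store \<Rightarrow> bool" where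
  "trained n r \<epsilon> f \<omega> train t s \<longleftrightarrow>
     exec n (labeled_by f \<omega>) train (initial_store n r \<epsilon>) t s"

text \<open>The hypothesis output by a learner is represented by the final store \<open>s\<close> of its training
  program; a second fixed program evaluates it. The query point is loaded into the real cells
  \<open>0,\<dots>,n-1\<close>, and the predicted label is 1 iff natural cell \<open>0\<close> is nonzero at the end. During
  evaluation there is no access to examples: the stream is the constant zero one.\<close>

definition predicts :: "nat \<Rightarrow> cmd \<Rightarrow> store \<Rightarrow> vect \<Rightarrow> nat \<Rightarrow> bool \<Rightarrow> bool" where
  "predicts n predict s x t y \<longleftrightarrow>
     (\<exists>s'. exec n (\<lambda>_. (\<lambda>_. 0, False)) predict
              (s\<lparr>rmem := (\<lambda>j. if j < n then x j else rmem s j)\<rparr>) t s' \<and>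
            y = (nmem s' 0 \<noteq> 0))"

definition hypothesis :: "nat \<Rightarrow> cmd \<Rightarrow> store \<Rightarrow> vect \<Rightarrow> bool" where
  "hypothesis n predict s x \<longleftrightarrow> (\<exists>t. predicts n predict s x t True)"

text \<open>Worst-case running time, for every sequence of examples and every query point; the time
  to evaluate the hypothesis is subject to the same bound.\<close>

definition runs_in_time ::
  "nat \<Rightarrow> real \<Rightarrow> real \<Rightarrow> (vect \<Rightarrow> bool) \<Rightarrow> cmd \<Rightarrow> cmd \<Rightarrow> real \<Rightarrow> bool" where
  "runs_in_time n r \<epsilon> f train predict B \<longleftrightarrow>
     (\<forall>\<omega>\<in>space (sample_space n). \<exists>t s. trained n r \<epsilon> f \<omega> train t s \<and> real t \<le> B \<and>
        (\<forall>x\<in>space (gauss n). \<exists>t' y. predicts n predict s x t' y \<and> real t' \<le> B))"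

text \<open>\<^const>\<open>measure\<close> is 0 on non-measurable sets; hence the measurability requirement
  on the hypothesis.\<close>

definition success ::
  "nat \<Rightarrow> real \<Rightarrow> real \<Rightarrow> (vect \<Rightarrow> bool) \<Rightarrow> cmd \<Rightarrow> cmd \<Rightarrow> (nat \<Rightarrow> vect) set" where
  "success n r \<epsilon> f train predict =
     {\<omega> \<in> space (sample_space n). \<exists>t s. trained n r \<epsilon> f \<omega> train t s \<and>
        boolean_function n (hypothesis n predict s) \<and>
        dist_G n f (hypothesis n predict s) \<le> OPT n r f + \<epsilon>}"

end

theory Submission
  imports Defs "HOL-Computational_Algebra.Polynomial"
begin

text \<open>Let \<open>T\<^sub>\<rho>\<close> be the Ornstein-Uhlenbeck operator and \<open>R = r / \<epsilon>\<close>. Split the outside of a polytope of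
  width \<open>r\<close> into cells according to the most violated facet. By a Gaussian translation argument
  the mass of a cell near its facet is controlled by that of the whole cell, and hence
  \<open>T\<^sub>\<rho>\<close> moves the indicator of the polytope by only \<open>O(r \<surd>(1 - \<rho>\<^sup>2))\<close> in \<open>L\<^sup>1\<close>, whatever the number
  of facets. Truncating the Hermite expansion of \<open>T\<^sub>\<rho>\<close> at degree \<open>d\<close> costs \<open>O(\<rho>\<^sup>d)\<close>, so
  that some polynomial of degree \<open>d = O(R\<^sup>3)\<close> is \<open>O(\<epsilon>)\<close>-close to the indicator in \<open>L\<^sup>1\<close>; its norm in the
  reproducing kernel Hilbert space of \<open>(1 + x \<bullet> u)\<^sup>d\<close> is at most \<open>(n + d)\<^bsup>O(d)\<^esup>\<close>. Stochastic
  subgradient descent for the absolute loss with this kernel therefore competes with every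
  such polynomial on \<open>(n + d)\<^bsup>O(d)\<^esup>\<close> samples. Rounding the average iterate at the \<open>d\<close> thresholds
  \<open>j / d\<close>, each on a fresh run, gives candidates whose errors average to at most
  \<open>OPT + O(\<epsilon>)\<close>, and validation picks a good one. Since \<open>ln \<alpha> / \<epsilon>\<^sup>4 \<ge> R\<^sup>4\<close> already with \<open>C = 1\<close>,
  the time \<open>(n + d)\<^bsup>O(d)\<^esup>\<close> is within the bound.\<close>


section \<open>Hermite polynomials and the Mehler kernel\<close>

text \<open>For the damping \<open>\<rho>^d\<close> alone a degree of order
  \<open>R^2 * ln (1 / \<epsilon>)\<close> would do. The cube comes from estimating
  \<open>exp (- x)\<close> by \<open>1 / x\<close>, which avoids a logarithm; the budget
  \<open>R^4\<close> still leaves one factor \<open>R\<close>, and this pays for \<open>ln d\<close>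
  in \<open>ln (n + d)\<close>. Subgradient descent is preferred to linear programming because its
  iterates are explicit kernel sums: a step appends one coefficient, so the learner is a short while
  program, and a norm defined by duality means that no feature space has to be built. One run is not
  enough: Markov's inequality lets a single candidate come within \<open>3 * \<epsilon> / 4\<close>
  of the optimum only with probability of order \<epsilon>, and the many independent runs repair
  this. The machine shapes the parameters as well. Its naturals have no product and its reals cannot
  be rounded, so the degree is found by counting upwards, and the sample size is a square
  \<open>U * U\<close> with which a counter can be compared as a real number.\<close>

abbreviation gauss1 :: "real measure" where
  "gauss1 \<equiv> density lborel (\<lambda>x. ennreal (std_normal_density x))"

lemma prob_space_gauss1: "prob_space gauss1"
  by (rule prob_space_normal_density) simp

lemma integrable_gauss1_iff:
  "g \<in> borel_measurable borel \<Longrightarrow>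
    integrable gauss1 g \<longleftrightarrow> integrable lborel (\<lambda>x. std_normal_density x * g x)"
  for g :: "real \<Rightarrow> real"
  by (subst integrable_density) auto

lemma integral_gauss1:
  "g \<in> borel_measurable borel \<Longrightarrow>
    (\<integral>x. g x \<partial>gauss1) = (\<integral>x. std_normal_density x * g x \<partial>lborel)"
  for g :: "real \<Rightarrow> real"
  by (subst integral_density) auto

lemma integrable_gauss1_power [simp]: "integrable gauss1 (\<lambda>x. x ^ k)"
  by (simp add: integrable_gauss1_iff integrable_std_normal_moment)

lemma borel_measurable_poly [measurable]: "poly p \<in> borel_measurable borel"
  for p :: "real poly"
  by (intro borel_measurable_continuous_onI continuous_on_poly continuous_on_id)

lemma integrable_gauss1_poly [simp]: "integrable gauss1 (poly p)"
  unfolding poly_altdef by (intro Bochner_Integration.integrable_sum integrable_mult_right) simp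

lemma integrable_gauss1_mult_poly: "integrable gauss1 (\<lambda>x. x * poly p x)"
proof -
  have "(\<lambda>x. x * poly p x) = poly ([:0, 1:] * p)" by (simp add: fun_eq_iff)
  then show ?thesis by (metis integrable_gauss1_poly)
qed

section \<open>Gaussian moments and integration by parts for polynomials\<close>

lemma gauss1_moment_even: "(\<integral>x. x ^ (2 * k) \<partial>gauss1) = fact (2 * k) / (2 ^ k * fact k)"
  by (simp add: integral_gauss1 integral_std_normal_moment_even)

lemma gauss1_moment_Suc_Suc:
  "(\<integral>x. x ^ Suc (Suc k) \<partial>gauss1) = real (Suc k) * (\<integral>x. x ^ k \<partial>gauss1)"
proof (cases "even k")
  case True
  then obtain m where k: "k = 2 * m" by auto
  have "Suc (Suc k) = 2 * Suc m" using k by simp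
  then have "(\<integral>x. x ^ Suc (Suc k) \<partial>gauss1) = fact (2 * Suc m) / (2 ^ Suc m * fact (Suc m))"
    by (simp only: gauss1_moment_even)
  also have "\<dots> = (2 * real (Suc m) * (real (Suc k) * fact (2 * m))) / (2 * real (Suc m) * (2 ^ m * fact m))"
    using k by (simp add: algebra_simps)
  also have "\<dots> = real (Suc k) * (fact (2 * m) / (2 ^ m * fact m))"
    by (subst mult_divide_mult_cancel_left) simp_all
  finally show ?thesis by (simp only: k gauss1_moment_even)
next
  case False
  then obtain m where k: "k = 2 * m + 1" by (elim oddE)
  have "Suc (Suc k) = 2 * Suc m + 1" using k by simp
  then have "(\<integral>x. x ^ Suc (Suc k) \<partial>gauss1) = 0"
    by (simp only: integral_gauss1[OF borel_measurable_power[OF measurable_ident_sets[OF refl]]]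
        integral_std_normal_moment_odd)
  moreover have "(\<integral>x. x ^ k \<partial>gauss1) = 0"
    by (simp only: k integral_gauss1[OF borel_measurable_power[OF measurable_ident_sets[OF refl]]]
        integral_std_normal_moment_odd)
  ultimately show ?thesis by simp
qed

lemma gauss1_moment_1: "(\<integral>x. x \<partial>gauss1) = 0"
  using integral_std_normal_moment_odd[of 0] by (simp add: integral_gauss1)

lemma poly_eq_sum_atMost: "degree p \<le> N \<Longrightarrow> poly p x = (\<Sum>i\<le>N. coeff p i * x ^ i)"
  for x :: "'a :: comm_semiring_1"
  unfolding poly_altdef by (rule sum.mono_neutral_left) (auto simp: coeff_eq_0)

text \<open>By linearity this is the moment recursion applied to each coefficient; the constant
  coefficient drops out because the first moment is 0. No boundary terms arise.\<close>

lemma gauss1_integral_by_parts: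
  "(\<integral>x. x * poly p x \<partial>gauss1) = (\<integral>x. poly (pderiv p) x \<partial>gauss1)"
proof -
  define N where "N = Suc (degree p)"
  have 1: "poly p x = (\<Sum>i\<le>N. coeff p i * x ^ i)" for x
    by (rule poly_eq_sum_atMost) (simp add: N_def)
  have 2: "poly (pderiv p) x = (\<Sum>i<N. coeff (pderiv p) i * x ^ i)" for x
  proof -
    have "poly (pderiv p) x = (\<Sum>i\<le>N. coeff (pderiv p) i * x ^ i)"
      by (rule poly_eq_sum_atMost) (simp add: N_def degree_pderiv)
    also have "\<dots> = (\<Sum>i<N. coeff (pderiv p) i * x ^ i)"
      by (simp add: lessThan_Suc_atMost[symmetric] coeff_pderiv N_def coeff_eq_0)
    finally show ?thesis .
  qed
  have "(\<integral>x. x * poly p x \<partial>gauss1) = (\<integral>x. (\<Sum>i\<le>N. coeff p i * x ^ Suc i) \<partial>gauss1)"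
    by (simp add: 1 sum_distrib_left mult_ac)
  also have "\<dots> = (\<Sum>i\<le>N. coeff p i * (\<integral>x. x ^ Suc i \<partial>gauss1))"
    using integrable_gauss1_power[of "Suc _"] by (subst Bochner_Integration.integral_sum) simp_all
  also have "\<dots> = (\<Sum>i<N. coeff p (Suc i) * (\<integral>x. x ^ Suc (Suc i) \<partial>gauss1))"
    by (simp only: lessThan_Suc_atMost[symmetric] sum.lessThan_Suc_shift)
       (simp add: gauss1_moment_1)
  also have "\<dots> = (\<Sum>i<N. coeff (pderiv p) i * (\<integral>x. x ^ i \<partial>gauss1))"
    by (simp only: gauss1_moment_Suc_Suc coeff_pderiv) (simp add: mult_ac)
  also have "\<dots> = (\<integral>x. (\<Sum>i<N. coeff (pderiv p) i * x ^ i) \<partial>gauss1)"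
    by (subst Bochner_Integration.integral_sum) simp_all
  finally show ?thesis by (simp add: 2)
qed

section \<open>The probabilists' Hermite polynomials and their orthogonality\<close>

fun hermite :: "nat \<Rightarrow> real poly" where
  "hermite 0 = 1"
| "hermite (Suc 0) = [:0, 1:]"
| "hermite (Suc (Suc k)) = [:0, 1:] * hermite (Suc k) - smult (real (Suc k)) (hermite k)"

lemma hermite_Suc: "hermite (Suc k) = [:0, 1:] * hermite k - smult (real k) (hermite (k - 1))"
  by (cases k) simp_all

lemma pderiv_hermite: "pderiv (hermite (Suc k)) = smult (real (Suc k)) (hermite k)"
proof (induction k rule: less_induct)
  case (less k)
  show ?case
  proof (cases k)
    case 0
    then show ?thesis by (simp add: pderiv_pCons)
  next
    case (Suc m)
    have IH: "pderiv (hermite (Suc m)) = smult (real (Suc m)) (hermite m)"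
      using less Suc by simp
    have IH': "pderiv (hermite m) = smult (real m) (hermite (m - 1))"
      using less[of "m - 1"] Suc by (cases m) auto
    have "pderiv (hermite (Suc k)) =
        hermite (Suc m) + smult (real (Suc m)) ([:0, 1:] * hermite m - smult (real m) (hermite (m - 1)))"
      by (simp add: Suc pderiv_diff pderiv_mult pderiv_smult IH IH' pderiv_pCons smult_diff_right mult_ac)
    also have "[:0, 1:] * hermite m - smult (real m) (hermite (m - 1)) = hermite (Suc m)"
      by (rule hermite_Suc[symmetric])
    also have "hermite (Suc m) + smult (real (Suc m)) (hermite (Suc m)) = smult (real (Suc k)) (hermite k)"
      using smult_add_left[of 1 "real (Suc m)" "hermite (Suc m)"] by (simp add: Suc)
    finally show ?thesis .
  qed
qed

lemma pderiv_hermite': "pderiv (hermite k) = smult (real k) (hermite (k - 1))"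
  by (cases k) (simp_all add: pderiv_hermite del: hermite.simps(3))

text \<open>Integration by parts trades the factor \<open>x\<close> in
  \<open>x H_j - j H_(j-1)\<close> for a derivative. Of the two terms of the product rule, the one
  that differentiates \<open>H_j\<close> cancels the second summand, and the other lowers
  \<open>H_k\<close>.\<close>

lemma hermite_orthogonal_step:
  "(\<integral>x. poly (hermite (Suc j)) x * poly (hermite k) x \<partial>gauss1) =
    real k * (\<integral>x. poly (hermite j) x * poly (hermite (k - 1)) x \<partial>gauss1)"
proof -
  have eq: "poly (hermite (Suc j)) x * poly (hermite k) x =
      x * poly (hermite j * hermite k) x - real j * (poly (hermite (j - 1) * hermite k) x)" for x
    by (simp add: hermite_Suc algebra_simps)
  note i1 = integrable_gauss1_mult_poly
  have "(\<integral>x. poly (hermite (Suc j)) x * poly (hermite k) x \<partial>gauss1) =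
      (\<integral>x. poly (pderiv (hermite j * hermite k)) x \<partial>gauss1)
      - real j * (\<integral>x. poly (hermite (j - 1) * hermite k) x \<partial>gauss1)"
    unfolding eq by (subst Bochner_Integration.integral_diff)
      (auto simp del: poly_mult simp: i1 gauss1_integral_by_parts)
  also have "pderiv (hermite j * hermite k) =
      smult (real k) (hermite j * hermite (k - 1)) + smult (real j) (hermite (j - 1) * hermite k)"
    by (simp add: pderiv_mult pderiv_hermite' mult_ac)
  also have "(\<integral>x. poly \<dots> x \<partial>gauss1) = real k * (\<integral>x. poly (hermite j * hermite (k - 1)) x \<partial>gauss1)
      + real j * (\<integral>x. poly (hermite (j - 1) * hermite k) x \<partial>gauss1)"
    by (simp del: poly_mult)
  finally show ?thesis by simp
qed

lemma hermite_orthogonal: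
  "(\<integral>x. poly (hermite j) x * poly (hermite k) x \<partial>gauss1) = (if j = k then fact k else 0)"
proof (induction j arbitrary: k)
  case 0
  interpret prob_space gauss1 by (rule prob_space_gauss1)
  show ?case
  proof (cases k)
    case 0
    then show ?thesis using prob_space by simp
  next
    case (Suc m)
    have "(\<integral>x. poly (hermite (Suc m)) x * poly (hermite 0) x \<partial>gauss1) = 0"
      by (simp add: hermite_orthogonal_step del: hermite.simps)
    then show ?thesis using Suc by (simp add: mult.commute)
  qed
next
  case (Suc j)
  show ?case
    by (cases k) (simp_all add: hermite_orthogonal_step Suc del: hermite.simps)
qed

definition hermite_fun :: "nat \<Rightarrow> real \<Rightarrow> real" where
  "hermite_fun k x = poly (hermite k) x / sqrt (fact k)"

lemma borel_measurable_hermite_fun [measurable]: "hermite_fun k \<in> borel_measurable borel"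
  unfolding hermite_fun_def by measurable

lemma integrable_hermite_fun_mult [simp]:
  "integrable gauss1 (\<lambda>x. hermite_fun j x * hermite_fun k x)"
  using integrable_divide[OF integrable_gauss1_poly[of "hermite j * hermite k"],
      of "sqrt (fact j) * sqrt (fact k)"]
  by (simp add: hermite_fun_def)

lemma integral_hermite_fun_mult:
  "(\<integral>x. hermite_fun j x * hermite_fun k x \<partial>gauss1) = (if j = k then 1 else 0)"
  by (simp add: hermite_fun_def hermite_orthogonal)

text \<open>The density of the normal law with mean \<open>\<rho> * x\<close> and variance
  \<open>1 - \<rho>^2\<close>, taken relative to the standard Gaussian. Integrating \<open>g\<close>
  against it averages \<open>g\<close> over \<open>\<rho> * x + \<sigma> * z\<close>, and in this
  relative form it is symmetric in its two arguments.\<close>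

definition mehler :: "real \<Rightarrow> real \<Rightarrow> real \<Rightarrow> real" where
  "mehler \<rho> x u = exp (- (\<rho>\<^sup>2 * x\<^sup>2 - 2 * \<rho> * x * u + \<rho>\<^sup>2 * u\<^sup>2) / (2 * (1 - \<rho>\<^sup>2))) / sqrt (1 - \<rho>\<^sup>2)"

lemma mehler_commute: "mehler \<rho> x u = mehler \<rho> u x"
  by (simp add: mehler_def algebra_simps)

lemma mehler_pos: "0 < \<rho> \<Longrightarrow> \<rho> < 1 \<Longrightarrow> 0 < mehler \<rho> x u"
  by (simp add: mehler_def power_less_one_iff)

lemma borel_measurable_mehler [measurable (raw)]:
  assumes [measurable]: "f \<in> borel_measurable M" "g \<in> borel_measurable M"
  shows "(\<lambda>w. mehler \<rho> (f w) (g w)) \<in> borel_measurable M"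
  unfolding mehler_def by measurable

lemma mehler_mult_density:
  assumes "0 < \<rho>" "\<rho> < 1"
  shows "std_normal_density u * mehler \<rho> x u = normal_density (\<rho> * x) (sqrt (1 - \<rho>\<^sup>2)) u"
proof -
  define q where "q = 1 - \<rho>\<^sup>2"
  have q: "q > 0" "\<rho>\<^sup>2 = 1 - q" using assms by (simp_all add: q_def power_less_one_iff)
  have "- u\<^sup>2 / 2 + - (\<rho>\<^sup>2 * x\<^sup>2 - 2 * \<rho> * x * u + \<rho>\<^sup>2 * u\<^sup>2) / (2 * q) = - (u - \<rho> * x)\<^sup>2 / (2 * q)"
    unfolding power2_diff power_mult_distrib q(2) using q(1) by (simp add: field_simps)
  then show ?thesis
    using q(1) unfolding mehler_def normal_density_def q_def[symmetric]
    by (simp add: exp_add[symmetric] real_sqrt_mult)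
qed

lemma normal_density_affine_std:
  assumes "0 < \<sigma>" shows "\<sigma> * normal_density \<mu> \<sigma> (\<mu> + \<sigma> * z) = std_normal_density z"
  using assms by (simp add: normal_density_def power_mult_distrib real_sqrt_mult)

lemma
  fixes g :: "real \<Rightarrow> real"
  assumes "0 < \<rho>" "\<rho> < 1" and [measurable]: "g \<in> borel_measurable borel"
  defines "\<sigma> \<equiv> sqrt (1 - \<rho>\<^sup>2)"
  shows integrable_mehler_iff:
      "integrable gauss1 (\<lambda>u. mehler \<rho> x u * g u) \<longleftrightarrow> integrable gauss1 (\<lambda>z. g (\<rho> * x + \<sigma> * z))"
    and integral_mehler:
      "(\<integral>u. mehler \<rho> x u * g u \<partial>gauss1) = (\<integral>z. g (\<rho> * x + \<sigma> * z) \<partial>gauss1)"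
proof -
  have \<sigma>: "\<sigma> > 0" using assms by (simp add: \<sigma>_def power_less_one_iff)
  have eq: "std_normal_density u * (mehler \<rho> x u * g u) = normal_density (\<rho> * x) \<sigma> u * g u" for u
    using mehler_mult_density[OF assms(1,2), of u x] by (simp add: \<sigma>_def mult.assoc[symmetric])
  have eq2: "\<sigma> * (normal_density (\<rho> * x) \<sigma> (\<rho> * x + \<sigma> * z) * g (\<rho> * x + \<sigma> * z)) =
      std_normal_density z * g (\<rho> * x + \<sigma> * z)" for z
    using normal_density_affine_std[OF \<sigma>, of "\<rho> * x" z] by (simp add: mult.assoc[symmetric])
  have "integrable gauss1 (\<lambda>u. mehler \<rho> x u * g u) \<longleftrightarrow>
      integrable lborel (\<lambda>u. normal_density (\<rho> * x) \<sigma> u * g u)"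
    by (subst integrable_gauss1_iff) (auto simp: eq)
  also have "\<dots> \<longleftrightarrow> integrable lborel
      (\<lambda>z. normal_density (\<rho> * x) \<sigma> (\<rho> * x + \<sigma> * z) * g (\<rho> * x + \<sigma> * z))"
    using \<sigma> by (intro lborel_integrable_real_affine_iff[symmetric]) simp
  also have "\<dots> \<longleftrightarrow> integrable lborel
      (\<lambda>z. \<sigma> * (normal_density (\<rho> * x) \<sigma> (\<rho> * x + \<sigma> * z) * g (\<rho> * x + \<sigma> * z)))"
    using \<sigma> by simp
  also have "\<dots> \<longleftrightarrow> integrable gauss1 (\<lambda>z. g (\<rho> * x + \<sigma> * z))"
    unfolding eq2 by (subst integrable_gauss1_iff) auto
  finally show "integrable gauss1 (\<lambda>u. mehler \<rho> x u * g u) \<longleftrightarrow>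
      integrable gauss1 (\<lambda>z. g (\<rho> * x + \<sigma> * z))" .
  have "(\<integral>u. mehler \<rho> x u * g u \<partial>gauss1) = (\<integral>u. normal_density (\<rho> * x) \<sigma> u * g u \<partial>lborel)"
    by (subst integral_gauss1) (auto simp: eq)
  also have "\<dots> = \<sigma> * (\<integral>z. normal_density (\<rho> * x) \<sigma> (\<rho> * x + \<sigma> * z) * g (\<rho> * x + \<sigma> * z) \<partial>lborel)"
    using \<sigma> by (subst lborel_integral_real_affine[where c = \<sigma> and t = "\<rho> * x"]) simp_all
  also have "\<dots> = (\<integral>z. \<sigma> * (normal_density (\<rho> * x) \<sigma> (\<rho> * x + \<sigma> * z) * g (\<rho> * x + \<sigma> * z)) \<partial>lborel)"
    by simp
  also have "\<dots> = (\<integral>z. g (\<rho> * x + \<sigma> * z) \<partial>gauss1)"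
    unfolding eq2 by (subst integral_gauss1) auto
  finally show "(\<integral>u. mehler \<rho> x u * g u \<partial>gauss1) = (\<integral>z. g (\<rho> * x + \<sigma> * z) \<partial>gauss1)" .
qed

text \<open>The induction follows the three-term recurrence. The summand with the factor
  \<open>z\<close> is integrated by parts and returns \<open>\<sigma>^2\<close> times the term two
  steps back; as \<open>\<sigma>^2 - 1 = - \<rho>^2\<close>, the powers of \<rho> match up. Thus the
  Hermite polynomials are eigenfunctions of the Mehler kernel.\<close>

lemma gauss1_hermite_affine:
  assumes "0 < \<rho>" "\<rho> < 1"
  shows "(\<integral>z. poly (hermite k) (\<rho> * x + sqrt (1 - \<rho>\<^sup>2) * z) \<partial>gauss1) = \<rho> ^ k * poly (hermite k) x"
proof (induction k rule: hermite.induct)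
  interpret prob_space gauss1 by (rule prob_space_gauss1)
  define \<sigma> where "\<sigma> = sqrt (1 - \<rho>\<^sup>2)"
  have \<sigma>2: "\<sigma> * \<sigma> = 1 - \<rho>\<^sup>2" using assms by (simp add: \<sigma>_def power_le_one)
  have comp: "poly p (\<rho> * x + \<sigma> * z) = poly (pcompose p [:\<rho> * x, \<sigma>:]) z" for p z
    by (simp add: poly_pcompose mult.commute)
  { case 1 show ?case using prob_space by simp }
  { case 2
    have "integrable gauss1 (\<lambda>z. z)" using integrable_gauss1_power[of 1] by simp
    then show ?case using prob_space by (simp add: gauss1_moment_1) }
  { case (3 k)
    note IH = 3[folded \<sigma>_def]
    let ?A = "\<lambda>k. \<integral>z. poly (hermite k) (\<rho> * x + \<sigma> * z) \<partial>gauss1"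
    let ?h = "pcompose (hermite (Suc k)) [:\<rho> * x, \<sigma>:]"
    note i1 = integrable_gauss1_mult_poly
    have i2: "integrable gauss1 (\<lambda>z. poly p (\<rho> * x + \<sigma> * z))" for p
      by (simp add: comp)
    have "?A (Suc (Suc k)) =
        (\<integral>z. \<rho> * x * poly (hermite (Suc k)) (\<rho> * x + \<sigma> * z) + \<sigma> * (z * poly ?h z)
          - real (Suc k) * poly (hermite k) (\<rho> * x + \<sigma> * z) \<partial>gauss1)"
      by (rule Bochner_Integration.integral_cong) (simp_all add: comp[symmetric] algebra_simps)
    also have "\<dots> = \<rho> * x * ?A (Suc k) + \<sigma> * (\<integral>z. z * poly ?h z \<partial>gauss1) - real (Suc k) * ?A k"
      by (simp add: i1 i2)
    also have "(\<integral>z. z * poly ?h z \<partial>gauss1) = \<sigma> * real (Suc k) * ?A k"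
    proof -
      have "pderiv ?h = smult (\<sigma> * real (Suc k)) (pcompose (hermite k) [:\<rho> * x, \<sigma>:])"
        by (simp add: pderiv_pcompose pderiv_hermite pcompose_smult pderiv_pCons mult.commute
              del: hermite.simps of_nat_Suc)
      then show ?thesis
        by (simp add: gauss1_integral_by_parts comp del: of_nat_Suc)
    qed
    also have "\<rho> * x * ?A (Suc k) + \<sigma> * (\<sigma> * real (Suc k) * ?A k) - real (Suc k) * ?A k =
        \<rho> * x * ?A (Suc k) + (\<sigma> * \<sigma> - 1) * (real (Suc k) * ?A k)"
      by (simp add: algebra_simps)
    also have "\<dots> = \<rho> ^ Suc (Suc k) * poly (hermite (Suc (Suc k))) x"
      unfolding \<sigma>2 IH by (simp add: algebra_simps power2_eq_square)
    finally show ?case by (simp only: \<sigma>_def) }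
qed

lemma integrable_mehler_poly:
  assumes "0 < \<rho>" "\<rho> < 1"
  shows "integrable gauss1 (\<lambda>u. mehler \<rho> x u * poly p u)"
proof -
  have "poly p (\<rho> * x + \<sigma> * z) = poly (pcompose p [:\<rho> * x, \<sigma>:]) z" for \<sigma> z
    by (simp add: poly_pcompose mult.commute)
  then show ?thesis by (simp add: integrable_mehler_iff[OF assms])
qed

lemma integrable_mehler_hermite_fun:
  assumes "0 < \<rho>" "\<rho> < 1"
  shows "integrable gauss1 (\<lambda>u. mehler \<rho> x u * hermite_fun k u)"
  using integrable_mehler_poly[OF assms, of x "hermite k"] by (simp add: hermite_fun_def)

lemma integral_mehler_hermite_fun:
  assumes "0 < \<rho>" "\<rho> < 1"
  shows "(\<integral>u. mehler \<rho> x u * hermite_fun k u \<partial>gauss1) = \<rho> ^ k * hermite_fun k x"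
proof -
  have "(\<integral>u. mehler \<rho> x u * poly (hermite k) u \<partial>gauss1) = \<rho> ^ k * poly (hermite k) x"
    by (simp add: integral_mehler[OF assms] gauss1_hermite_affine[OF assms])
  then show ?thesis by (simp add: hermite_fun_def)
qed

section \<open>Gaussian integrals of the squared kernel\<close>

lemma
  fixes a b :: real
  assumes a: "a < 1 / 2"
  shows integrable_gauss1_exp_quadratic: "integrable gauss1 (\<lambda>u. exp (a * u\<^sup>2 + b * u))"
    and integral_gauss1_exp_quadratic: "(\<integral>u. exp (a * u\<^sup>2 + b * u) \<partial>gauss1) =
      exp (b\<^sup>2 / (2 * (1 - 2 * a))) / sqrt (1 - 2 * a)"
proof -
  define v where "v = 1 - 2 * a"
  have v: "v > 0" "a = (1 - v) / 2" using a by (simp_all add: v_def)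
  have eq: "std_normal_density u * exp (a * u\<^sup>2 + b * u) =
      (exp (b\<^sup>2 / (2 * v)) / sqrt v) * normal_density (b / v) (1 / sqrt v) u" for u
  proof -
    have e: "- u\<^sup>2 / 2 + (a * u\<^sup>2 + b * u) = b\<^sup>2 / (2 * v) - v * (u - b / v)\<^sup>2 / 2"
      using v(1) unfolding v(2) by (simp add: power2_eq_square field_simps)
    have "normal_density (b / v) (1 / sqrt v) u =
        sqrt v / sqrt (2 * pi) * exp (- (v * (u - b / v)\<^sup>2 / 2))"
      using v(1) by (simp add: normal_density_def power_divide real_sqrt_divide real_sqrt_mult)
    moreover have "std_normal_density u * exp (a * u\<^sup>2 + b * u) =
        1 / sqrt (2 * pi) * (exp (b\<^sup>2 / (2 * v)) * exp (- (v * (u - b / v)\<^sup>2 / 2)))"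
      unfolding normal_density_def exp_add[symmetric] using e
      by (simp add: exp_add[symmetric] algebra_simps)
    ultimately show ?thesis using v(1) by simp
  qed
  have i: "integrable lborel (normal_density (b / v) (1 / sqrt v))"
    using v by (intro integrable_normal_density) simp
  show "integrable gauss1 (\<lambda>u. exp (a * u\<^sup>2 + b * u))"
    by (subst integrable_gauss1_iff) (use i in \<open>auto simp: eq\<close>)
  show "(\<integral>u. exp (a * u\<^sup>2 + b * u) \<partial>gauss1) = exp (b\<^sup>2 / (2 * (1 - 2 * a))) / sqrt (1 - 2 * a)"
    using v(1) by (subst integral_gauss1) (auto simp: eq v_def[symmetric])
qed

lemma
  assumes \<rho>: "0 < \<rho>" "\<rho> < 1"
  shows integrable_mehler_square: "integrable gauss1 (\<lambda>u. (mehler \<rho> x u)\<^sup>2)"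
    and integral_mehler_square: "(\<integral>u. (mehler \<rho> x u)\<^sup>2 \<partial>gauss1) =
      exp (\<rho>\<^sup>2 / (1 + \<rho>\<^sup>2) * x\<^sup>2) / sqrt ((1 - \<rho>\<^sup>2) * (1 + \<rho>\<^sup>2))"
proof -
  define q where "q = \<rho>\<^sup>2"
  have q: "0 < q" "q < 1" using \<rho> by (simp_all add: q_def power_less_one_iff)
  define a where "a = - q / (1 - q)"
  define b where "b = 2 * \<rho> * x / (1 - q)"
  define c where "c = exp (- q * x\<^sup>2 / (1 - q)) / (1 - q)"
  have a: "a < 1 / 2" "1 - 2 * a = (1 + q) / (1 - q)" using q by (simp_all add: a_def field_simps)
  have eq: "(mehler \<rho> x u)\<^sup>2 = c * exp (a * u\<^sup>2 + b * u)" for u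
  proof -
    have e: "2 * (- (q * x\<^sup>2 - 2 * \<rho> * x * u + q * u\<^sup>2) / (2 * (1 - q))) =
        - q * x\<^sup>2 / (1 - q) + (a * u\<^sup>2 + b * u)"
      unfolding a_def b_def divide_inverse inverse_mult_distrib by (simp add: algebra_simps)
    have "(mehler \<rho> x u)\<^sup>2 = exp (2 * (- (q * x\<^sup>2 - 2 * \<rho> * x * u + q * u\<^sup>2) / (2 * (1 - q)))) / (1 - q)"
      unfolding mehler_def q_def[symmetric] power_divide exp_double[symmetric] using q by simp
    then show ?thesis unfolding e exp_add by (simp add: c_def)
  qed
  show "integrable gauss1 (\<lambda>u. (mehler \<rho> x u)\<^sup>2)"
    unfolding eq by (intro integrable_mult_right integrable_gauss1_exp_quadratic a)
  have "(\<integral>u. (mehler \<rho> x u)\<^sup>2 \<partial>gauss1) = c * (exp (b\<^sup>2 / (2 * (1 - 2 * a))) / sqrt (1 - 2 * a))"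
    unfolding eq by (simp add: integral_gauss1_exp_quadratic[OF a(1)])
  also have "\<dots> = exp (- q * x\<^sup>2 / (1 - q) + b\<^sup>2 / (2 * (1 - 2 * a))) / ((1 - q) * sqrt (1 - 2 * a))"
    unfolding c_def exp_add by simp
  also have "- q * x\<^sup>2 / (1 - q) + b\<^sup>2 / (2 * (1 - 2 * a)) = q / (1 + q) * x\<^sup>2"
  proof -
    have "b\<^sup>2 / (2 * (1 - 2 * a)) = 2 * q * x\<^sup>2 / ((1 - q) * (1 + q))"
    proof -
      have *: "2\<^sup>2 * q * X / w\<^sup>2 / (2 * (v / w)) = 2 * q * X / (w * v)" if "w \<noteq> 0" "v \<noteq> 0" for X v w :: real
        using that by (simp add: field_simps power2_eq_square)
      then show ?thesis
        unfolding a(2) b_def power_divide power_mult_distrib q_def[symmetric] using q by (intro *) auto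
    qed
    moreover have "- q * x\<^sup>2 / (1 - q) + 2 * q * x\<^sup>2 / ((1 - q) * (1 + q)) = q / (1 + q) * x\<^sup>2"
      using q by (simp add: divide_simps) (simp add: algebra_simps)
    ultimately show ?thesis by simp
  qed
  also have "(1 - q) * sqrt (1 - 2 * a) = sqrt ((1 - q) * (1 + q))"
  proof -
    have "(1 - q) * sqrt (1 - 2 * a) = sqrt ((1 - q)\<^sup>2 * ((1 + q) / (1 - q)))"
      unfolding a(2) real_sqrt_mult using q by simp
    also have "(1 - q)\<^sup>2 * ((1 + q) / (1 - q)) = (1 - q) * (1 + q)"
      using q by (simp add: power2_eq_square)
    finally show ?thesis .
  qed
  finally show "(\<integral>u. (mehler \<rho> x u)\<^sup>2 \<partial>gauss1) =
      exp (\<rho>\<^sup>2 / (1 + \<rho>\<^sup>2) * x\<^sup>2) / sqrt ((1 - \<rho>\<^sup>2) * (1 + \<rho>\<^sup>2))"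
    by (simp add: q_def)
qed

text \<open>The double integral is the squared Hilbert-Schmidt norm of the kernel. Its value is the
  geometric series of the squared eigenvalues \<open>\<rho>^(2 * k)\<close>, which is what will
  force the Hermite expansion to exhaust the kernel.\<close>

lemma
  assumes \<rho>: "0 < \<rho>" "\<rho> < 1"
  shows integrable_integral_mehler_square:
      "integrable gauss1 (\<lambda>x. \<integral>u. (mehler \<rho> x u)\<^sup>2 \<partial>gauss1)"
    and integral_integral_mehler_square:
      "(\<integral>x. (\<integral>u. (mehler \<rho> x u)\<^sup>2 \<partial>gauss1) \<partial>gauss1) = 1 / (1 - \<rho>\<^sup>2)"
proof -
  define q where "q = \<rho>\<^sup>2"
  have q: "0 < q" "q < 1" using \<rho> by (simp_all add: q_def power_less_one_iff)
  have a: "q / (1 + q) < 1 / 2" "1 - 2 * (q / (1 + q)) = (1 - q) / (1 + q)"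
    using q by (simp_all add: field_simps)
  note i = integrable_gauss1_exp_quadratic[OF a(1), of 0, simplified]
    integral_gauss1_exp_quadratic[OF a(1), of 0, simplified]
  show "integrable gauss1 (\<lambda>x. \<integral>u. (mehler \<rho> x u)\<^sup>2 \<partial>gauss1)"
    unfolding integral_mehler_square[OF \<rho>] q_def[symmetric] using i(1) by (intro integrable_divide) simp
  have "(\<integral>x. (\<integral>u. (mehler \<rho> x u)\<^sup>2 \<partial>gauss1) \<partial>gauss1) =
      1 / sqrt (1 - 2 * (q / (1 + q))) / sqrt ((1 - q) * (1 + q))"
    unfolding integral_mehler_square[OF \<rho>] q_def[symmetric] using i(2) by simp
  also have "\<dots> = 1 / (1 - q)"
  proof -
    have "sqrt ((1 - q) / (1 + q)) * sqrt ((1 - q) * (1 + q)) = sqrt ((1 - q)\<^sup>2)"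
      unfolding real_sqrt_mult[symmetric] using q by (simp add: power2_eq_square)
    then show ?thesis unfolding a(2) using q by simp
  qed
  finally show "(\<integral>x. (\<integral>u. (mehler \<rho> x u)\<^sup>2 \<partial>gauss1) \<partial>gauss1) = 1 / (1 - \<rho>\<^sup>2)"
    by (simp add: q_def)
qed


section \<open>The Ornstein-Uhlenbeck operator in dimension \<open>n\<close>\<close>

lemma space_gauss: "space (gauss n) = Rn n"
  by (simp add: gauss_def Rn_def space_PiM)

lemma prob_space_gauss: "prob_space (gauss n)"
  unfolding gauss_def by (intro prob_space_PiM prob_space_gauss1)

lemma product_sigma_finite_gauss1: "product_sigma_finite (\<lambda>_::nat. gauss1)"
  by (intro product_sigma_finite.intro prob_space_imp_sigma_finite prob_space_gauss1)

lemma measurable_gauss_component [measurable (raw)]: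
  "f \<in> measurable M (gauss n) \<Longrightarrow> i < n \<Longrightarrow> (\<lambda>w. f w i) \<in> borel_measurable M"
proof -
  assume f: "f \<in> measurable M (gauss n)" and i: "i < n"
  have "(\<lambda>w. f w i) \<in> measurable M gauss1"
    using measurable_compose[OF f[unfolded gauss_def] measurable_component_singleton[of i]] i by simp
  then show ?thesis by simp
qed

lemma
  fixes g :: "nat \<Rightarrow> real \<Rightarrow> real"
  assumes "\<And>i. i < n \<Longrightarrow> integrable gauss1 (g i)"
  shows integrable_gauss_prod: "integrable (gauss n) (\<lambda>x. \<Prod>i<n. g i (x i))"
    and integral_gauss_prod: "(\<integral>x. (\<Prod>i<n. g i (x i)) \<partial>gauss n) = (\<Prod>i<n. \<integral>x. g i x \<partial>gauss1)"
  unfolding gauss_def using assms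
  by (auto intro!: product_sigma_finite.product_integrable_prod
      product_sigma_finite.product_integral_prod product_sigma_finite_gauss1)

lemma integrable_mult_of_squares:
  fixes f g :: "'a \<Rightarrow> real"
  assumes [measurable]: "f \<in> borel_measurable M" "g \<in> borel_measurable M"
    and "integrable M (\<lambda>x. (f x)\<^sup>2)" "integrable M (\<lambda>x. (g x)\<^sup>2)"
  shows "integrable M (\<lambda>x. f x * g x)"
proof (rule Bochner_Integration.integrable_bound)
  show "integrable M (\<lambda>x. (f x)\<^sup>2 + (g x)\<^sup>2)" using assms by simp
  have "norm (f x * g x) \<le> norm ((f x)\<^sup>2 + (g x)\<^sup>2)" for x
  proof -
    have "2 * (\<bar>f x\<bar> * \<bar>g x\<bar>) \<le> (f x)\<^sup>2 + (g x)\<^sup>2"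
      using sum_squares_bound[of "\<bar>f x\<bar>" "\<bar>g x\<bar>"] by simp
    moreover have "0 \<le> \<bar>f x\<bar> * \<bar>g x\<bar>" by simp
    ultimately have "\<bar>f x * g x\<bar> \<le> (f x)\<^sup>2 + (g x)\<^sup>2"
      unfolding abs_mult by linarith
    then show ?thesis by simp
  qed
  then show "AE x in M. norm (f x * g x) \<le> norm ((f x)\<^sup>2 + (g x)\<^sup>2)" by simp
qed simp

lemma (in prob_space) expectation_square_le:
  fixes f :: "'a \<Rightarrow> real"
  assumes [measurable]: "f \<in> borel_measurable M" and "integrable M (\<lambda>x. (f x)\<^sup>2)"
  shows "(expectation f)\<^sup>2 \<le> expectation (\<lambda>x. (f x)\<^sup>2)" "integrable M f"
proof -
  show i: "integrable M f"
    using integrable_mult_of_squares[of f M "\<lambda>_. 1"] assms by simp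
  show "(expectation f)\<^sup>2 \<le> expectation (\<lambda>x. (f x)\<^sup>2)"
    using variance_eq[OF i assms(2)] variance_positive[of f] by simp
qed

lemma (in prob_space) expectation_abs_le:
  fixes f :: "'a \<Rightarrow> real"
  assumes [measurable]: "f \<in> borel_measurable M" and "integrable M (\<lambda>x. (f x)\<^sup>2)"
    and "expectation (\<lambda>x. (f x)\<^sup>2) \<le> a\<^sup>2" "0 \<le> a"
  shows "expectation (\<lambda>x. \<bar>f x\<bar>) \<le> a"
proof -
  have "(expectation (\<lambda>x. \<bar>f x\<bar>))\<^sup>2 \<le> expectation (\<lambda>x. (f x)\<^sup>2)"
    using expectation_square_le(1)[of "\<lambda>x. \<bar>f x\<bar>"] assms(1,2) by simp
  also note assms(3)
  finally show ?thesis using assms(4) by (rule power2_le_imp_le)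
qed

section \<open>Tensor products of Hermite functions and Bessel's inequality\<close>

definition hermite_tensor :: "nat \<Rightarrow> (nat \<Rightarrow> nat) \<Rightarrow> vect \<Rightarrow> real" where
  "hermite_tensor n \<alpha> x = (\<Prod>i<n. hermite_fun (\<alpha> i) (x i))"

lemma borel_measurable_hermite_tensor [measurable (raw)]:
  assumes [measurable]: "f \<in> measurable M (gauss n)"
  shows "(\<lambda>w. hermite_tensor n \<alpha> (f w)) \<in> borel_measurable M"
  unfolding hermite_tensor_def by measurable

lemma integrable_hermite_tensor_mult:
  "integrable (gauss n) (\<lambda>x. hermite_tensor n \<alpha> x * hermite_tensor n \<beta> x)"
  unfolding hermite_tensor_def prod.distrib[symmetric]
  by (rule integrable_gauss_prod) simp

lemma integrable_hermite_tensor_square: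
  "integrable (gauss n) (\<lambda>x. (hermite_tensor n \<alpha> x)\<^sup>2)"
  using integrable_hermite_tensor_mult[of n \<alpha> \<alpha>] by (simp add: power2_eq_square)

lemma integral_hermite_tensor_mult:
  assumes "\<alpha> \<in> extensional {..<n}" "\<beta> \<in> extensional {..<n}"
  shows "(\<integral>x. hermite_tensor n \<alpha> x * hermite_tensor n \<beta> x \<partial>gauss n) = (if \<alpha> = \<beta> then 1 else 0)"
proof -
  have "(\<integral>x. hermite_tensor n \<alpha> x * hermite_tensor n \<beta> x \<partial>gauss n) =
      (\<Prod>i<n. if \<alpha> i = \<beta> i then 1 else 0)"
    unfolding hermite_tensor_def prod.distrib[symmetric]
    by (subst integral_gauss_prod) (simp_all add: integral_hermite_fun_mult)
  also have "\<dots> = (if \<alpha> = \<beta> then 1 else 0)"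
    using extensionalityI[OF assms] by (auto intro!: prod_zero)
  finally show ?thesis .
qed

text \<open>The coefficients are left arbitrary because the expansion serves three ends: with the
  Hermite coefficients of \<open>g\<close> it yields Bessel's inequality, with \<open>g\<close> a
  row of the Mehler kernel it measures a truncated kernel, and with \<open>g = 0\<close> it is
  Parseval's identity for finite sums.\<close>

lemma integral_square_diff_hermite:
  assumes [measurable]: "g \<in> borel_measurable (gauss n)"
    and g2: "integrable (gauss n) (\<lambda>x. (g x)\<^sup>2)"
    and A: "finite A" "A \<subseteq> extensional {..<n}"
  shows "integrable (gauss n) (\<lambda>x. (g x - (\<Sum>\<alpha>\<in>A. a \<alpha> * hermite_tensor n \<alpha> x))\<^sup>2)"
    and "(\<integral>x. (g x - (\<Sum>\<alpha>\<in>A. a \<alpha> * hermite_tensor n \<alpha> x))\<^sup>2 \<partial>gauss n) =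
      (\<integral>x. (g x)\<^sup>2 \<partial>gauss n) - 2 * (\<Sum>\<alpha>\<in>A. a \<alpha> * (\<integral>x. g x * hermite_tensor n \<alpha> x \<partial>gauss n))
      + (\<Sum>\<alpha>\<in>A. (a \<alpha>)\<^sup>2)"
proof -
  let ?h = "hermite_tensor n"
  have eq: "(g x - (\<Sum>\<alpha>\<in>A. a \<alpha> * ?h \<alpha> x))\<^sup>2 =
      (g x)\<^sup>2 - 2 * (\<Sum>\<alpha>\<in>A. a \<alpha> * (g x * ?h \<alpha> x))
      + (\<Sum>\<alpha>\<in>A. \<Sum>\<beta>\<in>A. a \<alpha> * a \<beta> * (?h \<alpha> x * ?h \<beta> x))" for x
  proof -
    have "(\<Sum>\<alpha>\<in>A. a \<alpha> * ?h \<alpha> x)\<^sup>2 = (\<Sum>\<alpha>\<in>A. \<Sum>\<beta>\<in>A. a \<alpha> * a \<beta> * (?h \<alpha> x * ?h \<beta> x))"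
      by (simp add: power2_eq_square sum_product mult_ac)
    moreover have "g x * (\<Sum>\<alpha>\<in>A. a \<alpha> * ?h \<alpha> x) = (\<Sum>\<alpha>\<in>A. a \<alpha> * (g x * ?h \<alpha> x))"
      by (simp add: sum_distrib_left mult_ac)
    ultimately show ?thesis by (simp add: power2_diff)
  qed
  have i: "integrable (gauss n) (\<lambda>x. g x * ?h \<alpha> x)" for \<alpha>
    by (rule integrable_mult_of_squares) (use g2 integrable_hermite_tensor_square in auto)
  note [simp] = i g2 integrable_hermite_tensor_mult
  show "integrable (gauss n) (\<lambda>x. (g x - (\<Sum>\<alpha>\<in>A. a \<alpha> * ?h \<alpha> x))\<^sup>2)"
    unfolding eq by simp
  have "(\<Sum>\<alpha>\<in>A. \<Sum>\<beta>\<in>A. a \<alpha> * a \<beta> * (\<integral>x. ?h \<alpha> x * ?h \<beta> x \<partial>gauss n)) =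
      (\<Sum>\<alpha>\<in>A. \<Sum>\<beta>\<in>A. if \<beta> = \<alpha> then (a \<alpha>)\<^sup>2 else 0)"
    using A(2) by (intro sum.cong refl) (auto simp: integral_hermite_tensor_mult power2_eq_square subset_eq)
  also have "\<dots> = (\<Sum>\<alpha>\<in>A. (a \<alpha>)\<^sup>2)"
    using A(1) by simp
  finally show "(\<integral>x. (g x - (\<Sum>\<alpha>\<in>A. a \<alpha> * ?h \<alpha> x))\<^sup>2 \<partial>gauss n) =
      (\<integral>x. (g x)\<^sup>2 \<partial>gauss n) - 2 * (\<Sum>\<alpha>\<in>A. a \<alpha> * (\<integral>x. g x * ?h \<alpha> x \<partial>gauss n))
      + (\<Sum>\<alpha>\<in>A. (a \<alpha>)\<^sup>2)"
    unfolding eq by simp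
qed

lemma hermite_bessel:
  assumes [measurable]: "g \<in> borel_measurable (gauss n)"
    and g2: "integrable (gauss n) (\<lambda>x. (g x)\<^sup>2)"
    and A: "finite A" "A \<subseteq> extensional {..<n}"
  shows "(\<Sum>\<alpha>\<in>A. (\<integral>x. g x * hermite_tensor n \<alpha> x \<partial>gauss n)\<^sup>2) \<le> (\<integral>x. (g x)\<^sup>2 \<partial>gauss n)"
proof -
  let ?c = "\<lambda>\<alpha>. \<integral>x. g x * hermite_tensor n \<alpha> x \<partial>gauss n"
  have "0 \<le> (\<integral>x. (g x - (\<Sum>\<alpha>\<in>A. ?c \<alpha> * hermite_tensor n \<alpha> x))\<^sup>2 \<partial>gauss n)" by simp
  then show ?thesis
    unfolding integral_square_diff_hermite(2)[OF assms] by (simp add: power2_eq_square)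
qed

section \<open>The tensorised Mehler kernel and the operator it defines\<close>

definition mehler_tensor :: "nat \<Rightarrow> real \<Rightarrow> vect \<Rightarrow> vect \<Rightarrow> real" where
  "mehler_tensor n \<rho> x u = (\<Prod>i<n. mehler \<rho> (x i) (u i))"

lemma mehler_tensor_commute: "mehler_tensor n \<rho> x u = mehler_tensor n \<rho> u x"
  unfolding mehler_tensor_def by (intro prod.cong refl mehler_commute)

lemma mehler_tensor_pos: "0 < \<rho> \<Longrightarrow> \<rho> < 1 \<Longrightarrow> 0 < mehler_tensor n \<rho> x u"
  unfolding mehler_tensor_def by (intro prod_pos) (simp add: mehler_pos)

lemma borel_measurable_mehler_tensor [measurable (raw)]:
  assumes [measurable]: "f \<in> measurable M (gauss n)" "g \<in> measurable M (gauss n)"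
  shows "(\<lambda>w. mehler_tensor n \<rho> (f w) (g w)) \<in> borel_measurable M"
  unfolding mehler_tensor_def by measurable

lemma
  assumes "0 < \<rho>" "\<rho> < 1"
  shows integrable_mehler_tensor_hermite:
      "integrable (gauss n) (\<lambda>u. mehler_tensor n \<rho> x u * hermite_tensor n \<alpha> u)"
    and integral_mehler_tensor_hermite:
      "(\<integral>u. mehler_tensor n \<rho> x u * hermite_tensor n \<alpha> u \<partial>gauss n) =
        \<rho> ^ (\<Sum>i<n. \<alpha> i) * hermite_tensor n \<alpha> x"
proof -
  let ?g = "\<lambda>i u. mehler \<rho> (x i) u * hermite_fun (\<alpha> i) u"
  note i = integrable_mehler_hermite_fun[OF assms]
  show "integrable (gauss n) (\<lambda>u. mehler_tensor n \<rho> x u * hermite_tensor n \<alpha> u)"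
    unfolding mehler_tensor_def hermite_tensor_def prod.distrib[symmetric]
    by (rule integrable_gauss_prod[of n ?g]) (rule i)
  show "(\<integral>u. mehler_tensor n \<rho> x u * hermite_tensor n \<alpha> u \<partial>gauss n) =
        \<rho> ^ (\<Sum>i<n. \<alpha> i) * hermite_tensor n \<alpha> x"
    unfolding mehler_tensor_def hermite_tensor_def prod.distrib[symmetric]
    by (subst integral_gauss_prod[of n ?g])
      (simp_all add: i integral_mehler_hermite_fun[OF assms] prod.distrib power_sum)
qed

lemma
  assumes "0 < \<rho>" "\<rho> < 1"
  shows integrable_mehler_tensor_square: "integrable (gauss n) (\<lambda>u. (mehler_tensor n \<rho> x u)\<^sup>2)"
    and integrable_integral_mehler_tensor_square:
      "integrable (gauss n) (\<lambda>x. \<integral>u. (mehler_tensor n \<rho> x u)\<^sup>2 \<partial>gauss n)"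
    and integral_integral_mehler_tensor_square:
      "(\<integral>x. (\<integral>u. (mehler_tensor n \<rho> x u)\<^sup>2 \<partial>gauss n) \<partial>gauss n) = (1 / (1 - \<rho>\<^sup>2)) ^ n"
proof -
  show "integrable (gauss n) (\<lambda>u. (mehler_tensor n \<rho> x u)\<^sup>2)"
    unfolding mehler_tensor_def prod_power_distrib
    by (intro integrable_gauss_prod integrable_mehler_square assms)
  have eq: "(\<integral>u. (mehler_tensor n \<rho> x u)\<^sup>2 \<partial>gauss n) =
      (\<Prod>i<n. \<integral>u. (mehler \<rho> (x i) u)\<^sup>2 \<partial>gauss1)" for x
    unfolding mehler_tensor_def prod_power_distrib
    by (intro integral_gauss_prod integrable_mehler_square assms)
  show "integrable (gauss n) (\<lambda>x. \<integral>u. (mehler_tensor n \<rho> x u)\<^sup>2 \<partial>gauss n)"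
    unfolding eq by (intro integrable_gauss_prod integrable_integral_mehler_square assms)
  show "(\<integral>x. (\<integral>u. (mehler_tensor n \<rho> x u)\<^sup>2 \<partial>gauss n) \<partial>gauss n) = (1 / (1 - \<rho>\<^sup>2)) ^ n"
    unfolding eq
    by (subst integral_gauss_prod)
      (simp_all add: integrable_integral_mehler_square assms integral_integral_mehler_square)
qed

definition ou :: "nat \<Rightarrow> real \<Rightarrow> (vect \<Rightarrow> real) \<Rightarrow> vect \<Rightarrow> real" where
  "ou n \<rho> f x = (\<integral>u. f u * mehler_tensor n \<rho> x u \<partial>gauss n)"

lemma borel_measurable_ou [measurable]:
  assumes [measurable]: "f \<in> borel_measurable (gauss n)"
  shows "ou n \<rho> f \<in> borel_measurable (gauss n)"
proof -
  interpret prob_space "gauss n" by (rule prob_space_gauss)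
  show ?thesis unfolding ou_def by measurable
qed

text \<open>Extensionality makes an index determined by its entries below \<open>n\<close>;
  orthogonality of distinct indices relies on that.\<close>

definition multi_indices :: "nat \<Rightarrow> nat \<Rightarrow> (nat \<Rightarrow> nat) set" where
  "multi_indices n d = {\<alpha> \<in> {..<n} \<rightarrow>\<^sub>E UNIV. (\<Sum>i<n. \<alpha> i) \<le> d}"

definition hermite_coeff :: "nat \<Rightarrow> (vect \<Rightarrow> real) \<Rightarrow> (nat \<Rightarrow> nat) \<Rightarrow> real" where
  "hermite_coeff n f \<alpha> = (\<integral>u. f u * hermite_tensor n \<alpha> u \<partial>gauss n)"

definition ou_truncated :: "nat \<Rightarrow> real \<Rightarrow> nat \<Rightarrow> (vect \<Rightarrow> real) \<Rightarrow> vect \<Rightarrow> real" where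
  "ou_truncated n \<rho> d f x =
    (\<Sum>\<alpha>\<in>multi_indices n d. (\<rho> ^ (\<Sum>i<n. \<alpha> i) * hermite_coeff n f \<alpha>) * hermite_tensor n \<alpha> x)"

lemma multi_indices_subset: "d \<le> D \<Longrightarrow> multi_indices n d \<subseteq> {..<n} \<rightarrow>\<^sub>E {..D}"
proof
  fix \<alpha> assume d: "d \<le> D" and \<alpha>: "\<alpha> \<in> multi_indices n d"
  have "\<alpha> i \<le> D" if "i < n" for i
  proof -
    have "\<alpha> i \<le> (\<Sum>i<n. \<alpha> i)" using that by (intro member_le_sum) auto
    then show ?thesis using \<alpha> d by (simp add: multi_indices_def)
  qed
  then show "\<alpha> \<in> {..<n} \<rightarrow>\<^sub>E {..D}"
    using \<alpha> by (auto simp: multi_indices_def PiE_iff)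
qed

lemma finite_multi_indices: "finite (multi_indices n d)"
  by (rule finite_subset[OF multi_indices_subset[OF order_refl]]) (intro finite_PiE; simp)

text \<open>The Hilbert-Schmidt norm of the Mehler kernel minus its truncated Hermite expansion needs
  only the eigenvalue equation, and it tends to 0; this replaces the completeness of the Hermite
  polynomials.\<close>

lemma ou_box_truncation:
  fixes f :: "vect \<Rightarrow> real" and D :: nat
  assumes \<rho>: "0 < \<rho>" "\<rho> < 1" and f [measurable]: "f \<in> borel_measurable (gauss n)"
    and f1: "\<And>x. \<bar>f x\<bar> \<le> 1"
  defines "A \<equiv> {..<n} \<rightarrow>\<^sub>E {..D}"
  defines "E \<equiv> \<lambda>x. ou n \<rho> f x -
    (\<Sum>\<alpha>\<in>A. (\<rho> ^ (\<Sum>i<n. \<alpha> i) * hermite_coeff n f \<alpha>) * hermite_tensor n \<alpha> x)"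
  shows "integrable (gauss n) (\<lambda>x. (E x)\<^sup>2)"
    and "(\<integral>x. (E x)\<^sup>2 \<partial>gauss n) \<le> (1 / (1 - \<rho>\<^sup>2)) ^ n - (\<Sum>k\<le>D. (\<rho>\<^sup>2) ^ k) ^ n"
proof -
  interpret prob_space "gauss n" by (rule prob_space_gauss)
  have fsq: "(f x)\<^sup>2 \<le> 1" for x
    using f1[of x] by (rule abs_square_le_1[THEN iffD2])
  let ?h = "hermite_tensor n" and ?M = "mehler_tensor n \<rho>"
  let ?r = "\<lambda>\<alpha>. \<rho> ^ (\<Sum>i<n. \<alpha> i)"
  have A: "finite A" "A \<subseteq> extensional {..<n}"
    by (simp add: A_def finite_PiE) (auto simp: A_def PiE_def)
  \<comment> \<open>This turns out to be the squared \<open>L^2\<close> norm, in \<open>u\<close>,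
    of the kernel row at \<open>x\<close> minus its truncation; \<open>f\<close> will enter only
    through its bound 1.\<close>
  define G where "G x = (\<integral>u. (?M x u)\<^sup>2 \<partial>gauss n) - (\<Sum>\<alpha>\<in>A. (?r \<alpha>)\<^sup>2 * (?h \<alpha> x)\<^sup>2)" for x
  have EG: "(E x)\<^sup>2 \<le> G x" if x: "x \<in> space (gauss n)" for x
  proof -
    have [measurable]: "?M x \<in> borel_measurable (gauss n)"
      using x by (intro borel_measurable_mehler_tensor) simp_all
    note sq = integral_square_diff_hermite[OF _ integrable_mehler_tensor_square[OF \<rho>] A,
        where a = "\<lambda>\<alpha>. ?r \<alpha> * ?h \<alpha> x" and x1 = x]
    let ?g = "\<lambda>u. ?M x u - (\<Sum>\<alpha>\<in>A. ?r \<alpha> * ?h \<alpha> x * ?h \<alpha> u)"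
    have g2: "integrable (gauss n) (\<lambda>u. (?g u)\<^sup>2)" using sq(1) by simp
    have gG: "(\<integral>u. (?g u)\<^sup>2 \<partial>gauss n) = G x"
    proof -
      have t: "?r \<alpha> * ?h \<alpha> x * (?r \<alpha> * ?h \<alpha> x) = (?r \<alpha>)\<^sup>2 * (?h \<alpha> x)\<^sup>2" for \<alpha>
        by (simp add: power2_eq_square)
      show ?thesis
        using sq(2) unfolding integral_mehler_tensor_hermite[OF \<rho>] t power_mult_distrib G_def by simp
    qed
    have f2: "integrable (gauss n) (\<lambda>u. (f u)\<^sup>2)"
      by (rule integrable_const_bound[where B = 1]) (simp_all add: fsq)
    have fh: "integrable (gauss n) (\<lambda>u. f u * ?h \<alpha> u)" for \<alpha>
      by (rule integrable_mult_of_squares) (auto simp: f2 integrable_hermite_tensor_square)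
    have fM: "integrable (gauss n) (\<lambda>u. f u * ?M x u)"
      by (rule integrable_mult_of_squares) (auto simp: f2 integrable_mehler_tensor_square[OF \<rho>])
    have fg: "integrable (gauss n) (\<lambda>u. (f u * ?g u)\<^sup>2)"
    proof (rule Bochner_Integration.integrable_bound[OF g2])
      have "(f u * ?g u)\<^sup>2 \<le> (?g u)\<^sup>2" for u
        using mult_right_mono[OF fsq[of u], of "(?g u)\<^sup>2"] by (simp add: power_mult_distrib)
      then show "AE u in gauss n. norm ((f u * ?g u)\<^sup>2) \<le> norm ((?g u)\<^sup>2)" by simp
    qed simp
    have "E x = (\<integral>u. f u * ?g u \<partial>gauss n)"
    proof -
      have "(\<integral>u. f u * ?g u \<partial>gauss n) =
          (\<integral>u. f u * ?M x u - (\<Sum>\<alpha>\<in>A. ?r \<alpha> * ?h \<alpha> x * (f u * ?h \<alpha> u)) \<partial>gauss n)"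
        by (intro Bochner_Integration.integral_cong refl)
          (simp add: right_diff_distrib sum_distrib_left mult_ac)
      also have "\<dots> = (\<integral>u. f u * ?M x u \<partial>gauss n)
          - (\<Sum>\<alpha>\<in>A. ?r \<alpha> * ?h \<alpha> x * (\<integral>u. f u * ?h \<alpha> u \<partial>gauss n))"
        by (simp add: fh fM)
      finally show ?thesis
        by (simp add: E_def ou_def hermite_coeff_def mult_ac)
    qed
    then have "(E x)\<^sup>2 \<le> (\<integral>u. (f u * ?g u)\<^sup>2 \<partial>gauss n)"
      using expectation_square_le(1)[OF _ fg] by simp
    also have "\<dots> \<le> (\<integral>u. (?g u)\<^sup>2 \<partial>gauss n)"
      using fg g2
    proof (rule integral_mono)
      show "(f u * ?g u)\<^sup>2 \<le> (?g u)\<^sup>2" for u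
        using mult_right_mono[OF fsq[of u], of "(?g u)\<^sup>2"] by (simp add: power_mult_distrib)
    qed
    also note gG
    finally show ?thesis .
  qed
  have iG: "integrable (gauss n) G"
    unfolding G_def using integrable_integral_mehler_tensor_square[OF \<rho>] integrable_hermite_tensor_square
    by simp
  have [measurable]: "E \<in> borel_measurable (gauss n)" unfolding E_def by measurable
  show iE: "integrable (gauss n) (\<lambda>x. (E x)\<^sup>2)"
  proof (rule Bochner_Integration.integrable_bound[OF iG])
    have "norm ((E x)\<^sup>2) \<le> norm (G x)" if "x \<in> space (gauss n)" for x
      using EG[OF that] by simp
    then show "AE x in gauss n. norm ((E x)\<^sup>2) \<le> norm (G x)" by (rule AE_I2)
  qed simp
  have "(\<integral>x. (E x)\<^sup>2 \<partial>gauss n) \<le> (\<integral>x. G x \<partial>gauss n)"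
    by (rule integral_mono[OF iE iG EG])
  also have "(\<integral>x. G x \<partial>gauss n) = (1 / (1 - \<rho>\<^sup>2)) ^ n - (\<Sum>\<alpha>\<in>A. (?r \<alpha>)\<^sup>2)"
  proof -
    have "(\<integral>x. (?h \<alpha> x)\<^sup>2 \<partial>gauss n) = 1" if "\<alpha> \<in> A" for \<alpha>
      using integral_hermite_tensor_mult[of \<alpha> n \<alpha>] A(2) that by (auto simp: power2_eq_square)
    then show ?thesis
      unfolding G_def using integrable_integral_mehler_tensor_square[OF \<rho>] integrable_hermite_tensor_square
      by (simp add: integral_integral_mehler_tensor_square[OF \<rho>])
  qed
  also have "(\<Sum>\<alpha>\<in>A. (?r \<alpha>)\<^sup>2) = (\<Sum>\<alpha>\<in>A. \<Prod>i<n. (\<rho>\<^sup>2) ^ \<alpha> i)"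
    by (simp add: power_sum prod_power_distrib power_mult[symmetric] mult.commute)
  \<comment> \<open>This factorisation is the reason for truncating to a box and not by total
    degree.\<close>
  also have "\<dots> = (\<Sum>k\<le>D. (\<rho>\<^sup>2) ^ k) ^ n"
    unfolding A_def by (subst prod_sum_PiE[symmetric]) simp_all
  finally show "(\<integral>x. (E x)\<^sup>2 \<partial>gauss n) \<le> (1 / (1 - \<rho>\<^sup>2)) ^ n - (\<Sum>k\<le>D. (\<rho>\<^sup>2) ^ k) ^ n" .
qed

text \<open>Both functions are compared with a truncation to a box whose side \<open>D\<close> is so
  large that the squared kernel error is below \<open>\<rho>^(2 * d)\<close>. What remains is a
  finite orthogonal sum over indices of total degree above \<open>d\<close>: there Bessel's
  inequality bounds all squared coefficients together, and each eigenvalue is at most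
  \<open>\<rho>^d\<close>. Each of the two comparisons costs \<open>\<rho>^d\<close>.\<close>

lemma ou_truncated_error:
  fixes f :: "vect \<Rightarrow> real"
  assumes \<rho>: "0 < \<rho>" "\<rho> < 1" and f [measurable]: "f \<in> borel_measurable (gauss n)"
    and f1: "\<And>x. \<bar>f x\<bar> \<le> 1"
  shows "integrable (gauss n) (\<lambda>x. \<bar>ou n \<rho> f x - ou_truncated n \<rho> d f x\<bar>)"
    and "(\<integral>x. \<bar>ou n \<rho> f x - ou_truncated n \<rho> d f x\<bar> \<partial>gauss n) \<le> 2 * \<rho> ^ d"
proof -
  interpret prob_space "gauss n" by (rule prob_space_gauss)
  have fsq: "(f x)\<^sup>2 \<le> 1" for x
    using f1[of x] by (rule abs_square_le_1[THEN iffD2])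
  let ?h = "hermite_tensor n" and ?r = "\<lambda>\<alpha>. \<rho> ^ (\<Sum>i<n. \<alpha> i)" and ?c = "hermite_coeff n f"
  have q: "norm (\<rho>\<^sup>2) < 1" using \<rho> by (simp add: power_less_one_iff)
  have "(\<lambda>D. \<Sum>k\<le>D. (\<rho>\<^sup>2) ^ k) \<longlonglongrightarrow> 1 / (1 - \<rho>\<^sup>2)"
    using geometric_sums[OF q] by (simp add: sums_def_le)
  then have "(\<lambda>D. (1 / (1 - \<rho>\<^sup>2)) ^ n - (\<Sum>k\<le>D. (\<rho>\<^sup>2) ^ k) ^ n) \<longlonglongrightarrow> 0"
    by (auto intro!: tendsto_eq_intros)
  moreover have "(\<rho> ^ d)\<^sup>2 > 0" using \<rho> by simp
  ultimately have "\<forall>\<^sub>F D in sequentially. (1 / (1 - \<rho>\<^sup>2)) ^ n - (\<Sum>k\<le>D. (\<rho>\<^sup>2) ^ k) ^ n < (\<rho> ^ d)\<^sup>2"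
    by (rule order_tendstoD)
  then have "\<forall>\<^sub>F D in sequentially. (1 / (1 - \<rho>\<^sup>2)) ^ n - (\<Sum>k\<le>D. (\<rho>\<^sup>2) ^ k) ^ n < (\<rho> ^ d)\<^sup>2 \<and> d \<le> D"
    using eventually_ge_at_top by (rule eventually_conj)
  then obtain D where D: "(1 / (1 - \<rho>\<^sup>2)) ^ n - (\<Sum>k\<le>D. (\<rho>\<^sup>2) ^ k) ^ n < (\<rho> ^ d)\<^sup>2" "d \<le> D"
    using eventually_happens'[OF sequentially_bot] by blast
  define A where "A = {..<n} \<rightarrow>\<^sub>E {..D}"
  have A: "finite A" "A \<subseteq> extensional {..<n}"
    by (simp add: A_def finite_PiE) (auto simp: A_def PiE_def)
  have sub: "multi_indices n d \<subseteq> A" unfolding A_def by (rule multi_indices_subset[OF D(2)])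
  define S where "S x = (\<Sum>\<alpha>\<in>A. (?r \<alpha> * ?c \<alpha>) * ?h \<alpha> x)" for x
  have [measurable]: "S \<in> borel_measurable (gauss n)" "ou_truncated n \<rho> d f \<in> borel_measurable (gauss n)"
    unfolding S_def ou_truncated_def[abs_def] by measurable
  define B where "B = A - multi_indices n d"
  have B: "finite B" "B \<subseteq> extensional {..<n}" using A by (auto simp: B_def)
  note box = ou_box_truncation[OF \<rho> f f1, of D, folded A_def, folded S_def]
  have e1: "(\<integral>x. \<bar>ou n \<rho> f x - S x\<bar> \<partial>gauss n) \<le> \<rho> ^ d"
    using order_trans[OF box(2) less_imp_le[OF D(1)]] \<rho> by (intro expectation_abs_le box(1)) simp_all
  have i1: "integrable (gauss n) (\<lambda>x. ou n \<rho> f x - S x)"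
    by (rule expectation_square_le(2)[OF _ box(1)]) simp
  have diff: "S x - ou_truncated n \<rho> d f x = (\<Sum>\<alpha>\<in>B. (?r \<alpha> * ?c \<alpha>) * ?h \<alpha> x)" for x
    unfolding S_def ou_truncated_def B_def by (subst sum_diff[OF A(1) sub]) (rule refl)
  have f2: "integrable (gauss n) (\<lambda>u. (f u)\<^sup>2)"
    by (rule integrable_const_bound[where B = 1]) (simp_all add: fsq)
  note sq = integral_square_diff_hermite[of "\<lambda>_. 0", OF _ _ B, where a = "\<lambda>\<alpha>. - (?r \<alpha> * ?c \<alpha>)"]
  have "(\<integral>x. (S x - ou_truncated n \<rho> d f x)\<^sup>2 \<partial>gauss n) = (\<Sum>\<alpha>\<in>B. (?r \<alpha> * ?c \<alpha>)\<^sup>2)"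
    unfolding diff using sq(2) by (simp add: sum_negf)
  also have "\<dots> \<le> (\<Sum>\<alpha>\<in>B. (\<rho> ^ d)\<^sup>2 * (?c \<alpha>)\<^sup>2)"
  proof (rule sum_mono)
    fix \<alpha> assume "\<alpha> \<in> B"
    then have "d \<le> (\<Sum>i<n. \<alpha> i)" by (auto simp: B_def A_def multi_indices_def PiE_iff)
    then have "?r \<alpha> \<le> \<rho> ^ d" using \<rho> by (intro power_decreasing) auto
    then show "(?r \<alpha> * ?c \<alpha>)\<^sup>2 \<le> (\<rho> ^ d)\<^sup>2 * (?c \<alpha>)\<^sup>2"
      unfolding power_mult_distrib using \<rho> by (intro mult_right_mono power_mono) auto
  qed
  also have "\<dots> \<le> (\<rho> ^ d)\<^sup>2 * 1"
  proof -
    have "(\<Sum>\<alpha>\<in>B. (?c \<alpha>)\<^sup>2) \<le> (\<integral>x. (f x)\<^sup>2 \<partial>gauss n)"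
      unfolding hermite_coeff_def using f f2 B by (rule hermite_bessel)
    also have "\<dots> \<le> (\<integral>x. 1 \<partial>gauss n)"
      using f2 by (intro integral_mono) (simp_all add: fsq)
    finally show ?thesis
      unfolding sum_distrib_left[symmetric] by (intro mult_left_mono) (auto simp: prob_space)
  qed
  finally have *: "(\<integral>x. (S x - ou_truncated n \<rho> d f x)\<^sup>2 \<partial>gauss n) \<le> (\<rho> ^ d)\<^sup>2" by simp
  have i2': "integrable (gauss n) (\<lambda>x. (S x - ou_truncated n \<rho> d f x)\<^sup>2)"
    unfolding diff using sq(1) by (simp add: sum_negf)
  have e2: "(\<integral>x. \<bar>S x - ou_truncated n \<rho> d f x\<bar> \<partial>gauss n) \<le> \<rho> ^ d"
    using * \<rho> by (intro expectation_abs_le i2') simp_all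
  have i2: "integrable (gauss n) (\<lambda>x. S x - ou_truncated n \<rho> d f x)"
    by (rule expectation_square_le(2)[OF _ i2']) simp
  have "integrable (gauss n) (\<lambda>x. (ou n \<rho> f x - S x) + (S x - ou_truncated n \<rho> d f x))"
    by (intro Bochner_Integration.integrable_add i1 i2)
  then show i: "integrable (gauss n) (\<lambda>x. \<bar>ou n \<rho> f x - ou_truncated n \<rho> d f x\<bar>)"
    by simp
  have "(\<integral>x. \<bar>ou n \<rho> f x - ou_truncated n \<rho> d f x\<bar> \<partial>gauss n) \<le>
      (\<integral>x. \<bar>ou n \<rho> f x - S x\<bar> + \<bar>S x - ou_truncated n \<rho> d f x\<bar> \<partial>gauss n)"
    using i i1 i2 by (intro integral_mono) auto
  also have "\<dots> \<le> \<rho> ^ d + \<rho> ^ d" using i1 i2 e1 e2 by simp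
  finally show "(\<integral>x. \<bar>ou n \<rho> f x - ou_truncated n \<rho> d f x\<bar> \<partial>gauss n) \<le> 2 * \<rho> ^ d" by simp
qed


section \<open>Noise stability of polytopes of bounded width\<close>

lemma borel_measurable_dotp [measurable (raw)]:
  assumes [measurable]: "f \<in> measurable M (gauss n)" "g \<in> measurable M (gauss n)"
  shows "(\<lambda>w. dotp n (f w) (g w)) \<in> borel_measurable M"
  unfolding dotp_def by measurable

lemma borel_measurable_dotp_const [measurable (raw)]:
  assumes [measurable]: "g \<in> measurable M (gauss n)"
  shows "(\<lambda>w. dotp n t (g w)) \<in> borel_measurable M"
  unfolding dotp_def by measurable

section \<open>Gaussian measure under translation\<close>

lemma measurable_gaussI:
  assumes "\<And>i. i < n \<Longrightarrow> (\<lambda>w. f w i) \<in> borel_measurable M"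
    and "\<And>w. w \<in> space M \<Longrightarrow> f w \<in> Rn n"
  shows "f \<in> measurable M (gauss n)"
  unfolding gauss_def using assms by (intro measurable_PiM_single') (auto simp: Rn_def)

definition translate_vect :: "nat \<Rightarrow> vect \<Rightarrow> vect \<Rightarrow> vect" where
  "translate_vect n w x = (\<lambda>i\<in>{..<n}. x i + w i)"

lemma measurable_translate_vect [measurable]: "translate_vect n w \<in> measurable (gauss n) (gauss n)"
  by (rule measurable_gaussI) (auto simp: translate_vect_def Rn_def)

lemma translate_vect_in_Rn: "translate_vect n w x \<in> Rn n"
  by (auto simp: translate_vect_def Rn_def)

lemma dotp_shift: "dotp n t (translate_vect n w x) = dotp n t x + dotp n t w"
  by (simp add: dotp_def translate_vect_def algebra_simps sum.distrib)

lemma gauss1_shift: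
  assumes [measurable]: "A \<in> sets borel"
  shows "(\<integral>\<^sup>+ x. ennreal (exp (- (w * x) - w\<^sup>2 / 2)) * indicator A (x + w) \<partial>gauss1) = emeasure gauss1 A"
proof -
  have eq: "std_normal_density x * exp (- (w * x) - w\<^sup>2 / 2) = std_normal_density (w + x)" for x
    unfolding normal_density_def
    by (simp add: exp_add[symmetric] power2_eq_square algebra_simps add_divide_distrib)
  have "(\<integral>\<^sup>+ x. ennreal (exp (- (w * x) - w\<^sup>2 / 2)) * indicator A (x + w) \<partial>gauss1) =
      (\<integral>\<^sup>+ x. ennreal (std_normal_density (w + x)) * indicator A (w + x) \<partial>lborel)"
    by (subst nn_integral_density)
      (auto simp: mult.assoc[symmetric] ennreal_mult'[symmetric] eq add.commute)
  also have "\<dots> = (\<integral>\<^sup>+ x. ennreal (std_normal_density x) * indicator A x \<partial>lborel)"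
    by (subst (2) nn_integral_real_affine[where c = 1 and t = w]) simp_all
  also have "\<dots> = emeasure gauss1 A"
    by (subst emeasure_density) simp_all
  finally show ?thesis .
qed

text \<open>The Cameron-Martin formula. The translated weighted measure and the Gaussian agree on
  boxes, where everything factors into the one-dimensional formula, and boxes determine a product
  measure.\<close>

lemma gauss_shift:
  fixes w :: vect
  assumes C: "C \<in> sets (gauss n)"
  shows "emeasure (gauss n) C =
    (\<integral>\<^sup>+ x. ennreal (exp (- dotp n w x - dotp n w w / 2)) * indicator C (translate_vect n w x) \<partial>gauss n)"
proof -
  interpret product_sigma_finite "\<lambda>_::nat. gauss1" by (rule product_sigma_finite_gauss1)
  let ?D = "\<lambda>x. ennreal (exp (- dotp n w x - dotp n w w / 2))"
  let ?P = "distr (density (gauss n) ?D) (gauss n) (translate_vect n w)"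
  have em: "emeasure ?P B = (\<integral>\<^sup>+ x. ?D x * indicator B (translate_vect n w x) \<partial>gauss n)"
    if [measurable]: "B \<in> sets (gauss n)" for B
    by (subst emeasure_distr, simp, simp, subst emeasure_density)
      (auto intro!: nn_integral_cong simp: indicator_def)
  have "?P = Pi\<^sub>M {..<n} (\<lambda>_. gauss1)"
  proof (rule PiM_eqI)
    fix A assume A: "\<And>i. i \<in> {..<n} \<Longrightarrow> A i \<in> sets gauss1"
    then have [measurable]: "i < n \<Longrightarrow> A i \<in> sets borel" for i by simp
    have "Pi\<^sub>E {..<n} A \<in> sets (gauss n)"
      unfolding gauss_def using A by (intro sets_PiM_I_finite) auto
    then have "emeasure ?P (Pi\<^sub>E {..<n} A) = (\<integral>\<^sup>+ x. ?D x * indicator (Pi\<^sub>E {..<n} A) (translate_vect n w x) \<partial>gauss n)"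
      by (rule em)
    also have "\<dots> = (\<integral>\<^sup>+ x. (\<Prod>i<n. ennreal (exp (- (w i * x i) - (w i)\<^sup>2 / 2)) * indicator (A i) (x i + w i)) \<partial>gauss n)"
    proof (rule nn_integral_cong)
      fix x
      have "?D x = (\<Prod>i<n. ennreal (exp (- (w i * x i) - (w i)\<^sup>2 / 2)))"
        by (simp add: dotp_def prod_ennreal exp_sum[symmetric] sum_subtractf sum_negf
            sum_divide_distrib power2_eq_square)
      moreover have "(indicator (Pi\<^sub>E {..<n} A) (translate_vect n w x) :: ennreal) = (\<Prod>i<n. indicator (A i) (x i + w i))"
        by (auto simp: indicator_def translate_vect_def PiE_iff prod_zero_iff)
      ultimately show "?D x * indicator (Pi\<^sub>E {..<n} A) (translate_vect n w x) =
          (\<Prod>i<n. ennreal (exp (- (w i * x i) - (w i)\<^sup>2 / 2)) * indicator (A i) (x i + w i))"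
        by (simp add: prod.distrib)
    qed
    also have "\<dots> = (\<Prod>i<n. \<integral>\<^sup>+ x. ennreal (exp (- (w i * x) - (w i)\<^sup>2 / 2)) * indicator (A i) (x + w i) \<partial>gauss1)"
      unfolding gauss_def by (rule product_nn_integral_prod) auto
    also have "\<dots> = (\<Prod>i<n. emeasure gauss1 (A i))"
      by (intro prod.cong refl gauss1_shift) simp
    finally show "emeasure ?P (Pi\<^sub>E {..<n} A) = (\<Prod>i\<in>{..<n}. emeasure gauss1 (A i))" .
  qed (simp_all add: gauss_def)
  then have "emeasure (gauss n) C = emeasure ?P C" by (simp add: gauss_def)
  then show ?thesis using em[OF C] by simp
qed

lemma gauss_shift_le:
  assumes B: "B \<in> sets (gauss n)" and C: "C \<in> sets (gauss n)"
    and BC: "\<And>x. x \<in> B \<Longrightarrow> translate_vect n w x \<in> C"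
    and e: "\<And>x. x \<in> B \<Longrightarrow> dotp n w x + dotp n w w / 2 \<le> e"
  shows "measure (gauss n) B \<le> exp e * measure (gauss n) C"
proof -
  interpret prob_space "gauss n" by (rule prob_space_gauss)
  have "ennreal (exp (- e)) * emeasure (gauss n) B = (\<integral>\<^sup>+ x. ennreal (exp (- e)) * indicator B x \<partial>gauss n)"
    using B by (simp add: nn_integral_cmult_indicator)
  also have "\<dots> \<le> (\<integral>\<^sup>+ x. ennreal (exp (- dotp n w x - dotp n w w / 2)) * indicator C (translate_vect n w x) \<partial>gauss n)"
    by (intro nn_integral_mono) (use e BC in \<open>fastforce simp: indicator_def intro!: ennreal_leI\<close>)
  also have "\<dots> = emeasure (gauss n) C" by (rule gauss_shift[OF C, symmetric])
  finally have "exp (- e) * measure (gauss n) B \<le> measure (gauss n) C"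
    by (simp add: emeasure_eq_measure ennreal_mult'[symmetric])
  then show ?thesis by (simp add: exp_minus field_simps)
qed

lemma exp_three_halves_le: "exp (3 / 2 :: real) \<le> 5"
proof -
  have "(exp (3 / 2 :: real))\<^sup>2 = exp 1 ^ 3"
    by (simp add: exp_of_nat_mult[symmetric] exp_double[symmetric])
  also have "\<dots> \<le> (272 / 100) ^ 3"
    using e_less_272 by (intro power_mono) auto
  also have "\<dots> \<le> (5 :: real)\<^sup>2" by (simp add: power2_eq_square power3_eq_cube)
  finally show ?thesis by (rule power2_le_imp_le) simp
qed

text \<open>Pushing the slab outwards by \<open>j * s\<close> for \<open>j < m\<close> gives
  \<open>m\<close> disjoint slabs of \<open>R\<close> beyond the facet. No push exceeds
  \<open>1 / (1 + r)\<close>, while \<open>t \<bullet> x\<close> is at most \<open>1 + r\<close> on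
  the slab, so each push costs at most the factor \<open>exp (3 / 2)\<close>. Hence one slab carries
  only a share \<open>5 / m\<close> of the region beyond the facet.\<close>

lemma gauss_slab_le:
  fixes m k :: nat
  assumes R [measurable]: "R \<in> sets (gauss n)"
    and up: "\<And>x v. x \<in> R \<Longrightarrow> 0 \<le> v \<Longrightarrow> translate_vect n (\<lambda>i. v * t i) x \<in> R"
    and t: "dotp n t t = 1" and b: "b \<le> r" and r: "0 \<le> r" and s: "0 < s"
    and m: "real m * s \<le> 1 / (1 + r)" and k: "k < m"
  shows "real m * measure (gauss n) {x \<in> R. b + real k * s < dotp n t x \<and> dotp n t x \<le> b + (real k + 1) * s} \<le>
    5 * measure (gauss n) {x \<in> R. b < dotp n t x}"
proof -
  interpret prob_space "gauss n" by (rule prob_space_gauss)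
  define G where "G j = {x \<in> R. b + real j * s < dotp n t x \<and> dotp n t x \<le> b + (real j + 1) * s}" for j :: nat
  have "R \<subseteq> space (gauss n)" using R by (rule sets.sets_into_space)
  then have Geq: "G j = {x \<in> space (gauss n). x \<in> R \<and> b + real j * s < dotp n t x \<and> dotp n t x \<le> b + (real j + 1) * s}"
    and Beq: "{x \<in> R. b < dotp n t x} = {x \<in> space (gauss n). x \<in> R \<and> b < dotp n t x}" for j
    by (auto simp: G_def)
  have G [measurable]: "G j \<in> sets (gauss n)" for j unfolding Geq by measurable
  have B [measurable]: "{x \<in> R. b < dotp n t x} \<in> sets (gauss n)" unfolding Beq by measurable
  have step: "measure (gauss n) (G k) \<le> 5 * measure (gauss n) (G (k + j))" if j: "j < m" for j
  proof -
    let ?w = "\<lambda>i. (real j * s) * t i"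
    have js: "0 \<le> real j * s" "real j * s \<le> 1 / (1 + r)"
      using j s m order_trans[OF mult_right_mono[of "real j" "real m" s] m] by auto
    have ks: "(real k + 1) * s \<le> 1 / (1 + r)"
      using k s order_trans[OF mult_right_mono[of "real k + 1" "real m" s] m] by auto
    have r1: "1 / (1 + r) \<le> 1" using r by simp
    have w: "dotp n t ?w = real j * s" "dotp n ?w x = real j * s * dotp n t x"
      "dotp n ?w ?w = (real j * s)\<^sup>2" for x
      using t by (simp_all add: dotp_def sum_distrib_left[symmetric] mult.assoc mult.left_commute power2_eq_square)
    have "measure (gauss n) (G k) \<le> exp (3 / 2) * measure (gauss n) (G (k + j))"
    proof (rule gauss_shift_le[where w = ?w])
      fix x assume x: "x \<in> G k"
      have "dotp n t x \<le> 1 + r" using x b ks r1 by (simp add: G_def)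
      then have "real j * s * dotp n t x \<le> real j * s * (1 + r)"
        using js by (intro mult_left_mono)
      also have "\<dots> \<le> 1 / (1 + r) * (1 + r)" using js r by (intro mult_right_mono) auto
      finally have 1: "real j * s * dotp n t x \<le> 1" using r by simp
      have "(real j * s)\<^sup>2 \<le> 1" using js r1 by (simp add: power_le_one)
      with 1 show "dotp n ?w x + dotp n ?w ?w / 2 \<le> 3 / 2"
        unfolding w by (simp add: power2_eq_square)
      have "dotp n t (translate_vect n ?w x) = dotp n t x + real j * s"
        by (simp only: dotp_shift w)
      then show "translate_vect n ?w x \<in> G (k + j)"
        using x up[of x "real j * s"] js by (simp add: G_def algebra_simps)
    qed (rule G)+
    also have "\<dots> \<le> 5 * measure (gauss n) (G (k + j))"
      by (intro mult_right_mono exp_three_halves_le) simp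
    finally show ?thesis .
  qed
  have disj: "disjoint_family_on (\<lambda>j. G (k + j)) {..<m}"
  proof (unfold disjoint_family_on_def, intro ballI impI)
    have *: "G i \<inter> G j = {}" if "i < j" for i j
    proof -
      have "(real i + 1) * s \<le> real j * s" using that s by (intro mult_right_mono) auto
      then show ?thesis by (fastforce simp: G_def)
    qed
    show "G (k + i) \<inter> G (k + j) = {}" if "i \<in> {..<m}" "j \<in> {..<m}" "i \<noteq> j" for i j
      using *[of "k + i" "k + j"] *[of "k + j" "k + i"] that by (cases i j rule: linorder_cases) auto
  qed
  have "real m * measure (gauss n) (G k) = (\<Sum>j<m. measure (gauss n) (G k))" by simp
  also have "\<dots> \<le> (\<Sum>j<m. 5 * measure (gauss n) (G (k + j)))"
    by (intro sum_mono step) simp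
  also have "\<dots> = 5 * measure (gauss n) (\<Union>j<m. G (k + j))"
    unfolding sum_distrib_left[symmetric] by (subst finite_measure_finite_Union[OF _ _ disj]) auto
  also have "measure (gauss n) (\<Union>j<m. G (k + j)) \<le> measure (gauss n) {x \<in> R. b < dotp n t x}"
    using s by (intro finite_measure_mono B) (auto simp: G_def intro: le_less_trans[rotated])
  finally show ?thesis by (simp add: G_def)
qed

section \<open>Mean, variance and tails of the noise\<close>

lemma integral_mehler_tensor:
  assumes "0 < \<rho>" "\<rho> < 1"
  shows "integrable (gauss n) (mehler_tensor n \<rho> x)" "(\<integral>u. mehler_tensor n \<rho> x u \<partial>gauss n) = 1"
  using integrable_mehler_tensor_hermite[OF assms, of n x "\<lambda>_. 0"]
    integral_mehler_tensor_hermite[OF assms, of n x "\<lambda>_. 0"]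
  by (simp_all add: hermite_tensor_def hermite_fun_def)

lemma mehler_tensor_variance:
  assumes \<rho>: "0 < \<rho>" "\<rho> < 1" and t: "dotp n t t = 1"
  shows "integrable (gauss n) (\<lambda>u. (dotp n t u - \<rho> * dotp n t x)\<^sup>2 * mehler_tensor n \<rho> x u)"
    and "(\<integral>u. (dotp n t u - \<rho> * dotp n t x)\<^sup>2 * mehler_tensor n \<rho> x u \<partial>gauss n) = 1 - \<rho>\<^sup>2"
proof -
  define \<sigma> where "\<sigma> = sqrt (1 - \<rho>\<^sup>2)"
  have \<sigma>2: "\<sigma>\<^sup>2 = 1 - \<rho>\<^sup>2" using \<rho> by (simp add: \<sigma>_def power_le_one)
  interpret g1: prob_space gauss1 by (rule prob_space_gauss1)
  have z: "integrable gauss1 (\<lambda>z. z)" "integrable gauss1 (\<lambda>z. z\<^sup>2)" "(\<integral>z. z\<^sup>2 \<partial>gauss1) = 1"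
    using integrable_gauss1_power[of 1] gauss1_moment_even[of 1] by simp_all
  have m: "integrable gauss1 (\<lambda>u. mehler \<rho> y u * (u - \<rho> * y) ^ k)"
    "(\<integral>u. mehler \<rho> y u * (u - \<rho> * y) ^ k \<partial>gauss1) = \<sigma> ^ k * (\<integral>z. z ^ k \<partial>gauss1)" for y k
    by (simp_all add: integrable_mehler_iff[OF \<rho>] integral_mehler[OF \<rho>] \<sigma>_def[symmetric] power_mult_distrib)
  \<comment> \<open>The exponent counts how often \<open>k\<close> occurs among \<open>i\<close> and
    \<open>j\<close>: it is 2 on the diagonal, where the variance arises, and 1 where just one index
    matches, so that a centred first moment kills the product.\<close>
  define g where "g i j k u = mehler \<rho> (x k) u * (u - \<rho> * x k) ^ (of_bool (k = i) + of_bool (k = j))"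
    for i j k :: nat and u
  have gi: "integrable gauss1 (g i j k)" for i j k unfolding g_def by (rule m)
  have gint: "(\<integral>u. g i j k u \<partial>gauss1) = (if k = i \<and> k = j then 1 - \<rho>\<^sup>2 else if k = i \<or> k = j then 0 else 1)" for i j k
    using m(2)[of "x k" 0] m(2)[of "x k" 1] m(2)[of "x k" 2] g1.prob_space
    by (auto simp: g_def gauss1_moment_1 z \<sigma>2 numeral_2_eq_2[symmetric])
  have prod: "(\<Prod>k<n. g i j k (u k)) = (u i - \<rho> * x i) * (u j - \<rho> * x j) * mehler_tensor n \<rho> x u"
    if "i < n" "j < n" for i j u
  proof -
    have pw: "(u k - \<rho> * x k) ^ of_bool (k = i) = (if k = i then u k - \<rho> * x k else 1)" for i k by simp
    show ?thesis
      unfolding g_def power_add pw prod.distrib mehler_tensor_def using that by simp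
  qed
  have eq: "(dotp n t u - \<rho> * dotp n t x)\<^sup>2 * mehler_tensor n \<rho> x u =
      (\<Sum>i<n. \<Sum>j<n. t i * t j * (\<Prod>k<n. g i j k (u k)))" for u
  proof -
    have "dotp n t u - \<rho> * dotp n t x = (\<Sum>i<n. t i * (u i - \<rho> * x i))"
      by (simp add: dotp_def sum_distrib_left sum_subtractf[symmetric] algebra_simps)
    then have "(dotp n t u - \<rho> * dotp n t x)\<^sup>2 =
        (\<Sum>i<n. \<Sum>j<n. t i * (u i - \<rho> * x i) * (t j * (u j - \<rho> * x j)))"
      by (simp add: power2_eq_square sum_product)
    then have "(dotp n t u - \<rho> * dotp n t x)\<^sup>2 * mehler_tensor n \<rho> x u =
        (\<Sum>i<n. \<Sum>j<n. t i * (u i - \<rho> * x i) * (t j * (u j - \<rho> * x j)) * mehler_tensor n \<rho> x u)"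
      by (simp only: sum_distrib_right)
    also have "\<dots> = (\<Sum>i<n. \<Sum>j<n. t i * t j * (\<Prod>k<n. g i j k (u k)))"
      by (intro sum.cong refl) (simp add: prod)
    finally show ?thesis .
  qed
  note gP = integrable_gauss_prod[OF gi] integral_gauss_prod[OF gi]
  show "integrable (gauss n) (\<lambda>u. (dotp n t u - \<rho> * dotp n t x)\<^sup>2 * mehler_tensor n \<rho> x u)"
    unfolding eq by (intro Bochner_Integration.integrable_sum integrable_mult_right gP)
  have "(\<integral>u. (dotp n t u - \<rho> * dotp n t x)\<^sup>2 * mehler_tensor n \<rho> x u \<partial>gauss n) =
      (\<Sum>i<n. \<Sum>j<n. t i * t j * (\<Prod>k<n. \<integral>u. g i j k u \<partial>gauss1))"
    unfolding eq by (simp add: gP)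
  also have "\<dots> = (\<Sum>i<n. \<Sum>j<n. if j = i then (t i)\<^sup>2 * (1 - \<rho>\<^sup>2) else 0)"
  proof (intro sum.cong refl)
    fix i j assume "i \<in> {..<n}" "j \<in> {..<n}"
    then show "t i * t j * (\<Prod>k<n. \<integral>u. g i j k u \<partial>gauss1) = (if j = i then (t i)\<^sup>2 * (1 - \<rho>\<^sup>2) else 0)"
      unfolding gint by (auto simp: prod_zero_iff power2_eq_square cong: if_cong)
  qed
  also have "\<dots> = (1 - \<rho>\<^sup>2) * dotp n t t"
    by (simp add: dotp_def power2_eq_square sum_distrib_left mult_ac)
  finally show "(\<integral>u. (dotp n t u - \<rho> * dotp n t x)\<^sup>2 * mehler_tensor n \<rho> x u \<partial>gauss n) = 1 - \<rho>\<^sup>2"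
    using t by simp
qed

text \<open>Symmetry of the kernel and Fubini's theorem show that noise preserves the Gaussian mean;
  \<open>polytope_noise\<close> uses this to replace the two-sided error by a one-sided one.\<close>

lemma
  fixes f :: "vect \<Rightarrow> real"
  assumes \<rho>: "0 < \<rho>" "\<rho> < 1" and [measurable]: "f \<in> borel_measurable (gauss n)"
    and f: "\<And>x. 0 \<le> f x" "\<And>x. f x \<le> 1"
  shows ou_nonneg: "0 \<le> ou n \<rho> f x"
    and integrable_ou_kernel: "x \<in> space (gauss n) \<Longrightarrow> integrable (gauss n) (\<lambda>u. f u * mehler_tensor n \<rho> x u)"
    and ou_le_1: "x \<in> space (gauss n) \<Longrightarrow> ou n \<rho> f x \<le> 1"
    and integrable_ou: "integrable (gauss n) (ou n \<rho> f)"
    and integral_ou: "(\<integral>x. ou n \<rho> f x \<partial>gauss n) = (\<integral>x. f x \<partial>gauss n)"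
proof -
  interpret G: prob_space "gauss n" by (rule prob_space_gauss)
  interpret P: pair_sigma_finite "gauss n" "gauss n" by standard
  note M = integral_mehler_tensor[OF \<rho>] mehler_tensor_pos[OF \<rho>]
  have le: "f u * mehler_tensor n \<rho> x u \<le> mehler_tensor n \<rho> x u" for x u
    using mult_right_mono[OF f(2)[of u] less_imp_le[OF M(3)[of n x u]]] by simp
  show nn: "0 \<le> ou n \<rho> f x" for x
    unfolding ou_def using f(1) less_imp_le[OF M(3)] by (intro Bochner_Integration.integral_nonneg) simp
  show i: "integrable (gauss n) (\<lambda>u. f u * mehler_tensor n \<rho> x u)" if "x \<in> space (gauss n)" for x
  proof (rule Bochner_Integration.integrable_bound[OF M(1)[of n x]])
    have [measurable]: "mehler_tensor n \<rho> x \<in> borel_measurable (gauss n)"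
      using that by (intro borel_measurable_mehler_tensor) simp_all
    show "(\<lambda>u. f u * mehler_tensor n \<rho> x u) \<in> borel_measurable (gauss n)" by measurable
    have "norm (f u * mehler_tensor n \<rho> x u) \<le> norm (mehler_tensor n \<rho> x u)" for u
      using le[of u x] f(1)[of u] M(3)[of n x u] by simp
    then show "AE u in gauss n. norm (f u * mehler_tensor n \<rho> x u) \<le> norm (mehler_tensor n \<rho> x u)"
      by simp
  qed
  show le1: "ou n \<rho> f x \<le> 1" if "x \<in> space (gauss n)" for x
    unfolding ou_def M(2)[of n x, symmetric] by (intro integral_mono i that M(1) le)
  show "integrable (gauss n) (ou n \<rho> f)"
    using nn le1 by (intro G.integrable_const_bound[where B = 1] AE_I2) auto
  have "integrable (gauss n \<Otimes>\<^sub>M gauss n) (\<lambda>(x, u). f u * mehler_tensor n \<rho> x u)"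
  proof (rule P.Fubini_integrable)
    show "(\<lambda>(x, u). f u * mehler_tensor n \<rho> x u) \<in> borel_measurable (gauss n \<Otimes>\<^sub>M gauss n)" by measurable
    have eq: "norm (f u * mehler_tensor n \<rho> x u) = f u * mehler_tensor n \<rho> x u" for x u
      using f(1)[of u] M(3)[of n x u] by simp
    show "integrable (gauss n) (\<lambda>x. \<integral>u. norm ((\<lambda>(x, u). f u * mehler_tensor n \<rho> x u) (x, u)) \<partial>gauss n)"
      unfolding prod.case eq ou_def[symmetric] by fact
    show "AE x in gauss n. integrable (gauss n) (\<lambda>u. (\<lambda>(x, u). f u * mehler_tensor n \<rho> x u) (x, u))"
      using i by (intro AE_I2) simp
  qed
  from P.Fubini_integral[OF this]
  have "(\<integral>x. ou n \<rho> f x \<partial>gauss n) = (\<integral>u. (\<integral>x. f u * mehler_tensor n \<rho> x u \<partial>gauss n) \<partial>gauss n)"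
    by (simp add: ou_def)
  also have "\<dots> = (\<integral>u. f u \<partial>gauss n)"
    by (simp add: mehler_tensor_commute[of n \<rho> _ "_ :: vect"] M(2)) 
  finally show "(\<integral>x. ou n \<rho> f x \<partial>gauss n) = (\<integral>x. f x \<partial>gauss n)" .
qed

text \<open>Chebyshev's inequality. Under the kernel at \<open>x\<close>, the value
  \<open>t \<bullet> u\<close> has mean \<open>\<rho> * (t \<bullet> x)\<close>, and to reach the
  support of \<open>f\<close> it must fall at least \<open>a / 4\<close> below it:
  \<open>\<rho> * a\<close> is at least \<open>a / 2\<close>, and the drift
  \<open>(1 - \<rho>) * b\<close> towards the origin costs at most \<open>a / 4\<close>.\<close>

lemma ou_tail:
  fixes f :: "vect \<Rightarrow> real"
  assumes \<rho>: "1 / 2 \<le> \<rho>" "\<rho> < 1" and [measurable]: "f \<in> borel_measurable (gauss n)"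
    and f: "\<And>x. 0 \<le> f x" "\<And>x. f x \<le> 1" and t: "dotp n t t = 1" and b: "b \<le> r"
    and supp: "\<And>u. f u \<noteq> 0 \<Longrightarrow> dotp n t u \<le> b" and x: "x \<in> space (gauss n)"
    and a: "0 < a" "b + a \<le> dotp n t x" "4 * ((1 - \<rho>) * r) \<le> a"
  shows "ou n \<rho> f x \<le> 16 * (1 - \<rho>\<^sup>2) / a\<^sup>2"
proof -
  have \<rho>': "0 < \<rho>" using \<rho> by simp
  note V = mehler_tensor_variance[OF \<rho>' \<rho>(2) t, of x]
  let ?V = "\<lambda>u. (dotp n t u - \<rho> * dotp n t x)\<^sup>2"
  have "f u * mehler_tensor n \<rho> x u \<le> 16 / a\<^sup>2 * (?V u * mehler_tensor n \<rho> x u)" for u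
  proof -
    have "f u \<le> 16 / a\<^sup>2 * ?V u"
    proof (cases "f u = 0")
      case False
      have "a / 4 \<le> \<rho> * dotp n t x - dotp n t u"
      proof -
        have "\<rho> * (b + a) \<le> \<rho> * dotp n t x" using a \<rho>' by (intro mult_left_mono) auto
        moreover have "dotp n t u \<le> b" by (rule supp[OF False])
        moreover have "(1 - \<rho>) * b \<le> (1 - \<rho>) * r" using b \<rho> by (intro mult_left_mono) auto
        moreover have "a / 2 \<le> \<rho> * a" using mult_right_mono[OF \<rho>(1), of a] a by simp
        ultimately show ?thesis using a(3) by (simp add: algebra_simps)
      qed
      then have "(a / 4)\<^sup>2 \<le> ?V u"
        using a by (subst power2_commute) (intro power_mono, auto)
      then have "1 \<le> 16 / a\<^sup>2 * ?V u" using a by (simp add: field_simps power_divide)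
      then show ?thesis using f(2)[of u] by simp
    qed simp
    from mult_right_mono[OF this less_imp_le[OF mehler_tensor_pos[OF \<rho>' \<rho>(2)]]]
    show ?thesis by (simp add: mult.assoc)
  qed
  then have "ou n \<rho> f x \<le> (\<integral>u. 16 / a\<^sup>2 * (?V u * mehler_tensor n \<rho> x u) \<partial>gauss n)"
    unfolding ou_def
    by (intro integral_mono integrable_ou_kernel[OF \<rho>' \<rho>(2) _ f x] integrable_mult_right V(1)) simp_all
  also have "\<dots> = 16 * (1 - \<rho>\<^sup>2) / a\<^sup>2" by (simp add: V(2))
  finally show ?thesis .
qed

lemma sum_inverse_squares_le: "(\<Sum>k<m. if k = 0 then 1 else 1 / (real k)\<^sup>2) \<le> 3"
proof -
  \<comment> \<open>The subtracted \<open>1 / (m + 1)\<close> makes the induction go through, each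
    new term being at most a telescoping difference.\<close>
  have *: "(\<Sum>k<Suc (Suc m). if k = 0 then 1 else 1 / (real k)\<^sup>2) \<le> 3 - 1 / (real m + 1)" for m
  proof (induction m)
    case (Suc m)
    have "1 / (real m + 2)\<^sup>2 \<le> 1 / (real m + 1) - 1 / (real m + 2)"
    proof -
      have "1 / (real m + 2)\<^sup>2 \<le> 1 / ((real m + 1) * (real m + 2))"
        unfolding power2_eq_square by (intro divide_left_mono mult_right_mono) auto
      also have "\<dots> = 1 / (real m + 1) - 1 / (real m + 2)" by (simp add: field_simps)
      finally show ?thesis .
    qed
    then show ?case using Suc by (simp add: add.commute)
  qed simp
  show ?thesis
  proof (cases "m \<le> 1")
    case True
    then show ?thesis by (cases m) auto
  next
    case False
    then obtain l where "m = Suc (Suc l)" by (metis One_nat_def Suc_pred not_less_eq_eq not_gr0 le0 less_Suc_eq_le)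
    then show ?thesis using *[of l] by (auto intro: order_trans)
  qed
qed

lemma nat_floor_bounds:
  assumes "1 \<le> (y::real)"
  shows "1 \<le> nat \<lfloor>y\<rfloor>" "real (nat \<lfloor>y\<rfloor>) \<le> y" "y / 2 \<le> real (nat \<lfloor>y\<rfloor>)"
proof -
  define F where "F = \<lfloor>y\<rfloor>"
  have F: "1 \<le> F" "y < real_of_int F + 1" "real_of_int F \<le> y"
    using assms unfolding F_def by linarith+
  then have "real (nat F) = real_of_int F" by simp
  then show "1 \<le> nat \<lfloor>y\<rfloor>" "real (nat \<lfloor>y\<rfloor>) \<le> y" "y / 2 \<le> real (nat \<lfloor>y\<rfloor>)"
    using F unfolding F_def[symmetric] by linarith+
qed

text \<open>The cell of points outside the polytope whose most violated constraint is the \<open>i\<close>-th one is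
  closed under translation along its normal \<open>t i\<close>: this is what makes the bound independent of
  the number of facets.\<close>

lemma polytope_noise:
  fixes N :: nat and t :: "nat \<Rightarrow> vect" and b :: "nat \<Rightarrow> real"
  assumes t: "\<And>i. i < N \<Longrightarrow> dotp n (t i) (t i) = 1" and b: "\<And>i. i < N \<Longrightarrow> b i \<le> r"
    and r: "0 \<le> r" and \<rho>: "1 / 2 \<le> \<rho>" "\<rho> < 1"
    and small: "8 * sqrt (1 - \<rho>\<^sup>2) * (1 + r) \<le> 1"
  defines "f \<equiv> indicator {x \<in> Rn n. \<forall>i<N. dotp n (t i) x \<le> b i} :: vect \<Rightarrow> real"
  shows "f \<in> borel_measurable (gauss n)"
    and "(\<integral>x. \<bar>f x - ou n \<rho> f x\<bar> \<partial>gauss n) \<le> 256 * (1 + r) * sqrt (1 - \<rho>\<^sup>2)"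
proof -
  interpret prob_space "gauss n" by (rule prob_space_gauss)
  define \<sigma> where "\<sigma> = sqrt (1 - \<rho>\<^sup>2)"
  have \<rho>': "0 < \<rho>" using \<rho> by simp
  have \<sigma>: "0 < \<sigma>" "\<sigma>\<^sup>2 = 1 - \<rho>\<^sup>2" using \<rho> \<rho>' by (simp_all add: \<sigma>_def power_less_one_iff power_le_one)
  have small: "8 * \<sigma> * (1 + r) \<le> 1" using small by (simp add: \<sigma>_def)
  show [measurable]: "f \<in> borel_measurable (gauss n)"
    unfolding f_def space_gauss[symmetric] by measurable
  have f01: "0 \<le> f x" "f x \<le> 1" for x by (simp_all add: f_def)
  define T where "T = ou n \<rho> f"
  have [measurable]: "T \<in> borel_measurable (gauss n)" unfolding T_def by measurable
  have T: "0 \<le> T x" for x unfolding T_def using \<rho>' \<rho>(2) f01 by (intro ou_nonneg) auto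
  have T1: "T x \<le> 1" if "x \<in> space (gauss n)" for x
    unfolding T_def using \<rho>' \<rho>(2) f01 that by (intro ou_le_1) auto
  have iT: "integrable (gauss n) T" "(\<integral>x. T x \<partial>gauss n) = (\<integral>x. f x \<partial>gauss n)"
    unfolding T_def using \<rho>' \<rho>(2) f01 by (auto intro!: integrable_ou integral_ou)
  have if': "integrable (gauss n) f"
    using f01 by (intro integrable_const_bound[where B = 1]) auto
  define v where "v i x = dotp n (t i) x - b i" for i x
  \<comment> \<open>Ties go to the smallest index, which makes the cells \<open>A i\<close>
    disjoint.\<close>
  define R where "R i = {x \<in> Rn n. (\<forall>j<N. v j x \<le> v i x) \<and> (\<forall>j<i. v j x < v i x)}" for i
  define A where "A i = {x \<in> R i. b i < dotp n (t i) x}" for i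
  have v: "v i \<in> borel_measurable (gauss n)" for i
    unfolding v_def by measurable
  have R_sets [measurable]: "R i \<in> sets (gauss n)" for i
  proof -
    have "{x \<in> space (gauss n). v j x \<le> v i x} \<in> sets (gauss n)"
      "{x \<in> space (gauss n). v j x < v i x} \<in> sets (gauss n)" for j
      by (intro borel_measurable_le borel_measurable_less v)+
    then show ?thesis
      unfolding R_def space_gauss[symmetric]
      by (intro sets.sets_Collect_conj sets.sets_Collect_countable_All sets.sets_Collect_imp
          sets.sets_Collect_const)
  qed
  have Aeq: "A i = {x \<in> space (gauss n). x \<in> R i \<and> b i < dotp n (t i) x}" for i
    using sets.sets_into_space[OF R_sets] by (auto simp: A_def)
  have [measurable]: "A i \<in> sets (gauss n)" for i unfolding Aeq by measurable
  \<comment> \<open>As many slabs of width \<open>4 * \<sigma>\<close> as fit within distance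
    \<open>1 / (1 + r)\<close> of the facet, the range in which translation costs a bounded
    factor.\<close>
  define m where "m = nat \<lfloor>1 / (4 * \<sigma> * (1 + r))\<rfloor>"
  have y: "1 \<le> 1 / (4 * \<sigma> * (1 + r))"
  proof -
    have "0 < \<sigma> * (1 + r)" using \<sigma> r by simp
    then have "0 < 4 * \<sigma> * (1 + r)" "4 * \<sigma> * (1 + r) \<le> 1" using small by linarith+
    then show ?thesis by (metis le_divide_eq_1_pos)
  qed
  note m = nat_floor_bounds[OF y, folded m_def]
  have ms: "real m * (4 * \<sigma>) \<le> 1 / (1 + r)"
  proof -
    have "1 / (4 * \<sigma> * (1 + r)) * (4 * \<sigma>) = 1 / (1 + r)" using \<sigma> by simp
    then show ?thesis using mult_right_mono[OF m(2), of "4 * \<sigma>"] \<sigma> by simp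
  qed
  define G where "G i k = {x \<in> R i. b i + real k * (4 * \<sigma>) < dotp n (t i) x \<and>
    dotp n (t i) x \<le> b i + (real k + 1) * (4 * \<sigma>)}" for i k
  have Geq: "G i k = {x \<in> space (gauss n). x \<in> R i \<and> b i + real k * (4 * \<sigma>) < dotp n (t i) x \<and>
    dotp n (t i) x \<le> b i + (real k + 1) * (4 * \<sigma>)}" for i k
    using sets.sets_into_space[OF R_sets] by (auto simp: G_def)
  have [measurable]: "G i k \<in> sets (gauss n)" for i k unfolding Geq by measurable
  \<comment> \<open>The value of the tail bound at distance \<open>k * (4 * \<sigma>)\<close>, where
    \<open>16 * \<sigma>^2 / (4 * \<sigma> * k)^2 = 1 / k^2\<close>; next to the facet only the
    trivial bound 1 is available.\<close>
  define wt :: "nat \<Rightarrow> real" where "wt k = (if k = 0 then 1 else 1 / (real k)\<^sup>2)" for k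
  have wt: "0 \<le> wt k" for k by (simp add: wt_def)
  \<comment> \<open>Normals are unit vectors, so moving along \<open>t i\<close> increases the
    violation of constraint \<open>i\<close> at full speed and no other violation faster; the
    maximiser stays the same.\<close>
  have up: "translate_vect n (\<lambda>l. c * t i l) x \<in> R i" if i: "i < N" and x: "x \<in> R i" and c: "0 \<le> c" for i x c
  proof -
    have le: "v j (translate_vect n (\<lambda>l. c * t i l) x) \<le> v j x + c" if "j < N" for j
    proof -
      have "2 * dotp n (t j) (t i) \<le> dotp n (t j) (t j) + dotp n (t i) (t i)"
        unfolding dotp_def sum_distrib_left sum.distrib[symmetric]
        by (intro sum_mono) (use sum_squares_bound in \<open>simp add: power2_eq_square mult.assoc\<close>)
      then have "c * dotp n (t j) (t i) \<le> c * 1" using t[OF i] t[OF that] c by (intro mult_left_mono) auto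
      moreover have "dotp n (t j) (\<lambda>l. c * t i l) = c * dotp n (t j) (t i)"
        by (simp add: dotp_def sum_distrib_left mult_ac)
      ultimately show ?thesis by (simp add: v_def dotp_shift)
    qed
    have eq: "v i (translate_vect n (\<lambda>l. c * t i l) x) = v i x + c"
    proof -
      have "dotp n (t i) (\<lambda>l. c * t i l) = c * dotp n (t i) (t i)"
        by (simp add: dotp_def sum_distrib_left mult_ac)
      then show ?thesis using t[OF i] by (simp add: v_def dotp_shift)
    qed
    have x': "\<forall>j<N. v j x \<le> v i x" "\<forall>j<i. v j x < v i x" using x by (auto simp: R_def)
    have "v j (translate_vect n (\<lambda>l. c * t i l) x) \<le> v i x + c" if "j < N" for j
      using le[OF that] x'(1)[rule_format, OF that] by linarith
    moreover have "v j (translate_vect n (\<lambda>l. c * t i l) x) < v i x + c" if "j < i" for j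
      using le[of j] x'(2)[rule_format, OF that] that i by linarith
    ultimately show ?thesis
      unfolding R_def by (simp add: translate_vect_in_Rn eq)
  qed
  have slab: "real m * measure (gauss n) (G i k) \<le> 5 * measure (gauss n) (A i)" if "i < N" "k < m" for i k
    unfolding G_def A_def using that t b r \<sigma> ms up
    by (intro gauss_slab_le[where r = r]) auto
  \<comment> \<open>Points past all \<open>m\<close> slabs receive the weight of slab
    \<open>m\<close>: the tail bound there holds at any greater distance.\<close>
  have TA: "T x \<le> (\<Sum>k<m. wt k * indicator (G i k) x) + wt m * indicator (A i) x"
    if i: "i < N" and x: "x \<in> A i" for i x
  proof -
    have xs: "x \<in> space (gauss n)" using x by (simp add: Aeq)
    have nn: "0 \<le> (\<Sum>k<m. wt k * indicator (G i k) x)" using wt by (intro sum_nonneg) simp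
    have tail: "T x \<le> wt k" if k: "b i + real k * (4 * \<sigma>) \<le> dotp n (t i) x" for k
    proof (cases "k = 0")
      case True
      then show ?thesis using T1[OF xs] by (simp add: wt_def)
    next
      case False
      have "(1 - \<rho>) * r \<le> \<sigma>"
      proof -
        have "(1 - \<rho>) * r \<le> \<sigma>\<^sup>2 * r"
        proof (rule mult_right_mono[OF _ r])
          have "\<rho>\<^sup>2 \<le> \<rho>" using \<rho> \<rho>' by (simp add: power2_eq_square)
          then show "1 - \<rho> \<le> \<sigma>\<^sup>2" using \<sigma>(2) by simp
        qed
        also have "\<dots> = \<sigma> * (\<sigma> * r)" by (simp add: power2_eq_square)
        also have "\<dots> \<le> \<sigma> * 1"
          using small \<sigma> r by (intro mult_left_mono) (auto simp: algebra_simps)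
        finally show ?thesis by simp
      qed
      moreover have "4 * \<sigma> \<le> real k * (4 * \<sigma>)" using False \<sigma> by simp
      ultimately have h4: "4 * ((1 - \<rho>) * r) \<le> real k * (4 * \<sigma>)" by linarith
      have supp: "dotp n (t i) u \<le> b i" if "f u \<noteq> 0" for u
        using that i by (auto simp: f_def indicator_def split: if_splits)
      have "T x \<le> 16 * (1 - \<rho>\<^sup>2) / (real k * (4 * \<sigma>))\<^sup>2"
        unfolding T_def using False \<sigma>
        by (intro ou_tail[where t = "t i" and b = "b i" and r = r]
            \<rho> f01 t[OF i] b[OF i] xs k supp h4 \<open>f \<in> borel_measurable (gauss n)\<close>) simp_all
      also have "\<dots> = wt k"
        using False \<sigma> unfolding \<sigma>(2)[symmetric] wt_def by (simp add: power_mult_distrib)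
      finally show ?thesis .
    qed
    have x': "x \<in> R i" "b i < dotp n (t i) x" using x by (auto simp: A_def)
    show ?thesis
    proof (cases "dotp n (t i) x \<le> b i + real m * (4 * \<sigma>)")
      case False
      then show ?thesis using tail[of m] nn x by simp
    next
      case True
      define a where "a = (dotp n (t i) x - b i) / (4 * \<sigma>)"
      have a: "0 < a" "a \<le> real m" using x' True \<sigma> by (simp_all add: a_def field_simps)
      \<comment> \<open>Slabs are open on the side of the facet and closed on the other, so a point
        at an exact multiple belongs to the slab before it.\<close>
      define k where "k = nat (\<lceil>a\<rceil> - 1)"
      have k: "real k < a" "a \<le> real k + 1" "k < m" unfolding k_def using a by linarith+
      have "real k * (4 * \<sigma>) < a * (4 * \<sigma>)" "a * (4 * \<sigma>) \<le> (real k + 1) * (4 * \<sigma>)"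
        using k \<sigma> by (simp_all add: mult_right_mono)
      moreover have "a * (4 * \<sigma>) = dotp n (t i) x - b i" using \<sigma> by (simp add: a_def)
      ultimately have kx: "b i + real k * (4 * \<sigma>) < dotp n (t i) x" "dotp n (t i) x \<le> b i + (real k + 1) * (4 * \<sigma>)"
        by linarith+
      then have "T x \<le> wt k * indicator (G i k) x" using tail[of k] x' by (simp add: G_def)
      also have "\<dots> \<le> (\<Sum>k<m. wt k * indicator (G i k) x)"
        using k wt by (intro member_le_sum) auto
      finally show ?thesis using wt[of m] by (simp add: indicator_def)
    qed
  qed
  have ind [simp]: "integrable (gauss n) (indicat_real (G i k))" "integrable (gauss n) (indicat_real (A i))" for i k
    by (rule integrable_const_bound[where B = 1]; simp)+
  have wm: "wt m \<le> 1 / real m"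
    using m(1) by (simp add: wt_def field_simps power2_eq_square)
  have intA: "(\<integral>x. indicator (A i) x * T x \<partial>gauss n) \<le> 16 / real m * measure (gauss n) (A i)"
    if i: "i < N" for i
  proof -
    have "(\<integral>x. indicator (A i) x * T x \<partial>gauss n) \<le>
        (\<integral>x. (\<Sum>k<m. wt k * indicator (G i k) x) + wt m * indicator (A i) x \<partial>gauss n)"
    proof (rule integral_mono)
      show "integrable (gauss n) (\<lambda>x. indicator (A i) x * T x)"
        using T T1 by (intro integrable_const_bound[where B = 1] AE_I2) (auto simp: indicator_def)
      show "integrable (gauss n) (\<lambda>x. (\<Sum>k<m. wt k * indicator (G i k) x) + wt m * indicator (A i) x)"
        by (intro Bochner_Integration.integrable_add Bochner_Integration.integrable_sum integrable_mult_right) simp_all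
      show "indicator (A i) x * T x \<le> (\<Sum>k<m. wt k * indicator (G i k) x) + wt m * indicator (A i) x"
        if "x \<in> space (gauss n)" for x
        using TA[OF i, of x] wt by (cases "x \<in> A i") (auto intro!: sum_nonneg)
    qed
    also have "\<dots> = (\<Sum>k<m. wt k * measure (gauss n) (G i k)) + wt m * measure (gauss n) (A i)"
    proof -
      have "(\<integral>x. (\<Sum>k<m. wt k * indicator (G i k) x) \<partial>gauss n) = (\<Sum>k<m. \<integral>x. wt k * indicator (G i k) x \<partial>gauss n)"
        by (intro Bochner_Integration.integral_sum integrable_mult_right ind)
      moreover have "(\<integral>x. (\<Sum>k<m. wt k * indicator (G i k) x) + wt m * indicator (A i) x \<partial>gauss n) =
          (\<integral>x. (\<Sum>k<m. wt k * indicator (G i k) x) \<partial>gauss n) + (\<integral>x. wt m * indicator (A i) x \<partial>gauss n)"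
        by (intro Bochner_Integration.integral_add Bochner_Integration.integrable_sum integrable_mult_right ind)
      moreover have "(\<integral>x. wt k * indicator (G i k) x \<partial>gauss n) = wt k * measure (gauss n) (G i k)" for k
        by simp
      moreover have "(\<integral>x. wt m * indicator (A i) x \<partial>gauss n) = wt m * measure (gauss n) (A i)"
        by simp
      ultimately show ?thesis by (simp only:)
    qed
    also have "\<dots> \<le> (\<Sum>k<m. wt k * (5 / real m * measure (gauss n) (A i))) + 1 / real m * measure (gauss n) (A i)"
      using slab[OF i] m(1) wt
      by (intro add_mono sum_mono mult_left_mono mult_right_mono wm) (auto simp: field_simps)
    also have "\<dots> = ((\<Sum>k<m. wt k) * 5 + 1) / real m * measure (gauss n) (A i)"
      unfolding sum_distrib_right[symmetric] by (simp add: add_divide_distrib algebra_simps)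
    \<comment> \<open>The weights sum to at most 3, each slab has the share \<open>5 / m\<close>,
      and the region past the slabs adds \<open>1 / m\<close>; this makes 16.\<close>
    also have "\<dots> \<le> 16 / real m * measure (gauss n) (A i)"
      using sum_inverse_squares_le[of m] by (intro mult_right_mono divide_right_mono) (auto simp: wt_def)
    finally show ?thesis .
  qed
  have disj: "disjoint_family_on A {..<N}"
  proof (unfold disjoint_family_on_def, intro ballI impI)
    have *: "A i \<inter> A j = {}" if "i < j" "i < N" "j < N" for i j
      using that by (fastforce simp: A_def R_def)
    show "A i \<inter> A j = {}" if "i \<in> {..<N}" "j \<in> {..<N}" "i \<noteq> j" for i j
      using *[of i j] *[of j i] that by (cases i j rule: linorder_cases) auto
  qed
  have cover: "1 - f x \<le> (\<Sum>i<N. indicator (A i) x)" if x: "x \<in> space (gauss n)" for x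
  proof (cases "f x = 1")
    case True
    then show ?thesis by (simp add: sum_nonneg)
  next
    case False
    then have "\<exists>i<N. b i < dotp n (t i) x"
      using x unfolding f_def space_gauss by (auto simp: indicator_def not_le split: if_splits)
    then obtain i0 where i0: "i0 < N" "0 < v i0 x" by (auto simp: v_def)
    define V where "V = Max ((\<lambda>i. v i x) ` {..<N})"
    have V: "v j x \<le> V" if "j < N" for j unfolding V_def using that by (intro Max_ge) auto
    have "V \<in> (\<lambda>i. v i x) ` {..<N}" unfolding V_def using i0 by (intro Max_in) auto
    then have ex: "\<exists>i. i < N \<and> v i x = V" by auto
    \<comment> \<open>The least maximiser, matching the tie-breaking in \<open>R\<close>.\<close>
    define i where "i = (LEAST i. i < N \<and> v i x = V)"
    have i: "i < N" "v i x = V" using LeastI_ex[OF ex] by (simp_all add: i_def)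
    have "v j x < V" if "j < i" for j
      using not_less_Least[OF that[unfolded i_def]] V[of j] that i(1) by (auto simp: less_le)
    then have "x \<in> A i" using x i V V[OF i0(1)] i0(2) by (auto simp: A_def R_def space_gauss v_def)
    then have "1 = (indicator (A i) x :: real)" by simp
    also have "\<dots> \<le> (\<Sum>i<N. indicator (A i) x :: real)"
      using i by (intro member_le_sum) auto
    finally show ?thesis using f01(1)[of x] by simp
  qed
  have i2: "integrable (gauss n) (\<lambda>x. (1 - f x) * T x)"
    using T T1 f01 by (intro integrable_const_bound[where B = 1] AE_I2) (auto simp: mult_le_one abs_mult)
  have i3: "integrable (gauss n) (\<lambda>x. indicator (A i) x * T x)" for i
    using T T1 by (intro integrable_const_bound[where B = 1] AE_I2) (auto simp: indicator_def)
  have "(\<integral>x. (1 - f x) * T x \<partial>gauss n) \<le> (\<integral>x. (\<Sum>i<N. indicator (A i) x * T x) \<partial>gauss n)"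
    using i2 i3 mult_right_mono[OF cover T]
    by (intro integral_mono Bochner_Integration.integrable_sum) (auto simp: sum_distrib_right)
  also have "\<dots> = (\<Sum>i<N. \<integral>x. indicator (A i) x * T x \<partial>gauss n)"
    by (intro Bochner_Integration.integral_sum i3)
  also have "\<dots> \<le> (\<Sum>i<N. 16 / real m * measure (gauss n) (A i))"
    by (intro sum_mono intA) simp
  also have "\<dots> = 16 / real m * measure (gauss n) (\<Union>i<N. A i)"
    unfolding sum_distrib_left[symmetric] by (subst finite_measure_finite_Union[OF _ _ disj]) auto
  also have "\<dots> \<le> 16 / real m * 1"
    by (intro mult_left_mono) simp_all
  also have "\<dots> \<le> 16 * (8 * \<sigma> * (1 + r))"
  proof -
    have w: "0 < 8 * \<sigma> * (1 + r)" using \<sigma> r by simp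
    have "1 / (8 * \<sigma> * (1 + r)) \<le> real m" using m(3) by simp
    then have "1 \<le> real m * (8 * \<sigma> * (1 + r))" by (simp only: pos_divide_le_eq[OF w])
    then have "16 / real m \<le> 16 * (real m * (8 * \<sigma> * (1 + r))) / real m"
      by (intro divide_right_mono) (linarith, simp)
    then show ?thesis using m(1) by simp
  qed
  finally have main: "(\<integral>x. (1 - f x) * T x \<partial>gauss n) \<le> 128 * (1 + r) * \<sigma>" by (simp add: algebra_simps)
  \<comment> \<open>As \<open>f\<close> takes only the values 0 and 1 and \<open>T\<close> lies
    between them, the error is \<open>f - T\<close> plus twice the part of \<open>T\<close> outside
    the polytope. The first summand integrates to 0, since noise preserves the mean.\<close>
  have "(\<integral>x. \<bar>f x - T x\<bar> \<partial>gauss n) = (\<integral>x. f x - T x + 2 * ((1 - f x) * T x) \<partial>gauss n)"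
  proof (intro Bochner_Integration.integral_cong refl)
    fix x assume "x \<in> space (gauss n)"
    then show "\<bar>f x - T x\<bar> = f x - T x + 2 * ((1 - f x) * T x)"
      using T[of x] T1[of x] by (cases "f x = 1") (auto simp: f_def indicator_def split: if_splits)
  qed
  also have "\<dots> = 2 * (\<integral>x. (1 - f x) * T x \<partial>gauss n)"
    using i2 iT if' by simp
  finally show "(\<integral>x. \<bar>f x - ou n \<rho> f x\<bar> \<partial>gauss n) \<le> 256 * (1 + r) * sqrt (1 - \<rho>\<^sup>2)"
    using main unfolding T_def \<sigma>_def by (simp add: algebra_simps)
qed


section \<open>The polynomial kernel\<close>

definition poly_kernel :: "nat \<Rightarrow> nat \<Rightarrow> vect \<Rightarrow> vect \<Rightarrow> real" where
  "poly_kernel n d x u = (1 + dotp n x u) ^ d"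

text \<open>The squared norm, in the reproducing kernel Hilbert space, of the combination with
  coefficients \<open>c\<close> of the kernel functions at the points \<open>X\<close>.\<close>

definition kernel_quad :: "nat \<Rightarrow> nat \<Rightarrow> nat \<Rightarrow> (nat \<Rightarrow> real) \<Rightarrow> (nat \<Rightarrow> vect) \<Rightarrow> real" where
  "kernel_quad n d m c X = (\<Sum>s<m. \<Sum>t<m. c s * c t * poly_kernel n d (X s) (X t))"

text \<open>The bound \<open>B\<close> on the norm of \<open>p\<close> in the reproducing kernel Hilbert space of the polynomial
  kernel is expressed by duality, through finite combinations of point evaluations.\<close>

definition rkhs_le :: "nat \<Rightarrow> nat \<Rightarrow> real \<Rightarrow> (vect \<Rightarrow> real) \<Rightarrow> bool" where
  "rkhs_le n d B p \<longleftrightarrow> 0 \<le> B \<and>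
     (\<forall>m c X. \<bar>\<Sum>t<m. c t * p (X t)\<bar> \<le> B * sqrt (kernel_quad n d m c X))"

text \<open>The homogenised vector: with an additional coordinate 1 in position \<open>n\<close>,
  the base \<open>1 + x \<bullet> u\<close> of the kernel becomes a plain inner product.\<close>

definition coord1 :: "nat \<Rightarrow> nat \<Rightarrow> vect \<Rightarrow> real" where
  "coord1 n i x = (if i < n then x i else 1)"

lemma one_plus_dotp: "1 + dotp n x u = (\<Sum>i\<le>n. coord1 n i x * coord1 n i u)"
  by (simp add: lessThan_Suc_atMost[symmetric] coord1_def dotp_def)

text \<open>Peeling off one factor \<open>1 + x \<bullet> u\<close> turns the form of degree
  \<open>d + 1\<close> into \<open>n + 1\<close> forms of degree \<open>d\<close>. This replaces a
  feature map: positivity and multiplication by coordinates both come from it by induction.\<close>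

lemma kernel_quad_Suc:
  "kernel_quad n (Suc d) m c X = (\<Sum>i\<le>n. kernel_quad n d m (\<lambda>t. c t * coord1 n i (X t)) X)"
proof -
  have "kernel_quad n (Suc d) m c X =
      (\<Sum>s<m. \<Sum>t<m. \<Sum>i\<le>n. (c s * coord1 n i (X s)) * (c t * coord1 n i (X t)) * poly_kernel n d (X s) (X t))"
    unfolding kernel_quad_def poly_kernel_def power_Suc one_plus_dotp
    by (intro sum.cong refl) (simp add: sum_distrib_left sum_distrib_right mult_ac)
  also have "\<dots> = (\<Sum>s<m. \<Sum>i\<le>n. \<Sum>t<m. (c s * coord1 n i (X s)) * (c t * coord1 n i (X t)) * poly_kernel n d (X s) (X t))"
    by (intro sum.cong refl sum.swap)
  also have "\<dots> = (\<Sum>i\<le>n. \<Sum>s<m. \<Sum>t<m. (c s * coord1 n i (X s)) * (c t * coord1 n i (X t)) * poly_kernel n d (X s) (X t))"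
    by (rule sum.swap)
  finally show ?thesis by (simp add: kernel_quad_def)
qed

lemma kernel_quad_nonneg: "0 \<le> kernel_quad n d m c X"
proof (induction d arbitrary: c)
  case 0
  have "kernel_quad n 0 m c X = (\<Sum>s<m. c s)\<^sup>2"
    by (simp add: kernel_quad_def poly_kernel_def power2_eq_square sum_product)
  then show ?case by simp
next
  case (Suc d)
  then show ?case by (simp add: kernel_quad_Suc sum_nonneg)
qed

lemma rkhs_le_one: "rkhs_le n 0 1 (\<lambda>_. 1)"
proof -
  have "kernel_quad n 0 m c X = (\<Sum>s<m. c s)\<^sup>2" for m c X
    by (simp add: kernel_quad_def poly_kernel_def power2_eq_square sum_product)
  then show ?thesis by (simp add: rkhs_le_def)
qed

lemma rkhs_le_mono: "rkhs_le n d B p \<Longrightarrow> B \<le> B' \<Longrightarrow> rkhs_le n d B' p"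
  unfolding rkhs_le_def
  by (meson order_trans mult_right_mono real_sqrt_ge_zero kernel_quad_nonneg)

lemma rkhs_le_zero: "rkhs_le n d 0 (\<lambda>_. 0)"
  by (simp add: rkhs_le_def)

lemma rkhs_le_add:
  assumes "rkhs_le n d B p" "rkhs_le n d B' q"
  shows "rkhs_le n d (B + B') (\<lambda>x. p x + q x)"
  unfolding rkhs_le_def
proof (intro conjI allI)
  show "0 \<le> B + B'" using assms by (simp add: rkhs_le_def)
  fix m :: nat and c :: "nat \<Rightarrow> real" and X :: "nat \<Rightarrow> vect"
  have "\<bar>\<Sum>t<m. c t * (p (X t) + q (X t))\<bar> \<le> \<bar>\<Sum>t<m. c t * p (X t)\<bar> + \<bar>\<Sum>t<m. c t * q (X t)\<bar>"
    by (simp add: distrib_left sum.distrib)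
  also have "\<dots> \<le> B * sqrt (kernel_quad n d m c X) + B' * sqrt (kernel_quad n d m c X)"
    using assms by (intro add_mono) (simp_all add: rkhs_le_def)
  finally show "\<bar>\<Sum>t<m. c t * (p (X t) + q (X t))\<bar> \<le> (B + B') * sqrt (kernel_quad n d m c X)"
    by (simp add: distrib_right)
qed

lemma rkhs_le_scale:
  assumes "rkhs_le n d B p"
  shows "rkhs_le n d (\<bar>a\<bar> * B) (\<lambda>x. a * p x)"
  unfolding rkhs_le_def
proof (intro conjI allI)
  show "0 \<le> \<bar>a\<bar> * B" using assms by (simp add: rkhs_le_def)
  fix m :: nat and c :: "nat \<Rightarrow> real" and X :: "nat \<Rightarrow> vect"
  have "\<bar>\<Sum>t<m. c t * (a * p (X t))\<bar> = \<bar>a\<bar> * \<bar>\<Sum>t<m. c t * p (X t)\<bar>"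
    by (simp add: abs_mult[symmetric] sum_distrib_left mult_ac)
  also have "\<dots> \<le> \<bar>a\<bar> * (B * sqrt (kernel_quad n d m c X))"
    using assms by (intro mult_left_mono) (simp_all add: rkhs_le_def)
  finally show "\<bar>\<Sum>t<m. c t * (a * p (X t))\<bar> \<le> \<bar>a\<bar> * B * sqrt (kernel_quad n d m c X)"
    by (simp add: mult.assoc)
qed

lemma rkhs_le_sum:
  assumes "finite A" "\<And>a. a \<in> A \<Longrightarrow> rkhs_le n d (B a) (p a)"
  shows "rkhs_le n d (\<Sum>a\<in>A. B a) (\<lambda>x. \<Sum>a\<in>A. p a x)"
  using assms by (induction A) (auto simp: rkhs_le_zero intro!: rkhs_le_add)

text \<open>Absorbing the coordinate into the coefficients gives one of the nonnegative summands of
  \<open>kernel_quad_Suc\<close>, so the multiplication raises the degree but not the norm bound.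
  Coordinate \<open>n\<close>, the constant 1, embeds degree \<open>d\<close> in degree
  \<open>d + 1\<close>.\<close>

lemma rkhs_le_coord1:
  assumes "rkhs_le n d B p" "i \<le> n"
  shows "rkhs_le n (Suc d) B (\<lambda>x. coord1 n i x * p x)"
  unfolding rkhs_le_def
proof (intro conjI allI)
  show B: "0 \<le> B" using assms by (simp add: rkhs_le_def)
  fix m :: nat and c :: "nat \<Rightarrow> real" and X :: "nat \<Rightarrow> vect"
  have "\<bar>\<Sum>t<m. c t * (coord1 n i (X t) * p (X t))\<bar> \<le>
      B * sqrt (kernel_quad n d m (\<lambda>t. c t * coord1 n i (X t)) X)"
    using assms(1) unfolding rkhs_le_def by (metis (no_types, lifting) mult.assoc sum.cong)
  also have "\<dots> \<le> B * sqrt (kernel_quad n (Suc d) m c X)"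
    unfolding kernel_quad_Suc using assms(2)
    by (intro mult_left_mono B real_sqrt_le_mono member_le_sum kernel_quad_nonneg) auto
  finally show "\<bar>\<Sum>t<m. c t * (coord1 n i (X t) * p (X t))\<bar> \<le> B * sqrt (kernel_quad n (Suc d) m c X)" .
qed

lemma rkhs_le_Suc: "rkhs_le n d B p \<Longrightarrow> rkhs_le n (Suc d) B p"
  using rkhs_le_coord1[of n d B p n] by (simp add: coord1_def)

lemma rkhs_le_degree_mono: "rkhs_le n d B p \<Longrightarrow> d \<le> D \<Longrightarrow> rkhs_le n D B p"
  by (induction D) (auto intro: rkhs_le_Suc elim: le_SucE)

text \<open>The bound \<open>fact k\<close> is made to close under the recurrence:
  \<open>fact (k + 1) + (k + 1) * fact k\<close> equals \<open>2 * fact (k + 1)\<close>, which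
  \<open>fact (k + 2)\<close> dominates. The lower term is first lifted to the higher
  degree.\<close>

lemma rkhs_le_hermite:
  assumes p: "rkhs_le n d B p" and i: "i < n"
  shows "rkhs_le n (d + k) (fact k * B) (\<lambda>x. poly (hermite k) (x i) * p x)"
proof (induction k rule: hermite.induct)
  case 1
  then show ?case using p by simp
next
  case 2
  then show ?case using rkhs_le_coord1[OF p, of i] i by (simp add: coord1_def)
next
  case (3 k)
  have B: "0 \<le> B" using p by (simp add: rkhs_le_def)
  have "rkhs_le n (Suc (d + Suc k)) (fact (Suc k) * B)
      (\<lambda>x. coord1 n i x * (poly (hermite (Suc k)) (x i) * p x))"
    using 3 i by (intro rkhs_le_coord1) auto
  moreover have "rkhs_le n (Suc (d + Suc k)) (\<bar>- real (Suc k)\<bar> * (fact k * B))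
      (\<lambda>x. - real (Suc k) * (poly (hermite k) (x i) * p x))"
    using 3 by (intro rkhs_le_scale rkhs_le_degree_mono[OF 3(2)]) auto
  ultimately have "rkhs_le n (Suc (d + Suc k)) (fact (Suc k) * B + \<bar>- real (Suc k)\<bar> * (fact k * B))
      (\<lambda>x. coord1 n i x * (poly (hermite (Suc k)) (x i) * p x)
        + - real (Suc k) * (poly (hermite k) (x i) * p x))"
    by (rule rkhs_le_add)
  also have "(\<lambda>x. coord1 n i x * (poly (hermite (Suc k)) (x i) * p x)
        + - real (Suc k) * (poly (hermite k) (x i) * p x)) =
      (\<lambda>x. poly (hermite (Suc (Suc k))) (x i) * p x)"
    using i by (simp add: fun_eq_iff coord1_def algebra_simps)
  finally have "rkhs_le n (d + Suc (Suc k)) (fact (Suc k) * B + \<bar>- real (Suc k)\<bar> * (fact k * B))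
      (\<lambda>x. poly (hermite (Suc (Suc k))) (x i) * p x)"
    by simp
  then show ?case
  proof (rule rkhs_le_mono)
    have "fact (Suc k) * B + \<bar>- real (Suc k)\<bar> * (fact k * B) = 2 * (fact (Suc k) * B)"
      by (simp add: algebra_simps)
    also have "\<dots> \<le> real (Suc (Suc k)) * (fact (Suc k) * B)"
      using B by (intro mult_right_mono) auto
    also have "\<dots> = fact (Suc (Suc k)) * B" by (simp add: algebra_simps)
    finally show "fact (Suc k) * B + \<bar>- real (Suc k)\<bar> * (fact k * B) \<le> fact (Suc (Suc k)) * B" .
  qed
qed

lemma rkhs_le_hermite_fun:
  assumes p: "rkhs_le n d B p" and i: "i < n"
  shows "rkhs_le n (d + k) (fact k * B) (\<lambda>x. hermite_fun k (x i) * p x)"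
proof -
  have B: "0 \<le> B" using p by (simp add: rkhs_le_def)
  have f: "1 \<le> sqrt (fact k)" by simp
  have "rkhs_le n (d + k) (\<bar>1 / sqrt (fact k)\<bar> * (fact k * B))
      (\<lambda>x. 1 / sqrt (fact k) * (poly (hermite k) (x i) * p x))"
    by (rule rkhs_le_scale[OF rkhs_le_hermite[OF assms]])
  moreover have "\<bar>1 / sqrt (fact k)\<bar> * (fact k * B) \<le> 1 * (fact k * B)"
    using f B by (intro mult_right_mono) auto
  ultimately show ?thesis
    by (auto simp: hermite_fun_def intro: rkhs_le_mono)
qed

lemma fact_le_power_le: "k \<le> d \<Longrightarrow> fact k \<le> real d ^ k"
proof (induction k)
  case (Suc k)
  then have "real (Suc k) * fact k \<le> real d * real d ^ k"
    by (intro mult_mono) auto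
  then show ?case by simp
qed simp

lemma rkhs_le_hermite_tensor:
  assumes "(\<Sum>i<n. \<alpha> i) \<le> d"
  shows "rkhs_le n d (real d ^ d) (hermite_tensor n \<alpha>)"
proof -
  have \<alpha>d: "\<alpha> i \<le> d" if "i < n" for i
    using member_le_sum[of i "{..<n}" \<alpha>] that assms by simp
  have "rkhs_le n (\<Sum>i<m. \<alpha> i) (real d ^ (\<Sum>i<m. \<alpha> i)) (\<lambda>x. \<Prod>i<m. hermite_fun (\<alpha> i) (x i))"
    if "m \<le> n" for m
    using that
  proof (induction m)
    case 0
    then show ?case using rkhs_le_one by simp
  next
    case (Suc m)
    then have m: "m < n" and IH: "rkhs_le n (\<Sum>i<m. \<alpha> i) (real d ^ (\<Sum>i<m. \<alpha> i)) (\<lambda>x. \<Prod>i<m. hermite_fun (\<alpha> i) (x i))"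
      by auto
    have "fact (\<alpha> m) * real d ^ (\<Sum>i<m. \<alpha> i) \<le> real d ^ \<alpha> m * real d ^ (\<Sum>i<m. \<alpha> i)"
      by (intro mult_right_mono fact_le_power_le \<alpha>d[OF m]) simp
    also have "\<dots> = real d ^ (\<Sum>i<Suc m. \<alpha> i)" by (simp add: power_add)
    finally show ?case
      using rkhs_le_mono[OF rkhs_le_hermite_fun[OF IH m, of "\<alpha> m"]] by (simp add: mult.commute)
  qed
  from this[of n] have "rkhs_le n (\<Sum>i<n. \<alpha> i) (real d ^ (\<Sum>i<n. \<alpha> i)) (hermite_tensor n \<alpha>)"
    by (simp add: hermite_tensor_def[abs_def])
  then have *: "rkhs_le n d (real d ^ (\<Sum>i<n. \<alpha> i)) (hermite_tensor n \<alpha>)"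
    using assms by (rule rkhs_le_degree_mono)
  show ?thesis
  \<comment> \<open>Monotonicity in the exponent needs a base of at least 1; for
    \<open>d = 0\<close> both powers are \<open>0 ^ 0\<close>.\<close>
  proof (cases "d = 0")
    case False
    then have "real d ^ (\<Sum>i<n. \<alpha> i) \<le> real d ^ d"
      using assms by (intro power_increasing) auto
    then show ?thesis using * by (rule rkhs_le_mono[rotated])
  qed (use * assms in auto)
qed

text \<open>An index of degree \<open>d + 1\<close> is one of degree \<open>d\<close> with an entry
  raised, which leaves \<open>n\<close> choices; the indices of smaller degree make the factor
  \<open>n + 1\<close>.\<close>

lemma card_multi_indices: "card (multi_indices n d) \<le> (n + 1) ^ d"
proof (induction d)
  case 0
  have "multi_indices n 0 \<subseteq> {\<lambda>i\<in>{..<n}. 0}"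
    by (auto simp: multi_indices_def PiE_iff fun_eq_iff extensional_def restrict_def)
  from card_mono[OF _ this] show ?case by simp
next
  case (Suc d)
  let ?M = "multi_indices n d"
  have "multi_indices n (Suc d) \<subseteq> ?M \<union> (\<Union>i<n. (\<lambda>\<alpha>. \<alpha>(i := Suc (\<alpha> i))) ` ?M)"
  proof
    fix \<alpha> assume \<alpha>: "\<alpha> \<in> multi_indices n (Suc d)"
    show "\<alpha> \<in> ?M \<union> (\<Union>i<n. (\<lambda>\<alpha>. \<alpha>(i := Suc (\<alpha> i))) ` ?M)"
    proof (cases "(\<Sum>i<n. \<alpha> i) \<le> d")
      case True
      then show ?thesis using \<alpha> by (simp add: multi_indices_def)
    next
      case False
      then have "(\<Sum>i<n. \<alpha> i) \<noteq> 0" by (metis le0)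
      then obtain i where i: "i < n" "\<alpha> i \<noteq> 0" by (meson lessThan_iff sum.neutral)
      define \<beta> where "\<beta> = \<alpha>(i := \<alpha> i - 1)"
      have "(\<Sum>j<n. \<alpha> j) = \<alpha> i + (\<Sum>j\<in>{..<n} - {i}. \<alpha> j)"
        using i by (simp add: sum.remove)
      moreover have "(\<Sum>j<n. \<beta> j) = (\<alpha> i - 1) + (\<Sum>j\<in>{..<n} - {i}. \<alpha> j)"
        using i by (simp add: sum.remove \<beta>_def)
      ultimately have "\<beta> \<in> ?M"
        using \<alpha> i by (auto simp: multi_indices_def PiE_iff \<beta>_def extensional_def)
      moreover have "\<alpha> = \<beta>(i := Suc (\<beta> i))" using i by (simp add: \<beta>_def fun_eq_iff)
      ultimately show ?thesis using i(1) by blast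
    qed
  qed
  then have "card (multi_indices n (Suc d)) \<le> card (?M \<union> (\<Union>i<n. (\<lambda>\<alpha>. \<alpha>(i := Suc (\<alpha> i))) ` ?M))"
    by (rule card_mono[rotated]) (simp add: finite_multi_indices)
  also have "\<dots> \<le> card ?M + card (\<Union>i<n. (\<lambda>\<alpha>. \<alpha>(i := Suc (\<alpha> i))) ` ?M)"
    by (rule card_Un_le)
  also have "card (\<Union>i<n. (\<lambda>\<alpha>. \<alpha>(i := Suc (\<alpha> i))) ` ?M) \<le> (\<Sum>i<n. card ((\<lambda>\<alpha>. \<alpha>(i := Suc (\<alpha> i))) ` ?M))"
    by (rule card_UN_le) simp
  also have "\<dots> \<le> (\<Sum>i<n. card ?M)"
    by (intro sum_mono card_image_le finite_multi_indices)
  finally have "card (multi_indices n (Suc d)) \<le> (n + 1) * card ?M" by simp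
  also have "\<dots> \<le> (n + 1) * (n + 1) ^ d" using Suc by (intro mult_left_mono) auto
  finally show ?case by simp
qed

text \<open>Bessel's inequality for a single index bounds every coefficient by 1, so the norm is at
  most the number of indices times the bound for one tensor.\<close>

lemma rkhs_le_ou_truncated:
  assumes \<rho>: "0 \<le> \<rho>" "\<rho> \<le> 1" and f [measurable]: "f \<in> borel_measurable (gauss n)"
    and f1: "\<And>x. \<bar>f x\<bar> \<le> 1"
  shows "rkhs_le n d (real (n + 1) ^ d * real d ^ d) (ou_truncated n \<rho> d f)"
proof -
  interpret prob_space "gauss n" by (rule prob_space_gauss)
  have f2: "integrable (gauss n) (\<lambda>u. (f u)\<^sup>2)" "(\<integral>u. (f u)\<^sup>2 \<partial>gauss n) \<le> 1"
  proof -
    have fsq: "(f x)\<^sup>2 \<le> 1" for x using f1[of x] by (rule abs_square_le_1[THEN iffD2])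
    show i: "integrable (gauss n) (\<lambda>u. (f u)\<^sup>2)"
      by (rule integrable_const_bound[where B = 1]) (simp_all add: fsq)
    show "(\<integral>u. (f u)\<^sup>2 \<partial>gauss n) \<le> 1"
      using integral_mono[OF i, of "\<lambda>_. 1"] fsq by (simp add: prob_space)
  qed
  let ?a = "\<lambda>\<alpha>. \<rho> ^ (\<Sum>i<n. \<alpha> i) * hermite_coeff n f \<alpha>"
  have a: "\<bar>?a \<alpha>\<bar> \<le> 1" if "\<alpha> \<in> multi_indices n d" for \<alpha>
  proof -
    have "(hermite_coeff n f \<alpha>)\<^sup>2 \<le> 1"
      using hermite_bessel[OF f f2(1), of "{\<alpha>}"] f2(2) that
      by (simp add: hermite_coeff_def multi_indices_def PiE_iff)
    then have "\<bar>hermite_coeff n f \<alpha>\<bar> \<le> 1" by (rule abs_square_le_1[THEN iffD1])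
    then show ?thesis
      using \<rho> by (simp add: abs_mult mult_le_one power_le_one)
  qed
  have "rkhs_le n d (\<Sum>\<alpha>\<in>multi_indices n d. \<bar>?a \<alpha>\<bar> * real d ^ d)
      (\<lambda>x. \<Sum>\<alpha>\<in>multi_indices n d. ?a \<alpha> * hermite_tensor n \<alpha> x)"
    by (intro rkhs_le_sum rkhs_le_scale rkhs_le_hermite_tensor finite_multi_indices)
      (simp add: multi_indices_def)
  then have "rkhs_le n d (\<Sum>\<alpha>\<in>multi_indices n d. \<bar>?a \<alpha>\<bar> * real d ^ d) (ou_truncated n \<rho> d f)"
    by (simp add: ou_truncated_def[abs_def])
  then show ?thesis
  proof (rule rkhs_le_mono)
    have "(\<Sum>\<alpha>\<in>multi_indices n d. \<bar>?a \<alpha>\<bar> * real d ^ d) \<le> (\<Sum>\<alpha>\<in>multi_indices n d. 1 * real d ^ d)"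
      by (intro sum_mono mult_right_mono a) simp_all
    also have "\<dots> = real (card (multi_indices n d)) * real d ^ d" by simp
    also have "\<dots> \<le> real ((n + 1) ^ d) * real d ^ d"
      using card_multi_indices[of n d] by (intro mult_right_mono of_nat_mono) simp_all
    finally show "(\<Sum>\<alpha>\<in>multi_indices n d. \<bar>?a \<alpha>\<bar> * real d ^ d) \<le> real (n + 1) ^ d * real d ^ d"
      by simp
  qed
qed

text \<open>There may be uncountably many facets. The complement is a union of open half-spaces, so
  by Lindelof's theorem countably many of them suffice, which already gives measurability;
  continuity from above then leaves finitely many at the cost of \<eta>. Their number stays
  uncontrolled, and \<open>polytope_noise\<close> does not depend on it.\<close>

lemma Conv_approx_polytope:
  assumes h: "h \<in> Conv n r" and \<eta>: "0 < \<eta>"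
  shows "boolean_function n h"
    and "\<exists>(N::nat) t b. (\<forall>i<N. dotp n (t i) (t i) = 1 \<and> b i \<le> r) \<and>
      measure (gauss n) {x \<in> space (gauss n). h x \<noteq> (x \<in> {x \<in> Rn n. \<forall>i<N. dotp n (t i) x \<le> b i})} < \<eta>"
proof -
  interpret prob_space "gauss n" by (rule prob_space_gauss)
  obtain T b where T: "T \<subseteq> unit_sphere n" "\<forall>t\<in>T. \<bar>b t\<bar> \<le> r"
    and hK: "h = (\<lambda>x. x \<in> {x \<in> Rn n. \<forall>t\<in>T. dotp n t x \<le> b t})"
    using h unfolding Conv_def geometric_width_le_def by blast
  define U where "U t = {x :: vect. b t < dotp n t x}" for t
  have "open (U t)" for t
    unfolding U_def dotp_def
    by (intro open_Collect_less continuous_intros continuous_on_product_coordinates)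
  then have "\<exists>F'\<subseteq>U ` T. countable F' \<and> \<Union>F' = \<Union>(U ` T)"
    by (metis (no_types, lifting) Lindelof imageE)
  then obtain T0 where T0: "T0 \<subseteq> T" "countable T0" "\<Union>(U ` T0) = \<Union>(U ` T)"
    unfolding countable_subset_image by (metis countable_subset_image)
  have "(\<forall>t\<in>T. dotp n t x \<le> b t) \<longleftrightarrow> (\<forall>t\<in>T0. dotp n t x \<le> b t)" for x
  proof -
    have *: "(\<forall>t\<in>S. dotp n t x \<le> b t) \<longleftrightarrow> x \<notin> \<Union>(U ` S)" for S
      by (auto simp: U_def not_less)
    show ?thesis unfolding * T0(3) ..
  qed
  then have hK: "h = (\<lambda>x. x \<in> Rn n \<and> (\<forall>t\<in>T0. dotp n t x \<le> b t))"
    unfolding hK by auto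
  have unit: "dotp n t t = 1" if "t \<in> T0" for t
    using that T0(1) T(1) by (auto simp: unit_sphere_def L2_set_def dotp_def power2_eq_square)
  have br: "b t \<le> r" if "t \<in> T0" for t
    using that T0(1) T(2) by (meson abs_le_D1 subsetD)
  have "boolean_function n h \<and> (\<exists>(N::nat) t b. (\<forall>i<N. dotp n (t i) (t i) = 1 \<and> b i \<le> r) \<and>
      measure (gauss n) {x \<in> space (gauss n). h x \<noteq> (x \<in> {x \<in> Rn n. \<forall>i<N. dotp n (t i) x \<le> b i})} < \<eta>)"
  proof (cases "T0 = {}")
    case True
    have "boolean_function n h"
      unfolding hK True by (rule measurable_cong[THEN iffD2, of _ _ "\<lambda>_. True"]) (auto simp: space_gauss)
    then show ?thesis
      using \<eta> by (intro conjI exI[of _ "0::nat"]) (auto simp: hK True space_gauss)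
  next
    case False
    define e where "e = from_nat_into T0"
    have e: "e i \<in> T0" for i unfolding e_def by (rule from_nat_into[OF False])
    have range_e: "range e = T0" unfolding e_def by (rule range_from_nat_into[OF False T0(2)])
    define K where "K N = {x \<in> space (gauss n). \<forall>i<N. dotp n (e i) x \<le> b (e i)}" for N :: nat
    define H where "H = (\<Inter>N. K N)"
    have hH: "h x \<longleftrightarrow> x \<in> H" for x
      using range_e[symmetric] by (auto simp: hK H_def K_def space_gauss)
    have K [measurable]: "K N \<in> sets (gauss n)" for N unfolding K_def by measurable
    have H [measurable]: "H \<in> sets (gauss n)" unfolding H_def by measurable
    have dec: "decseq K" unfolding decseq_def K_def by auto
    have "(\<lambda>N. measure (gauss n) (K N)) \<longlonglongrightarrow> measure (gauss n) H"
      unfolding H_def using K dec by (intro finite_Lim_measure_decseq) auto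
    then have "\<forall>\<^sub>F N in sequentially. measure (gauss n) (K N) < measure (gauss n) H + \<eta>"
      using \<eta> by (intro order_tendstoD) auto
    then obtain N where N: "measure (gauss n) (K N) < measure (gauss n) H + \<eta>"
      using eventually_happens'[OF sequentially_bot] by blast
    have "{x \<in> space (gauss n). h x \<noteq> (x \<in> {x \<in> Rn n. \<forall>i<N. dotp n (e i) x \<le> b (e i)})} = K N - H"
      by (auto simp: hH H_def K_def space_gauss)
    moreover have "measure (gauss n) (K N - H) = measure (gauss n) (K N) - measure (gauss n) H"
      by (intro finite_measure_Diff) (auto simp: H_def)
    moreover have "boolean_function n h"
      unfolding hH by measurable
    ultimately show ?thesis
      using N unit[OF e] br[OF e]
      by (intro conjI exI[of _ N] exI[of _ e] exI[of _ "\<lambda>i. b (e i)"]) auto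
  qed
  then show "boolean_function n h"
    "\<exists>(N::nat) t b. (\<forall>i<N. dotp n (t i) (t i) = 1 \<and> b i \<le> r) \<and>
      measure (gauss n) {x \<in> space (gauss n). h x \<noteq> (x \<in> {x \<in> Rn n. \<forall>i<N. dotp n (t i) x \<le> b i})} < \<eta>"
    by blast+
qed

text \<open>The way from \<open>f\<close> to the polynomial leads through \<open>h\<close>, a
  polytope and the noisy polytope; the last three legs cost \<open>\<epsilon> / 16\<close>
  each.\<close>

lemma polynomial_comparator:
  assumes h: "h \<in> Conv n r" and r: "1 \<le> r" and \<epsilon>: "0 < \<epsilon>" "\<epsilon> < 1 / 2"
    and d: "2 ^ 32 * (r / \<epsilon>) ^ 3 \<le> real d" and f [measurable]: "boolean_function n f"
  shows "\<exists>p. rkhs_le n d (real (n + 1) ^ d * real d ^ d) p \<and> p \<in> borel_measurable (gauss n) \<and>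
    integrable (gauss n) (\<lambda>x. \<bar>p x - of_bool (f x)\<bar>) \<and>
    (\<integral>x. \<bar>p x - of_bool (f x)\<bar> \<partial>gauss n) \<le> dist_G n f h + \<epsilon> / 4"
proof -
  interpret prob_space "gauss n" by (rule prob_space_gauss)
  \<comment> \<open>Noise costs \<open>256 * (1 + r) * \<sigma>\<close>, which is to be at most
    \<open>\<epsilon> / 16\<close>; with \<open>1 + r \<le> 2 * r\<close> this asks for
    \<open>8192 * r * \<sigma> \<le> \<epsilon>\<close>.\<close>
  define \<sigma> where "\<sigma> = \<epsilon> / (8192 * r)"
  define \<rho> where "\<rho> = sqrt (1 - \<sigma>\<^sup>2)"
  have \<sigma>: "0 < \<sigma>" "\<sigma> \<le> 1 / 2"
    using r \<epsilon> by (simp_all add: \<sigma>_def field_simps)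
  have \<sigma>r: "8192 * (\<sigma> * r) = \<epsilon>" using r by (simp add: \<sigma>_def)
  have \<sigma>1r: "4096 * (\<sigma> * (1 + r)) \<le> \<epsilon>"
  proof -
    have "\<sigma> * 1 \<le> \<sigma> * r" using \<sigma> r by (intro mult_left_mono) auto
    then show ?thesis using \<sigma>r by (simp add: algebra_simps)
  qed
  have \<sigma>2: "\<sigma>\<^sup>2 \<le> 1 / 4" using power_mono[OF \<sigma>(2), of 2] \<sigma>(1) by (simp add: power2_eq_square)
  have \<rho>: "1 / 2 \<le> \<rho>" "\<rho> < 1" "\<rho>\<^sup>2 = 1 - \<sigma>\<^sup>2"
  proof -
    show "1 / 2 \<le> \<rho>" unfolding \<rho>_def using \<sigma>2 by (intro real_le_rsqrt) (simp add: power2_eq_square)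
    show "\<rho> < 1" unfolding \<rho>_def using \<sigma>(1) by simp
    show "\<rho>\<^sup>2 = 1 - \<sigma>\<^sup>2" unfolding \<rho>_def using \<sigma>2 by simp
  qed
  have \<sigma>\<rho>: "sqrt (1 - \<rho>\<^sup>2) = \<sigma>" using \<rho>(3) \<sigma>(1) by simp
  have \<rho>d: "2 * \<rho> ^ d \<le> \<epsilon> / 16"
  proof -
    have d0: "0 < real d" using d r \<epsilon> by (smt (verit) zero_less_power divide_pos_pos mult_pos_pos)
    have "\<rho>\<^sup>2 \<le> (exp (- \<sigma>\<^sup>2 / 2))\<^sup>2"
      using exp_ge_add_one_self[of "- \<sigma>\<^sup>2"] by (simp add: \<rho>(3) exp_double[symmetric])
    then have "\<rho> \<le> exp (- \<sigma>\<^sup>2 / 2)" by (rule power2_le_imp_le) simp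
    then have "\<rho> ^ d \<le> exp (- \<sigma>\<^sup>2 / 2) ^ d" using \<rho> by (intro power_mono) auto
    also have "\<dots> = 1 / exp (real d * \<sigma>\<^sup>2 / 2)"
      by (simp add: exp_of_nat_mult[symmetric] exp_minus field_simps)
    also have "\<dots> \<le> 1 / (real d * \<sigma>\<^sup>2 / 2)"
    proof -
      have "real d * \<sigma>\<^sup>2 / 2 \<le> exp (real d * \<sigma>\<^sup>2 / 2)"
        using exp_ge_add_one_self[of "real d * \<sigma>\<^sup>2 / 2"] by linarith
      then show ?thesis using d0 \<sigma>(1) by (intro divide_left_mono) auto
    qed
    \<comment> \<open>It suffices that \<open>d * \<epsilon> * \<sigma>^2\<close> is at least 64. As
      \<open>\<sigma>^2 = \<epsilon>^2 / (2 ^ 26 * r^2)\<close>, the assumption on \<open>d\<close>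
      gives \<open>64 * r\<close>; this is the origin of \<open>2 ^ 32\<close> and of the
      cube.\<close>
    also have "\<dots> \<le> \<epsilon> / 32"
    proof -
      have "64 \<le> 64 * r" using r by simp
      also have "\<dots> = 2 ^ 32 * (r / \<epsilon>) ^ 3 * (\<epsilon> * \<sigma>\<^sup>2)"
        unfolding \<sigma>_def using r \<epsilon> by (simp add: power2_eq_square power3_eq_cube field_simps)
      also have "\<dots> \<le> real d * (\<epsilon> * \<sigma>\<^sup>2)"
        using d \<epsilon> by (intro mult_right_mono) auto
      finally show ?thesis using d0 \<sigma>(1) \<epsilon> by (simp add: field_simps)
    qed
    finally show ?thesis by simp
  qed
  have "0 < \<epsilon> / 16" using \<epsilon> by simp
  from Conv_approx_polytope[OF h this] obtain N t b where hm [measurable]: "boolean_function n h"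
    and tb: "\<And>i. i < (N::nat) \<Longrightarrow> dotp n (t i) (t i) = 1" "\<And>i. i < N \<Longrightarrow> b i \<le> r"
    and close: "measure (gauss n) {x \<in> space (gauss n). h x \<noteq> (x \<in> {x \<in> Rn n. \<forall>i<N. dotp n (t i) x \<le> b i})} < \<epsilon> / 16"
    by blast
  define K where "K = {x \<in> Rn n. \<forall>i<N. dotp n (t i) x \<le> b i}"
  define g where "g = (indicator K :: vect \<Rightarrow> real)"
  have small: "8 * sqrt (1 - \<rho>\<^sup>2) * (1 + r) \<le> 1"
    unfolding \<sigma>\<rho> using \<sigma>1r \<epsilon> \<sigma> r mult_pos_pos[of \<sigma> "1 + r"] by (simp add: mult.assoc)
  note noise = polytope_noise[where N = N and t = t and b = b, OF tb order_trans[OF zero_le_one r] \<rho>(1,2) small, folded K_def, folded g_def]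
  have g [measurable]: "g \<in> borel_measurable (gauss n)" using noise(1) by simp
  have K [measurable]: "K \<in> sets (gauss n)"
    unfolding K_def space_gauss[symmetric] by measurable
  have \<rho>0: "0 < \<rho>" using \<rho> by simp
  define p where "p = ou_truncated n \<rho> d g"
  have [measurable]: "p \<in> borel_measurable (gauss n)" unfolding p_def ou_truncated_def[abs_def] by measurable
  have g1: "\<bar>g x\<bar> \<le> 1" for x by (simp add: g_def indicator_def)
  note tr = ou_truncated_error[OF \<rho>0 \<rho>(2) g g1, of d, folded p_def]
  have rk: "rkhs_le n d (real (n + 1) ^ d * real d ^ d) p"
    unfolding p_def using \<rho> \<rho>0 by (intro rkhs_le_ou_truncated g g1) auto
  have i1: "integrable (gauss n) (\<lambda>x. \<bar>of_bool (f x) - of_bool (h x) :: real\<bar>)"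
    "integrable (gauss n) (\<lambda>x. \<bar>of_bool (h x) - g x\<bar>)"
    by (rule integrable_const_bound[where B = 1]; simp add: g_def indicator_def)+
  have i2: "integrable (gauss n) (\<lambda>x. \<bar>g x - ou n \<rho> g x\<bar>)"
  proof -
    have "integrable (gauss n) g" using g1 by (intro integrable_const_bound[where B = 1]) auto
    moreover have "integrable (gauss n) (ou n \<rho> g)"
      by (rule integrable_ou[OF \<rho>0 \<rho>(2) g]) (auto simp: g_def indicator_def)
    ultimately show ?thesis by simp
  qed
  have e1: "(\<integral>x. \<bar>of_bool (f x) - of_bool (h x) :: real\<bar> \<partial>gauss n) = dist_G n f h"
  proof -
    have "(\<integral>x. \<bar>of_bool (f x) - of_bool (h x) :: real\<bar> \<partial>gauss n) =
        (\<integral>x. indicator {x \<in> space (gauss n). f x \<noteq> h x} x \<partial>gauss n)"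
      by (intro Bochner_Integration.integral_cong) (auto simp: indicator_def)
    then show ?thesis by (simp add: dist_G_def)
  qed
  have e2: "(\<integral>x. \<bar>of_bool (h x) - g x\<bar> \<partial>gauss n) \<le> \<epsilon> / 16"
  proof -
    have "(\<integral>x. \<bar>of_bool (h x) - g x\<bar> \<partial>gauss n) =
        (\<integral>x. indicator {x \<in> space (gauss n). h x \<noteq> (x \<in> K)} x \<partial>gauss n)"
      by (intro Bochner_Integration.integral_cong) (auto simp: indicator_def g_def)
    also have "\<dots> = measure (gauss n) {x \<in> space (gauss n). h x \<noteq> (x \<in> K)}"
      by (subst Bochner_Integration.integral_indicator) (auto intro!: arg_cong[where f = "measure _"])
    finally show ?thesis using close unfolding K_def[symmetric] by linarith
  qed
  have e3: "(\<integral>x. \<bar>g x - ou n \<rho> g x\<bar> \<partial>gauss n) \<le> \<epsilon> / 16"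
    using noise(2) \<sigma>1r unfolding \<sigma>\<rho> by (simp add: algebra_simps)
  let ?s = "\<lambda>x. \<bar>of_bool (f x) - of_bool (h x)\<bar> + \<bar>of_bool (h x) - g x\<bar> + \<bar>g x - ou n \<rho> g x\<bar> + \<bar>ou n \<rho> g x - p x\<bar>"
  have le: "\<bar>p x - of_bool (f x)\<bar> \<le> ?s x" for x by linarith
  have iS: "integrable (gauss n) ?s" using i1 i2 tr(1) by simp
  have ip: "integrable (gauss n) (\<lambda>x. \<bar>p x - of_bool (f x)\<bar>)"
  proof (rule Bochner_Integration.integrable_bound[OF iS])
    show "AE x in gauss n. norm \<bar>p x - of_bool (f x)\<bar> \<le> norm (?s x)"
      using le by (intro AE_I2) (metis abs_ge_self abs_idempotent order_trans real_norm_def)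
  qed simp
  have "(\<integral>x. \<bar>p x - of_bool (f x)\<bar> \<partial>gauss n) \<le> (\<integral>x. ?s x \<partial>gauss n)"
    by (rule integral_mono[OF ip iS le])
  also have "\<dots> \<le> dist_G n f h + \<epsilon> / 4"
    using i1 i2 tr e1 e2 e3 \<rho>d \<epsilon> by simp
  finally show ?thesis using rk ip by (intro exI[of _ p]) simp
qed


section \<open>Stochastic subgradient descent\<close>

definition kernel_sum :: "nat \<Rightarrow> nat \<Rightarrow> nat \<Rightarrow> (nat \<Rightarrow> real) \<Rightarrow> (nat \<Rightarrow> vect) \<Rightarrow> vect \<Rightarrow> real" where
  "kernel_sum n d m c X x = (\<Sum>t<m. c t * poly_kernel n d (X t) x)"

text \<open>A subgradient of the absolute loss is plus or minus the kernel function at the current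
  sample, so a step of size \<open>1 / U\<close> appends one coefficient and never revises the
  earlier ones. A tie is treated as overshooting.\<close>

primrec sgd_coeffs :: "nat \<Rightarrow> nat \<Rightarrow> real \<Rightarrow> (vect \<Rightarrow> bool) \<Rightarrow> (nat \<Rightarrow> vect) \<Rightarrow> nat \<Rightarrow> nat \<Rightarrow> real" where
  "sgd_coeffs n d U f X 0 = (\<lambda>_. 0)"
| "sgd_coeffs n d U f X (Suc t) = (sgd_coeffs n d U f X t)(t :=
     if kernel_sum n d t (sgd_coeffs n d U f X t) X (X t) < of_bool (f (X t)) then 1 / U else - (1 / U))"

definition sgd_iterate :: "nat \<Rightarrow> nat \<Rightarrow> real \<Rightarrow> (vect \<Rightarrow> bool) \<Rightarrow> (nat \<Rightarrow> vect) \<Rightarrow> nat \<Rightarrow> vect \<Rightarrow> real" where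
  "sgd_iterate n d U f X t x = kernel_sum n d t (sgd_coeffs n d U f X t) X x"

text \<open>Sample \<open>t\<close> contributes to the \<open>N - t - 1\<close> iterates after it,
  among the first \<open>N\<close>; hence the weights. In this form the average is a single kernel
  sum and can be stored like an iterate.\<close>

definition sgd_average :: "nat \<Rightarrow> nat \<Rightarrow> real \<Rightarrow> (vect \<Rightarrow> bool) \<Rightarrow> nat \<Rightarrow> (nat \<Rightarrow> vect) \<Rightarrow> vect \<Rightarrow> real" where
  "sgd_average n d U f N X x =
    kernel_sum n d N (\<lambda>t. sgd_coeffs n d U f X N t * real (N - t - 1) / real N) X x"

lemma poly_kernel_commute: "poly_kernel n d x u = poly_kernel n d u x"
  by (simp add: poly_kernel_def dotp_def mult.commute)

lemma sgd_coeffs_stable: "s < t \<Longrightarrow> t \<le> T \<Longrightarrow> sgd_coeffs n d U f X T s = sgd_coeffs n d U f X t s"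
proof (induction T)
  case (Suc T)
  then show ?case by (cases "t = Suc T") auto
qed simp

lemma kernel_sum_cong:
  "(\<And>t. t < m \<Longrightarrow> c t = c' t) \<Longrightarrow> (\<And>t. t < m \<Longrightarrow> X t = X' t) \<Longrightarrow>
    kernel_sum n d m c X x = kernel_sum n d m c' X' x"
  by (simp add: kernel_sum_def)

text \<open>Dependence on the first \<open>t\<close> samples only is what makes sample
  \<open>t\<close> fresh for iterate \<open>t\<close>.\<close>

lemma sgd_coeffs_cong:
  "(\<And>i. i < t \<Longrightarrow> X i = Y i) \<Longrightarrow> sgd_coeffs n d U f X t = sgd_coeffs n d U f Y t"
proof (induction t)
  case (Suc t)
  have "kernel_sum n d t (sgd_coeffs n d U f Y t) X (Y t) = kernel_sum n d t (sgd_coeffs n d U f Y t) Y (Y t)"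
    using Suc.prems by (intro kernel_sum_cong) auto
  then show ?case using Suc by simp
qed simp

lemma sgd_iterate_cong:
  "(\<And>i. i < t \<Longrightarrow> X i = Y i) \<Longrightarrow> sgd_iterate n d U f X t x = sgd_iterate n d U f Y t x"
  unfolding sgd_iterate_def using sgd_coeffs_cong[of t X Y] by (auto intro!: kernel_sum_cong)

lemma sgd_average_cong:
  "(\<And>i. i < N \<Longrightarrow> X i = Y i) \<Longrightarrow> sgd_average n d U f N X x = sgd_average n d U f N Y x"
  unfolding sgd_average_def using sgd_coeffs_cong[of N X Y] by (auto intro!: kernel_sum_cong)

lemma sgd_average_eq:
  assumes "0 < N"
  shows "sgd_average n d U f N X x = (\<Sum>t<N. sgd_iterate n d U f X t x) / real N"
proof -
  define c where "c s = sgd_coeffs n d U f X N s * poly_kernel n d (X s) x" for s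
  have it: "sgd_iterate n d U f X t x = (\<Sum>s<t. c s)" if "t < N" for t
    unfolding sgd_iterate_def kernel_sum_def c_def
    using that sgd_coeffs_stable[of _ t N n d U f X] by (intro sum.cong) auto
  have main: "(\<Sum>t<M. \<Sum>s<t. c s) = (\<Sum>s<M. c s * real (M - s - 1))" for M
  proof (induction M)
    case (Suc M)
    have "(\<Sum>s<M. c s * real (Suc M - s - 1)) = (\<Sum>s<M. c s * real (M - s - 1) + c s)"
    proof (intro sum.cong refl)
      fix s assume "s \<in> {..<M}"
      then have "Suc M - s - 1 = Suc (M - s - 1)" by auto
      then show "c s * real (Suc M - s - 1) = c s * real (M - s - 1) + c s"
        by (simp only: of_nat_Suc) (simp add: algebra_simps)
    qed
    then show ?case using Suc by (simp add: sum.distrib)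
  qed simp
  have "(\<Sum>t<N. sgd_iterate n d U f X t x) = (\<Sum>s<N. c s * real (N - s - 1))"
    unfolding main[symmetric] using it by simp
  then show ?thesis
    by (simp add: sgd_average_def kernel_sum_def c_def sum_divide_distrib mult_ac)
qed

lemma kernel_quad_Suc_points:
  "kernel_quad n d (Suc m) c X =
    kernel_quad n d m c X + 2 * (c m * kernel_sum n d m c X (X m)) + (c m)\<^sup>2 * poly_kernel n d (X m) (X m)"
proof -
  have "kernel_quad n d (Suc m) c X = kernel_quad n d m c X
      + (\<Sum>s<m. c s * c m * poly_kernel n d (X s) (X m))
      + (\<Sum>t<m. c m * c t * poly_kernel n d (X m) (X t)) + c m * c m * poly_kernel n d (X m) (X m)"
    by (simp add: kernel_quad_def sum.distrib)
  also have "(\<Sum>t<m. c m * c t * poly_kernel n d (X m) (X t)) = (\<Sum>s<m. c s * c m * poly_kernel n d (X s) (X m))"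
    by (intro sum.cong refl) (metis mult.commute poly_kernel_commute)
  also have "(\<Sum>s<m. c s * c m * poly_kernel n d (X s) (X m)) = c m * kernel_sum n d m c X (X m)"
    by (simp add: kernel_sum_def sum_distrib_left mult_ac)
  finally show ?thesis by (simp add: power2_eq_square)
qed

text \<open>The potential argument for subgradient descent in dual form. The squared norm
  \<open>q\<close> of the final kernel combination unfolds along the steps, while
  \<open>rkhs_le\<close> bounds its pairing with \<open>p\<close> by \<open>B * sqrt q\<close>,
  hence by \<open>(B^2 + q) / 2\<close>. So \<open>p\<close> enters through its values at the
  samples and never as a vector.\<close>

lemma sgd_regret:
  assumes p: "rkhs_le n d B p" and U: "0 < U"
  shows "(\<Sum>t<N. \<bar>sgd_iterate n d U f X t (X t) - of_bool (f (X t))\<bar>) \<le>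
    (\<Sum>t<N. \<bar>p (X t) - of_bool (f (X t))\<bar>) + B\<^sup>2 * U / 2 + (\<Sum>t<N. poly_kernel n d (X t) (X t)) / (2 * U)"
proof -
  define c where "c = sgd_coeffs n d U f X N"
  define y where "y t = (of_bool (f (X t)) :: real)" for t
  define w where "w t = sgd_iterate n d U f X t (X t)" for t
  define k where "k t = poly_kernel n d (X t) (X t)" for t
  have w: "w t = kernel_sum n d t c X (X t)" if "t < N" for t
    unfolding w_def sgd_iterate_def c_def
    using that sgd_coeffs_stable[of _ t N n d U f X] by (intro kernel_sum_cong) auto
  have c: "c t = (if w t < y t then 1 / U else - (1 / U))" if "t < N" for t
    using that sgd_coeffs_stable[of t "Suc t" N n d U f X]
    by (simp add: c_def w_def y_def sgd_iterate_def)
  have c2: "(c t)\<^sup>2 = (1 / U)\<^sup>2" if "t < N" for t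
    using c[OF that] by (simp add: power2_eq_square)
  have quad: "kernel_quad n d M c X = (\<Sum>t<M. 2 * (c t * w t) + (1 / U)\<^sup>2 * k t)" if "M \<le> N" for M
    using that
  proof (induction M)
    case 0
    then show ?case by (simp add: kernel_quad_def)
  next
    case (Suc M)
    then show ?case using w[of M] c2[of M] by (simp add: kernel_quad_Suc_points k_def)
  qed
  define q where "q = kernel_quad n d N c X"
  have q: "0 \<le> q" unfolding q_def by (rule kernel_quad_nonneg)
  have "(\<Sum>t<N. c t * p (X t)) \<le> B * sqrt q"
    using p unfolding rkhs_le_def q_def by (meson abs_le_D1)
  also have "\<dots> \<le> (B\<^sup>2 + q) / 2"
    using sum_squares_bound[of B "sqrt q"] q by simp
  finally have 1: "(\<Sum>t<N. c t * p (X t)) \<le> (B\<^sup>2 + q) / 2" .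
  have 2: "q = 2 * (\<Sum>t<N. c t * w t) + (1 / U)\<^sup>2 * (\<Sum>t<N. k t)"
    unfolding q_def quad[OF order_refl] by (simp add: sum.distrib sum_distrib_left)
  \<comment> \<open>Convexity of the absolute value: \<open>- U * c t\<close> is a subgradient of
    the loss at \<open>w t\<close>.\<close>
  have "c t * (w t - p (X t)) \<le> 1 / U * (\<bar>p (X t) - y t\<bar> - \<bar>w t - y t\<bar>)" if "t < N" for t
  proof (cases "w t < y t")
    case True
    then have "w t - p (X t) \<le> \<bar>p (X t) - y t\<bar> - \<bar>w t - y t\<bar>" by linarith
    then show ?thesis using True c[OF that] U by (simp add: divide_right_mono)
  next
    case False
    then have "p (X t) - w t \<le> \<bar>p (X t) - y t\<bar> - \<bar>w t - y t\<bar>" by linarith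
    then have "1 / U * (p (X t) - w t) \<le> 1 / U * (\<bar>p (X t) - y t\<bar> - \<bar>w t - y t\<bar>)"
      using U by (intro mult_left_mono) auto
    then show ?thesis using False c[OF that] by (simp add: algebra_simps)
  qed
  then have "(\<Sum>t<N. c t * (w t - p (X t))) \<le> (\<Sum>t<N. 1 / U * (\<bar>p (X t) - y t\<bar> - \<bar>w t - y t\<bar>))"
    by (intro sum_mono) simp
  also have "\<dots> = 1 / U * ((\<Sum>t<N. \<bar>p (X t) - y t\<bar>) - (\<Sum>t<N. \<bar>w t - y t\<bar>))"
    by (simp only: sum_distrib_left[symmetric] sum_subtractf)
  finally have "(\<Sum>t<N. c t * w t) - (\<Sum>t<N. c t * p (X t)) \<le>
      1 / U * ((\<Sum>t<N. \<bar>p (X t) - y t\<bar>) - (\<Sum>t<N. \<bar>w t - y t\<bar>))"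
    by (simp add: right_diff_distrib sum_subtractf)
  moreover define Z where "Z = 1 / U * ((\<Sum>t<N. \<bar>p (X t) - y t\<bar>) - (\<Sum>t<N. \<bar>w t - y t\<bar>))"
  ultimately have 3: "(\<Sum>t<N. c t * w t) - (\<Sum>t<N. c t * p (X t)) \<le> Z"
    by (simp only:)
  define V where "V = (1 / U)\<^sup>2 * (\<Sum>t<N. k t)"
  have "- (B\<^sup>2 + V) / 2 \<le> Z"
  proof -
    have "- (b + V) / 2 \<le> Z" if "P \<le> (b + q) / 2" "q = 2 * W + V" "W - P \<le> Z" for b P W :: real
      using that by (simp add: field_simps)
    from this[OF 1 2[folded V_def] 3] show ?thesis .
  qed
  then have "- (B\<^sup>2 + (1 / U)\<^sup>2 * (\<Sum>t<N. k t)) / 2 \<le>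
      1 / U * ((\<Sum>t<N. \<bar>p (X t) - y t\<bar>) - (\<Sum>t<N. \<bar>w t - y t\<bar>))"
    by (simp only: V_def Z_def)
  then have "(\<Sum>t<N. \<bar>w t - y t\<bar>) \<le> (\<Sum>t<N. \<bar>p (X t) - y t\<bar>) + U * ((B\<^sup>2 + (1 / U)\<^sup>2 * (\<Sum>t<N. k t)) / 2)"
  proof -
    have "W \<le> P + U * (b / 2)" if "- b / 2 \<le> 1 / U * (P - W)" for b P W :: real
      using that U by (simp add: field_simps)
    then show ?thesis if "- (B\<^sup>2 + (1 / U)\<^sup>2 * (\<Sum>t<N. k t)) / 2 \<le>
        1 / U * ((\<Sum>t<N. \<bar>p (X t) - y t\<bar>) - (\<Sum>t<N. \<bar>w t - y t\<bar>))"
      using that by blast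
  qed
  also have "U * ((B\<^sup>2 + (1 / U)\<^sup>2 * (\<Sum>t<N. k t)) / 2) = B\<^sup>2 * U / 2 + (\<Sum>t<N. k t) / (2 * U)"
    using U by (simp add: field_simps power2_eq_square)
  finally show ?thesis by (simp add: w_def y_def k_def add.assoc)
qed

section \<open>Streams of independent samples\<close>

lemma prob_space_sample_space: "prob_space (sample_space n)"
  unfolding sample_space_def by (intro prob_space_PiM prob_space_gauss)

lemma sequence_space_gauss: "sequence_space (gauss n)"
  unfolding sequence_space_def by (intro product_prob_spaceI prob_space_gauss)

lemma measurable_sample_component [measurable (raw)]:
  "g \<in> measurable M (sample_space n) \<Longrightarrow> (\<lambda>w. g w i) \<in> measurable M (gauss n)"
  unfolding sample_space_def by (rule measurable_compose[OF _ measurable_component_singleton]) auto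

lemma measurable_sampleI:
  assumes "\<And>i. (\<lambda>w. g w i) \<in> measurable M (gauss n)"
  shows "g \<in> measurable M (sample_space n)"
  unfolding sample_space_def
  using assms by (intro measurable_PiM_single') (auto simp: measurable_def Pi_iff)

definition drop_samples :: "nat \<Rightarrow> (nat \<Rightarrow> vect) \<Rightarrow> nat \<Rightarrow> vect" where
  "drop_samples a \<omega> i = \<omega> (a + i)"

lemma measurable_drop_samples [measurable (raw)]:
  assumes [measurable]: "g \<in> measurable M (sample_space n)"
  shows "(\<lambda>w. drop_samples a (g w)) \<in> measurable M (sample_space n)"
  by (rule measurable_sampleI) (simp add: drop_samples_def)

lemma borel_measurable_poly_kernel [measurable (raw)]:
  assumes [measurable]: "g \<in> measurable M (gauss n)" "h \<in> measurable M (gauss n)"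
  shows "(\<lambda>w. poly_kernel n d (g w) (h w)) \<in> borel_measurable M"
  unfolding poly_kernel_def by measurable

lemma borel_measurable_of_bool_f [measurable (raw)]:
  assumes f: "boolean_function n f" and g: "g \<in> measurable M (gauss n)"
  shows "(\<lambda>w. of_bool (f (g w)) :: real) \<in> borel_measurable M"
  using measurable_compose[OF g f] by measurable

lemma borel_measurable_sgd_coeffs:
  assumes f: "boolean_function n f" and [measurable]: "g \<in> measurable M (sample_space n)"
  shows "(\<lambda>w. sgd_coeffs n d U f (g w) t s) \<in> borel_measurable M"
proof (induction t arbitrary: s)
  case (Suc t)
  note [measurable] = Suc borel_measurable_of_bool_f[OF f]
  show ?case
    by (cases "s = t") (simp_all add: kernel_sum_def Suc)
qed simp

lemma borel_measurable_sgd_iterate [measurable (raw)]: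
  assumes f: "boolean_function n f" and [measurable]: "g \<in> measurable M (sample_space n)"
    "h \<in> measurable M (gauss n)"
  shows "(\<lambda>w. sgd_iterate n d U f (g w) t (h w)) \<in> borel_measurable M"
  unfolding sgd_iterate_def kernel_sum_def
  using borel_measurable_sgd_coeffs[OF f assms(2)] by measurable

lemma borel_measurable_sgd_average [measurable (raw)]:
  assumes f: "boolean_function n f" and [measurable]: "g \<in> measurable M (sample_space n)"
    "h \<in> measurable M (gauss n)"
  shows "(\<lambda>w. sgd_average n d U f N (g w) (h w)) \<in> borel_measurable M"
  unfolding sgd_average_def kernel_sum_def
  using borel_measurable_sgd_coeffs[OF f assms(2)] by measurable

text \<open>An independent sequence has the law of its first \<open>a\<close> terms followed by a
  fresh copy of the whole; \<open>comb_seq a\<close> does the splicing. Independence of past and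
  future samples is used in this form.\<close>

lemma nn_integral_sample_split:
  assumes [measurable]: "F \<in> borel_measurable (sample_space n)"
  shows "(\<integral>\<^sup>+ \<omega>. F \<omega> \<partial>sample_space n) =
    (\<integral>\<^sup>+ \<omega>. (\<integral>\<^sup>+ \<omega>'. F (comb_seq a \<omega> \<omega>') \<partial>sample_space n) \<partial>sample_space n)"
proof -
  interpret sequence_space "gauss n" by (rule sequence_space_gauss)
  have S: "sample_space n = S" by (simp add: sample_space_def)
  have [measurable]: "F \<in> borel_measurable S" using assms by (simp add: S)
  have "(\<integral>\<^sup>+ \<omega>. F \<omega> \<partial>S) = (\<integral>\<^sup>+ \<omega>. F \<omega> \<partial>distr (S \<Otimes>\<^sub>M S) S (\<lambda>(\<omega>, \<omega>'). comb_seq a \<omega> \<omega>'))"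
    unfolding PiM_comb_seq ..
  also have "\<dots> = (\<integral>\<^sup>+ z. F (case z of (\<omega>, \<omega>') \<Rightarrow> comb_seq a \<omega> \<omega>') \<partial>(S \<Otimes>\<^sub>M S))"
    by (rule nn_integral_distr) (auto intro: measurable_comb_seq)
  also have "\<dots> = (\<integral>\<^sup>+ z. (\<lambda>(\<omega>, \<omega>'). F (comb_seq a \<omega> \<omega>')) z \<partial>(S \<Otimes>\<^sub>M S))"
    by (intro nn_integral_cong) (auto split: prod.splits)
  also have "\<dots> = (\<integral>\<^sup>+ \<omega>. (\<integral>\<^sup>+ \<omega>'. F (comb_seq a \<omega> \<omega>') \<partial>S) \<partial>S)"
    using prob_space_imp_sigma_finite[OF prob_space_sample_space[of n], unfolded S]
    by (subst sigma_finite_measure.nn_integral_fst[symmetric]) (auto intro!: measurable_compose[OF measurable_comb_seq[unfolded split_beta']] simp: split_beta')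
  finally show ?thesis by (simp only: S)
qed

lemma nn_integral_sample_component:
  assumes "F \<in> borel_measurable (gauss n)"
  shows "(\<integral>\<^sup>+ \<omega>. F (\<omega> i) \<partial>sample_space n) = (\<integral>\<^sup>+ x. F x \<partial>gauss n)"
proof -
  interpret sequence_space "gauss n" by (rule sequence_space_gauss)
  have "(\<integral>\<^sup>+ x. F x \<partial>gauss n) = (\<integral>\<^sup>+ x. F x \<partial>distr S (gauss n) (\<lambda>\<omega>. \<omega> i))"
    by (simp add: PiM_component)
  also have "\<dots> = (\<integral>\<^sup>+ \<omega>. F (\<omega> i) \<partial>S)"
    by (rule nn_integral_distr) (use assms in auto)
  finally show ?thesis by (simp add: sample_space_def)
qed

text \<open>Splitting the stream at time \<open>t\<close> makes \<open>\<omega> t\<close> the first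
  sample of the fresh half, while \<open>F \<omega>\<close> is determined by the other half.\<close>

lemma nn_integral_fresh_sample:
  assumes F: "(\<lambda>(\<omega>, x). F \<omega> x) \<in> borel_measurable (sample_space n \<Otimes>\<^sub>M gauss n)"
    and dep: "\<And>\<omega> \<omega>' x. (\<And>i. i < t \<Longrightarrow> \<omega> i = \<omega>' i) \<Longrightarrow> F \<omega> x = F \<omega>' x"
  shows "(\<integral>\<^sup>+ \<omega>. F \<omega> (\<omega> t) \<partial>sample_space n) = (\<integral>\<^sup>+ \<omega>. (\<integral>\<^sup>+ x. F \<omega> x \<partial>gauss n) \<partial>sample_space n)"
proof -
  have m1: "(\<lambda>\<omega>. F \<omega> (\<omega> t)) \<in> borel_measurable (sample_space n)"
    using measurable_compose[OF _ F, of "\<lambda>\<omega>. (\<omega>, \<omega> t)" "sample_space n"] by simp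
  have "(\<integral>\<^sup>+ \<omega>. F \<omega> (\<omega> t) \<partial>sample_space n) =
      (\<integral>\<^sup>+ \<omega>. (\<integral>\<^sup>+ \<omega>'. F (comb_seq t \<omega> \<omega>') (comb_seq t \<omega> \<omega>' t) \<partial>sample_space n) \<partial>sample_space n)"
    by (rule nn_integral_sample_split[OF m1])
  also have "\<dots> = (\<integral>\<^sup>+ \<omega>. (\<integral>\<^sup>+ \<omega>'. F \<omega> (\<omega>' 0) \<partial>sample_space n) \<partial>sample_space n)"
  proof (intro nn_integral_cong)
    fix \<omega> \<omega>' :: "nat \<Rightarrow> vect"
    have "comb_seq t \<omega> \<omega>' t = \<omega>' 0" using comb_seq_add[of t \<omega> \<omega>' 0] by simp
    then show "F (comb_seq t \<omega> \<omega>') (comb_seq t \<omega> \<omega>' t) = F \<omega> (\<omega>' 0)"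
      using dep[of "comb_seq t \<omega> \<omega>'" \<omega>] by (simp add: comb_seq_less)
  qed
  also have "\<dots> = (\<integral>\<^sup>+ \<omega>. (\<integral>\<^sup>+ x. F \<omega> x \<partial>gauss n) \<partial>sample_space n)"
  proof (intro nn_integral_cong nn_integral_sample_component)
    fix \<omega> assume "\<omega> \<in> space (sample_space n)"
    then show "F \<omega> \<in> borel_measurable (gauss n)"
      using measurable_compose[OF measurable_Pair1'[of \<omega> "sample_space n" "gauss n"] F] by simp
  qed
  finally show ?thesis .
qed

text \<open>Online-to-batch conversion: iterate \<open>t\<close> is built from the samples before
  \<open>t\<close>, so its expected loss on sample \<open>t\<close> is its expected loss on the
  whole distribution, and the bound on the observed losses carries over. Nonnegative integrals avoid
  any question of integrability of the iterates.\<close>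

lemma sgd_expected_loss:
  assumes f: "boolean_function n f" and p: "rkhs_le n d B p" and [measurable]: "p \<in> borel_measurable (gauss n)"
    and ip: "integrable (gauss n) (\<lambda>x. \<bar>p x - of_bool (f x)\<bar>)" and U: "0 < U"
    and M2: "(\<integral>\<^sup>+ x. ennreal (poly_kernel n d x x) \<partial>gauss n) \<le> ennreal M2" "0 \<le> M2"
  shows "(\<integral>\<^sup>+ \<omega>. (\<Sum>t<N. \<integral>\<^sup>+ x. ennreal \<bar>sgd_iterate n d U f \<omega> t x - of_bool (f x)\<bar> \<partial>gauss n) \<partial>sample_space n) \<le>
    ennreal (real N * (\<integral>x. \<bar>p x - of_bool (f x)\<bar> \<partial>gauss n) + B\<^sup>2 * U / 2 + real N * M2 / (2 * U))"
proof -
  interpret S: prob_space "sample_space n" by (rule prob_space_sample_space)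
  interpret G: prob_space "gauss n" by (rule prob_space_gauss)
  note [measurable] = borel_measurable_of_bool_f[OF f] borel_measurable_sgd_iterate[OF f]
  define L where "L = (\<integral>x. \<bar>p x - of_bool (f x)\<bar> \<partial>gauss n)"
  have L: "0 \<le> L" unfolding L_def by simp
  have k0: "0 \<le> poly_kernel n d x x" for x
    by (simp add: poly_kernel_def dotp_def sum_nonneg)
  have fresh: "(\<integral>\<^sup>+ \<omega>. ennreal \<bar>sgd_iterate n d U f \<omega> t (\<omega> t) - of_bool (f (\<omega> t))\<bar> \<partial>sample_space n) =
      (\<integral>\<^sup>+ \<omega>. (\<integral>\<^sup>+ x. ennreal \<bar>sgd_iterate n d U f \<omega> t x - of_bool (f x)\<bar> \<partial>gauss n) \<partial>sample_space n)" for t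
    by (rule nn_integral_fresh_sample, measurable) (simp cong: sgd_iterate_cong)
  have "(\<integral>\<^sup>+ \<omega>. (\<Sum>t<N. \<integral>\<^sup>+ x. ennreal \<bar>sgd_iterate n d U f \<omega> t x - of_bool (f x)\<bar> \<partial>gauss n) \<partial>sample_space n) =
      (\<Sum>t<N. \<integral>\<^sup>+ \<omega>. (\<integral>\<^sup>+ x. ennreal \<bar>sgd_iterate n d U f \<omega> t x - of_bool (f x)\<bar> \<partial>gauss n) \<partial>sample_space n)"
    by (rule nn_integral_sum) measurable
  also have "\<dots> = (\<Sum>t<N. \<integral>\<^sup>+ \<omega>. ennreal \<bar>sgd_iterate n d U f \<omega> t (\<omega> t) - of_bool (f (\<omega> t))\<bar> \<partial>sample_space n)"
    by (simp add: fresh)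
  also have "\<dots> = (\<integral>\<^sup>+ \<omega>. (\<Sum>t<N. ennreal \<bar>sgd_iterate n d U f \<omega> t (\<omega> t) - of_bool (f (\<omega> t))\<bar>) \<partial>sample_space n)"
    by (rule nn_integral_sum[symmetric]) measurable
  also have "\<dots> \<le> (\<integral>\<^sup>+ \<omega>. (\<Sum>t<N. ennreal \<bar>p (\<omega> t) - of_bool (f (\<omega> t))\<bar>) + ennreal (B\<^sup>2 * U / 2)
      + (\<Sum>t<N. ennreal (poly_kernel n d (\<omega> t) (\<omega> t)) * ennreal (1 / (2 * U))) \<partial>sample_space n)"
  proof (rule nn_integral_mono)
    fix \<omega> :: "nat \<Rightarrow> vect"
    have "(\<Sum>t<N. ennreal \<bar>sgd_iterate n d U f \<omega> t (\<omega> t) - of_bool (f (\<omega> t))\<bar>) =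
        ennreal (\<Sum>t<N. \<bar>sgd_iterate n d U f \<omega> t (\<omega> t) - of_bool (f (\<omega> t))\<bar>)"
      by (rule sum_ennreal) simp
    also have "\<dots> \<le> ennreal ((\<Sum>t<N. \<bar>p (\<omega> t) - of_bool (f (\<omega> t))\<bar>) + B\<^sup>2 * U / 2
        + (\<Sum>t<N. poly_kernel n d (\<omega> t) (\<omega> t)) / (2 * U))"
      by (intro ennreal_leI sgd_regret p U)
    also have "\<dots> = ennreal (\<Sum>t<N. \<bar>p (\<omega> t) - of_bool (f (\<omega> t))\<bar>) + ennreal (B\<^sup>2 * U / 2)
        + ennreal ((\<Sum>t<N. poly_kernel n d (\<omega> t) (\<omega> t)) / (2 * U))"
      using U k0 by (subst ennreal_plus[symmetric] | simp add: sum_nonneg)+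
    also have "\<dots> = (\<Sum>t<N. ennreal \<bar>p (\<omega> t) - of_bool (f (\<omega> t))\<bar>) + ennreal (B\<^sup>2 * U / 2)
      + (\<Sum>t<N. ennreal (poly_kernel n d (\<omega> t) (\<omega> t)) * ennreal (1 / (2 * U)))"
    proof -
      have "ennreal ((\<Sum>t<N. poly_kernel n d (\<omega> t) (\<omega> t)) / (2 * U)) =
          ennreal (\<Sum>t<N. poly_kernel n d (\<omega> t) (\<omega> t) * (1 / (2 * U)))"
        by (simp add: sum_divide_distrib)
      also have "\<dots> = (\<Sum>t<N. ennreal (poly_kernel n d (\<omega> t) (\<omega> t) * (1 / (2 * U))))"
        using U k0 by (intro sum_ennreal[symmetric] mult_nonneg_nonneg) simp_all
      also have "\<dots> = (\<Sum>t<N. ennreal (poly_kernel n d (\<omega> t) (\<omega> t)) * ennreal (1 / (2 * U)))"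
        using U k0 by (intro sum.cong refl ennreal_mult) simp_all
      finally have 1: "ennreal ((\<Sum>t<N. poly_kernel n d (\<omega> t) (\<omega> t)) / (2 * U)) = \<dots>" .
      have "ennreal (\<Sum>t<N. \<bar>p (\<omega> t) - of_bool (f (\<omega> t))\<bar>) = (\<Sum>t<N. ennreal \<bar>p (\<omega> t) - of_bool (f (\<omega> t))\<bar>)"
        by (rule sum_ennreal[symmetric]) simp
      then show ?thesis by (simp only: 1)
    qed
    finally show "(\<Sum>t<N. ennreal \<bar>sgd_iterate n d U f \<omega> t (\<omega> t) - of_bool (f (\<omega> t))\<bar>) \<le> \<dots>" .
  qed
  also have "\<dots> = (\<Sum>t<N. \<integral>\<^sup>+ \<omega>. ennreal \<bar>p (\<omega> t) - of_bool (f (\<omega> t))\<bar> \<partial>sample_space n) + ennreal (B\<^sup>2 * U / 2)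
      + (\<Sum>t<N. (\<integral>\<^sup>+ \<omega>. ennreal (poly_kernel n d (\<omega> t) (\<omega> t)) \<partial>sample_space n) * ennreal (1 / (2 * U)))"
    by (simp add: nn_integral_add nn_integral_sum nn_integral_multc S.emeasure_space_1 del: sum_ennreal)
  also have "(\<lambda>t. \<integral>\<^sup>+ \<omega>. ennreal \<bar>p (\<omega> t) - of_bool (f (\<omega> t))\<bar> \<partial>sample_space n) = (\<lambda>t. ennreal L)"
    unfolding L_def by (subst nn_integral_sample_component) (auto simp: nn_integral_eq_integral ip)
  also have "(\<lambda>t. (\<integral>\<^sup>+ \<omega>. ennreal (poly_kernel n d (\<omega> t) (\<omega> t)) \<partial>sample_space n) * ennreal (1 / (2 * U))) =
      (\<lambda>t. (\<integral>\<^sup>+ x. ennreal (poly_kernel n d x x) \<partial>gauss n) * ennreal (1 / (2 * U)))"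
    by (subst nn_integral_sample_component) auto
  also have "(\<Sum>t<N. ennreal L) + ennreal (B\<^sup>2 * U / 2)
      + (\<Sum>t<N. (\<integral>\<^sup>+ x. ennreal (poly_kernel n d x x) \<partial>gauss n) * ennreal (1 / (2 * U))) \<le>
      (\<Sum>t<N. ennreal L) + ennreal (B\<^sup>2 * U / 2) + (\<Sum>t<N. ennreal M2 * ennreal (1 / (2 * U)))"
    by (intro add_mono sum_mono mult_right_mono order_refl M2(1)) simp
  also have "\<dots> = ennreal (real N * L + B\<^sup>2 * U / 2 + real N * M2 / (2 * U))"
  proof -
    have "(\<Sum>t<N. ennreal L) = ennreal (real N * L)"
      using L by (simp add: ennreal_mult ennreal_of_nat_eq_real_of_nat)
    moreover have "(\<Sum>t<N. ennreal M2 * ennreal (1 / (2 * U))) = ennreal (real N * M2 / (2 * U))"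
    proof -
      have "ennreal M2 * ennreal (1 / (2 * U)) = ennreal (M2 / (2 * U))"
        using M2(2) U by (subst ennreal_mult[symmetric]) simp_all
      then have "(\<Sum>t<N. ennreal M2 * ennreal (1 / (2 * U))) = ennreal (real N) * ennreal (M2 / (2 * U))"
        by (simp add: ennreal_of_nat_eq_real_of_nat)
      also have "\<dots> = ennreal (real N * (M2 / (2 * U)))"
        using M2(2) U by (intro ennreal_mult[symmetric]) simp_all
      finally show ?thesis by simp
    qed
    moreover have "ennreal (real N * L) + ennreal (B\<^sup>2 * U / 2) + ennreal (real N * M2 / (2 * U)) =
        ennreal (real N * L + B\<^sup>2 * U / 2 + real N * M2 / (2 * U))"
      using U M2(2) L by simp
    ultimately show ?thesis by (simp only:)
  qed
  finally show ?thesis by (simp add: L_def)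
qed

text \<open>Randomising the threshold turns the \<open>L\<^sup>1\<close> error of a real-valued predictor into a
  classification error.\<close>

lemma sum_threshold_errors:
  fixes z :: real and m :: nat
  shows "(\<Sum>j<m. of_bool ((real j \<le> z * real m) \<noteq> y)) \<le> real m * \<bar>z - of_bool y\<bar> + 1"
proof -
  have eq: "(\<Sum>j<m. of_bool ((real j \<le> z * real m) \<noteq> y) :: real) = real (card {j \<in> {..<m}. (real j \<le> z * real m) \<noteq> y})"
    by (simp add: of_bool_def sum.If_cases Int_def conj_commute)
  show ?thesis
  proof (cases y)
    case False
    show ?thesis
    proof (cases "0 \<le> z")
      case True
      \<comment> \<open>The wrong thresholds run from 0 to the floor of \<open>z * m\<close>;
        threshold 0 is the additional 1 in the bound.\<close>
      have "card {j \<in> {..<m}. (real j \<le> z * real m) \<noteq> y} \<le> card {..nat \<lfloor>z * real m\<rfloor>}"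
        using False True by (intro card_mono) (auto simp: le_nat_floor)
      also have "\<dots> = nat \<lfloor>z * real m\<rfloor> + 1" by simp
      finally have "real (card {j \<in> {..<m}. (real j \<le> z * real m) \<noteq> y}) \<le> real (nat \<lfloor>z * real m\<rfloor>) + 1"
        by simp
      also have "\<dots> \<le> z * real m + 1" using True by (simp add: of_nat_floor)
      finally show ?thesis using False True unfolding eq by (simp add: mult.commute)
    next
      case neg: False
      have "\<not> real j \<le> z * real m" if "j < m" for j
        using neg that mult_neg_pos[of z "real m"] by (simp add: not_le)
      then have "(\<Sum>j<m. of_bool ((real j \<le> z * real m) \<noteq> y) :: real) = 0" using False by simp
      then show ?thesis by simp
    qed
  next
    case True
    show ?thesis
    proof (cases "0 \<le> z")
      case pos: True
      define a where "a = nat \<lfloor>z * real m\<rfloor>"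
      have "{j \<in> {..<m}. (real j \<le> z * real m) \<noteq> y} \<subseteq> {Suc a..<m}"
        using True pos unfolding a_def by (auto simp: not_le Suc_le_eq) (metis floor_less_iff nat_less_iff of_int_of_nat_eq zero_le_floor zero_le_mult_iff of_nat_0_le_iff)
      then have "card {j \<in> {..<m}. (real j \<le> z * real m) \<noteq> y} \<le> m - Suc a"
        using card_mono[of "{Suc a..<m}"] by simp
      then have "real (card {j \<in> {..<m}. (real j \<le> z * real m) \<noteq> y}) \<le> real (m - Suc a)" by simp
      also have "\<dots> \<le> real m * \<bar>z - 1\<bar> + 1"
      proof (cases "Suc a \<le> m")
        case le: True
        have "z * real m \<le> real a + 1" unfolding a_def using pos by linarith
        then have "real (m - Suc a) \<le> real m * (1 - z)" using le by (simp add: of_nat_diff algebra_simps)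
        also have "\<dots> \<le> real m * \<bar>z - 1\<bar>" by (intro mult_left_mono) auto
        finally show ?thesis by simp
      qed simp
      finally show ?thesis using True unfolding eq by simp
    next
      case neg: False
      have "real (card {j \<in> {..<m}. (real j \<le> z * real m) \<noteq> y}) \<le> real (card {..<m})"
        by (intro of_nat_mono card_mono) auto
      also have "\<dots> \<le> real m * \<bar>z - 1\<bar>"
        using neg mult_left_mono[of 1 "\<bar>z - 1\<bar>" "real m"] by simp
      finally show ?thesis using True unfolding eq by simp
    qed
  qed
qed

section \<open>Thresholded average iterates and their expected error\<close>

definition sgd_hypothesis :: "nat \<Rightarrow> nat \<Rightarrow> real \<Rightarrow> (vect \<Rightarrow> bool) \<Rightarrow> nat \<Rightarrow> nat \<Rightarrow> (nat \<Rightarrow> vect) \<Rightarrow> vect \<Rightarrow> bool" where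
  "sgd_hypothesis n d U f N j X x \<longleftrightarrow> real j \<le> sgd_average n d U f N X x * real d"

lemma sgd_hypothesis_cong:
  "(\<And>i. i < N \<Longrightarrow> X i = Y i) \<Longrightarrow> sgd_hypothesis n d U f N j X x = sgd_hypothesis n d U f N j Y x"
  unfolding sgd_hypothesis_def using sgd_average_cong[of N X Y] by simp

lemma pred_sgd_hypothesis [measurable (raw)]:
  assumes f: "boolean_function n f" and [measurable]: "g \<in> measurable M (sample_space n)"
    "h \<in> measurable M (gauss n)"
  shows "Measurable.pred M (\<lambda>w. sgd_hypothesis n d U f N j (g w) (h w))"
  unfolding sgd_hypothesis_def using borel_measurable_sgd_average[OF f assms(2,3)] by measurable

lemma borel_measurable_dist_G:
  assumes f [measurable]: "boolean_function n f"
    and h [measurable]: "Measurable.pred (M \<Otimes>\<^sub>M gauss n) (\<lambda>(w, x). h w x)"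
  shows "(\<lambda>w. dist_G n f (h w)) \<in> borel_measurable M"
proof -
  interpret prob_space "gauss n" by (rule prob_space_gauss)
  have "{z \<in> space (M \<Otimes>\<^sub>M gauss n). f (snd z) \<noteq> (\<lambda>(w, x). h w x) z} \<in> sets (M \<Otimes>\<^sub>M gauss n)"
    by measurable
  from measurable_emeasure_Pair[OF this]
  have "(\<lambda>w. measure (gauss n) (Pair w -` {z \<in> space (M \<Otimes>\<^sub>M gauss n). f (snd z) \<noteq> (\<lambda>(w, x). h w x) z})) \<in> borel_measurable M"
    unfolding measure_def by measurable
  moreover have "Pair w -` {z \<in> space (M \<Otimes>\<^sub>M gauss n). f (snd z) \<noteq> (\<lambda>(w, x). h w x) z} =
      {x \<in> space (gauss n). f x \<noteq> h w x}" if "w \<in> space M" for w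
    using that by (auto simp: space_pair_measure)
  ultimately show ?thesis
    unfolding dist_G_def by (simp cong: measurable_cong)
qed

lemma dist_sgd_hypothesis_measurable [measurable (raw)]:
  assumes f: "boolean_function n f" and [measurable]: "g \<in> measurable M (sample_space n)"
  shows "(\<lambda>w. dist_G n f (sgd_hypothesis n d U f N j (g w))) \<in> borel_measurable M"
  by (rule borel_measurable_dist_G[OF f])
    (simp add: split_beta', intro pred_sgd_hypothesis f, measurable)

text \<open>Here all thresholds are applied to one and the same run, although the learner takes a
  fresh run for each: only the sum of the expectations matters, and every run has the same law. By
  the triangle inequality the average iterate is no worse than the iterates on average.\<close>

lemma sgd_hypotheses_expected_error:
  assumes f: "boolean_function n f" and p: "rkhs_le n d B p" and pm: "p \<in> borel_measurable (gauss n)"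
    and ip: "integrable (gauss n) (\<lambda>x. \<bar>p x - of_bool (f x)\<bar>)" and U: "0 < U" and N: "0 < N"
    and M2: "(\<integral>\<^sup>+ x. ennreal (poly_kernel n d x x) \<partial>gauss n) \<le> ennreal M2" "0 \<le> M2"
  shows "(\<Sum>j<d. \<integral>\<omega>. dist_G n f (sgd_hypothesis n d U f N j \<omega>) \<partial>sample_space n) \<le>
    real d * ((\<integral>x. \<bar>p x - of_bool (f x)\<bar> \<partial>gauss n) + B\<^sup>2 * U / (2 * real N) + M2 / (2 * U)) + 1"
proof -
  interpret S: prob_space "sample_space n" by (rule prob_space_sample_space)
  interpret G: prob_space "gauss n" by (rule prob_space_gauss)
  note [measurable] = borel_measurable_of_bool_f[OF f] borel_measurable_sgd_iterate[OF f]
    borel_measurable_sgd_average[OF f] dist_sgd_hypothesis_measurable[OF f] pred_sgd_hypothesis[OF f] f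
  let ?y = "\<lambda>x. of_bool (f x) :: real"
  let ?e = "\<lambda>j \<omega>. dist_G n f (sgd_hypothesis n d U f N j \<omega>)"
  define R where "R = real N * (\<integral>x. \<bar>p x - ?y x\<bar> \<partial>gauss n) + B\<^sup>2 * U / 2 + real N * M2 / (2 * U)"
  have R: "0 \<le> R" unfolding R_def using U M2 by (intro add_nonneg_nonneg) auto
  have pt: "(\<Sum>j<d. ennreal (?e j \<omega>)) \<le>
      ennreal (real d / real N) * (\<Sum>t<N. \<integral>\<^sup>+ x. ennreal \<bar>sgd_iterate n d U f \<omega> t x - ?y x\<bar> \<partial>gauss n) + 1"
    if \<omega>: "\<omega> \<in> space (sample_space n)" for \<omega>
  proof -
    have [measurable]: "(\<lambda>x. sgd_iterate n d U f \<omega> t x) \<in> borel_measurable (gauss n)" for t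
      using \<omega> by (intro borel_measurable_sgd_iterate[OF f]) auto
    have hm: "Measurable.pred (gauss n) (sgd_hypothesis n d U f N j \<omega>)" for j
      using \<omega> by (intro pred_sgd_hypothesis[OF f]) auto
    note [measurable] = hm
    have e: "ennreal (?e j \<omega>) = (\<integral>\<^sup>+ x. ennreal (of_bool (sgd_hypothesis n d U f N j \<omega> x \<noteq> f x)) \<partial>gauss n)" for j
    proof -
      have "ennreal (?e j \<omega>) = emeasure (gauss n) {x \<in> space (gauss n). f x \<noteq> sgd_hypothesis n d U f N j \<omega> x}"
        by (simp add: dist_G_def G.emeasure_eq_measure)
      also have "\<dots> = (\<integral>\<^sup>+ x. indicator {x \<in> space (gauss n). f x \<noteq> sgd_hypothesis n d U f N j \<omega> x} x \<partial>gauss n)"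
        by (rule nn_integral_indicator[symmetric]) measurable
      also have "\<dots> = (\<integral>\<^sup>+ x. ennreal (of_bool (sgd_hypothesis n d U f N j \<omega> x \<noteq> f x)) \<partial>gauss n)"
        by (intro nn_integral_cong) (auto simp: indicator_def)
      finally show ?thesis .
    qed
    have "(\<Sum>j<d. ennreal (?e j \<omega>)) =
        (\<integral>\<^sup>+ x. (\<Sum>j<d. ennreal (of_bool (sgd_hypothesis n d U f N j \<omega> x \<noteq> f x))) \<partial>gauss n)"
      unfolding e by (rule nn_integral_sum[symmetric]) measurable
    also have "\<dots> \<le> (\<integral>\<^sup>+ x. ennreal (real d / real N) * (\<Sum>t<N. ennreal \<bar>sgd_iterate n d U f \<omega> t x - ?y x\<bar>) + 1 \<partial>gauss n)"
    proof (rule nn_integral_mono)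
      fix x
      have "(\<Sum>j<d. ennreal (of_bool (sgd_hypothesis n d U f N j \<omega> x \<noteq> f x))) =
          ennreal (\<Sum>j<d. of_bool ((real j \<le> sgd_average n d U f N \<omega> x * real d) \<noteq> f x))"
        unfolding sgd_hypothesis_def by (rule sum_ennreal) simp
      also have "\<dots> \<le> ennreal (real d * \<bar>sgd_average n d U f N \<omega> x - ?y x\<bar> + 1)"
        by (intro ennreal_leI sum_threshold_errors)
      also have "\<dots> \<le> ennreal (real d / real N * (\<Sum>t<N. \<bar>sgd_iterate n d U f \<omega> t x - ?y x\<bar>) + 1)"
      proof (intro ennreal_leI add_right_mono)
        have "sgd_average n d U f N \<omega> x - ?y x = (\<Sum>t<N. sgd_iterate n d U f \<omega> t x - ?y x) / real N"
          using N by (simp add: sgd_average_eq sum_subtractf diff_divide_distrib)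
        then have "\<bar>sgd_average n d U f N \<omega> x - ?y x\<bar> \<le> (\<Sum>t<N. \<bar>sgd_iterate n d U f \<omega> t x - ?y x\<bar>) / real N"
          using N by (simp add: divide_right_mono)
        from mult_left_mono[OF this, of "real d"]
        show "real d * \<bar>sgd_average n d U f N \<omega> x - ?y x\<bar> \<le>
            real d / real N * (\<Sum>t<N. \<bar>sgd_iterate n d U f \<omega> t x - ?y x\<bar>)" by simp
      qed
      also have "\<dots> = ennreal (real d / real N * (\<Sum>t<N. \<bar>sgd_iterate n d U f \<omega> t x - ?y x\<bar>)) + 1"
        by (subst ennreal_plus) (auto intro!: mult_nonneg_nonneg divide_nonneg_nonneg sum_nonneg)
      also have "\<dots> = ennreal (real d / real N) * (\<Sum>t<N. ennreal \<bar>sgd_iterate n d U f \<omega> t x - ?y x\<bar>) + 1"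
        by (subst ennreal_mult) (auto intro!: sum_nonneg)
      finally show "(\<Sum>j<d. ennreal (of_bool (sgd_hypothesis n d U f N j \<omega> x \<noteq> f x))) \<le> \<dots>" .
    qed
    also have "\<dots> = ennreal (real d / real N) *
        (\<Sum>t<N. \<integral>\<^sup>+ x. ennreal \<bar>sgd_iterate n d U f \<omega> t x - ?y x\<bar> \<partial>gauss n) + 1"
      by (simp add: nn_integral_add nn_integral_cmult nn_integral_sum G.emeasure_space_1 del: sum_ennreal)
    finally show ?thesis .
  qed
  have ie: "integrable (sample_space n) (?e j)" for j
    by (rule S.integrable_const_bound[where B = 1]) (simp_all add: dist_G_def)
  have "ennreal (\<Sum>j<d. \<integral>\<omega>. ?e j \<omega> \<partial>sample_space n) = (\<Sum>j<d. ennreal (\<integral>\<omega>. ?e j \<omega> \<partial>sample_space n))"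
    by (rule sum_ennreal[symmetric]) (simp add: dist_G_def)
  also have "\<dots> = (\<Sum>j<d. \<integral>\<^sup>+ \<omega>. ennreal (?e j \<omega>) \<partial>sample_space n)"
    by (intro sum.cong refl nn_integral_eq_integral[symmetric] ie) (simp add: dist_G_def)
  also have "\<dots> = (\<integral>\<^sup>+ \<omega>. (\<Sum>j<d. ennreal (?e j \<omega>)) \<partial>sample_space n)"
    by (rule nn_integral_sum[symmetric]) measurable
  also have "\<dots> \<le> (\<integral>\<^sup>+ \<omega>. ennreal (real d / real N) *
      (\<Sum>t<N. \<integral>\<^sup>+ x. ennreal \<bar>sgd_iterate n d U f \<omega> t x - ?y x\<bar> \<partial>gauss n) + 1 \<partial>sample_space n)"
    by (rule nn_integral_mono) (rule pt)
  also have "\<dots> = ennreal (real d / real N) * (\<integral>\<^sup>+ \<omega>.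
      (\<Sum>t<N. \<integral>\<^sup>+ x. ennreal \<bar>sgd_iterate n d U f \<omega> t x - ?y x\<bar> \<partial>gauss n) \<partial>sample_space n) + 1"
    by (simp add: nn_integral_add nn_integral_cmult S.emeasure_space_1)
  also have "\<dots> \<le> ennreal (real d / real N) * ennreal R + 1"
    unfolding R_def by (intro add_right_mono mult_left_mono sgd_expected_loss f p pm ip U M2) simp
  also have "\<dots> = ennreal (real d / real N * R + 1)"
    using R by (subst ennreal_mult[symmetric]) simp_all
  finally have "(\<Sum>j<d. \<integral>\<omega>. ?e j \<omega> \<partial>sample_space n) \<le> real d / real N * R + 1"
    using R by (subst (asm) ennreal_le_iff) auto
  also have "real d / real N * R = real d * ((\<integral>x. \<bar>p x - ?y x\<bar> \<partial>gauss n) + B\<^sup>2 * U / (2 * real N) + M2 / (2 * U))"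
    unfolding R_def using N U by (simp add: field_simps)
  finally show ?thesis by simp
qed


section \<open>Independent runs and validation\<close>

lemma gauss_moment_le: "(\<integral>x. x ^ (2 * d) \<partial>gauss1) \<le> real d ^ d"
proof -
  have "fact (2 * d) div fact (2 * d - d) \<le> (2 * d) ^ d"
    by (rule fact_div_fact_le_pow) simp
  then have "fact (2 * d) \<le> (2 * d) ^ d * (fact d :: nat)"
    by (metis diff_add_inverse2 dvd_div_mult_self fact_dvd le_add2 mult_2 mult_le_mono1)
  then have "real (fact (2 * d)) \<le> real ((2 * d) ^ d * fact d)" by (rule of_nat_mono)
  then have "fact (2 * d) \<le> real d ^ d * (2 ^ d * fact d)"
    by (simp add: power_mult_distrib mult_ac)
  then show ?thesis by (simp add: gauss1_moment_even divide_le_eq)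
qed

text \<open>The diagonal of the kernel is the squared norm of a subgradient. A sum of
  \<open>n + 1\<close> nonnegative terms is at most \<open>n + 1\<close> times the largest, whose
  \<open>d\<close>-th power is one of the summed powers; this leaves one-dimensional moments of
  order \<open>2 * d\<close>.\<close>

lemma kernel_diagonal_moment:
  assumes "1 \<le> d"
  shows "(\<integral>\<^sup>+ x. ennreal (poly_kernel n d x x) \<partial>gauss n) \<le> ennreal (real (n + 1) ^ (d + 1) * real d ^ d)"
proof -
  interpret prob_space "gauss n" by (rule prob_space_gauss)
  have pw: "(1 + dotp n x x) ^ d \<le> real (n + 1) ^ d * (1 + (\<Sum>i<n. x i ^ (2 * d)))" for x
  proof -
    define z where "z i = (if i < n then (x i)\<^sup>2 else 1)" for i
    have z: "0 \<le> z i" for i by (simp add: z_def)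
    have eq: "1 + dotp n x x = (\<Sum>i\<le>n. z i)"
      by (simp add: lessThan_Suc_atMost[symmetric] z_def dotp_def power2_eq_square)
    define m where "m = Max (z ` {..n})"
    have m: "z i \<le> m" if "i \<le> n" for i unfolding m_def using that by (intro Max_ge) auto
    have "m \<in> z ` {..n}" unfolding m_def by (intro Max_in) auto
    then obtain k where k: "k \<le> n" "m = z k" by auto
    have "(\<Sum>i\<le>n. z i) \<le> real (n + 1) * m"
      using sum_bounded_above[of "{..n}" z m] m by simp
    then have "(1 + dotp n x x) ^ d \<le> (real (n + 1) * m) ^ d"
      unfolding eq using z by (intro power_mono sum_nonneg) auto
    also have "\<dots> = real (n + 1) ^ d * z k ^ d" by (simp add: power_mult_distrib k)
    also have "\<dots> \<le> real (n + 1) ^ d * (\<Sum>i\<le>n. z i ^ d)"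
      using k z by (intro mult_left_mono member_le_sum) auto
    also have "(\<Sum>i\<le>n. z i ^ d) = 1 + (\<Sum>i<n. x i ^ (2 * d))"
      by (simp add: lessThan_Suc_atMost[symmetric] z_def power_mult)
    finally show ?thesis .
  qed
  define g where "g i j y = (if j = i then y ^ (2 * d) else 1 :: real)" for i j :: nat and y :: real
  interpret g1: prob_space gauss1 by (rule prob_space_gauss1)
  have gi: "integrable gauss1 (g i j)" for i j by (cases "j = i") (simp_all add: g_def[abs_def])
  have geq: "(\<Prod>j<n. g i j (x j)) = x i ^ (2 * d)" if "i < n" for i x
    using that by (simp add: g_def)
  have coord: "integrable (gauss n) (\<lambda>x. x i ^ (2 * d))"
    "(\<integral>x. x i ^ (2 * d) \<partial>gauss n) \<le> real d ^ d" if i: "i < n" for i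
  proof -
    show "integrable (gauss n) (\<lambda>x. x i ^ (2 * d))"
      using integrable_gauss_prod[of n "g i", OF gi] by (simp add: geq[OF i])
    have "(\<integral>x. x i ^ (2 * d) \<partial>gauss n) = (\<Prod>j<n. \<integral>y. g i j y \<partial>gauss1)"
      using integral_gauss_prod[of n "g i", OF gi] by (simp add: geq[OF i])
    also have "\<dots> = (\<Prod>j<n. if j = i then (\<integral>y. y ^ (2 * d) \<partial>gauss1) else 1)"
      using g1.prob_space by (intro prod.cong refl) (simp add: g_def[abs_def])
    also have "\<dots> \<le> real d ^ d" using i gauss_moment_le by simp
    finally show "(\<integral>x. x i ^ (2 * d) \<partial>gauss n) \<le> real d ^ d" .
  qed
  let ?h = "\<lambda>x. real (n + 1) ^ d * (1 + (\<Sum>i<n. x i ^ (2 * d)))"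
  have ih: "integrable (gauss n) ?h"
    by (intro integrable_mult_right Bochner_Integration.integrable_add Bochner_Integration.integrable_sum coord) auto
  have "(\<integral>\<^sup>+ x. ennreal (poly_kernel n d x x) \<partial>gauss n) \<le> (\<integral>\<^sup>+ x. ennreal (?h x) \<partial>gauss n)"
    unfolding poly_kernel_def by (intro nn_integral_mono ennreal_leI pw)
  also have "\<dots> = ennreal (\<integral>x. ?h x \<partial>gauss n)"
    by (intro nn_integral_eq_integral ih) (auto intro!: sum_nonneg mult_nonneg_nonneg add_nonneg_nonneg)
  also have "(\<integral>x. ?h x \<partial>gauss n) = real (n + 1) ^ d * (1 + (\<Sum>i<n. \<integral>x. x i ^ (2 * d) \<partial>gauss n))"
  proof -
    have "(\<integral>x. 1 + (\<Sum>i<n. x i ^ (2 * d)) \<partial>gauss n) = (\<integral>x. 1 \<partial>gauss n) + (\<integral>x. (\<Sum>i<n. x i ^ (2 * d)) \<partial>gauss n)"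
      by (intro Bochner_Integration.integral_add Bochner_Integration.integrable_sum coord) auto
    also have "(\<integral>x. (\<Sum>i<n. x i ^ (2 * d)) \<partial>gauss n) = (\<Sum>i<n. \<integral>x. x i ^ (2 * d) \<partial>gauss n)"
      by (intro Bochner_Integration.integral_sum coord) auto
    finally show ?thesis by (simp add: prob_space)
  qed
  also have "\<dots> \<le> real (n + 1) ^ d * (real d ^ d + (\<Sum>i<n. real d ^ d))"
    using assms by (intro mult_left_mono add_mono sum_mono coord) auto
  also have "\<dots> = real (n + 1) ^ (d + 1) * real d ^ d" by (simp add: algebra_simps)
  finally show ?thesis using order_trans ennreal_leI by blast
qed

section \<open>Independent blocks of the sample stream\<close>

lemma drop_samples_comb_seq: "drop_samples a (comb_seq a \<omega> \<omega>') = \<omega>'"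
  by (rule ext) (metis add.commute comb_seq_add drop_samples_def)

lemma drop_samples_drop_samples: "drop_samples a (drop_samples b \<omega>) = drop_samples (b + a) \<omega>"
  by (simp add: drop_samples_def fun_eq_iff add.assoc)

lemma drop_samples_in_space: "\<omega> \<in> space (sample_space n) \<Longrightarrow> drop_samples a \<omega> \<in> space (sample_space n)"
  by (simp add: sample_space_def space_PiM PiE_iff drop_samples_def)

lemma comb_seq_in_space:
  "\<omega> \<in> space (sample_space n) \<Longrightarrow> \<omega>' \<in> space (sample_space n) \<Longrightarrow> comb_seq a \<omega> \<omega>' \<in> space (sample_space n)"
  by (simp add: sample_space_def space_PiM PiE_iff comb_seq_def)

lemma measure_sample_split:
  assumes A [measurable]: "A \<in> sets (sample_space n)" and B [measurable]: "B \<in> sets (sample_space n)"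
    and dep: "\<And>\<omega> \<omega>'. \<omega> \<in> A \<Longrightarrow> \<omega>' \<in> space (sample_space n) \<Longrightarrow> (\<And>i. i < a \<Longrightarrow> \<omega> i = \<omega>' i) \<Longrightarrow> \<omega>' \<in> A"
  shows "measure (sample_space n) {\<omega> \<in> A. drop_samples a \<omega> \<in> B} =
    measure (sample_space n) A * measure (sample_space n) B"
proof -
  interpret S: prob_space "sample_space n" by (rule prob_space_sample_space)
  have As: "A \<subseteq> space (sample_space n)" using A by (rule sets.sets_into_space)
  have eq: "{\<omega> \<in> A. drop_samples a \<omega> \<in> B} = {\<omega> \<in> space (sample_space n). \<omega> \<in> A \<and> drop_samples a \<omega> \<in> B}"
    using As by auto
  have AB [measurable]: "{\<omega> \<in> A. drop_samples a \<omega> \<in> B} \<in> sets (sample_space n)"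
    unfolding eq by measurable
  have "emeasure (sample_space n) {\<omega> \<in> A. drop_samples a \<omega> \<in> B} =
      (\<integral>\<^sup>+ \<omega>. indicator {\<omega> \<in> A. drop_samples a \<omega> \<in> B} \<omega> \<partial>sample_space n)"
    by simp
  also have "\<dots> = (\<integral>\<^sup>+ \<omega>. (\<integral>\<^sup>+ \<omega>'. indicator {\<omega> \<in> A. drop_samples a \<omega> \<in> B} (comb_seq a \<omega> \<omega>') \<partial>sample_space n) \<partial>sample_space n)"
    by (rule nn_integral_sample_split) simp
  also have "\<dots> = (\<integral>\<^sup>+ \<omega>. (\<integral>\<^sup>+ \<omega>'. indicator A \<omega> * indicator B \<omega>' \<partial>sample_space n) \<partial>sample_space n)"
  proof (intro nn_integral_cong)
    fix \<omega> \<omega>' assume sp: "\<omega> \<in> space (sample_space n)" "\<omega>' \<in> space (sample_space n)"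
    have "comb_seq a \<omega> \<omega>' \<in> A \<longleftrightarrow> \<omega> \<in> A"
      using dep[of \<omega> "comb_seq a \<omega> \<omega>'"] dep[of "comb_seq a \<omega> \<omega>'" \<omega>] sp
      by (auto simp: comb_seq_less comb_seq_in_space)
    then show "indicator {\<omega> \<in> A. drop_samples a \<omega> \<in> B} (comb_seq a \<omega> \<omega>') = indicator A \<omega> * (indicator B \<omega>' :: ennreal)"
      by (auto simp: indicator_def drop_samples_comb_seq)
  qed
  also have "\<dots> = emeasure (sample_space n) A * emeasure (sample_space n) B"
    by (simp add: nn_integral_cmult nn_integral_multc)
  finally show ?thesis
    by (simp add: S.emeasure_eq_measure ennreal_mult'[symmetric])
qed

lemma measure_drop_samples:
  assumes B: "B \<in> sets (sample_space n)"
  shows "measure (sample_space n) {\<omega> \<in> space (sample_space n). drop_samples a \<omega> \<in> B} = measure (sample_space n) B"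
proof -
  interpret S: prob_space "sample_space n" by (rule prob_space_sample_space)
  show ?thesis
    using measure_sample_split[OF sets.top B, of a] by (simp add: S.prob_space)
qed

text \<open>Event \<open>E j\<close> looks only at the \<open>L\<close> samples of its own block.
  The first block splits off, and the others are blocks of the shifted stream.\<close>

lemma measure_sample_blocks:
  fixes E :: "nat \<Rightarrow> (nat \<Rightarrow> vect) set"
  assumes E: "\<And>j. E j \<in> sets (sample_space n)"
    and dep: "\<And>j \<omega> \<omega>'. \<omega> \<in> E j \<Longrightarrow> \<omega>' \<in> space (sample_space n) \<Longrightarrow> (\<And>i. i < L \<Longrightarrow> \<omega> i = \<omega>' i) \<Longrightarrow> \<omega>' \<in> E j"
  shows "measure (sample_space n) {\<omega> \<in> space (sample_space n). \<forall>j<m. drop_samples (j * L) \<omega> \<in> E j} =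
    (\<Prod>j<m. measure (sample_space n) (E j))"
  using E dep
proof (induction m arbitrary: E)
  case 0
  interpret S: prob_space "sample_space n" by (rule prob_space_sample_space)
  show ?case by (simp add: S.prob_space)
next
  case (Suc m)
  note [measurable] = Suc.prems(1)
  have d0: "drop_samples 0 \<omega> = \<omega>" for \<omega> by (simp add: drop_samples_def fun_eq_iff)
  define B where "B = {\<omega> \<in> space (sample_space n). \<forall>j<m. drop_samples (j * L) \<omega> \<in> E (Suc j)}"
  have B: "B \<in> sets (sample_space n)" unfolding B_def by measurable
  have sub: "E 0 \<subseteq> space (sample_space n)" using Suc.prems(1) by (rule sets.sets_into_space)
  have "{\<omega> \<in> space (sample_space n). \<forall>j<Suc m. drop_samples (j * L) \<omega> \<in> E j} = {\<omega> \<in> E 0. drop_samples L \<omega> \<in> B}"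
    unfolding B_def using sub
    by (auto simp: All_less_Suc2 d0 drop_samples_drop_samples drop_samples_in_space)
  then have "measure (sample_space n) {\<omega> \<in> space (sample_space n). \<forall>j<Suc m. drop_samples (j * L) \<omega> \<in> E j} =
      measure (sample_space n) (E 0) * measure (sample_space n) B"
    using measure_sample_split[OF Suc.prems(1)[of 0] B, of L] Suc.prems(2)[of _ 0] by simp
  also have "measure (sample_space n) B = (\<Prod>j<m. measure (sample_space n) (E (Suc j)))"
    unfolding B_def by (rule Suc.IH) (use Suc.prems in blast)+
  finally show ?case by (simp only: prod.lessThan_Suc_shift)
qed

section \<open>Validation on fresh samples\<close>

lemma sample_second_moment:
  fixes D :: "vect \<Rightarrow> real"
  assumes [measurable]: "D \<in> borel_measurable (gauss n)" and D1: "\<And>x. \<bar>D x\<bar> \<le> 1"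
    and D0: "(\<integral>x. D x \<partial>gauss n) = 0"
  shows "(\<integral>\<omega>. (\<Sum>v<N. D (\<omega> v))\<^sup>2 \<partial>sample_space n) \<le> real N"
proof -
  interpret S: prob_space "sample_space n" by (rule prob_space_sample_space)
  interpret Q: sequence_space "gauss n" by (rule sequence_space_gauss)
  have distr: "distr (sample_space n) (gauss n) (\<lambda>\<omega>. \<omega> v) = gauss n" for v
    unfolding sample_space_def using Q.PiM_component[of v] by simp
  have int: "integrable (sample_space n) (\<lambda>\<omega>. D (\<omega> u) * D (\<omega> v))" for u v
    by (rule S.integrable_const_bound[where B = 1]) (auto simp: abs_mult intro!: mult_le_one D1)
  have ind: "S.indep_vars (\<lambda>_. gauss n) (\<lambda>v \<omega>. \<omega> v) (UNIV :: nat set)"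
    by (subst S.indep_vars_iff_distr_eq_PiM') (auto simp: distr, simp add: sample_space_def restrict_UNIV distr_id)
  have indD: "S.indep_vars (\<lambda>_. borel) (\<lambda>v \<omega>. D (\<omega> v)) (UNIV :: nat set)"
    by (rule S.indep_vars_compose2[OF ind]) simp
  have e: "(\<integral>\<omega>. D (\<omega> v) \<partial>sample_space n) = 0" for v
  proof -
    have "(\<integral>\<omega>. D (\<omega> v) \<partial>sample_space n) = (\<integral>x. D x \<partial>distr (sample_space n) (gauss n) (\<lambda>\<omega>. \<omega> v))"
      by (subst integral_distr) auto
    then show ?thesis by (simp add: distr D0)
  qed
  have iD: "integrable (sample_space n) (\<lambda>\<omega>. D (\<omega> v))" for v
    by (rule S.integrable_const_bound[where B = 1]) (auto simp: D1)
  have cross: "(\<integral>\<omega>. D (\<omega> u) * D (\<omega> v) \<partial>sample_space n) = 0" if "u \<noteq> v" for u v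
  proof -
    have "(\<integral>\<omega>. (\<Prod>i\<in>{u, v}. D (\<omega> i)) \<partial>sample_space n) = (\<Prod>i\<in>{u, v}. \<integral>\<omega>. D (\<omega> i) \<partial>sample_space n)"
      by (rule S.indep_vars_lebesgue_integral) (auto intro: S.indep_vars_subset[OF indD] iD)
    then show ?thesis using that e by simp
  qed
  have "(\<integral>\<omega>. (\<Sum>v<N. D (\<omega> v))\<^sup>2 \<partial>sample_space n) = (\<Sum>u<N. \<Sum>v<N. \<integral>\<omega>. D (\<omega> u) * D (\<omega> v) \<partial>sample_space n)"
    unfolding power2_eq_square sum_product using int by simp
  also have "\<dots> = (\<Sum>u<N. \<Sum>v<N. if v = u then (\<integral>\<omega>. D (\<omega> u) * D (\<omega> u) \<partial>sample_space n) else 0)"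
    by (intro sum.cong refl) (auto simp: cross)
  also have "\<dots> = (\<Sum>u<N. \<integral>\<omega>. D (\<omega> u) * D (\<omega> u) \<partial>sample_space n)" by simp
  also have "\<dots> \<le> (\<Sum>u<N. 1)"
  proof (rule sum_mono)
    fix u
    have "D x * D x \<le> 1" for x
      using D1[of x] by (metis abs_mult_self_eq mult_le_one abs_ge_zero)
    then show "(\<integral>\<omega>. D (\<omega> u) * D (\<omega> u) \<partial>sample_space n) \<le> 1"
      using integral_mono[OF int[of u u], of "\<lambda>_. 1"] by (simp add: S.prob_space)
  qed
  finally show ?thesis by simp
qed

text \<open>Chebyshev's inequality is enough: the sample size will be so large that a union bound
  over all candidates survives the weak tail.\<close>

lemma validation_fixed:
  assumes f [measurable]: "boolean_function n f" and h [measurable]: "Measurable.pred (gauss n) h"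
    and \<delta>: "0 < \<delta>" and N: "0 < N"
  shows "measure (sample_space n) {\<omega> \<in> space (sample_space n).
      \<delta> * real N \<le> \<bar>real (card {v. v < N \<and> h (\<omega> v) = f (\<omega> v)}) - real N * (1 - dist_G n f h)\<bar>} \<le> 1 / (real N * \<delta>\<^sup>2)"
proof -
  interpret S: prob_space "sample_space n" by (rule prob_space_sample_space)
  interpret G: prob_space "gauss n" by (rule prob_space_gauss)
  define q where "q = 1 - dist_G n f h"
  define D where "D x = of_bool (h x = f x) - q" for x
  have q: "q = (\<integral>x. of_bool (h x = f x) \<partial>gauss n)"
  proof -
    have "dist_G n f h = (\<integral>x. indicator {x \<in> space (gauss n). f x \<noteq> h x} x \<partial>gauss n)"
      by (simp add: dist_G_def)
    also have "\<dots> = (\<integral>x. 1 - of_bool (h x = f x) \<partial>gauss n)"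
      by (intro Bochner_Integration.integral_cong) (auto simp: indicator_def)
    also have "\<dots> = 1 - (\<integral>x. of_bool (h x = f x) \<partial>gauss n)"
      by (subst Bochner_Integration.integral_diff)
        (auto intro!: G.integrable_const_bound[where B = 1] simp: G.prob_space)
    finally show ?thesis by (simp add: q_def)
  qed
  have q01: "0 \<le> q" "q \<le> 1" unfolding q_def dist_G_def by simp_all
  have [measurable]: "D \<in> borel_measurable (gauss n)" unfolding D_def by measurable
  have D1: "\<bar>D x\<bar> \<le> 1" for x using q01 by (simp add: D_def of_bool_def)
  have D0: "(\<integral>x. D x \<partial>gauss n) = 0"
    unfolding D_def by (subst Bochner_Integration.integral_diff)
      (auto intro!: G.integrable_const_bound[where B = 1] simp: G.prob_space q)
  have sumD: "(\<Sum>v<N. D (\<omega> v)) = real (card {v. v < N \<and> h (\<omega> v) = f (\<omega> v)}) - real N * (1 - dist_G n f h)" for \<omega>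
  proof -
    have "(\<Sum>v<N. of_bool (h (\<omega> v) = f (\<omega> v)) :: real) = real (card {v. v < N \<and> h (\<omega> v) = f (\<omega> v)})"
      by (simp add: of_bool_def sum.If_cases Int_def)
    then show ?thesis by (simp add: D_def sum_subtractf q_def)
  qed
  have "\<delta> * real N > 0" using \<delta> N by simp
  then have eq: "\<delta> * real N \<le> \<bar>z\<bar> \<longleftrightarrow> (\<delta> * real N)\<^sup>2 \<le> z\<^sup>2" for z :: real
    using abs_le_square_iff[of "\<delta> * real N" z] by simp
  have i: "integrable (sample_space n) (\<lambda>\<omega>. (\<Sum>v<N. D (\<omega> v))\<^sup>2)"
  proof (rule S.integrable_const_bound[where B = "(real N)\<^sup>2"])
    have "\<bar>\<Sum>v<N. D (\<omega> v)\<bar> \<le> real N" for \<omega>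
    proof -
      have "\<bar>\<Sum>v<N. D (\<omega> v)\<bar> \<le> (\<Sum>v<N. \<bar>D (\<omega> v)\<bar>)" by (rule sum_abs)
      also have "\<dots> \<le> (\<Sum>v<N. 1)" by (rule sum_mono) (rule D1)
      finally show ?thesis by simp
    qed
    then have "\<bar>\<Sum>v<N. D (\<omega> v)\<bar>\<^sup>2 \<le> (real N)\<^sup>2" for \<omega> by (intro power_mono) auto
    then show "AE \<omega> in sample_space n. norm ((\<Sum>v<N. D (\<omega> v))\<^sup>2) \<le> (real N)\<^sup>2" by simp
  qed simp
  have "measure (sample_space n) {\<omega> \<in> space (sample_space n). (\<delta> * real N)\<^sup>2 \<le> (\<Sum>v<N. D (\<omega> v))\<^sup>2} \<le>
      (\<integral>\<omega>. (\<Sum>v<N. D (\<omega> v))\<^sup>2 \<partial>sample_space n) / (\<delta> * real N)\<^sup>2"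
    using \<delta> N by (intro integral_Markov_inequality_measure[OF i sets.top]) auto
  also have "\<dots> \<le> real N / (\<delta> * real N)\<^sup>2"
    by (intro divide_right_mono sample_second_moment D1 D0) auto
  also have "\<dots> = 1 / (real N * \<delta>\<^sup>2)"
    using N \<delta> by (simp add: power2_eq_square)
  finally show ?thesis unfolding eq sumD .
qed

definition num_correct :: "nat \<Rightarrow> nat \<Rightarrow> real \<Rightarrow> (vect \<Rightarrow> bool) \<Rightarrow> nat \<Rightarrow> nat \<Rightarrow> (nat \<Rightarrow> vect) \<Rightarrow> nat" where
  "num_correct n d U f N j X = card {v. v < N \<and> sgd_hypothesis n d U f N j X (X (N + v)) = f (X (N + v))}"

lemma measurable_num_correct [measurable (raw)]:
  assumes f [measurable]: "boolean_function n f" and [measurable]: "g \<in> measurable M (sample_space n)"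
  shows "(\<lambda>w. real (num_correct n d U f N j (g w))) \<in> borel_measurable M"
proof -
  note [measurable] = borel_measurable_of_bool_f[OF f]
  have [measurable]: "Measurable.pred M (\<lambda>w. sgd_hypothesis n d U f N j (g w) (g w (N + v)))"
    "Measurable.pred M (\<lambda>w. f (g w (N + v)))" for v
    using measurable_compose[OF measurable_sample_component[OF assms(2), of "N + v"] f]
    by (auto intro!: pred_sgd_hypothesis[OF f] simp: comp_def)
  have "(\<lambda>w. real (num_correct n d U f N j (g w))) =
      (\<lambda>w. \<Sum>v<N. of_bool (sgd_hypothesis n d U f N j (g w) (g w (N + v)) = f (g w (N + v))))"
    by (rule ext) (simp add: num_correct_def of_bool_def sum.If_cases Int_def)
  moreover have "\<dots> \<in> borel_measurable M" by measurable
  ultimately show ?thesis by (simp only:)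
qed

text \<open>The candidate is trained on the first \<open>N\<close> samples of its block and tested
  on the next \<open>N\<close>. After splitting the stream at \<open>N\<close> it is a fixed
  hypothesis for the test, with a bound uniform in the training half.\<close>

lemma validation_error:
  fixes d j :: nat and U :: real
  assumes f: "boolean_function n f" and \<delta>: "0 < \<delta>" and N: "0 < N"
  defines "Bad \<equiv> {X \<in> space (sample_space n). \<delta> * real N \<le>
    \<bar>real (num_correct n d U f N j X) - real N * (1 - dist_G n f (sgd_hypothesis n d U f N j X))\<bar>}"
  shows "Bad \<in> sets (sample_space n)" and "measure (sample_space n) Bad \<le> 1 / (real N * \<delta>\<^sup>2)"
proof -
  interpret S: prob_space "sample_space n" by (rule prob_space_sample_space)
  note [measurable] = dist_sgd_hypothesis_measurable[OF f] measurable_num_correct[OF f]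
  show Bad [measurable]: "Bad \<in> sets (sample_space n)" unfolding Bad_def by measurable
  have "emeasure (sample_space n) Bad = (\<integral>\<^sup>+ X. indicator Bad X \<partial>sample_space n)" by simp
  also have "\<dots> = (\<integral>\<^sup>+ X. (\<integral>\<^sup>+ Y. indicator Bad (comb_seq N X Y) \<partial>sample_space n) \<partial>sample_space n)"
    by (rule nn_integral_sample_split) simp
  also have "\<dots> \<le> (\<integral>\<^sup>+ X. ennreal (1 / (real N * \<delta>\<^sup>2)) \<partial>sample_space n)"
  proof (rule nn_integral_mono)
    fix X assume X: "X \<in> space (sample_space n)"
    define h where "h = sgd_hypothesis n d U f N j X"
    have h: "Measurable.pred (gauss n) h"
      unfolding h_def using X by (intro pred_sgd_hypothesis[OF f]) auto
    note [measurable] = f h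
    have same: "sgd_hypothesis n d U f N j (comb_seq N X Y) = h" for Y
      unfolding h_def by (rule ext, rule sgd_hypothesis_cong) (simp add: comb_seq_less)
    have shift: "comb_seq N X Y (N + v) = Y v" for Y v
      using comb_seq_add[of N X Y v] by (simp add: add.commute)
    let ?C = "{Y \<in> space (sample_space n). \<delta> * real N \<le>
      \<bar>real (card {v. v < N \<and> h (Y v) = f (Y v)}) - real N * (1 - dist_G n f h)\<bar>}"
    have C: "?C \<in> sets (sample_space n)"
    proof -
      have [measurable]: "Measurable.pred (sample_space n) (\<lambda>Y. h (Y v))" "Measurable.pred (sample_space n) (\<lambda>Y. f (Y v))" for v
      proof -
        have c: "(\<lambda>Y. Y v) \<in> measurable (sample_space n) (gauss n)"
          by (rule measurable_sample_component) simp
        show "Measurable.pred (sample_space n) (\<lambda>Y. h (Y v))" "Measurable.pred (sample_space n) (\<lambda>Y. f (Y v))"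
          using measurable_compose[OF c h] measurable_compose[OF c f] by simp_all
      qed
      have eq: "real (card {v. v < N \<and> h (Y v) = f (Y v)}) = (\<Sum>v<N. of_bool (h (Y v) = f (Y v)))" for Y
        by (simp add: of_bool_def sum.If_cases Int_def)
      show ?thesis unfolding eq by measurable
    qed
    have "(\<integral>\<^sup>+ Y. indicator Bad (comb_seq N X Y) \<partial>sample_space n) = (\<integral>\<^sup>+ Y. indicator ?C Y \<partial>sample_space n)"
    proof (rule nn_integral_cong)
      fix Y assume Y: "Y \<in> space (sample_space n)"
      have "comb_seq N X Y \<in> Bad \<longleftrightarrow> Y \<in> ?C"
        using comb_seq_in_space[OF X Y] Y by (simp add: Bad_def num_correct_def same shift)
      then show "indicator Bad (comb_seq N X Y) = (indicator ?C Y :: ennreal)"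
        by (simp only: indicator_def)
    qed
    also have "\<dots> = ennreal (measure (sample_space n) ?C)"
      using C by (simp add: S.emeasure_eq_measure)
    also have "\<dots> \<le> ennreal (1 / (real N * \<delta>\<^sup>2))"
      by (intro ennreal_leI validation_fixed f h \<delta> N)
    finally show "(\<integral>\<^sup>+ Y. indicator Bad (comb_seq N X Y) \<partial>sample_space n) \<le> ennreal (1 / (real N * \<delta>\<^sup>2))" .
  qed
  also have "\<dots> = ennreal (1 / (real N * \<delta>\<^sup>2))" by (simp add: S.emeasure_space_1)
  finally show "measure (sample_space n) Bad \<le> 1 / (real N * \<delta>\<^sup>2)"
    by (simp add: S.emeasure_eq_measure)
qed

lemma dist_G_nonneg: "0 \<le> dist_G n f h"
  by (simp add: dist_G_def)

lemma dist_G_le_1: "dist_G n f h \<le> 1"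
  using prob_space.prob_le_1[OF prob_space_gauss] by (simp add: dist_G_def)

text \<open>If the expected errors of the independent candidates average to at most \<open>\<mu>\<close>, then Markov's
  inequality leaves each candidate only a small chance, but all of them together a large one, of
  beating \<open>\<tau>\<close>.\<close>

lemma all_candidates_fail:
  assumes f: "boolean_function n f" and N: "N \<le> L" and \<tau>: "0 < \<tau>"
    and avg: "(\<Sum>j<d. \<integral>\<omega>. dist_G n f (sgd_hypothesis n d U f N j \<omega>) \<partial>sample_space n) \<le> real d * \<mu>"
  shows "measure (sample_space n) {\<omega> \<in> space (sample_space n).
      \<forall>j<d. \<tau> \<le> dist_G n f (sgd_hypothesis n d U f N j (drop_samples (j * L) \<omega>))} \<le> exp (- (real d * (1 - \<mu> / \<tau>)))"
proof -
  interpret S: prob_space "sample_space n" by (rule prob_space_sample_space)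
  let ?e = "\<lambda>j \<omega>. dist_G n f (sgd_hypothesis n d U f N j \<omega>)"
  note [measurable] = dist_sgd_hypothesis_measurable[OF f]
  define E where "E j = {\<omega> \<in> space (sample_space n). \<tau> \<le> ?e j \<omega>}" for j
  have E: "E j \<in> sets (sample_space n)" for j unfolding E_def by measurable
  have dep: "\<omega>' \<in> E j" if "\<omega> \<in> E j" "\<omega>' \<in> space (sample_space n)" "\<And>i. i < L \<Longrightarrow> \<omega> i = \<omega>' i" for j \<omega> \<omega>'
  proof -
    have "sgd_hypothesis n d U f N j \<omega> = sgd_hypothesis n d U f N j \<omega>'"
      by (rule ext, rule sgd_hypothesis_cong) (use that(3) N in auto)
    then show ?thesis using that by (simp add: E_def)
  qed
  have ie: "integrable (sample_space n) (?e j)" for j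
    by (rule S.integrable_const_bound[where B = 1]) (simp_all add: dist_G_nonneg dist_G_le_1)
  have "{\<omega> \<in> space (sample_space n). \<forall>j<d. \<tau> \<le> ?e j (drop_samples (j * L) \<omega>)} =
      {\<omega> \<in> space (sample_space n). \<forall>j<d. drop_samples (j * L) \<omega> \<in> E j}"
    by (auto simp: E_def drop_samples_in_space)
  then have "measure (sample_space n) {\<omega> \<in> space (sample_space n). \<forall>j<d. \<tau> \<le> ?e j (drop_samples (j * L) \<omega>)} =
      (\<Prod>j<d. measure (sample_space n) (E j))"
    using measure_sample_blocks[where L = L and m = d, OF E dep] by simp
  \<comment> \<open>Each Markov bound \<open>z\<close> is relaxed to \<open>exp (z - 1)\<close>, so
    that the product depends only on the sum of the expected errors.\<close>
  also have "\<dots> \<le> (\<Prod>j<d. exp ((\<integral>\<omega>. ?e j \<omega> \<partial>sample_space n) / \<tau> - 1))"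
  proof (intro prod_mono conjI)
    fix j
    have "measure (sample_space n) (E j) \<le> (\<integral>\<omega>. ?e j \<omega> \<partial>sample_space n) / \<tau>"
      unfolding E_def using \<tau> by (intro integral_Markov_inequality_measure[OF ie sets.top]) (simp_all add: dist_G_nonneg)
    also have "\<dots> \<le> exp ((\<integral>\<omega>. ?e j \<omega> \<partial>sample_space n) / \<tau> - 1)"
      using exp_ge_add_one_self[of "(\<integral>\<omega>. ?e j \<omega> \<partial>sample_space n) / \<tau> - 1"] by simp
    finally show "measure (sample_space n) (E j) \<le> exp ((\<integral>\<omega>. ?e j \<omega> \<partial>sample_space n) / \<tau> - 1)" .
  qed simp
  also have "\<dots> = exp ((\<Sum>j<d. \<integral>\<omega>. ?e j \<omega> \<partial>sample_space n) / \<tau> - real d)"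
    by (simp add: exp_sum[symmetric] sum_subtractf sum_divide_distrib)
  also have "\<dots> \<le> exp (- (real d * (1 - \<mu> / \<tau>)))"
    using divide_right_mono[OF avg, of \<tau>] \<tau> by (simp add: algebra_simps)
  finally show ?thesis .
qed

text \<open>The whole space, cut out by no constraint, lies in the class, so the infimum is over a
  nonempty set. It need not be attained; hence the slack \<eta>.\<close>

lemma Conv_near_OPT:
  assumes "0 < \<eta>"
  shows "\<exists>h\<in>Conv n r. dist_G n f h < OPT n r f + \<eta>" "OPT n r f \<le> 1" "0 \<le> OPT n r f"
proof -
  interpret prob_space "gauss n" by (rule prob_space_gauss)
  have "(\<lambda>x. x \<in> Rn n) \<in> Conv n r"
    unfolding Conv_def
  proof (intro CollectI exI conjI)
    show "convex_Rn n (Rn n)" by (auto simp: convex_Rn_def Rn_def)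
    show "geometric_width_le n r (Rn n)"
      unfolding geometric_width_le_def by (rule exI[of _ "{}"]) simp
  qed simp
  then have ne: "Conv n r \<noteq> {}" by auto
  have bdd: "bdd_below (dist_G n f ` Conv n r)"
    by (rule bdd_belowI[of _ 0]) (auto simp: dist_G_nonneg)
  have "\<exists>z\<in>dist_G n f ` Conv n r. z < OPT n r f + \<eta>"
    unfolding OPT_def using ne assms by (intro cInf_lessD) auto
  then show "\<exists>h\<in>Conv n r. dist_G n f h < OPT n r f + \<eta>" by auto
  obtain h where h: "h \<in> Conv n r" using ne by auto
  have "OPT n r f \<le> dist_G n f h" unfolding OPT_def by (rule cINF_lower[OF bdd h])
  also have "\<dots> \<le> 1" by (rule dist_G_le_1)
  finally show "OPT n r f \<le> 1" .
  show "0 \<le> OPT n r f" unfolding OPT_def using ne by (intro cINF_greatest) (auto simp: dist_G_nonneg)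
qed

text \<open>The selection \<open>sel\<close> is abstract: any candidate with the most correct
  predictions will do. The excess \<epsilon> is spent as \<open>\<epsilon> / 2\<close> on the
  expectation, \<open>\<epsilon> / 4\<close> on Markov's inequality and
  \<open>\<epsilon> / 4\<close> on the validation errors of the best and the selected
  candidate.\<close>

lemma learner_success:
  fixes sel :: "(nat \<Rightarrow> vect) \<Rightarrow> nat"
  assumes f: "boolean_function n f" and n: "1 \<le> n" and r: "1 \<le> r" and \<epsilon>: "0 < \<epsilon>" "\<epsilon> < 1 / 2"
    and d: "2 ^ 32 * (r / \<epsilon>) ^ 3 \<le> real d"
    and U: "U = real (n + d) ^ (5 * d)" and N: "N = (n + d) ^ (10 * d)"
    and sel [measurable]: "sel \<in> measurable (sample_space n) (count_space UNIV)"
    and sel_less: "\<And>\<omega>. sel \<omega> < d"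
    and sel_max: "\<And>\<omega> j. j < d \<Longrightarrow> num_correct n d U f N j (drop_samples (j * (2 * N)) \<omega>) \<le>
      num_correct n d U f N (sel \<omega>) (drop_samples (sel \<omega> * (2 * N)) \<omega>)"
  defines "G \<equiv> {\<omega> \<in> space (sample_space n).
    dist_G n f (sgd_hypothesis n d U f N (sel \<omega>) (drop_samples (sel \<omega> * (2 * N)) \<omega>)) \<le> OPT n r f + \<epsilon>}"
  shows "G \<in> sets (sample_space n)" and "9 / 10 \<le> measure (sample_space n) G"
proof -
  interpret S: prob_space "sample_space n" by (rule prob_space_sample_space)
  let ?h = "\<lambda>j \<omega>. sgd_hypothesis n d U f N j (drop_samples (j * (2 * N)) \<omega>)"
  let ?e = "\<lambda>j \<omega>. dist_G n f (?h j \<omega>)"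
  note [measurable] = dist_sgd_hypothesis_measurable[OF f]
  have "G = (\<Union>j<d. {\<omega> \<in> space (sample_space n). sel \<omega> = j \<and> ?e j \<omega> \<le> OPT n r f + \<epsilon>})"
    unfolding G_def using sel_less by auto
  moreover have "\<dots> \<in> sets (sample_space n)"
    by (intro sets.finite_UN) (simp, measurable)
  ultimately show G: "G \<in> sets (sample_space n)" by simp
  have inv: "1 / \<epsilon> \<le> r / \<epsilon>" using r \<epsilon> by (simp add: divide_right_mono)
  have d3: "2 ^ 32 * (1 / \<epsilon>) ^ 3 \<le> real d"
    using order_trans[OF mult_left_mono[OF power_mono[OF inv, of 3]] d] \<epsilon> by simp
  have ie: "2 \<le> 1 / \<epsilon>" using \<epsilon> by (simp add: field_simps)
  have d1: "2 ^ 32 * (1 / \<epsilon>) \<le> real d" "2 ^ 32 * (1 / \<epsilon>)\<^sup>2 \<le> real d"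
  proof -
    have "1 / \<epsilon> \<le> (1 / \<epsilon>) ^ 3" "(1 / \<epsilon>)\<^sup>2 \<le> (1 / \<epsilon>) ^ 3"
      using ie by (auto intro!: self_le_power power_increasing simp del: power_divide)
    moreover have "2 ^ 32 * a \<le> real d" if "a \<le> (1 / \<epsilon>) ^ 3" for a :: real
      using order_trans[OF mult_left_mono[OF that, of "2 ^ 32"] d3] by simp
    ultimately show "2 ^ 32 * (1 / \<epsilon>) \<le> real d" "2 ^ 32 * (1 / \<epsilon>)\<^sup>2 \<le> real d"
      by blast+
  qed
  have dpos: "1 \<le> d"
  proof -
    have "0 < 2 ^ 32 * (1 / \<epsilon>)" using \<epsilon> by simp
    then have "0 < real d" using d1(1) by (rule less_le_trans)
    then show ?thesis by simp
  qed
  have d\<epsilon>: "1 / real d \<le> \<epsilon> / 16"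
  proof -
    have "16 * (1 / \<epsilon>) \<le> 2 ^ 32 * (1 / \<epsilon>)" using \<epsilon> by (intro mult_right_mono) auto
    then have "16 * (1 / \<epsilon>) \<le> real d" using d1(1) by linarith
    then show ?thesis using dpos \<epsilon> by (simp add: field_simps)
  qed
  define Q where "Q = real (n + d)"
  have Q: "2 \<le> Q" "real d \<le> Q" "real (n + 1) \<le> Q" using n dpos by (simp_all add: Q_def)
  have U': "U = Q ^ (5 * d)" and N': "real N = Q ^ (10 * d)" by (simp_all add: U N Q_def)
  have U0: "0 < U" and N0: "0 < N" and NR: "0 < real N" using Q dpos by (simp_all add: U N)
  have Qd: "real d \<le> Q ^ d" using Q dpos order_trans[OF Q(2) self_le_power[of Q d]] by simp
  define B where "B = real (n + 1) ^ d * real d ^ d"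
  define M2 where "M2 = real (n + 1) ^ (d + 1) * real d ^ d"
  have B: "0 \<le> B" "B \<le> Q ^ (2 * d)"
  proof -
    have "B \<le> Q ^ d * Q ^ d" unfolding B_def using Q by (intro mult_mono power_mono) auto
    then show "B \<le> Q ^ (2 * d)" by (simp add: mult_2 power_add)
  qed (simp add: B_def)
  have M2: "0 \<le> M2" "M2 \<le> Q ^ (4 * d)"
  proof -
    have "M2 \<le> Q ^ (d + 1) * Q ^ d" unfolding M2_def using Q by (intro mult_mono power_mono) auto
    also have "\<dots> = Q ^ (2 * d + 1)" by (simp add: power_add mult_2)
    also have "\<dots> \<le> Q ^ (4 * d)" using Q dpos by (intro power_increasing) auto
    finally show "M2 \<le> Q ^ (4 * d)" .
  qed (simp add: M2_def)
  \<comment> \<open>The exponents \<open>5 * d\<close> and \<open>10 * d\<close> balance both regret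
    terms: \<open>B^2 \<le> Q^(4 * d)\<close> stands against \<open>N / U = Q^(5 * d)\<close>, and
    \<open>M2 \<le> Q^(4 * d)\<close> against \<open>U = Q^(5 * d)\<close>, each with a factor
    \<open>Q^d \<ge> d\<close> to spare.\<close>
  have k1: "B\<^sup>2 * U / (2 * real N) \<le> 1 / (2 * real d)"
  proof -
    have "B\<^sup>2 \<le> (Q ^ (2 * d))\<^sup>2" using B by (intro power_mono)
    then have "B\<^sup>2 * U / (2 * real N) \<le> (Q ^ (2 * d))\<^sup>2 * U / (2 * real N)"
      using U0 NR by (intro divide_right_mono mult_right_mono) auto
    also have "\<dots> = 1 / (2 * Q ^ d)"
    proof -
      have "Q ^ (10 * d) = (Q ^ (2 * d))\<^sup>2 * Q ^ (5 * d) * Q ^ d"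
        by (simp add: power_mult[symmetric] power_add[symmetric])
      then show ?thesis using Q unfolding U' N' by simp
    qed
    also have "\<dots> \<le> 1 / (2 * real d)" using Qd dpos by (intro divide_left_mono) auto
    finally show ?thesis .
  qed
  have k2: "M2 / (2 * U) \<le> 1 / (2 * real d)"
  proof -
    have "M2 / (2 * U) \<le> Q ^ (4 * d) / (2 * U)" using M2 U0 by (intro divide_right_mono) auto
    also have "\<dots> = 1 / (2 * Q ^ d)"
    proof -
      have "Q ^ (5 * d) = Q ^ (4 * d) * Q ^ d" by (simp add: power_add[symmetric])
      then show ?thesis using Q unfolding U' by simp
    qed
    also have "\<dots> \<le> 1 / (2 * real d)" using Qd dpos by (intro divide_left_mono) auto
    finally show ?thesis .
  qed
  have "0 < \<epsilon> / 16" using \<epsilon> by simp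
  from Conv_near_OPT[OF this, of n r f] obtain h where h: "h \<in> Conv n r" "dist_G n f h < OPT n r f + \<epsilon> / 16"
    and opt: "0 \<le> OPT n r f" "OPT n r f \<le> 1" by auto
  from polynomial_comparator[OF h(1) r \<epsilon> d f] obtain p where p: "rkhs_le n d B p" "p \<in> borel_measurable (gauss n)"
    "integrable (gauss n) (\<lambda>x. \<bar>p x - of_bool (f x)\<bar>)"
    "(\<integral>x. \<bar>p x - of_bool (f x)\<bar> \<partial>gauss n) \<le> dist_G n f h + \<epsilon> / 4"
    unfolding B_def by blast
  define \<mu> where "\<mu> = OPT n r f + \<epsilon> / 2"
  \<comment> \<open>The gap \<open>\<tau> - \<mu> = \<epsilon> / 4\<close> makes
    \<open>1 - \<mu> / \<tau>\<close> at least \<open>\<epsilon> / 8\<close>; multiplied by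
    \<open>d\<close> this is large enough to make the failure of all candidates unlikely.\<close>
  define \<tau> where "\<tau> = OPT n r f + 3 * \<epsilon> / 4"
  have \<tau>: "0 < \<tau>" "\<tau> \<le> 2" using opt \<epsilon> by (simp_all add: \<tau>_def)
  have "(\<Sum>j<d. \<integral>\<omega>. dist_G n f (sgd_hypothesis n d U f N j \<omega>) \<partial>sample_space n) \<le>
      real d * ((\<integral>x. \<bar>p x - of_bool (f x)\<bar> \<partial>gauss n) + B\<^sup>2 * U / (2 * real N) + M2 / (2 * U)) + 1"
    unfolding M2_def
    by (rule sgd_hypotheses_expected_error[OF f p(1-3) U0 N0 kernel_diagonal_moment[OF dpos]]) simp
  also have "\<dots> = real d * ((\<integral>x. \<bar>p x - of_bool (f x)\<bar> \<partial>gauss n) + B\<^sup>2 * U / (2 * real N) + M2 / (2 * U) + 1 / real d)"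
    using dpos by (simp add: distrib_left)
  also have "\<dots> \<le> real d * \<mu>"
  proof (rule mult_left_mono)
    have "1 / (2 * real d) = 1 / real d / 2" by simp
    then show "(\<integral>x. \<bar>p x - of_bool (f x)\<bar> \<partial>gauss n) + B\<^sup>2 * U / (2 * real N) + M2 / (2 * U) + 1 / real d \<le> \<mu>"
      using k1 k2 p(4) h(2) d\<epsilon> \<epsilon> unfolding \<mu>_def by linarith
  qed simp
  finally have avg: "(\<Sum>j<d. \<integral>\<omega>. dist_G n f (sgd_hypothesis n d U f N j \<omega>) \<partial>sample_space n) \<le> real d * \<mu>" .
  define F where "F = {\<omega> \<in> space (sample_space n). \<forall>j<d. \<tau> \<le> ?e j \<omega>}"
  have F_sets: "F \<in> sets (sample_space n)" unfolding F_def by measurable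
  have F: "measure (sample_space n) F \<le> 1 / 20"
  proof -
    have "measure (sample_space n) F \<le> exp (- (real d * (1 - \<mu> / \<tau>)))"
      unfolding F_def by (rule all_candidates_fail[OF f _ \<tau>(1) avg]) simp
    also have "\<dots> \<le> exp (- 20)"
    proof -
      have "\<epsilon> / 8 \<le> \<epsilon> / 4 / \<tau>" using \<tau> \<epsilon> by (simp add: field_simps)
      also have "\<dots> = 1 - \<mu> / \<tau>" using \<tau> by (simp add: \<mu>_def \<tau>_def field_simps)
      finally have "real d * (\<epsilon> / 8) \<le> real d * (1 - \<mu> / \<tau>)" by (intro mult_left_mono) auto
      moreover have "2 ^ 32 \<le> real d * \<epsilon>" using d1(1) \<epsilon> by (simp add: field_simps)
      moreover have "20 \<le> z" if "real d * (\<epsilon> / 8) \<le> z" "2 ^ 32 \<le> real d * \<epsilon>" for z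
        using that by simp
      ultimately have "20 \<le> real d * (1 - \<mu> / \<tau>)" by blast
      then show ?thesis by (simp only: exp_le_cancel_iff neg_le_iff_le)
    qed
    also have "exp (- 20 :: real) \<le> 1 / 20"
    proof -
      have "20 \<le> exp (20 :: real)" using exp_ge_add_one_self[of "20 :: real"] by linarith
      then show ?thesis by (simp add: exp_minus field_simps)
    qed
    finally show ?thesis .
  qed
  define Bad where "Bad j = {X \<in> space (sample_space n). \<epsilon> / 8 * real N \<le>
    \<bar>real (num_correct n d U f N j X) - real N * (1 - dist_G n f (sgd_hypothesis n d U f N j X))\<bar>}" for j
  have "0 < \<epsilon> / 8" using \<epsilon> by simp
  note Bad = validation_error[where d = d and U = U, OF f this N0, folded Bad_def]
  define V where "V j = {\<omega> \<in> space (sample_space n). drop_samples (j * (2 * N)) \<omega> \<in> Bad j}" for j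
  have V_sets [measurable]: "V j \<in> sets (sample_space n)" for j
    unfolding V_def using Bad(1)[of j] by measurable
  have V: "measure (sample_space n) (\<Union>j<d. V j) \<le> 1 / 20"
  proof -
    have "measure (sample_space n) (\<Union>j<d. V j) \<le> (\<Sum>j<d. measure (sample_space n) (V j))"
      by (rule S.finite_measure_subadditive_finite) auto
    also have "\<dots> \<le> (\<Sum>j<d. 1 / (real N * (\<epsilon> / 8)\<^sup>2))"
      unfolding V_def by (rule sum_mono) (simp only: measure_drop_samples[OF Bad(1)] Bad(2))
    also have "\<dots> = real d * (64 * (1 / \<epsilon>)\<^sup>2) / real N"
      by (simp add: power_divide)
    also have "\<dots> \<le> 1 / 20"
    proof -
      have "real d * (1280 * (1 / \<epsilon>)\<^sup>2) \<le> real d * real d"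
        using d1(2) by (intro mult_left_mono) auto
      also have "\<dots> \<le> Q ^ 2" using Q(2) by (simp add: power2_eq_square mult_mono)
      also have "\<dots> \<le> real N" unfolding N' using Q dpos by (intro power_increasing) auto
      finally show ?thesis using NR by (simp add: divide_le_eq)
    qed
    finally show ?thesis .
  qed
  have sub: "space (sample_space n) - (F \<union> (\<Union>j<d. V j)) \<subseteq> G"
  proof
    fix \<omega> assume \<omega>: "\<omega> \<in> space (sample_space n) - (F \<union> (\<Union>j<d. V j))"
    then obtain j where j: "j < d" "?e j \<omega> < \<tau>" by (auto simp: F_def not_le)
    let ?c = "\<lambda>j. real (num_correct n d U f N j (drop_samples (j * (2 * N)) \<omega>))"
    have close: "\<bar>?c i - real N * (1 - ?e i \<omega>)\<bar> < \<epsilon> / 8 * real N" if "i < d" for i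
      using \<omega> that by (auto simp: V_def Bad_def drop_samples_in_space not_le)
    have "?c j \<le> ?c (sel \<omega>)" using sel_max[OF j(1), of \<omega>] by simp
    then have "real N * (1 - ?e j \<omega>) - \<epsilon> / 8 * real N \<le> real N * (1 - ?e (sel \<omega>) \<omega>) + \<epsilon> / 8 * real N"
      using close[OF j(1)] close[OF sel_less[of \<omega>]] by linarith
    then have "real N * ?e (sel \<omega>) \<omega> \<le> real N * (?e j \<omega> + \<epsilon> / 4)"
      by (simp add: algebra_simps)
    then have "?e (sel \<omega>) \<omega> \<le> ?e j \<omega> + \<epsilon> / 4" using NR by simp
    then show "\<omega> \<in> G" using j(2) \<omega> by (simp add: G_def \<tau>_def)
  qed
  have FV: "F \<union> (\<Union>j<d. V j) \<in> sets (sample_space n)" using F_sets by measurable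
  have "measure (sample_space n) (F \<union> (\<Union>j<d. V j)) \<le> 1 / 10"
  proof -
    have "(\<Union>j<d. V j) \<in> sets (sample_space n)" by measurable
    then show ?thesis using measure_Un_le[OF F_sets, of "\<Union>j<d. V j"] F V by simp
  qed
  then have "9 / 10 \<le> measure (sample_space n) (space (sample_space n) - (F \<union> (\<Union>j<d. V j)))"
    using S.prob_compl[OF FV] by simp
  also have "\<dots> \<le> measure (sample_space n) G"
    by (rule S.finite_measure_mono[OF sub G])
  finally show "9 / 10 \<le> measure (sample_space n) G" .
qed


section \<open>Programs\<close>

text \<open>A judgement of total correctness in which an upper bound takes the place of the exact
  time of \<open>exec\<close>, so that different branches and iterations can share one
  bound.\<close>

definition runs :: "nat \<Rightarrow> (nat \<Rightarrow> vect \<times> bool) \<Rightarrow> cmd \<Rightarrow> store \<Rightarrow> nat \<Rightarrow> (store \<Rightarrow> bool) \<Rightarrow> bool" where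
  "runs n S c s b Q \<longleftrightarrow> (\<exists>t s'. exec n S c s t s' \<and> t \<le> b \<and> Q s')"

lemma runs_mono: "runs n S c s b Q \<Longrightarrow> b \<le> b' \<Longrightarrow> (\<And>s'. Q s' \<Longrightarrow> Q' s') \<Longrightarrow> runs n S c s b' Q'"
  unfolding runs_def by (meson order_trans)

lemma runs_Skip: "Q s \<Longrightarrow> runs n S Skip s 1 Q"
  unfolding runs_def using exec.Skip by blast

lemma runs_NStore:
  "Q (s\<lparr>nmem := (nmem s)(nval s a := nval s e)\<rparr>) \<Longrightarrow> runs n S (NStore a e) s (1 + ncost a + ncost e) Q"
  unfolding runs_def using exec.NStore by blast

lemma runs_RStore:
  "Q (s\<lparr>rmem := (rmem s)(nval s a := rval s e)\<rparr>) \<Longrightarrow> runs n S (RStore a e) s (1 + ncost a + rcost e) Q"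
  unfolding runs_def using exec.RStore by blast

lemma runs_Draw:
  "Q (s\<lparr>rmem := put_example n (nval s a) (S (drawn s)) (rmem s), drawn := drawn s + 1\<rparr>) \<Longrightarrow>
    runs n S (Draw a) s (1 + ncost a + (n + 1)) Q"
  unfolding runs_def using exec.Draw by blast

lemma runs_Seq: "runs n S c s b1 (\<lambda>s'. runs n S d s' b2 Q) \<Longrightarrow> runs n S (Seq c d) s (b1 + b2) Q"
  unfolding runs_def by (meson exec.Seq add_mono)

lemma runs_Seq':
  assumes "runs n S c s b1 R" "\<And>s'. R s' \<Longrightarrow> runs n S d s' b2 Q"
  shows "runs n S (Seq c d) s (b1 + b2) Q"
  by (rule runs_Seq, rule runs_mono[OF assms(1) order_refl assms(2)])

lemma runs_Ite:
  "(bval s b \<Longrightarrow> runs n S c s k1 Q) \<Longrightarrow> (\<not> bval s b \<Longrightarrow> runs n S d s k2 Q) \<Longrightarrow>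
    runs n S (Ite b c d) s (1 + bcost b + (k1 + k2)) Q"
proof (cases "bval s b")
  case True
  assume "bval s b \<Longrightarrow> runs n S c s k1 Q"
  then obtain t s' where "exec n S c s t s'" "t \<le> k1" "Q s'" using True unfolding runs_def by blast
  then show ?thesis
    unfolding runs_def using True by (intro exI[of _ "1 + bcost b + t"] exI[of _ s']) (use exec.IteTrue[OF True, of n S c t s' d] in simp)
next
  case False
  assume "\<not> bval s b \<Longrightarrow> runs n S d s k2 Q"
  then obtain t s' where "exec n S d s t s'" "t \<le> k2" "Q s'" using False unfolding runs_def by blast
  then show ?thesis
    unfolding runs_def using False by (intro exI[of _ "1 + bcost b + t"] exI[of _ s']) (use exec.IteFalse[OF False, of n S d t s' c] in simp)
qed

text \<open>The number of iterations is fixed in advance and indexes the invariant, so termination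
  and the time bound come from one induction on \<open>m - i\<close>.\<close>

lemma runs_While:
  assumes init: "I 0 s"
    and step: "\<And>i s. i < m \<Longrightarrow> I i s \<Longrightarrow> bval s b \<and> runs n S c s k (I (Suc i))"
    and stop: "\<And>s. I m s \<Longrightarrow> \<not> bval s b"
  shows "runs n S (While b c) s (m * (1 + bcost b + k) + 1 + bcost b) (I m)"
proof -
  have "runs n S (While b c) s ((m - i) * (1 + bcost b + k) + 1 + bcost b) (I m)" if "i \<le> m" "I i s" for i s
    using that
  proof (induction "m - i" arbitrary: i s)
    case 0
    then have "i = m" by simp
    then show ?case
      using 0 stop[of s] unfolding runs_def by (auto intro!: exI[of _ s] exI[of _ "1 + bcost b"] exec.WhileFalse)
  next
    case (Suc l)
    then have i: "i < m" "l = m - Suc i" by simp_all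
    from step[OF i(1) Suc.prems(2)] obtain t s1 where b: "bval s b" and
      1: "exec n S c s t s1" "t \<le> k" "I (Suc i) s1" unfolding runs_def by blast
    from Suc.hyps(1)[OF i(2) _ 1(3)] i obtain t' s2 where
      2: "exec n S (While b c) s1 t' s2" "t' \<le> (m - Suc i) * (1 + bcost b + k) + 1 + bcost b" "I m s2"
      unfolding runs_def by auto
    have "m - i = Suc (m - Suc i)" using i by simp
    then have "1 + bcost b + t + t' \<le> (m - i) * (1 + bcost b + k) + 1 + bcost b"
      using 1(2) 2(2) by simp
    then show ?case
      unfolding runs_def using exec.WhileTrue[OF b 1(1) 2(1)] 2(3) by blast
  qed
  from this[of 0 s] init show ?thesis by simp
qed

section \<open>Evaluating a kernel sum\<close>

abbreviation "nreg k \<equiv> NLoad (NConst k)"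
abbreviation "nset k e \<equiv> NStore (NConst k) e"
abbreviation "ninc k \<equiv> NStore (NConst k) (NAdd (NLoad (NConst k)) (NConst 1))"
text \<open>Real registers are addressed relative to the dimension, because prediction loads the
  query into the real cells below \<open>n\<close>.\<close>

abbreviation "rreg k \<equiv> RLoad (NAdd (NLoad (NConst 0)) (NConst k))"
abbreviation "rset k e \<equiv> RStore (NAdd (NLoad (NConst 0)) (NConst k)) e"

text \<open>Natural cells: 0 dimension, 1 degree and number of runs, 2 base address of the data of the
  current run, 3 address of the query point, 4--6 scratch, 7 number of stored samples, 8 current run,
  9 first free real cell, 10 validation counter, 11 base address of the best run so far,
  13 number of correct predictions, 14 the same for the best run, 15 best run.
  Real cells: \<open>n + 2\<close> the kernel sum, \<open>n + 3\<close> and \<open>n + 4\<close> scratch, \<open>n + 5\<close> the inverse step size.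
  A stored sample occupies \<open>n + 1\<close> cells, the last of which holds its coefficient.\<close>

definition dot_loop :: cmd where
  "dot_loop = While (NLess (nreg 5) (nreg 0))
     (Seq (rset 3 (RAdd (rreg 3) (RMul (RLoad (NAdd (nreg 6) (nreg 5))) (RLoad (NAdd (nreg 3) (nreg 5))))))
       (ninc 5))"

definition pow_loop :: cmd where
  "pow_loop = While (NLess (nreg 5) (nreg 1)) (Seq (rset 4 (RMul (rreg 4) (rreg 3))) (ninc 5))"

definition eval_prog :: cmd where
  "eval_prog =
     Seq (rset 2 (RConst 0)) (Seq (nset 4 (NConst 0)) (Seq (nset 6 (nreg 2))
       (While (NLess (nreg 4) (nreg 7))
         (Seq (rset 3 (RConst 1)) (Seq (nset 5 (NConst 0)) (Seq dot_loop
           (Seq (rset 4 (RLoad (NAdd (nreg 6) (nreg 0)))) (Seq (nset 5 (NConst 0)) (Seq pow_loop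
             (Seq (rset 2 (RAdd (rreg 2) (rreg 4)))
               (Seq (nset 6 (NAdd (NAdd (nreg 6) (nreg 0)) (NConst 1))) (ninc 4))))))))))))"

text \<open>Cell \<open>n + 5\<close> is deliberately absent from the exceptions: the inverse step
  size must survive an evaluation.\<close>

definition scratch_frame :: "nat \<Rightarrow> store \<Rightarrow> store \<Rightarrow> bool" where
  "scratch_frame n s s' \<longleftrightarrow> (\<forall>a. a \<noteq> 4 \<and> a \<noteq> 5 \<and> a \<noteq> 6 \<longrightarrow> nmem s' a = nmem s a) \<and>
     (\<forall>a. a \<noteq> n + 2 \<and> a \<noteq> n + 3 \<and> a \<noteq> n + 4 \<longrightarrow> rmem s' a = rmem s a) \<and> drawn s' = drawn s"

text \<open>The condition on \<open>q\<close> keeps the query off the scratch cells: it lies at the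
  bottom of the memory during prediction and in the data area during training. Each stored sample
  costs one dot product and one power, hence the product in the time bound.\<close>

lemma eval_prog_runs:
  assumes s: "nmem s 0 = n" "nmem s 1 = d" "nmem s 2 = p" "nmem s 3 = q" "nmem s 7 = m"
    and p: "n + 6 \<le> p" and q: "q + n \<le> n + 2 \<or> n + 6 \<le> q"
  shows "runs n S eval_prog s (300 * (n + d + 1) * (m + 1)) (\<lambda>s'. scratch_frame n s s' \<and>
    rmem s' (n + 2) = (\<Sum>t<m. rmem s (p + t * (n + 1) + n) *
      (1 + (\<Sum>k<n. rmem s (p + t * (n + 1) + k) * rmem s (q + k))) ^ d))"
proof -
  let ?x = "\<lambda>t k. rmem s (p + t * (n + 1) + k)"
  let ?y = "\<lambda>k. rmem s (q + k)"
  define V where "V i = (\<Sum>t<i. ?x t n * (1 + (\<Sum>k<n. ?x t k * ?y k)) ^ d)" for i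
  \<comment> \<open>Three nested invariants: \<open>I\<close> between samples, \<open>J\<close>
    inside the dot product, \<open>H\<close> inside the power. The accumulator of \<open>H\<close>
    starts at the coefficient, so the power comes out already multiplied by it.\<close>
  define I where "I i s' \<longleftrightarrow> scratch_frame n s s' \<and> nmem s' 4 = i \<and> nmem s' 6 = p + i * (n + 1) \<and>
    rmem s' (n + 2) = V i" for i s'
  define J where "J i k s' \<longleftrightarrow> I i s' \<and> nmem s' 5 = k \<and> rmem s' (n + 3) = 1 + (\<Sum>l<k. ?x i l * ?y l)" for i k s'
  define H where "H i k s' \<longleftrightarrow> I i s' \<and> nmem s' 5 = k \<and> rmem s' (n + 3) = 1 + (\<Sum>l<n. ?x i l * ?y l) \<and>
    rmem s' (n + 4) = ?x i n * (1 + (\<Sum>l<n. ?x i l * ?y l)) ^ k" for i k s'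
  have regs: "nmem s' 0 = n" "nmem s' 1 = d" "nmem s' 2 = p" "nmem s' 3 = q" "nmem s' 7 = m"
    if "scratch_frame n s s'" for s'
    using that s by (auto simp: scratch_frame_def)
  have cells: "rmem s' (p + i * (n + 1) + k) = ?x i k" "k < n \<Longrightarrow> rmem s' (q + k) = ?y k"
    if "scratch_frame n s s'" for s' i k
  proof -
    have "p + i * (n + 1) + k \<noteq> n + 2" "p + i * (n + 1) + k \<noteq> n + 3" "p + i * (n + 1) + k \<noteq> n + 4"
      using p by linarith+
    then show "rmem s' (p + i * (n + 1) + k) = ?x i k" using that by (simp add: scratch_frame_def)
    assume "k < n"
    then have "q + k \<noteq> n + 2" "q + k \<noteq> n + 3" "q + k \<noteq> n + 4" using q by linarith+
    then show "rmem s' (q + k) = ?y k" using that by (simp add: scratch_frame_def)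
  qed
  have dot: "runs n S dot_loop s' (n * 40 + 10) (J i n)" if "J i 0 s'" for i s'
    unfolding dot_loop_def
  proof (rule runs_mono[OF runs_While[where I = "J i" and m = n and k = 30]])
    show "J i 0 s'" by fact
    fix k s'
    assume k: "k < n" and J: "J i k s'"
    then have fr: "scratch_frame n s s'" by (simp add: J_def I_def)
    note r = regs[OF fr] cells(1)[OF fr, of i k] cells(2)[OF fr k]
    have c6: "nmem s' 6 = p + i * (n + 1)" using J by (simp add: J_def I_def)
    have "runs n S (Seq (rset 3 (RAdd (rreg 3) (RMul (RLoad (NAdd (nreg 6) (nreg 5))) (RLoad (NAdd (nreg 3) (nreg 5))))))
       (ninc 5)) s' 30 (J i (Suc k))"
      by (rule runs_mono[OF runs_Seq[OF runs_RStore[OF runs_NStore]]])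
        (use J r c6 in \<open>auto simp: J_def I_def scratch_frame_def\<close>)
    moreover have "bval s' (NLess (nreg 5) (nreg 0))" using J k r by (simp add: J_def)
    ultimately show "bval s' (NLess (nreg 5) (nreg 0)) \<and> runs n S (Seq (rset 3 (RAdd (rreg 3) (RMul (RLoad (NAdd (nreg 6) (nreg 5))) (RLoad (NAdd (nreg 3) (nreg 5))))))
       (ninc 5)) s' 30 (J i (Suc k))" by simp
  next
    fix s' assume "J i n s'"
    then show "\<not> bval s' (NLess (nreg 5) (nreg 0))" using regs[of s'] by (simp add: J_def I_def)
  qed auto
  have pow: "runs n S pow_loop s' (d * 40 + 10) (H i d)" if "H i 0 s'" for i s'
    unfolding pow_loop_def
  proof (rule runs_mono[OF runs_While[where I = "H i" and m = d and k = 30]])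
    show "H i 0 s'" by fact
    fix k s'
    assume k: "k < d" and H: "H i k s'"
    then have fr: "scratch_frame n s s'" by (simp add: H_def I_def)
    note r = regs[OF fr]
    have "runs n S (Seq (rset 4 (RMul (rreg 4) (rreg 3))) (ninc 5)) s' 30 (H i (Suc k))"
      by (rule runs_mono[OF runs_Seq[OF runs_RStore[OF runs_NStore]]])
        (use H r in \<open>auto simp: H_def I_def scratch_frame_def\<close>)
    moreover have "bval s' (NLess (nreg 5) (nreg 1))" using H k r by (simp add: H_def)
    ultimately show "bval s' (NLess (nreg 5) (nreg 1)) \<and> runs n S (Seq (rset 4 (RMul (rreg 4) (rreg 3))) (ninc 5)) s' 30 (H i (Suc k))"
      by simp
  next
    fix s' assume "H i d s'"
    then show "\<not> bval s' (NLess (nreg 5) (nreg 1))" using regs[of s'] by (simp add: H_def I_def)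
  qed auto
  let ?body = "Seq (rset 3 (RConst 1)) (Seq (nset 5 (NConst 0)) (Seq dot_loop
           (Seq (rset 4 (RLoad (NAdd (nreg 6) (nreg 0)))) (Seq (nset 5 (NConst 0)) (Seq pow_loop
             (Seq (rset 2 (RAdd (rreg 2) (rreg 4)))
               (Seq (nset 6 (NAdd (NAdd (nreg 6) (nreg 0)) (NConst 1))) (ninc 4))))))))"
  have body: "runs n S ?body s' (40 * (n + d) + 120) (I (Suc i))" if I: "I i s'" for i s'
  proof -
    have fr: "scratch_frame n s s'" using I by (simp add: I_def)
    have post: "runs n S (Seq (rset 2 (RAdd (rreg 2) (rreg 4)))
               (Seq (nset 6 (NAdd (NAdd (nreg 6) (nreg 0)) (NConst 1))) (ninc 4))) s' 40 (I (Suc i))"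
      if H: "H i d s'" for s'
    proof -
      have fr: "scratch_frame n s s'" using H by (simp add: H_def I_def)
      show ?thesis
        by (rule runs_mono[OF runs_Seq[OF runs_RStore[OF runs_Seq[OF runs_NStore[OF runs_NStore]]]]])
          (use H regs[OF fr] in \<open>auto simp: H_def I_def scratch_frame_def V_def\<close>)
    qed
    note pow_post = runs_Seq'[OF pow post]
    have mid: "runs n S (Seq (rset 4 (RLoad (NAdd (nreg 6) (nreg 0)))) (Seq (nset 5 (NConst 0)) (Seq pow_loop
             (Seq (rset 2 (RAdd (rreg 2) (rreg 4)))
               (Seq (nset 6 (NAdd (NAdd (nreg 6) (nreg 0)) (NConst 1))) (ninc 4)))))) s' (d * 40 + 70) (I (Suc i))"
      if J: "J i n s'" for s'
    proof -
      have fr: "scratch_frame n s s'" using J by (simp add: J_def I_def)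
      note r = regs[OF fr] cells(1)[OF fr, of i n]
      have c6: "nmem s' 6 = p + i * (n + 1)" using J by (simp add: J_def I_def)
      show ?thesis
        by (rule runs_mono[OF runs_Seq[OF runs_RStore[OF runs_Seq[OF runs_NStore[OF pow_post]]]]])
          (use J r c6 in \<open>auto simp: J_def H_def I_def scratch_frame_def\<close>)
    qed
    note dot_mid = runs_Seq'[OF dot mid]
    show ?thesis
      by (rule runs_mono[OF runs_Seq[OF runs_RStore[OF runs_Seq[OF runs_NStore[OF dot_mid]]]]])
        (use I regs[OF fr] in \<open>auto simp: J_def I_def scratch_frame_def\<close>)
  qed
  have loop: "runs n S (While (NLess (nreg 4) (nreg 7)) ?body) s' (m * (40 * (n + d) + 130) + 10) (I m)" if "I 0 s'" for s'
  proof (rule runs_mono[OF runs_While[where I = I and m = m and k = "40 * (n + d) + 120"]])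
    show "I 0 s'" by fact
    show "bval s' (NLess (nreg 4) (nreg 7)) \<and> runs n S ?body s' (40 * (n + d) + 120) (I (Suc i))"
      if "i < m" "I i s'" for i s'
      using that body[of i s'] regs[of s'] by (simp add: I_def)
    show "\<not> bval s' (NLess (nreg 4) (nreg 7))" if "I m s'" for s'
      using that regs[of s'] by (simp add: I_def)
  qed (auto simp: algebra_simps)
  have "runs n S eval_prog s (m * (40 * (n + d) + 130) + 50) (I m)"
    unfolding eval_prog_def
    by (rule runs_mono[OF runs_Seq[OF runs_RStore[OF runs_Seq[OF runs_NStore[OF runs_Seq[OF runs_NStore[OF loop]]]]]]])
      (use s in \<open>auto simp: I_def V_def scratch_frame_def\<close>)
  then show ?thesis
    by (rule runs_mono) (auto simp: I_def V_def algebra_simps)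
qed

definition stored :: "nat \<Rightarrow> nat \<Rightarrow> nat \<Rightarrow> (nat \<Rightarrow> vect) \<Rightarrow> (nat \<Rightarrow> real) \<Rightarrow> (nat \<Rightarrow> real) \<Rightarrow> bool" where
  "stored n p m X c rm \<longleftrightarrow>
     (\<forall>t<m. (\<forall>k<n. rm (p + t * (n + 1) + k) = X t k) \<and> rm (p + t * (n + 1) + n) = c t)"

lemma block_address_less:
  fixes n :: nat
  assumes "t < m" "k \<le> n" shows "t * (n + 1) + k < m * (n + 1)"
proof -
  have "t * (n + 1) + k < (t + 1) * (n + 1)" using assms(2) by simp
  also have "\<dots> \<le> m * (n + 1)" using assms(1) by (intro mult_right_mono) auto
  finally show ?thesis .
qed

lemma stored_cong:
  assumes "stored n p m X c rm"
    and rm: "\<And>a. p \<le> a \<Longrightarrow> a < p + m * (n + 1) \<Longrightarrow> rm' a = rm a"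
  shows "stored n p m X c rm'"
  unfolding stored_def
proof (intro allI impI conjI)
  fix t k assume t: "t < m" and k: "k < n"
  have "rm' (p + t * (n + 1) + k) = rm (p + t * (n + 1) + k)"
    using block_address_less[OF t, of k n] k by (intro rm) auto
  then show "rm' (p + t * (n + 1) + k) = X t k" using assms(1) t k by (simp add: stored_def)
next
  fix t assume t: "t < m"
  have "rm' (p + t * (n + 1) + n) = rm (p + t * (n + 1) + n)"
    using block_address_less[OF t, of n n] by (intro rm) auto
  then show "rm' (p + t * (n + 1) + n) = c t" using assms(1) t by (simp add: stored_def)
qed

lemma eval_prog_kernel_sum:
  assumes s: "nmem s 0 = n" "nmem s 1 = d" "nmem s 2 = p" "nmem s 3 = q" "nmem s 7 = m"
    and p: "n + 6 \<le> p" and q: "q + n \<le> n + 2 \<or> n + 6 \<le> q"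
    and st: "stored n p m X c (rmem s)" and x: "\<And>k. k < n \<Longrightarrow> rmem s (q + k) = x k"
  shows "runs n S eval_prog s (300 * (n + d + 1) * (m + 1)) (\<lambda>s'. scratch_frame n s s' \<and>
    rmem s' (n + 2) = kernel_sum n d m c X x)"
proof -
  have "(\<Sum>t<m. rmem s (p + t * (n + 1) + n) *
      (1 + (\<Sum>k<n. rmem s (p + t * (n + 1) + k) * rmem s (q + k))) ^ d) = kernel_sum n d m c X x"
    unfolding kernel_sum_def poly_kernel_def dotp_def
    using st x unfolding stored_def by (intro sum.cong refl arg_cong2[where f = "(*)"] arg_cong2[where f = "(^)"] arg_cong2[where f = "(+)"]) auto
  then show ?thesis using eval_prog_runs[OF s p q, of S] by simp
qed

section \<open>One run: training, averaging, validation\<close>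

definition draw_eval :: cmd where
  "draw_eval = Seq (Draw (nreg 9)) (Seq (nset 3 (nreg 9)) eval_prog)"

text \<open>All real cells from \<open>n + 5\<close> up to \<open>a\<close> are preserved, which
  covers the step size, the earlier runs and the samples stored so far. The label arrives in cell
  \<open>a + n\<close>, the slot reserved for a coefficient.\<close>

lemma draw_eval_runs:
  assumes s: "nmem s 0 = n" "nmem s 1 = d" "nmem s 2 = p" "nmem s 7 = m" "nmem s 9 = a"
    and p: "n + 6 \<le> p" and a: "p + m * (n + 1) \<le> a" and st: "stored n p m X c (rmem s)"
  shows "runs n S draw_eval s (310 * (n + d + 1) * (m + 1)) (\<lambda>s'.
    (\<forall>b. b \<notin> {3, 4, 5, 6} \<longrightarrow> nmem s' b = nmem s b) \<and>
    (\<forall>b. n + 5 \<le> b \<and> b < a \<longrightarrow> rmem s' b = rmem s b) \<and> drawn s' = drawn s + 1 \<and>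
    rmem s' (n + 2) = kernel_sum n d m c X (fst (S (drawn s))) \<and>
    (\<forall>k<n. rmem s' (a + k) = fst (S (drawn s)) k) \<and> rmem s' (a + n) = of_bool (snd (S (drawn s))))"
    (is "runs n S _ s _ ?Q")
proof -
  define e where "e = S (drawn s)"
  define s2 where "s2 = s\<lparr>rmem := put_example n a e (rmem s), drawn := drawn s + 1, nmem := (nmem s)(3 := a)\<rparr>"
  have below: "rmem s2 b = rmem s b" if "b < a" for b
    using that by (simp add: s2_def put_example_def)
  have st2: "stored n p m X c (rmem s2)"
    by (rule stored_cong[OF st]) (use a below in auto)
  have x2: "rmem s2 (a + k) = fst e k" if "k < n" for k
    using that by (simp add: s2_def put_example_def)
  have y2: "rmem s2 (a + n) = of_bool (snd e)"
    by (simp add: s2_def put_example_def)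
  have regs2: "nmem s2 0 = n" "nmem s2 1 = d" "nmem s2 2 = p" "nmem s2 3 = a" "nmem s2 7 = m"
    using s by (simp_all add: s2_def)
  have "n + 6 \<le> a" using p a by simp
  then have ev: "runs n S eval_prog s2 (300 * (n + d + 1) * (m + 1)) (\<lambda>s'. scratch_frame n s2 s' \<and>
    rmem s' (n + 2) = kernel_sum n d m c X (fst e))"
    using x2 by (intro eval_prog_kernel_sum[OF regs2 p _ st2]) auto
  have ev': "runs n S eval_prog s2 (300 * (n + d + 1) * (m + 1)) ?Q"
  proof (rule runs_mono[OF ev order_refl])
    fix s' assume *: "scratch_frame n s2 s' \<and> rmem s' (n + 2) = kernel_sum n d m c X (fst e)"
    have na: "a + k \<noteq> n + 2" "a + k \<noteq> n + 3" "a + k \<noteq> n + 4" for k using \<open>n + 6 \<le> a\<close> by linarith+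
    have "rmem s' (a + k) = rmem s2 (a + k)" for k
      using * na by (simp add: scratch_frame_def)
    moreover have "rmem s' b = rmem s b" if "n + 5 \<le> b" "b < a" for b
      using * that below[of b] by (simp add: scratch_frame_def)
    ultimately show "?Q s'"
      using * x2 y2 by (auto simp: scratch_frame_def s2_def e_def[symmetric])
  qed
  have s2: "s\<lparr>rmem := put_example n (nval s (nreg 9)) (S (drawn s)) (rmem s), drawn := drawn s + 1\<rparr>
      \<lparr>nmem := (nmem s)(3 := a)\<rparr> = s2"
    using s by (simp add: s2_def e_def)
  show ?thesis
    unfolding draw_eval_def
  proof (rule runs_mono[OF runs_Seq[OF runs_Draw[OF runs_Seq[OF runs_NStore]]]])
    show "runs n S eval_prog
        (s\<lparr>rmem := put_example n (nval s (nreg 9)) (S (drawn s)) (rmem s), drawn := drawn s + 1\<rparr>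
         \<lparr>nmem := (nmem (s\<lparr>rmem := put_example n (nval s (nreg 9)) (S (drawn s)) (rmem s), drawn := drawn s + 1\<rparr>))
           (nval (s\<lparr>rmem := put_example n (nval s (nreg 9)) (S (drawn s)) (rmem s), drawn := drawn s + 1\<rparr>) (NConst 3) :=
            nval (s\<lparr>rmem := put_example n (nval s (nreg 9)) (S (drawn s)) (rmem s), drawn := drawn s + 1\<rparr>) (nreg 9))\<rparr>)
        (300 * (n + d + 1) * (m + 1)) ?Q"
      using ev' s by (simp add: s2_def e_def)
  qed (auto simp: algebra_simps)
qed

text \<open>The comparison reads the label from the slot of the coefficient, which then overwrites
  it.\<close>

definition train_body :: cmd where
  "train_body = Seq draw_eval
     (Seq (Ite (RLess (rreg 2) (RLoad (NAdd (nreg 9) (nreg 0))))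
            (RStore (NAdd (nreg 9) (nreg 0)) (RDiv (RConst 1) (rreg 5)))
            (RStore (NAdd (nreg 9) (nreg 0)) (RSub (RConst 0) (RDiv (RConst 1) (rreg 5)))))
     (Seq (nset 9 (NAdd (NAdd (nreg 9) (nreg 0)) (NConst 1))) (ninc 7)))"

text \<open>The number of samples is never computed as a natural number: the counter, read as a
  real, is compared with the square of the inverse step size, and its final value is
  \<open>N\<close>.\<close>

definition train_loop :: cmd where
  "train_loop = While (RLess (RNat (nreg 7)) (RMul (rreg 5) (rreg 5))) train_body"

definition average_loop :: cmd where
  "average_loop = Seq (nset 4 (NConst 0)) (Seq (nset 6 (nreg 2)) (While (NLess (nreg 4) (nreg 7))
     (Seq (RStore (NAdd (nreg 6) (nreg 0))
            (RDiv (RMul (RLoad (NAdd (nreg 6) (nreg 0))) (RNat (NSub (NSub (nreg 7) (nreg 4)) (NConst 1)))) (RNat (nreg 7))))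
     (Seq (nset 6 (NAdd (NAdd (nreg 6) (nreg 0)) (NConst 1))) (ninc 4)))))"

definition below_threshold :: bexp where
  "below_threshold = RLess (RMul (rreg 2) (RNat (nreg 1))) (RNat (nreg 8))"

text \<open>Equality of two truth values, written by excluding both ways of disagreeing, since only
  negation and conjunction are at hand.\<close>

definition correct_test :: bexp where
  "correct_test = (let y = RLess (RConst 0) (RLoad (NAdd (nreg 9) (nreg 0))) in
     BAnd (BNot (BAnd below_threshold y)) (BNot (BAnd (BNot below_threshold) (BNot y))))"

definition validate_loop :: cmd where
  "validate_loop = Seq (nset 10 (NConst 0)) (Seq (nset 13 (NConst 0)) (While (NLess (nreg 10) (nreg 7))
     (Seq draw_eval (Seq (Ite correct_test (ninc 13) Skip) (ninc 10)))))"

definition run_prog :: cmd where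
  "run_prog = Seq (nset 2 (nreg 9)) (Seq (nset 7 (NConst 0)) (Seq train_loop (Seq average_loop (Seq validate_loop
     (Seq (Ite (NLess (nreg 13) (nreg 14)) Skip
             (Seq (nset 14 (nreg 13)) (Seq (nset 11 (nreg 2)) (nset 15 (nreg 8)))))
       (ninc 8))))))"

definition average_coeffs :: "nat \<Rightarrow> nat \<Rightarrow> real \<Rightarrow> (vect \<Rightarrow> bool) \<Rightarrow> nat \<Rightarrow> (nat \<Rightarrow> vect) \<Rightarrow> nat \<Rightarrow> real" where
  "average_coeffs n d U f N X t = sgd_coeffs n d U f X N t * real (N - t - 1) / real N"

lemma kernel_sum_average_coeffs:
  "kernel_sum n d N (average_coeffs n d U f N X) X x = sgd_average n d U f N X x"
  by (simp add: sgd_average_def average_coeffs_def kernel_sum_def)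

text \<open>What one run with data from \<open>p\<close> on must leave alone: the registers of the
  outer loop, the step size, and the data of all earlier runs below \<open>p\<close>.\<close>

definition run_frame :: "nat \<Rightarrow> nat \<Rightarrow> store \<Rightarrow> store \<Rightarrow> bool" where
  "run_frame n p s s' \<longleftrightarrow> (\<forall>a\<in>{0, 1, 2, 8, 11, 14, 15}. nmem s' a = nmem s a) \<and>
     (\<forall>a. n + 5 \<le> a \<and> a < p \<longrightarrow> rmem s' a = rmem s a)"

context
  fixes n d N :: nat and U :: real and f :: "vect \<Rightarrow> bool" and \<omega> :: "nat \<Rightarrow> vect"
  assumes U: "real N = U * U"
begin


definition "train_inv p a s i s' \<longleftrightarrow> run_frame n p s s' \<and> nmem s' 7 = i \<and> nmem s' 9 = p + i * (n + 1) \<and>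
  drawn s' = a + i \<and> stored n p i (drop_samples a \<omega>) (sgd_coeffs n d U f (drop_samples a \<omega>) i) (rmem s')"

lemma train_body_runs:
  assumes s: "nmem s 0 = n" "nmem s 1 = d" "nmem s 2 = p" "rmem s (n + 5) = U" and p: "n + 6 \<le> p"
    and inv: "train_inv p a s i s'" and i: "i < N"
  shows "runs n (labeled_by f \<omega>) train_body s' (410 * (n + d + 1) * (N + 1)) (train_inv p a s (Suc i))"
proof -
  define X where "X = drop_samples a \<omega>"
  define c where "c = sgd_coeffs n d U f X i"
  define b where "b = p + i * (n + 1)"
  have fr: "run_frame n p s s'" and r7: "nmem s' 7 = i" and r9: "nmem s' 9 = b" and dr: "drawn s' = a + i"
    and st: "stored n p i X c (rmem s')"
    using inv by (simp_all add: train_inv_def X_def c_def b_def)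
  have regs: "nmem s' 0 = n" "nmem s' 1 = d" "nmem s' 2 = p" using fr s by (simp_all add: run_frame_def)
  have e: "(labeled_by f \<omega>) (drawn s') = (X i, f (X i))" by (simp add: labeled_by_def dr X_def drop_samples_def)
  have pb: "p \<le> b" by (simp add: b_def)
  define M where "M s1 \<longleftrightarrow> (\<forall>x. x \<notin> {3, 4, 5, 6} \<longrightarrow> nmem s1 x = nmem s' x) \<and>
    (\<forall>x. n + 5 \<le> x \<and> x < b \<longrightarrow> rmem s1 x = rmem s' x) \<and> drawn s1 = a + i + 1 \<and>
    rmem s1 (n + 2) = kernel_sum n d i c X (X i) \<and>
    (\<forall>k<n. rmem s1 (b + k) = X i k) \<and> rmem s1 (b + n) = of_bool (f (X i))" for s1 :: store
  have 1: "runs n (labeled_by f \<omega>) draw_eval s' (310 * (n + d + 1) * (i + 1)) M"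
    by (rule runs_mono[OF draw_eval_runs[OF regs r7 r9 p _ st] order_refl])
      (simp_all add: b_def M_def dr e[unfolded dr])
  have 2: "runs n (labeled_by f \<omega>) (Seq (Ite (RLess (rreg 2) (RLoad (NAdd (nreg 9) (nreg 0))))
            (RStore (NAdd (nreg 9) (nreg 0)) (RDiv (RConst 1) (rreg 5)))
            (RStore (NAdd (nreg 9) (nreg 0)) (RSub (RConst 0) (RDiv (RConst 1) (rreg 5)))))
     (Seq (nset 9 (NAdd (NAdd (nreg 9) (nreg 0)) (NConst 1))) (ninc 7))) s1 100 (train_inv p a s (Suc i))"
    if M: "M s1" for s1
  proof -
    define v where "v = (if rmem s1 (n + 2) < rmem s1 (b + n) then 1 / U else - (1 / U))"
    define s2 where "s2 = s1\<lparr>rmem := (rmem s1)(b + n := v)\<rparr>"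
    have r: "nmem s1 0 = n" "nmem s1 9 = b" "nmem s1 7 = i" "rmem s1 (n + 5) = U"
    proof -
      show "nmem s1 0 = n" "nmem s1 9 = b" "nmem s1 7 = i" using M regs r9 r7 by (simp_all add: M_def)
      have "rmem s1 (n + 5) = rmem s' (n + 5)" using M p pb by (simp add: M_def)
      also have "\<dots> = U" using fr s p by (simp add: run_frame_def)
      finally show "rmem s1 (n + 5) = U" .
    qed
    have v: "v = sgd_coeffs n d U f X (Suc i) i" using M by (simp add: v_def c_def M_def)
    have st2: "stored n p (Suc i) X (sgd_coeffs n d U f X (Suc i)) (rmem s2)"
    proof -
      have low: "rmem s2 x = rmem s' x" if "n + 5 \<le> x" "x < b" for x
        using M that by (simp add: M_def s2_def)
      have "stored n p i X c (rmem s2)"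
        by (rule stored_cong[OF st]) (use p low b_def in auto)
      moreover have "rmem s2 (b + k) = X i k" if "k < n" for k
        using M that by (simp add: M_def s2_def)
      moreover have "rmem s2 (b + n) = sgd_coeffs n d U f X (Suc i) i" by (simp add: s2_def v)
      ultimately show ?thesis
        unfolding stored_def less_Suc_eq by (auto simp: c_def b_def)
    qed
    have post: "train_inv p a s (Suc i) (s2\<lparr>nmem := (nmem s2)(9 := b + n + 1, 7 := Suc i)\<rparr>)"
      using M fr st2 p pb unfolding train_inv_def X_def[symmetric]
      by (auto simp: run_frame_def M_def s2_def b_def)
    have fin: "runs n (labeled_by f \<omega>) (Seq (nset 9 (NAdd (NAdd (nreg 9) (nreg 0)) (NConst 1))) (ninc 7)) s2 20 (train_inv p a s (Suc i))"
      by (rule runs_mono[OF runs_Seq[OF runs_NStore[OF runs_NStore]]]) (use post r in \<open>simp_all add: s2_def\<close>)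
    have ite: "runs n (labeled_by f \<omega>) (Ite (RLess (rreg 2) (RLoad (NAdd (nreg 9) (nreg 0))))
            (RStore (NAdd (nreg 9) (nreg 0)) (RDiv (RConst 1) (rreg 5)))
            (RStore (NAdd (nreg 9) (nreg 0)) (RSub (RConst 0) (RDiv (RConst 1) (rreg 5))))) s1 70 (\<lambda>s. s = s2)"
      by (rule runs_mono[OF runs_Ite[OF runs_RStore runs_RStore]]) (use r in \<open>simp_all add: s2_def v_def\<close>)
    show ?thesis
      by (rule runs_mono[OF runs_Seq'[OF ite]]) (use fin in auto)
  qed
  have i1: "310 * (n + d + 1) * (i + 1) + 100 \<le> 410 * (n + d + 1) * (N + 1)"
  proof -
    have "310 * (n + d + 1) * (i + 1) \<le> 310 * (n + d + 1) * (N + 1)" using i by (intro mult_left_mono) auto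
    moreover have "410 * (n + d + 1) * (N + 1) = 310 * (n + d + 1) * (N + 1) + 100 * ((n + d + 1) * (N + 1))"
      by (simp add: algebra_simps)
    moreover have "1 \<le> (n + d + 1) * (N + 1)" by simp
    ultimately show ?thesis by linarith
  qed
  show ?thesis
    unfolding train_body_def by (rule runs_mono[OF runs_Seq'[OF 1 2] i1])
qed

lemma train_loop_runs:
  assumes s: "nmem s 0 = n" "nmem s 1 = d" "nmem s 2 = p" "rmem s (n + 5) = U" and p: "n + 6 \<le> p"
    and inv: "train_inv p a s 0 s0"
  shows "runs n (labeled_by f \<omega>) train_loop s0 (N * (410 * (n + d + 1) * (N + 1) + 20) + 20) (train_inv p a s N)"
  unfolding train_loop_def
proof (rule runs_mono[OF runs_While[where I = "train_inv p a s" and m = N and k = "410 * (n + d + 1) * (N + 1)"]])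
  have test: "bval s' (RLess (RNat (nreg 7)) (RMul (rreg 5) (rreg 5))) \<longleftrightarrow> i < N" if "train_inv p a s i s'" for i s'
  proof -
    have "nmem s' 0 = n" "rmem s' (n + 5) = U" "nmem s' 7 = i"
      using that s p by (simp_all add: train_inv_def run_frame_def)
    then show ?thesis by (simp add: U[symmetric])
  qed
  show "train_inv p a s 0 s0" by fact
  show "bval s' (RLess (RNat (nreg 7)) (RMul (rreg 5) (rreg 5))) \<and>
      runs n (labeled_by f \<omega>) train_body s' (410 * (n + d + 1) * (N + 1)) (train_inv p a s (Suc i))"
    if "i < N" "train_inv p a s i s'" for i s'
    using that test train_body_runs[OF s p that(2,1)] by simp
  show "\<not> bval s' (RLess (RNat (nreg 7)) (RMul (rreg 5) (rreg 5)))" if "train_inv p a s N s'" for s'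
    using test[OF that] by simp
qed (simp_all add: algebra_simps)

lemma average_loop_runs:
  assumes s: "nmem s 0 = n" "nmem s 1 = d" "nmem s 2 = p" and p: "n + 6 \<le> p"
    and inv: "train_inv p a s N s0"
  defines "X \<equiv> drop_samples a \<omega>"
  shows "runs n (labeled_by f \<omega>) average_loop s0 (N * 80 + 50) (\<lambda>s'. run_frame n p s s' \<and> nmem s' 7 = N \<and>
    nmem s' 9 = p + N * (n + 1) \<and> drawn s' = a + N \<and> stored n p N X (average_coeffs n d U f N X) (rmem s'))"
proof -
  define c where "c = sgd_coeffs n d U f X N"
  \<comment> \<open>The rescaling happens in place: entries before \<open>i\<close> already carry
    their averaging weight, the others are still raw.\<close>
  define A where "A i s' \<longleftrightarrow> run_frame n p s s' \<and> nmem s' 7 = N \<and> nmem s' 9 = p + N * (n + 1) \<and> drawn s' = a + N \<and>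
    nmem s' 4 = i \<and> nmem s' 6 = p + i * (n + 1) \<and>
    stored n p N X (\<lambda>t. if t < i then average_coeffs n d U f N X t else c t) (rmem s')" for i and s' :: store
  let ?body = "Seq (RStore (NAdd (nreg 6) (nreg 0))
            (RDiv (RMul (RLoad (NAdd (nreg 6) (nreg 0))) (RNat (NSub (NSub (nreg 7) (nreg 4)) (NConst 1)))) (RNat (nreg 7))))
     (Seq (nset 6 (NAdd (NAdd (nreg 6) (nreg 0)) (NConst 1))) (ninc 4))"
  have regs: "nmem s' 0 = n" "nmem s' 1 = d" "nmem s' 2 = p" if "run_frame n p s s'" for s'
    using that s by (simp_all add: run_frame_def)
  have body: "runs n (labeled_by f \<omega>) ?body s' 70 (A (Suc i))" if i: "i < N" and A: "A i s'" for i s'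
  proof -
    define b where "b = p + i * (n + 1)"
    have fr: "run_frame n p s s'" and r: "nmem s' 7 = N" "nmem s' 9 = p + N * (n + 1)" "drawn s' = a + N" "nmem s' 4 = i" "nmem s' 6 = b"
      and st: "stored n p N X (\<lambda>t. if t < i then average_coeffs n d U f N X t else c t) (rmem s')"
      using A by (simp_all add: A_def b_def)
    define v where "v = average_coeffs n d U f N X i"
    have cell: "rmem s' (b + n) = c i" using st i by (simp add: stored_def b_def)
    define s2 where "s2 = s'\<lparr>rmem := (rmem s')(b + n := v)\<rparr>"
    have other: "p + t * (n + 1) + k \<noteq> b + n" if "t \<noteq> i" "k \<le> n" for t k
    proof (cases "t < i")
      case True
      then show ?thesis using block_address_less[OF True that(2)] by (simp add: b_def)
    next
      case False
      then have "i < t" using that by simp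
      then show ?thesis using block_address_less[of i t n n] by (simp add: b_def)
    qed
    have st2: "stored n p N X (\<lambda>t. if t < Suc i then average_coeffs n d U f N X t else c t) (rmem s2)"
      unfolding stored_def
    proof (intro allI impI conjI)
      fix t k assume t: "t < N" and k: "k < n"
      have "p + t * (n + 1) + k \<noteq> b + n" using other[of t k] k by (cases "t = i") (auto simp: b_def)
      then show "rmem s2 (p + t * (n + 1) + k) = X t k" using st t k by (simp add: s2_def stored_def)
    next
      fix t assume t: "t < N"
      show "rmem s2 (p + t * (n + 1) + n) = (if t < Suc i then average_coeffs n d U f N X t else c t)"
        using other[of t n] st t by (cases "t = i") (auto simp: s2_def stored_def b_def v_def)
    qed
    have fin: "runs n (labeled_by f \<omega>) (Seq (nset 6 (NAdd (NAdd (nreg 6) (nreg 0)) (NConst 1))) (ninc 4)) s2 20 (A (Suc i))"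
    proof -
      have "A (Suc i) (s2\<lparr>nmem := (nmem s2)(6 := b + n + 1, 4 := Suc i)\<rparr>)"
        using fr r st2 p unfolding A_def
        by (auto simp: run_frame_def s2_def b_def)
      then show ?thesis
        by (intro runs_mono[OF runs_Seq[OF runs_NStore[OF runs_NStore]]]) (use regs[OF fr] r in \<open>simp_all add: s2_def\<close>)
    qed
    have upd: "s'\<lparr>rmem := (rmem s')(nval s' (NAdd (nreg 6) (nreg 0)) := rval s' (RDiv (RMul (RLoad (NAdd (nreg 6) (nreg 0))) (RNat (NSub (NSub (nreg 7) (nreg 4)) (NConst 1)))) (RNat (nreg 7))))\<rparr> = s2"
      using regs[OF fr] r cell by (simp add: s2_def v_def average_coeffs_def c_def)
    have "runs n (labeled_by f \<omega>) (RStore (NAdd (nreg 6) (nreg 0))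
            (RDiv (RMul (RLoad (NAdd (nreg 6) (nreg 0))) (RNat (NSub (NSub (nreg 7) (nreg 4)) (NConst 1)))) (RNat (nreg 7)))) s' 40 (\<lambda>s. s = s2)"
      by (rule runs_mono[OF runs_RStore[where Q = "\<lambda>s. s = s2"]]) (rule upd, simp_all)
    then show ?thesis
      by (rule runs_mono[OF runs_Seq'[where Q = "A (Suc i)" and ?b2.0 = 20]]) (use fin in auto)
  qed
  have loop: "runs n (labeled_by f \<omega>) (While (NLess (nreg 4) (nreg 7)) ?body) s' (N * 80 + 10) (A N)" if "A 0 s'" for s'
    by (rule runs_mono[OF runs_While[where I = A and m = N and k = 70]])
      (use that body in \<open>auto simp: A_def\<close>)
  have fr0: "run_frame n p s s0" using inv by (simp add: train_inv_def)
  have "runs n (labeled_by f \<omega>) average_loop s0 (N * 80 + 50) (A N)"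
    unfolding average_loop_def
  proof (rule runs_mono[OF runs_Seq[OF runs_NStore[OF runs_Seq[OF runs_NStore[OF loop]]]]])
    have "s0\<lparr>nmem := (nmem s0)(4 := 0, 6 := p)\<rparr> = s0\<lparr>nmem := ((nmem s0)(4 := 0))(6 := p)\<rparr>" by simp
    have "A 0 (s0\<lparr>nmem := (nmem s0)(4 := 0, 6 := p)\<rparr>)"
      using inv unfolding A_def train_inv_def X_def c_def by (auto simp: run_frame_def)
    then show "A 0 (s0\<lparr>nmem := (nmem s0)(nval s0 (NConst 4) := nval s0 (NConst 0))\<rparr>
       \<lparr>nmem := (nmem (s0\<lparr>nmem := (nmem s0)(nval s0 (NConst 4) := nval s0 (NConst 0))\<rparr>))
          (nval (s0\<lparr>nmem := (nmem s0)(nval s0 (NConst 4) := nval s0 (NConst 0))\<rparr>) (NConst 6) :=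
           nval (s0\<lparr>nmem := (nmem s0)(nval s0 (NConst 4) := nval s0 (NConst 0))\<rparr>) (nreg 2))\<rparr>)"
      using regs[OF fr0] by simp
  qed simp_all
  moreover have "stored n p N X (average_coeffs n d U f N X) rm"
    if "stored n p N X (\<lambda>t. if t < N then average_coeffs n d U f N X t else c t) rm" for rm
    using that by (simp add: stored_def)
  ultimately show ?thesis
    by (elim runs_mono) (auto simp: A_def)
qed

lemma bval_correct_test:
  assumes "nmem s 0 = n" "nmem s 1 = d" "nmem s 8 = j" "nmem s 9 = b"
    and "rmem s (n + 2) = z" "rmem s (b + n) = of_bool y"
  shows "bval s correct_test \<longleftrightarrow> (real j \<le> z * real d) = y"
  using assms by (cases y) (auto simp: correct_test_def below_threshold_def Let_def not_less)

text \<open>Register 9 stays fixed, so each validation example overwrites the one before, just past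
  the stored model. The samples used are those following the training samples of the same
  block.\<close>

lemma validate_loop_runs:
  fixes a :: nat
  assumes s: "nmem s 0 = n" "nmem s 1 = d" "nmem s 2 = p" "nmem s 8 = j" and p: "n + 6 \<le> p"
  defines "X \<equiv> drop_samples a \<omega>"
  assumes s0: "run_frame n p s s0" "nmem s0 7 = N" "nmem s0 9 = p + N * (n + 1)" "drawn s0 = a + N"
    "stored n p N X (average_coeffs n d U f N X) (rmem s0)"
  shows "runs n (labeled_by f \<omega>) validate_loop s0 (N * (310 * (n + d + 1) * (N + 1) + 100) + 50) (\<lambda>s'. run_frame n p s s' \<and> nmem s' 7 = N \<and>
    nmem s' 9 = p + N * (n + 1) \<and> drawn s' = a + N + N \<and> stored n p N X (average_coeffs n d U f N X) (rmem s') \<and>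
    nmem s' 13 = num_correct n d U f N j X)"
proof -
  define b where "b = p + N * (n + 1)"
  define hyp where "hyp = sgd_hypothesis n d U f N j X"
  define W where "W v s' \<longleftrightarrow> run_frame n p s s' \<and> nmem s' 7 = N \<and> nmem s' 9 = b \<and> drawn s' = a + N + v \<and>
    stored n p N X (average_coeffs n d U f N X) (rmem s') \<and> nmem s' 10 = v \<and>
    nmem s' 13 = card {u. u < v \<and> hyp (X (N + u)) = f (X (N + u))}" for v and s' :: store
  have regs: "nmem s' 0 = n" "nmem s' 1 = d" "nmem s' 2 = p" "nmem s' 8 = j" if "run_frame n p s s'" for s'
    using that s by (simp_all add: run_frame_def)
  let ?body = "Seq draw_eval (Seq (Ite correct_test (ninc 13) Skip) (ninc 10))"
  have body: "runs n (labeled_by f \<omega>) ?body s' (310 * (n + d + 1) * (N + 1) + 80) (W (Suc v))" if W: "W v s'" for v s'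
  proof -
    have fr: "run_frame n p s s'" and r: "nmem s' 7 = N" "nmem s' 9 = b" and dr: "drawn s' = a + N + v"
      and st: "stored n p N X (average_coeffs n d U f N X) (rmem s')" using W by (simp_all add: W_def)
    define x where "x = X (N + v)"
    have e: "(labeled_by f \<omega>) (drawn s') = (x, f x)" by (simp add: x_def labeled_by_def dr X_def drop_samples_def add.assoc)
    have pb: "p \<le> b" by (simp add: b_def)
    define M where "M s1 \<longleftrightarrow> (\<forall>x. x \<notin> {3, 4, 5, 6} \<longrightarrow> nmem s1 x = nmem s' x) \<and>
      (\<forall>x. n + 5 \<le> x \<and> x < b \<longrightarrow> rmem s1 x = rmem s' x) \<and> drawn s1 = a + N + v + 1 \<and>
      rmem s1 (n + 2) = sgd_average n d U f N X x \<and> rmem s1 (b + n) = of_bool (f x)" for s1 :: store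
    have 1: "runs n (labeled_by f \<omega>) draw_eval s' (310 * (n + d + 1) * (N + 1)) M"
      by (rule runs_mono[OF draw_eval_runs[OF regs(1-3)[OF fr] r p _ st] order_refl])
        (simp_all add: b_def M_def dr e[unfolded dr] kernel_sum_average_coeffs)
    have 2: "runs n (labeled_by f \<omega>) (Seq (Ite correct_test (ninc 13) Skip) (ninc 10)) s1 80 (W (Suc v))" if M: "M s1" for s1
    proof -
      have r1: "nmem s1 0 = n" "nmem s1 1 = d" "nmem s1 8 = j" "nmem s1 9 = b" "nmem s1 10 = v"
        "nmem s1 13 = card {u. u < v \<and> hyp (X (N + u)) = f (X (N + u))}"
        using M regs[OF fr] r W by (simp_all add: M_def W_def)
      have test: "bval s1 correct_test \<longleftrightarrow> hyp x = f x"
        using bval_correct_test[of s1 j b, OF r1(1-4)] M by (simp add: M_def hyp_def sgd_hypothesis_def)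
      have card: "card {u. u < Suc v \<and> hyp (X (N + u)) = f (X (N + u))} =
          (if hyp x = f x then Suc (nmem s1 13) else nmem s1 13)"
      proof -
        have "{u. u < Suc v \<and> hyp (X (N + u)) = f (X (N + u))} =
            (if hyp x = f x then insert v {u. u < v \<and> hyp (X (N + u)) = f (X (N + u))}
             else {u. u < v \<and> hyp (X (N + u)) = f (X (N + u))})"
          by (auto simp: less_Suc_eq x_def)
        then show ?thesis using r1(6) by simp
      qed
      have st1: "stored n p N X (average_coeffs n d U f N X) (rmem s1)"
        by (rule stored_cong[OF st]) (use M p b_def in \<open>auto simp: M_def\<close>)
      have fr1: "run_frame n p s s1" using fr M pb by (auto simp: run_frame_def M_def)
      have fin: "runs n (labeled_by f \<omega>) (ninc 10) s2 10 (W (Suc v))"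
        if "s2 = s1\<lparr>nmem := (nmem s1)(13 := card {u. u < Suc v \<and> hyp (X (N + u)) = f (X (N + u))})\<rparr>" for s2
        by (rule runs_mono[OF runs_NStore])
          (use that fr1 st1 M r in \<open>auto simp: W_def M_def run_frame_def r1\<close>)
      have same: "s1\<lparr>nmem := (nmem s1)(13 := nmem s1 13)\<rparr> = s1" by simp
      have ite: "runs n (labeled_by f \<omega>) (Ite correct_test (ninc 13) Skip) s1 70
          (\<lambda>s2. s2 = s1\<lparr>nmem := (nmem s1)(13 := card {u. u < Suc v \<and> hyp (X (N + u)) = f (X (N + u))})\<rparr>)"
        by (rule runs_mono[OF runs_Ite[OF runs_NStore runs_Skip]])
          (auto simp: test card same simp del: fun_upd_apply, simp_all add: correct_test_def below_threshold_def Let_def)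
      show ?thesis by (rule runs_mono[OF runs_Seq'[OF ite fin]]) auto
    qed
    show ?thesis by (rule runs_mono[OF runs_Seq'[OF 1 2]]) auto
  qed
  have loop: "runs n (labeled_by f \<omega>) (While (NLess (nreg 10) (nreg 7)) ?body) s' (N * (310 * (n + d + 1) * (N + 1) + 100) + 10) (W N)"
    if "W 0 s'" for s'
    by (rule runs_mono[OF runs_While[where I = W and m = N and k = "310 * (n + d + 1) * (N + 1) + 80"]])
      (use that body in \<open>auto simp: W_def algebra_simps\<close>)
  have "runs n (labeled_by f \<omega>) validate_loop s0 (N * (310 * (n + d + 1) * (N + 1) + 100) + 50) (W N)"
    unfolding validate_loop_def
    by (rule runs_mono[OF runs_Seq[OF runs_NStore[OF runs_Seq[OF runs_NStore[OF loop]]]]])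
      (use s0 in \<open>auto simp: W_def run_frame_def b_def\<close>)
  then show ?thesis
    by (elim runs_mono) (auto simp: W_def b_def num_correct_def hyp_def)
qed

end

text \<open>Pairs of a score and a run. Ties go to the later run, so run 0 always replaces the
  initial pair, whose score is 0.\<close>

primrec best_run :: "(nat \<Rightarrow> nat) \<Rightarrow> nat \<Rightarrow> nat \<times> nat" where
  "best_run c 0 = (0, 0)"
| "best_run c (Suc j) = (if c j < fst (best_run c j) then best_run c j else (c j, j))"

lemma best_run:
  assumes "0 < j"
  shows "snd (best_run c j) < j" "i < j \<Longrightarrow> c i \<le> c (snd (best_run c j))"
    and "fst (best_run c j) = c (snd (best_run c j))"
proof -
  define P where "P j b \<longleftrightarrow> snd b < j \<and> (\<forall>i<j. c i \<le> c (snd b)) \<and> fst b = c (snd b)" for j and b :: "nat \<times> nat"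
  have *: "P (Suc k) (best_run c (Suc k))" for k
  proof (induction k)
    case 0
    show ?case by (simp add: P_def)
  next
    case (Suc k)
    define b where "b = best_run c (Suc k)"
    have b: "snd b < Suc k" "\<And>i. i < Suc k \<Longrightarrow> c i \<le> c (snd b)" "fst b = c (snd b)"
      using Suc by (simp_all only: b_def P_def)
    have step: "best_run c (Suc (Suc k)) = (if c (Suc k) < fst b then b else (c (Suc k), Suc k))"
      by (simp only: best_run.simps(2)[of c "Suc k"] b_def)
    show ?case
    proof (cases "c (Suc k) < fst b")
      case True
      have "c i \<le> c (snd b)" if "i < Suc (Suc k)" for i
        using that b(2)[of i] b(3) True by (cases "i = Suc k") auto
      then show ?thesis using True b unfolding step by (simp add: P_def)
    next
      case False
      have "c i \<le> c (Suc k)" if "i < Suc (Suc k)" for i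
      proof (cases "i = Suc k")
        case i: False
        then have "c i \<le> c (snd b)" using that by (intro b(2)) simp
        then show ?thesis using False b(3) by linarith
      qed simp
      then show ?thesis using False unfolding step by (simp add: P_def)
    qed
  qed
  obtain k where j: "j = Suc k" using assms by (cases j) auto
  show "snd (best_run c j) < j" "i < j \<Longrightarrow> c i \<le> c (snd (best_run c j))"
    "fst (best_run c j) = c (snd (best_run c j))"
    using *[of k] unfolding j P_def by blast+
qed

text \<open>Counting up to \<open>2 ^ 32 * (r / \<epsilon>)^3\<close> is the way to round a real up
  to a natural. The inverse step size \<open>(n + d)^(5 * d)\<close> is then built from
  \<open>d\<close> multiplications by a fifth power. Data begin at \<open>n + 6\<close>, past the
  reserved real cells.\<close>

definition init_prog :: cmd where
  "init_prog =
     Seq (While (RLess (RNat (nreg 1)) (RMul (RConst 4294967296)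
            (RMul (RDiv (RLoad (NConst 0)) (RLoad (NConst 1))) (RMul (RDiv (RLoad (NConst 0)) (RLoad (NConst 1)))
              (RDiv (RLoad (NConst 0)) (RLoad (NConst 1)))))))
          (ninc 1))
     (Seq (rset 5 (RConst 1)) (Seq (nset 5 (NConst 0))
     (Seq (While (NLess (nreg 5) (nreg 1))
            (Seq (rset 5 (RMul (rreg 5) (RMul (RNat (NAdd (nreg 0) (nreg 1))) (RMul (RNat (NAdd (nreg 0) (nreg 1)))
              (RMul (RNat (NAdd (nreg 0) (nreg 1))) (RMul (RNat (NAdd (nreg 0) (nreg 1))) (RNat (NAdd (nreg 0) (nreg 1)))))))))
              (ninc 5)))
       (nset 9 (NAdd (nreg 0) (NConst 6))))))"

text \<open>The last two assignments put the base address and the threshold of the winner where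
  \<open>eval_prog\<close> and \<open>below_threshold\<close> expect them, so prediction can reuse
  both.\<close>

definition train_prog :: cmd where
  "train_prog = Seq init_prog (Seq (While (NLess (nreg 8) (nreg 1)) run_prog)
     (Seq (nset 2 (nreg 11)) (nset 8 (nreg 15))))"

definition predict_prog :: cmd where
  "predict_prog = Seq (nset 3 (NConst 0)) (Seq eval_prog
     (Ite below_threshold (nset 0 (NConst 0)) (nset 0 (NConst 1))))"

definition model_at :: "nat \<Rightarrow> nat \<Rightarrow> nat \<Rightarrow> real \<Rightarrow> (vect \<Rightarrow> bool) \<Rightarrow> nat \<Rightarrow> nat \<Rightarrow> (nat \<Rightarrow> vect) \<Rightarrow> store \<Rightarrow> bool" where
  "model_at p n d U f N j X s \<longleftrightarrow> n + 6 \<le> p \<and> nmem s 0 = n \<and> nmem s 1 = d \<and> nmem s 2 = p \<and> nmem s 7 = N \<and> nmem s 8 = j \<and>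
     stored n p N X (average_coeffs n d U f N X) (rmem s)"

text \<open>The query overwrites only real cells below \<open>n\<close>, and the model lies at
  \<open>n + 6\<close> or above.\<close>

lemma predict_prog_runs:
  assumes m: "model_at p n d U f N j X s"
  shows "runs n S predict_prog (s\<lparr>rmem := (\<lambda>i. if i < n then x i else rmem s i)\<rparr>) (300 * (n + d + 1) * (N + 1) + 50)
    (\<lambda>s'. (nmem s' 0 \<noteq> 0) = sgd_hypothesis n d U f N j X x)"
proof -
  define s1 where "s1 = s\<lparr>rmem := (\<lambda>i. if i < n then x i else rmem s i), nmem := (nmem s)(3 := 0)\<rparr>"
  have r: "nmem s1 0 = n" "nmem s1 1 = d" "nmem s1 2 = p" "nmem s1 3 = 0" "nmem s1 7 = N" "nmem s1 8 = j"
    and p: "n + 6 \<le> p"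
    using m by (simp_all add: model_at_def s1_def)
  have st: "stored n p N X (average_coeffs n d U f N X) (rmem s1)"
    by (rule stored_cong[where rm = "rmem s"]) (use m in \<open>auto simp: model_at_def s1_def\<close>)
  have x1: "rmem s1 (0 + k) = x k" if "k < n" for k using that by (simp add: s1_def)
  have ev: "runs n S eval_prog s1 (300 * (n + d + 1) * (N + 1)) (\<lambda>s'. scratch_frame n s1 s' \<and>
      rmem s' (n + 2) = sgd_average n d U f N X x)"
  proof (rule runs_mono[OF eval_prog_kernel_sum[OF r(1-5) p _ st x1] order_refl])
    show "0 + n \<le> n + 2 \<or> n + 6 \<le> 0" by simp
  qed (simp_all only: kernel_sum_average_coeffs simp_thms)
  have fin: "runs n S (Ite below_threshold (nset 0 (NConst 0)) (nset 0 (NConst 1))) s' 40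
      (\<lambda>s'. (nmem s' 0 \<noteq> 0) = sgd_hypothesis n d U f N j X x)"
    if "scratch_frame n s1 s' \<and> rmem s' (n + 2) = sgd_average n d U f N X x" for s'
  proof -
    have "nmem s' 0 = n" "nmem s' 1 = d" "nmem s' 8 = j" using that r by (simp_all add: scratch_frame_def)
    then have "bval s' below_threshold \<longleftrightarrow> \<not> sgd_hypothesis n d U f N j X x"
      using that by (simp add: below_threshold_def sgd_hypothesis_def not_le)
    then show ?thesis
      by (intro runs_mono[OF runs_Ite[OF runs_NStore runs_NStore]]) (simp_all add: below_threshold_def)
  qed
  have main: "runs n S (Seq eval_prog (Ite below_threshold (nset 0 (NConst 0)) (nset 0 (NConst 1)))) s2
      (300 * (n + d + 1) * (N + 1) + 40) (\<lambda>s'. (nmem s' 0 \<noteq> 0) = sgd_hypothesis n d U f N j X x)" if "s2 = s1" for s2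
    unfolding that by (rule runs_Seq'[OF ev fin])
  let ?s = "s\<lparr>rmem := (\<lambda>i. if i < n then x i else rmem s i)\<rparr>"
  have s1: "?s\<lparr>nmem := (nmem ?s)(nval ?s (NConst 3) := nval ?s (NConst 0))\<rparr> = s1"
    by (simp add: s1_def)
  have k: "1 + ncost (NConst 3) + ncost (NConst 0) + (y + 40) \<le> y + 50" for y
    by simp
  show ?thesis
    unfolding predict_prog_def
    by (rule runs_mono[OF runs_Seq[OF runs_NStore[where Q = "\<lambda>s2. runs n S _ s2 _ _"]] k]) (rule main[OF s1])
qed

text \<open>A hypothesis is defined by the existence of an execution that answers 1; determinism
  rules out a second one with another answer.\<close>

lemma predictsI:
  assumes m: "model_at p n d U f N j X s"
  shows "\<exists>t y. predicts n predict_prog s x t y \<and> t \<le> 300 * (n + d + 1) * (N + 1) + 50"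
    and "hypothesis n predict_prog s x \<longleftrightarrow> sgd_hypothesis n d U f N j X x"
proof -
  let ?S = "\<lambda>_::nat. (\<lambda>_. 0, False)"
  let ?s = "s\<lparr>rmem := (\<lambda>i. if i < n then x i else rmem s i)\<rparr>"
  obtain t s' where t: "exec n ?S predict_prog ?s t s'" "t \<le> 300 * (n + d + 1) * (N + 1) + 50"
    and y: "(nmem s' 0 \<noteq> 0) = sgd_hypothesis n d U f N j X x"
    using predict_prog_runs[OF m, of ?S x] unfolding runs_def by blast
  then show "\<exists>t y. predicts n predict_prog s x t y \<and> t \<le> 300 * (n + d + 1) * (N + 1) + 50"
    unfolding predicts_def by blast
  have "s'' = s'" if "exec n ?S predict_prog ?s u s''" for u s''
    using exec_deterministic[OF t(1) that] by (rule conjunct2)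
  then show "hypothesis n predict_prog s x \<longleftrightarrow> sgd_hypothesis n d U f N j X x"
    unfolding hypothesis_def predicts_def using t(1) y by metis
qed

section \<open>The loop over all runs\<close>

context
  fixes n d N :: nat and U :: real and f :: "vect \<Rightarrow> bool" and \<omega> :: "nat \<Rightarrow> vect"
  assumes U: "real N = U * U"
begin


definition "run_base j = n + 6 + j * (N * (n + 1))"

abbreviation "run_sample j \<equiv> drop_samples (j * (2 * N)) \<omega>"

definition "best_before j = best_run (\<lambda>j. num_correct n d U f N j (run_sample j)) j"

text \<open>Registers 7 and 11 are first written inside a run, hence the guard \<open>0 < j\<close>.
  Every earlier model stays in memory, because only the end decides which one is needed.\<close>

definition "outer_inv j s \<longleftrightarrow> nmem s 0 = n \<and> nmem s 1 = d \<and> nmem s 8 = j \<and> nmem s 9 = run_base j \<and> rmem s (n + 5) = U \<and>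
  drawn s = j * (2 * N) \<and> nmem s 14 = fst (best_before j) \<and> nmem s 15 = snd (best_before j) \<and>
  (0 < j \<longrightarrow> nmem s 11 = run_base (snd (best_before j)) \<and> nmem s 7 = N) \<and>
  (\<forall>i<j. stored n (run_base i) N (run_sample i) (average_coeffs n d U f N (run_sample i)) (rmem s))"

lemma run_prog_runs:
  assumes s: "outer_inv j s"
  shows "runs n (labeled_by f \<omega>) run_prog s (1300 * (n + d + 1) * (N + 1) * (N + 1)) (outer_inv (Suc j))"
proof -
  define p where "p = run_base j"
  define a where "a = j * (2 * N)"
  define X where "X = run_sample j"
  have p: "n + 6 \<le> p" by (simp add: p_def run_base_def)
  define s1 where "s1 = s\<lparr>nmem := (nmem s)(2 := p, 7 := 0)\<rparr>"
  have r1: "nmem s1 0 = n" "nmem s1 1 = d" "nmem s1 2 = p" "rmem s1 (n + 5) = U" "nmem s1 8 = j"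
    "nmem s1 14 = fst (best_before j)" "nmem s1 15 = snd (best_before j)"
    using s by (simp_all add: outer_inv_def s1_def)
  have t0: "train_inv n d U f \<omega> p a s1 0 s1"
    using s by (simp add: train_inv_def[OF U] s1_def run_frame_def stored_def outer_inv_def p_def a_def)
  let ?ct = "N * (410 * (n + d + 1) * (N + 1) + 20) + 20"
  let ?cv = "N * (310 * (n + d + 1) * (N + 1) + 100) + 50"
  have tr: "runs n (labeled_by f \<omega>) train_loop s1 ?ct (train_inv n d U f \<omega> p a s1 N)"
    by (rule train_loop_runs[OF U r1(1-4) p t0])
  define Q1 where "Q1 s' \<longleftrightarrow> run_frame n p s1 s' \<and> nmem s' 7 = N \<and>
    nmem s' 9 = p + N * (n + 1) \<and> drawn s' = a + N \<and> stored n p N X (average_coeffs n d U f N X) (rmem s')" for s' :: store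
  have av: "runs n (labeled_by f \<omega>) average_loop s' (N * 80 + 50) Q1" if "train_inv n d U f \<omega> p a s1 N s'" for s'
    by (rule runs_mono[OF average_loop_runs[OF U r1(1-3) p that] order_refl]) (simp add: Q1_def X_def a_def)
  define Q2 where "Q2 s' \<longleftrightarrow> run_frame n p s1 s' \<and> nmem s' 7 = N \<and>
    nmem s' 9 = p + N * (n + 1) \<and> drawn s' = a + N + N \<and> stored n p N X (average_coeffs n d U f N X) (rmem s') \<and>
    nmem s' 13 = num_correct n d U f N j X" for s' :: store
  have va: "runs n (labeled_by f \<omega>) validate_loop s' ?cv Q2" if "Q1 s'" for s'
    by (rule runs_mono[OF validate_loop_runs[OF U r1(1-3,5) p, where a = a] order_refl])
      (use that in \<open>simp_all add: Q1_def Q2_def X_def a_def\<close>)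
  let ?upd = "Seq (Ite (NLess (nreg 13) (nreg 14)) Skip
             (Seq (nset 14 (nreg 13)) (Seq (nset 11 (nreg 2)) (nset 15 (nreg 8))))) (ninc 8)"
  have up: "runs n (labeled_by f \<omega>) ?upd s' 60 (outer_inv (Suc j))" if Q: "Q2 s'" for s'
  proof -
    define c where "c = num_correct n d U f N j X"
    have fr: "run_frame n p s1 s'" and r13: "nmem s' 13 = c" using Q by (simp_all add: Q2_def c_def)
    have r: "nmem s' 0 = n" "nmem s' 1 = d" "nmem s' 2 = p" "nmem s' 8 = j"
      "nmem s' 14 = fst (best_before j)" "nmem s' 15 = snd (best_before j)"
      using fr r1 by (simp_all add: run_frame_def)
    have r11: "0 < j \<longrightarrow> nmem s' 11 = run_base (snd (best_before j))"
      using fr s by (simp add: run_frame_def s1_def outer_inv_def)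
    have rU: "rmem s' (n + 5) = U" using fr r1 p by (simp add: run_frame_def)
    have st: "stored n (run_base i) N (run_sample i) (average_coeffs n d U f N (run_sample i)) (rmem s')" if i: "i < Suc j" for i
    proof (cases "i = j")
      case True
      then show ?thesis using Q by (simp add: Q2_def p_def X_def)
    next
      case False
      then have "i < j" using i by simp
      have "run_base i + N * (n + 1) = n + 6 + (i + 1) * (N * (n + 1))" by (simp add: run_base_def)
      also have "\<dots> \<le> p" unfolding p_def run_base_def using \<open>i < j\<close> by (intro add_left_mono mult_right_mono) auto
      finally have bi: "run_base i + N * (n + 1) \<le> p" .
      have "stored n (run_base i) N (run_sample i) (average_coeffs n d U f N (run_sample i)) (rmem s)"
        using s \<open>i < j\<close> by (simp add: outer_inv_def)
      then show ?thesis
      proof (rule stored_cong)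
        fix x assume "run_base i \<le> x" "x < run_base i + N * (n + 1)"
        then have "n + 5 \<le> x" "x < p" using bi by (auto simp: run_base_def)
        then show "rmem s' x = rmem s x" using fr by (simp add: run_frame_def s1_def)
      qed
    qed
    have b9: "nmem s' 9 = run_base (Suc j)" using Q by (simp add: Q2_def p_def run_base_def algebra_simps)
    have dr: "drawn s' = Suc j * (2 * N)" using Q by (simp add: Q2_def a_def)
    have r7: "nmem s' 7 = N" using Q by (simp add: Q2_def)
    have bS: "best_before (Suc j) = (if c < fst (best_before j) then best_before j else (c, j))"
      by (simp add: best_before_def c_def X_def)
    define B where "B s2 \<longleftrightarrow> nmem s2 0 = n \<and> nmem s2 1 = d \<and> nmem s2 8 = j \<and> nmem s2 9 = run_base (Suc j) \<and>
      rmem s2 = rmem s' \<and> drawn s2 = drawn s' \<and> nmem s2 14 = fst (best_before (Suc j)) \<and> nmem s2 15 = snd (best_before (Suc j)) \<and>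
      nmem s2 11 = run_base (snd (best_before (Suc j))) \<and> nmem s2 7 = N" for s2 :: store
    have ite: "runs n (labeled_by f \<omega>) (Ite (NLess (nreg 13) (nreg 14)) Skip
             (Seq (nset 14 (nreg 13)) (Seq (nset 11 (nreg 2)) (nset 15 (nreg 8))))) s' 40 B"
    proof -
      have 1: "runs n (labeled_by f \<omega>) Skip s' 1 B" if "bval s' (NLess (nreg 13) (nreg 14))"
      proof (rule runs_Skip)
        have c: "c < fst (best_before j)" using that r r13 by simp
        \<comment> \<open>Before the first run the best score is 0 and cannot exceed
          \<open>c\<close>; so some earlier run has already set register 11.\<close>
        then have "0 < j" by (cases j) (auto simp: best_before_def)
        then show "B s'" using r r11 r7 b9 c by (simp add: B_def bS)
      qed
      have 2: "runs n (labeled_by f \<omega>) (Seq (nset 14 (nreg 13)) (Seq (nset 11 (nreg 2)) (nset 15 (nreg 8)))) s' 20 B"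
        if "\<not> bval s' (NLess (nreg 13) (nreg 14))"
        by (rule runs_mono[OF runs_Seq[OF runs_NStore[OF runs_Seq[OF runs_NStore[OF runs_NStore[where Q = B]]]]]])
          (use that r r7 r13 b9 in \<open>simp_all add: B_def bS p_def\<close>)
      show ?thesis by (rule runs_mono[OF runs_Ite[OF 1 2]]) simp_all
    qed
    have fin: "runs n (labeled_by f \<omega>) (ninc 8) s2 10 (outer_inv (Suc j))" if "B s2" for s2
      by (rule runs_mono[OF runs_NStore]) (use that rU dr st in \<open>auto simp: B_def outer_inv_def\<close>)
    show ?thesis by (rule runs_mono[OF runs_Seq'[OF ite fin]]) auto
  qed
  have all: "runs n (labeled_by f \<omega>) (Seq train_loop (Seq average_loop (Seq validate_loop ?upd))) s1
      (?ct + ((N * 80 + 50) + (?cv + 60))) (outer_inv (Suc j))"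
  proof -
    have 1: "runs n (labeled_by f \<omega>) (Seq validate_loop ?upd) s' (?cv + 60) (outer_inv (Suc j))" if "Q1 s'" for s'
      by (rule runs_Seq'[OF va[OF that] up])
    have 2: "runs n (labeled_by f \<omega>) (Seq average_loop (Seq validate_loop ?upd)) s' ((N * 80 + 50) + (?cv + 60)) (outer_inv (Suc j))"
      if "train_inv n d U f \<omega> p a s1 N s'" for s'
      by (rule runs_Seq'[OF av[OF that] 1])
    show ?thesis by (rule runs_Seq'[OF tr 2])
  qed
  have all': "runs n (labeled_by f \<omega>) (Seq train_loop (Seq average_loop (Seq validate_loop ?upd))) s2
      (?ct + ((N * 80 + 50) + (?cv + 60))) (outer_inv (Suc j))" if "s2 = s1" for s2
    unfolding that by (rule all)
  have cost: "?ct + ((N * 80 + 50) + (?cv + 60)) + 20 \<le> 1300 * (n + d + 1) * (N + 1) * (N + 1)"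
  proof -
    define A where "A = (n + d + 1) * (N + 1) * (N + 1)"
    have 1: "N * ((n + d + 1) * (N + 1)) \<le> A" unfolding A_def by (simp add: algebra_simps)
    have 2: "N \<le> A" unfolding A_def by (simp add: algebra_simps)
    have 3: "1 \<le> A" unfolding A_def by simp
    have "?ct + ((N * 80 + 50) + (?cv + 60)) + 20 = 720 * (N * ((n + d + 1) * (N + 1))) + 200 * N + 200"
      by (simp add: algebra_simps)
    also have "720 * x + 200 * y + 200 \<le> 1300 * z" if "x \<le> z" "y \<le> z" "1 \<le> z" for x y z :: nat
      using that by linarith
    note this[OF 1 2 3]
    finally show ?thesis unfolding A_def mult.assoc .
  qed
  show ?thesis
    unfolding run_prog_def
  proof (rule runs_mono[OF runs_Seq[OF runs_NStore[OF runs_Seq[OF runs_NStore[OF all']]]]])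
    show "1 + ncost (NConst 2) + ncost (nreg 9) + (1 + ncost (NConst 7) + ncost (NConst 0) +
        (?ct + ((N * 80 + 50) + (?cv + 60)))) \<le> 1300 * (n + d + 1) * (N + 1) * (N + 1)"
    proof -
      have "1 + ncost (NConst 2) + ncost (nreg 9) + (1 + ncost (NConst 7) + ncost (NConst 0) + x) \<le> x + 20" for x
        by simp
      then show ?thesis using cost by (rule order_trans)
    qed
    have "nmem s 9 = p" using s by (simp add: outer_inv_def p_def)
    then show "s\<lparr>nmem := (nmem s)(nval s (NConst 2) := nval s (nreg 9))\<rparr>
       \<lparr>nmem := (nmem (s\<lparr>nmem := (nmem s)(nval s (NConst 2) := nval s (nreg 9))\<rparr>))
         (nval (s\<lparr>nmem := (nmem s)(nval s (NConst 2) := nval s (nreg 9))\<rparr>) (NConst 7) :=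
          nval (s\<lparr>nmem := (nmem s)(nval s (NConst 2) := nval s (nreg 9))\<rparr>) (NConst 0))\<rparr> = s1"
      by (simp add: s1_def)
  qed
qed

end

section \<open>Choice of the degree and the complete learner\<close>

definition degree_target :: "real \<Rightarrow> real" where
  "degree_target R = 4294967296 * (R * (R * R))"

definition degree_of :: "real \<Rightarrow> nat" where
  "degree_of R = nat \<lceil>degree_target R\<rceil>"

text \<open>A natural number is below a ceiling exactly if it is below the real itself, and that is
  the test of the counting loop.\<close>

lemma less_degree_of: "i < degree_of R \<longleftrightarrow> real i < degree_target R"
  by (simp add: degree_of_def zless_nat_eq_int_zless less_ceiling_iff)

lemma init_prog_runs:
  fixes n :: nat and r \<epsilon> :: real
  defines "d \<equiv> degree_of (r / \<epsilon>)"
  assumes n: "1 \<le> n"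
  shows "runs n S init_prog (initial_store n r \<epsilon>) (200 * (d + 1)) (\<lambda>s. nmem s 0 = n \<and> nmem s 1 = d \<and>
    nmem s 8 = 0 \<and> nmem s 9 = n + 6 \<and> nmem s 14 = 0 \<and> nmem s 15 = 0 \<and> drawn s = 0 \<and>
    rmem s (n + 5) = real (n + d) ^ (5 * d))"
proof -
  let ?s = "initial_store n r \<epsilon>"
  define T where "T = RMul (RConst 4294967296)
            (RMul (RDiv (RLoad (NConst 0)) (RLoad (NConst 1))) (RMul (RDiv (RLoad (NConst 0)) (RLoad (NConst 1)))
              (RDiv (RLoad (NConst 0)) (RLoad (NConst 1)))))"
  have rcT: "rcost T \<le> 40" by (simp add: T_def)
  define F where "F s \<longleftrightarrow> nmem s 0 = n \<and> nmem s 8 = 0 \<and> nmem s 14 = 0 \<and> nmem s 15 = 0 \<and> drawn s = 0" for s :: store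
  define I where "I i s \<longleftrightarrow> F s \<and> nmem s 1 = i \<and> rmem s 0 = r \<and> rmem s 1 = \<epsilon>" for i s
  have bT: "bval s (RLess (RNat (nreg 1)) T) \<longleftrightarrow> i < d" if "I i s" for i s
    using that by (simp add: I_def T_def d_def less_degree_of degree_target_def of_rat_numeral_eq)
  have l1: "runs n S (While (RLess (RNat (nreg 1)) T) (ninc 1)) ?s (d * 60 + 50) (I d)"
  proof (rule runs_mono[OF runs_While[where I = I and m = d and k = 10]])
    show "I 0 ?s" using n by (simp add: I_def F_def initial_store_def)
    show "bval s (RLess (RNat (nreg 1)) T) \<and> runs n S (ninc 1) s 10 (I (Suc i))" if "i < d" "I i s" for i s
    proof
      show "bval s (RLess (RNat (nreg 1)) T)" using bT[OF that(2)] that(1) by blast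
      show "runs n S (ninc 1) s 10 (I (Suc i))"
        by (rule runs_mono[OF runs_NStore[where Q = "I (Suc i)"]]) (use that in \<open>simp_all add: I_def F_def\<close>)
    qed
    show "\<not> bval s (RLess (RNat (nreg 1)) T)" if "I d s" for s
      using bT[OF that] by simp
    have "d * (1 + bcost (RLess (RNat (nreg 1)) T) + 10) \<le> d * 60" using rcT by (intro mult_left_mono) auto
    moreover have "bcost (RLess (RNat (nreg 1)) T) \<le> 45" using rcT by simp
    ultimately show "d * (1 + bcost (RLess (RNat (nreg 1)) T) + 10) + 1 + bcost (RLess (RNat (nreg 1)) T) \<le> d * 60 + 50"
      by linarith
  qed
  define J where "J i s \<longleftrightarrow> F s \<and> nmem s 1 = d \<and> nmem s 5 = i \<and> rmem s (n + 5) = real (n + d) ^ (5 * i)" for i s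
  define M where "M = RMul (rreg 5) (RMul (RNat (NAdd (nreg 0) (nreg 1))) (RMul (RNat (NAdd (nreg 0) (nreg 1)))
              (RMul (RNat (NAdd (nreg 0) (nreg 1))) (RMul (RNat (NAdd (nreg 0) (nreg 1))) (RNat (NAdd (nreg 0) (nreg 1)))))))"
  have rcM: "rcost M \<le> 60" by (simp add: M_def)
  have rvM: "rval s M = real (n + d) ^ (5 * Suc i)" if "J i s" for i s
  proof -
    have "rval s M = real (n + d) ^ (5 * i) * real (n + d) ^ 5"
      using that by (simp add: J_def F_def M_def eval_nat_numeral)
    also have "\<dots> = real (n + d) ^ (5 * i + 5)" by (simp only: power_add)
    finally show ?thesis by (simp only: mult_Suc_right add.commute)
  qed
  have l2: "runs n S (While (NLess (nreg 5) (nreg 1)) (Seq (rset 5 M) (ninc 5))) s (d * 100 + 20) (J d)" if "J 0 s" for s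
  proof (rule runs_mono[OF runs_While[where I = J and m = d and k = 80]])
    show "J 0 s" by fact
    show "bval s (NLess (nreg 5) (nreg 1)) \<and> runs n S (Seq (rset 5 M) (ninc 5)) s 80 (J (Suc i))" if "i < d" "J i s" for i s
    proof
      show "bval s (NLess (nreg 5) (nreg 1))" using that by (simp add: J_def)
      have v: "J (Suc i) (s\<lparr>rmem := (rmem s)(nval s (NAdd (nreg 0) (NConst 5)) := rval s M),
          nmem := (nmem s)(5 := Suc i)\<rparr>)"
        using that rvM[OF that(2)] by (simp add: J_def F_def)
      show "runs n S (Seq (rset 5 M) (ninc 5)) s 80 (J (Suc i))"
        by (rule runs_mono[OF runs_Seq[OF runs_RStore[OF runs_NStore[where Q = "J (Suc i)"]]]])
          (use v that rcM in \<open>simp_all add: J_def\<close>)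
    qed
    show "\<not> bval s (NLess (nreg 5) (nreg 1))" if "J d s" for s using that by (simp add: J_def)
  qed auto
  let ?Q = "\<lambda>s. nmem s 0 = n \<and> nmem s 1 = d \<and>
    nmem s 8 = 0 \<and> nmem s 9 = n + 6 \<and> nmem s 14 = 0 \<and> nmem s 15 = 0 \<and> drawn s = 0 \<and>
    rmem s (n + 5) = real (n + d) ^ (5 * d)"
  have e: "runs n S (nset 9 (NAdd (nreg 0) (NConst 6))) s 10 ?Q" if "J d s" for s
    by (rule runs_mono[OF runs_NStore[where Q = ?Q]]) (use that in \<open>simp_all add: J_def F_def\<close>)
  have l3: "runs n S (Seq (While (NLess (nreg 5) (nreg 1)) (Seq (rset 5 M) (ninc 5))) (nset 9 (NAdd (nreg 0) (NConst 6)))) s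
      (d * 100 + 20 + 10) ?Q" if "J 0 s" for s
    by (rule runs_Seq'[OF l2[OF that] e])
  have l4: "runs n S (Seq (rset 5 (RConst 1)) (Seq (nset 5 (NConst 0)) (Seq (While (NLess (nreg 5) (nreg 1)) (Seq (rset 5 M) (ninc 5)))
       (nset 9 (NAdd (nreg 0) (NConst 6)))))) s (d * 100 + 50) ?Q" if "I d s" for s
  proof -
    have v: "J 0 (s\<lparr>rmem := (rmem s)(n + 5 := 1), nmem := (nmem s)(5 := 0)\<rparr>)" using that by (simp add: I_def J_def F_def)
    have nv: "nval s (NAdd (nreg 0) (NConst 5)) = n + 5" using that by (simp add: I_def F_def)
    show ?thesis
      by (rule runs_mono[OF runs_Seq[OF runs_RStore[OF runs_Seq[OF runs_NStore[where Q = "\<lambda>s2. runs n S _ s2 _ _"]]]]], rule l3)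
        (use v nv in \<open>simp_all add: of_rat_1\<close>)
  qed
  show ?thesis
    unfolding init_prog_def T_def[symmetric] M_def[symmetric]
    by (rule runs_mono[OF runs_Seq'[OF l1 l4]]) simp_all
qed

lemma train_prog_runs:
  fixes n :: nat and r \<epsilon> :: real and f :: "vect \<Rightarrow> bool" and \<omega> :: "nat \<Rightarrow> vect"
  defines "d \<equiv> degree_of (r / \<epsilon>)"
  defines "N \<equiv> (n + d) ^ (10 * d)" and "U \<equiv> real (n + d) ^ (5 * d)"
  defines "b \<equiv> snd (best_run (\<lambda>j. num_correct n d U f N j (drop_samples (j * (2 * N)) \<omega>)) d)"
  assumes n: "1 \<le> n" and d: "1 \<le> d"
  shows "runs n (labeled_by f \<omega>) train_prog (initial_store n r \<epsilon>) (2000 * (n + d + 1) * (d + 1) * (N + 1) * (N + 1))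
    (model_at (run_base n N b) n d U f N b (drop_samples (b * (2 * N)) \<omega>))"
proof -
  have U: "real N = U * U" by (simp add: N_def U_def flip: power_add)
  let ?A = "(n + d + 1) * (N + 1) * (N + 1)"
  let ?k = "1300 * (n + d + 1) * (N + 1) * (N + 1)"
  have loop: "runs n (labeled_by f \<omega>) (While (NLess (nreg 8) (nreg 1)) run_prog) s (d * (?k + 10) + 10) (outer_inv n d N U f \<omega> d)"
    if "nmem s 0 = n \<and> nmem s 1 = d \<and>
    nmem s 8 = 0 \<and> nmem s 9 = n + 6 \<and> nmem s 14 = 0 \<and> nmem s 15 = 0 \<and> drawn s = 0 \<and>
    rmem s (n + 5) = real (n + d) ^ (5 * d)" for s
  proof (rule runs_mono[OF runs_While[where I = "outer_inv n d N U f \<omega>" and m = d and k = ?k]])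
    show "outer_inv n d N U f \<omega> 0 s"
      using that unfolding U_def[symmetric] by (simp add: outer_inv_def[OF U] run_base_def[OF U] best_before_def[OF U])
    show "bval s (NLess (nreg 8) (nreg 1)) \<and> runs n (labeled_by f \<omega>) run_prog s ?k (outer_inv n d N U f \<omega> (Suc i))"
      if i: "i < d" "outer_inv n d N U f \<omega> i s" for i s
      using i(1) run_prog_runs[OF U i(2)] i(2) by (auto simp: outer_inv_def[OF U])
    show "\<not> bval s (NLess (nreg 8) (nreg 1))" if "outer_inv n d N U f \<omega> d s" for s
      using that by (simp add: outer_inv_def[OF U])
    have "bcost (NLess (nreg 8) (nreg 1)) = 5" by simp
    moreover have "d * (1 + 5 + k) + 1 + 5 \<le> d * (k + 10) + 10" for k
      by (simp add: add_mult_distrib2)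
    ultimately show "d * (1 + bcost (NLess (nreg 8) (nreg 1)) + ?k) + 1 + bcost (NLess (nreg 8) (nreg 1)) \<le> d * (?k + 10) + 10"
      by (simp only:)
  qed
  have b: "b = snd (best_before n d N U f \<omega> d)" by (simp add: b_def best_before_def[OF U])
  have bd: "b < d" unfolding b_def using d by (intro best_run) simp
  let ?Q = "model_at (run_base n N b) n d U f N b (drop_samples (b * (2 * N)) \<omega>)"
  have fin: "runs n (labeled_by f \<omega>) (Seq (nset 2 (nreg 11)) (nset 8 (nreg 15))) s 20 ?Q"
    if s: "outer_inv n d N U f \<omega> d s" for s
  proof -
    have st: "stored n (run_base n N b) N (drop_samples (b * (2 * N)) \<omega>)
        (average_coeffs n d U f N (drop_samples (b * (2 * N)) \<omega>)) (rmem s)"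
      using s bd by (simp add: outer_inv_def[OF U])
    have r: "nmem s 0 = n" "nmem s 1 = d" "nmem s 7 = N" "nmem s 11 = run_base n N b" "nmem s 15 = b"
      using s d by (simp_all add: outer_inv_def[OF U] b)
    have "n + 6 \<le> run_base n N b" by (simp add: run_base_def[OF U])
    then show ?thesis
      by (intro runs_mono[OF runs_Seq[OF runs_NStore[OF runs_NStore[where Q = ?Q]]]]) (use r st in \<open>simp_all add: model_at_def\<close>)
  qed
  have cost: "200 * (d + 1) + (d * (?k + 10) + 10 + 20) \<le> 2000 * (n + d + 1) * (d + 1) * (N + 1) * (N + 1)"
  proof -
    have "1 * 1 * 1 \<le> ?A" by (intro mult_mono) auto
    then have 1: "d + 1 \<le> (d + 1) * ?A" using mult_left_mono[of 1 ?A "d + 1"] by simp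
    have 2: "d * ?A \<le> (d + 1) * ?A" by (intro mult_right_mono) auto
    have 3: "d * (?k + 10) = 1300 * (d * ?A) + 10 * d" by (simp add: algebra_simps)
    have "200 * (d + 1) + (y + 10 + 20) \<le> 2000 * z" if "d + 1 \<le> z" "x \<le> z" "y = 1300 * x + 10 * d" for x y z :: nat
      unfolding that(3) using that(1,2) by simp
    from this[OF 1 2 3] have "200 * (d + 1) + (d * (?k + 10) + 10 + 20) \<le> 2000 * ((d + 1) * ?A)" .
    also have "\<dots> = 2000 * (n + d + 1) * (d + 1) * (N + 1) * (N + 1)" by (simp only: ac_simps)
    finally show ?thesis .
  qed
  show ?thesis
    unfolding train_prog_def
    by (rule runs_mono[OF runs_Seq'[OF init_prog_runs[OF n, where r = r and \<epsilon> = \<epsilon> and S = "labeled_by f \<omega>", folded d_def] runs_Seq'[OF loop fin]] cost])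
qed

lemma measurable_best_run:
  assumes c: "\<And>j. (\<lambda>w. real (c j w)) \<in> borel_measurable M"
  shows "(\<lambda>w. best_run (\<lambda>j. c j w) d) \<in> measurable M (count_space UNIV)"
proof (induction d)
  case (Suc d)
  \<comment> \<open>The counts are given as measurable real functions; the floor brings them back to
    the naturals.\<close>
  have "(\<lambda>w. nat \<lfloor>real (c d w)\<rfloor>) \<in> measurable M (count_space UNIV)"
    by (rule measurable_compose[OF measurable_compose[OF c measurable_real_floor]]) simp
  then have cn: "c d \<in> measurable M (count_space UNIV)" by simp
  have [measurable]: "(\<lambda>w. real (fst (best_run (\<lambda>j. c j w) d))) \<in> borel_measurable M"
    by (rule measurable_compose[OF Suc]) simp
  have "{w \<in> space M. real (c d w) < real (fst (best_run (\<lambda>j. c j w) d))} \<in> sets M"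
    using c[of d] by measurable
  moreover have "(\<lambda>w. (c d w, d)) \<in> measurable M (count_space UNIV)"
    by (rule measurable_compose[OF cn]) simp
  ultimately show ?case
    by (simp only: best_run.simps of_nat_less_iff) (rule measurable_If[OF Suc])
qed simp

text \<open>By determinism the final store in the definition of \<open>success\<close> is the one
  from \<open>train_prog_runs\<close>, so the success set is the event of
  \<open>learner_success\<close> with \<open>sel\<close> the index of the best run.\<close>

lemma learner_correct:
  fixes n :: nat and r \<epsilon> :: real and f :: "vect \<Rightarrow> bool"
  defines "d \<equiv> degree_of (r / \<epsilon>)"
  defines "N \<equiv> (n + d) ^ (10 * d)"
  assumes f: "boolean_function n f" and n: "1 \<le> n" and r: "1 \<le> r" and \<epsilon>: "0 < \<epsilon>" "\<epsilon> < 1 / 2" and d: "1 \<le> d"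
    and B: "real (2000 * (n + d + 1) * (d + 1) * (N + 1) * (N + 1)) \<le> B"
  shows "runs_in_time n r \<epsilon> f train_prog predict_prog B"
    and "9 / 10 \<le> measure (sample_space n) (success n r \<epsilon> f train_prog predict_prog)"
proof -
  define U where "U = real (n + d) ^ (5 * d)"
  define c where "c j \<omega> = num_correct n d U f N j (drop_samples (j * (2 * N)) \<omega>)" for j \<omega>
  define sel where "sel \<omega> = snd (best_run (\<lambda>j. c j \<omega>) d)" for \<omega>
  define h where "h \<omega> = sgd_hypothesis n d U f N (sel \<omega>) (drop_samples (sel \<omega> * (2 * N)) \<omega>)" for \<omega>
  have tr: "\<exists>t s. trained n r \<epsilon> f \<omega> train_prog t s \<and> real t \<le> B \<and> hypothesis n predict_prog s = h \<omega> \<and>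
      (\<forall>x. \<exists>t' y. predicts n predict_prog s x t' y \<and> real t' \<le> B)" for \<omega>
  proof -
    obtain t s where t: "trained n r \<epsilon> f \<omega> train_prog t s" "t \<le> 2000 * (n + d + 1) * (d + 1) * (N + 1) * (N + 1)"
      and m: "model_at (run_base n N (sel \<omega>)) n d U f N (sel \<omega>) (drop_samples (sel \<omega> * (2 * N)) \<omega>) s"
      using train_prog_runs[OF n d[unfolded d_def], where f = f and \<omega> = \<omega>]
      unfolding runs_def trained_def sel_def c_def U_def N_def d_def by blast
    have "hypothesis n predict_prog s = h \<omega>"
      unfolding h_def by (rule ext) (rule predictsI(2)[OF m])
    moreover have "\<exists>t' y. predicts n predict_prog s x t' y \<and> real t' \<le> B" for x
    proof -
      obtain t' y where p: "predicts n predict_prog s x t' y" "t' \<le> 300 * (n + d + 1) * (N + 1) + 50"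
        using predictsI(1)[OF m, of x] by blast
      define A where "A = (n + d + 1) * (N + 1)"
      have "1 * 1 \<le> A" unfolding A_def by (intro mult_mono) auto
      have "A * (1 * 1) \<le> A * ((d + 1) * (N + 1))" by (intro mult_left_mono mult_mono) auto
      have "t' \<le> 300 * A + 50" using p(2) unfolding A_def by (simp only: mult.assoc)
      also have "\<dots> \<le> 2000 * (A * ((d + 1) * (N + 1)))" using \<open>1 * 1 \<le> A\<close> \<open>A * (1 * 1) \<le> A * ((d + 1) * (N + 1))\<close> by linarith
      also have "\<dots> = 2000 * (n + d + 1) * (d + 1) * (N + 1) * (N + 1)" unfolding A_def by (simp only: ac_simps)
      finally have "real t' \<le> B" using B by (meson of_nat_mono order_trans)
      then show ?thesis using p(1) by blast
    qed
    moreover have "real t \<le> B" using t(2) B by (meson of_nat_mono order_trans)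
    ultimately show ?thesis using t(1) by blast
  qed
  then show "runs_in_time n r \<epsilon> f train_prog predict_prog B"
    unfolding runs_in_time_def by blast
  have cm: "(\<lambda>\<omega>. real (c j \<omega>)) \<in> borel_measurable (sample_space n)" for j
    unfolding c_def by (intro measurable_num_correct[OF f] measurable_drop_samples) simp
  have selm: "sel \<in> measurable (sample_space n) (count_space UNIV)"
    unfolding sel_def[abs_def] by (rule measurable_compose[OF measurable_best_run[OF cm]]) simp
  have sel: "sel \<omega> < d" "j < d \<Longrightarrow> c j \<omega> \<le> c (sel \<omega>) \<omega>" for \<omega> j
    unfolding sel_def using d by (auto intro!: best_run)
  have dR: "2 ^ 32 * (r / \<epsilon>) ^ 3 \<le> real d"
    using less_degree_of[of d "r / \<epsilon>"] unfolding d_def[symmetric] degree_target_def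
    by (simp add: power3_eq_cube mult.assoc)
  have hyp: "boolean_function n (h \<omega>)" if "\<omega> \<in> space (sample_space n)" for \<omega>
    unfolding h_def using that
    by (intro pred_sgd_hypothesis[OF f, where h = "\<lambda>x. x"] measurable_drop_samples measurable_const) auto
  have "success n r \<epsilon> f train_prog predict_prog = {\<omega> \<in> space (sample_space n). dist_G n f (h \<omega>) \<le> OPT n r f + \<epsilon>}"
  proof (intro set_eqI iffI)
    fix \<omega> assume "\<omega> \<in> success n r \<epsilon> f train_prog predict_prog"
    then obtain t s where \<omega>: "\<omega> \<in> space (sample_space n)" and t: "trained n r \<epsilon> f \<omega> train_prog t s"
      and e: "dist_G n f (hypothesis n predict_prog s) \<le> OPT n r f + \<epsilon>"
      unfolding success_def by blast
    obtain t' s' where "trained n r \<epsilon> f \<omega> train_prog t' s'" "hypothesis n predict_prog s' = h \<omega>"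
      using tr[of \<omega>] by blast
    moreover have "s' = s" using exec_deterministic t calculation(1) unfolding trained_def by blast
    ultimately show "\<omega> \<in> {\<omega> \<in> space (sample_space n). dist_G n f (h \<omega>) \<le> OPT n r f + \<epsilon>}"
      using \<omega> e by simp
  next
    fix \<omega> assume "\<omega> \<in> {\<omega> \<in> space (sample_space n). dist_G n f (h \<omega>) \<le> OPT n r f + \<epsilon>}"
    then have \<omega>: "\<omega> \<in> space (sample_space n)" "dist_G n f (h \<omega>) \<le> OPT n r f + \<epsilon>" by simp_all
    obtain t s where "trained n r \<epsilon> f \<omega> train_prog t s" and s: "hypothesis n predict_prog s = h \<omega>"
      using tr[of \<omega>] by blast
    moreover have "boolean_function n (hypothesis n predict_prog s)" "dist_G n f (hypothesis n predict_prog s) \<le> OPT n r f + \<epsilon>"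
      unfolding s using \<omega>(2) hyp[OF \<omega>(1)] by blast+
    ultimately show "\<omega> \<in> success n r \<epsilon> f train_prog predict_prog"
      unfolding success_def using \<omega>(1) by blast
  qed
  then show "9 / 10 \<le> measure (sample_space n) (success n r \<epsilon> f train_prog predict_prog)"
    using learner_success(2)[OF f n r \<epsilon> dR U_def N_def[THEN meta_eq_to_obj_eq] selm sel(1) sel(2)[unfolded c_def]] unfolding h_def by simp
qed


section \<open>The bounds on the running time\<close>

text \<open>The logarithm at \<open>\<epsilon> / 2\<close> is at least 1 because
  \<open>2 / \<epsilon> \<ge> 4\<close>, and at most \<open>2 * ln (1 / \<epsilon>)\<close> because
  \<open>2 / \<epsilon> \<le> 1 / \<epsilon>^2\<close>. The factor 4 is the squared half from the
  denominator of \<open>alpha\<close>.\<close>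

lemma ln_alpha:
  assumes "0 < \<epsilon>" "\<epsilon> < 1 / 2"
  obtains L where "L = ln (1 / (\<epsilon> / 2))" "1 \<le> L" "L \<le> 2 * ln (1 / \<epsilon>)"
    "ln (alpha 1 r (\<epsilon> / 2)) / \<epsilon> ^ 4 = 4 * (L * (r + sqrt L) ^ 4) / \<epsilon> ^ 6"
proof
  let ?L = "ln (1 / (\<epsilon> / 2))"
  have "exp 1 \<le> (4 :: real)" using exp_le by simp
  moreover have "4 \<le> 1 / (\<epsilon> / 2)" using assms by (simp add: field_simps)
  ultimately have "exp 1 \<le> 1 / (\<epsilon> / 2)" by linarith
  then show "1 \<le> ?L" using assms by (simp add: ln_ge_iff)
  have "1 / (\<epsilon> / 2) \<le> (1 / \<epsilon>) ^ 2" using assms by (simp add: field_simps power2_eq_square)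
  then have "?L \<le> ln ((1 / \<epsilon>) ^ 2)" using assms by (subst ln_le_cancel_iff) auto
  then show "?L \<le> 2 * ln (1 / \<epsilon>)" using assms by (simp add: ln_realpow)
  show "ln (alpha 1 r (\<epsilon> / 2)) / \<epsilon> ^ 4 = 4 * (?L * (r + sqrt ?L) ^ 4) / \<epsilon> ^ 6"
    using assms by (simp add: alpha_def field_simps power2_eq_square eval_nat_numeral)
qed simp

text \<open>The exponent has \<open>\<epsilon>^6\<close> in its denominator where
  \<open>(r / \<epsilon>)^4\<close> has only \<open>\<epsilon>^4\<close>; this surplus and all
  logarithms are given away.\<close>

lemma ln_alpha_ge:
  assumes r: "1 \<le> r" and \<epsilon>: "0 < \<epsilon>" "\<epsilon> < 1 / 2"
  shows "(r / \<epsilon>) ^ 4 \<le> ln (alpha 1 r (\<epsilon> / 2)) / \<epsilon> ^ 4"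
proof -
  obtain L where L: "1 \<le> L" and e: "ln (alpha 1 r (\<epsilon> / 2)) / \<epsilon> ^ 4 = 4 * (L * (r + sqrt L) ^ 4) / \<epsilon> ^ 6"
    using ln_alpha[OF \<epsilon>] by metis
  have "\<epsilon> ^ 2 \<le> 1" using \<epsilon> by (simp add: power_le_one)
  then have "r ^ 4 * \<epsilon> ^ 2 \<le> r ^ 4 * 1" using r by (intro mult_left_mono) auto
  also have "r ^ 4 * 1 \<le> (r + sqrt L) ^ 4 * 1" using r L by (intro mult_right_mono power_mono) auto
  also have "\<dots> \<le> (r + sqrt L) ^ 4 * (4 * L)" using r L by (intro mult_left_mono) auto
  finally have "r ^ 4 * \<epsilon> ^ 2 / \<epsilon> ^ 6 \<le> (r + sqrt L) ^ 4 * (4 * L) / \<epsilon> ^ 6"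
    using \<epsilon> by (intro divide_right_mono) auto
  moreover have "r ^ 4 * \<epsilon> ^ 2 / \<epsilon> ^ 6 = (r / \<epsilon>) ^ 4" using \<epsilon> by (simp add: power_divide eval_nat_numeral)
  ultimately show ?thesis unfolding e by (simp add: ac_simps)
qed

text \<open>One logarithm comes from the factor \<open>L\<close> and two from the fourth power of
  \<open>sqrt L\<close>, whence the cube. As \<open>r + sqrt L\<close> is at most
  \<open>2 * r * sqrt X\<close>, the constant is \<open>4 * 2^4\<close>.\<close>

lemma ln_alpha_le:
  assumes r: "1 \<le> r" and \<epsilon>: "0 < \<epsilon>" "\<epsilon> < 1 / 2"
  shows "ln (alpha 1 r (\<epsilon> / 2)) / \<epsilon> ^ 4 \<le> 64 * (r ^ 4 / \<epsilon> ^ 6 * ln (r ^ 4 / \<epsilon> ^ 6) ^ 3)"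
proof -
  obtain L where L: "1 \<le> L" "L \<le> 2 * ln (1 / \<epsilon>)"
    and e: "ln (alpha 1 r (\<epsilon> / 2)) / \<epsilon> ^ 4 = 4 * (L * (r + sqrt L) ^ 4) / \<epsilon> ^ 6"
    using ln_alpha[OF \<epsilon>] by metis
  define X where "X = ln (r ^ 4 / \<epsilon> ^ 6)"
  have "X = 4 * ln r + 6 * ln (1 / \<epsilon>)"
    unfolding X_def using r \<epsilon> by (simp add: ln_div ln_realpow)
  then have X: "L \<le> X" "1 \<le> X" using L ln_ge_zero[OF r] by linarith+
  have "r + sqrt L \<le> r * sqrt X + r * sqrt X"
  proof (rule add_mono)
    show "r \<le> r * sqrt X" using r X by simp
    show "sqrt L \<le> r * sqrt X"
      using mult_mono[OF r real_sqrt_le_mono[OF X(1)]] r L by simp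
  qed
  then have "(r + sqrt L) ^ 4 \<le> (2 * r * sqrt X) ^ 4" using r L by (intro power_mono) auto
  also have "\<dots> = 16 * r ^ 4 * (sqrt X ^ 2) ^ 2" by (simp add: power_mult_distrib flip: power_mult)
  also have "\<dots> = 16 * r ^ 4 * X ^ 2" using X by simp
  finally have "L * (r + sqrt L) ^ 4 \<le> X * (16 * r ^ 4 * X ^ 2)"
    using X L r by (intro mult_mono) auto
  then have "4 * (L * (r + sqrt L) ^ 4) / \<epsilon> ^ 6 \<le> 4 * (X * (16 * r ^ 4 * X ^ 2)) / \<epsilon> ^ 6"
    using \<epsilon> by (intro divide_right_mono mult_left_mono) auto
  also have "\<dots> = 64 * (r ^ 4 / \<epsilon> ^ 6 * X ^ 3)" by (simp add: eval_nat_numeral)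
  finally show ?thesis unfolding e X_def .
qed

text \<open>The time is at most \<open>Q^(21 * d)\<close> with \<open>Q = n + d\<close>, so its
  logarithm is of order \<open>R^3 * (ln m + ln d)\<close>. Bounding \<open>ln d\<close> by a linear
  function of \<open>R\<close> is affordable, as the target is \<open>R^4\<close>. The base
  \<open>max n 2\<close> keeps \<open>ln m\<close> away from 0, so that constants can be absorbed
  even for \<open>n = 1\<close>.\<close>

lemma time_bound:
  fixes n :: nat and R :: real
  defines "d \<equiv> degree_of R"
  defines "N \<equiv> (n + d) ^ (10 * d)"
  assumes n: "1 \<le> n" and R: "2 \<le> R"
  shows "1 \<le> d"
    and "real (2000 * (n + d + 1) * (d + 1) * (N + 1) * (N + 1)) \<le> real (max n 2) powr (2 ^ 43 * R ^ 4)"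
proof -
  define Q where "Q = real (n + d)"
  define m where "m = real (max n 2)"
  have T: "degree_target R = 2 ^ 32 * R ^ 3" by (simp add: degree_target_def power3_eq_cube)
  have R3: "1 \<le> R ^ 3" using R by (simp add: one_le_power)
  have d_ge: "2 ^ 32 * R ^ 3 \<le> real d" using less_degree_of[of d R] unfolding d_def[symmetric] T by simp
  moreover have "2 ^ 32 * 1 \<le> 2 ^ 32 * R ^ 3" using R3 by (intro mult_left_mono) auto
  ultimately have d32: "2 ^ 32 \<le> real d" unfolding mult_1_right by (meson order_trans)
  then show d1: "1 \<le> d" by simp
  have "real (d - 1) < 2 ^ 32 * R ^ 3" using less_degree_of[of "d - 1" R] d1 unfolding d_def[symmetric] T by simp
  then have d_le: "real d \<le> 2 ^ 33 * R ^ 3" using R3 d1 by (simp add: of_nat_diff)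
  have Q: "2 ^ 32 \<le> Q" "real d \<le> Q" using d32 by (simp_all add: Q_def)
  have d3: "3 \<le> d" using d32 by simp
  have QN: "1 \<le> Q ^ (10 * d)" using Q by (simp add: one_le_power)
  have N: "real N = Q ^ (10 * d)" by (simp add: N_def Q_def)
  have "real (2000 * (n + d + 1) * (d + 1) * (N + 1) * (N + 1)) =
      2000 * (Q + 1) * (real d + 1) * (Q ^ (10 * d) + 1) * (Q ^ (10 * d) + 1)"
    by (simp only: of_nat_mult of_nat_add of_nat_1 of_nat_numeral N Q_def)
  also have "\<dots> \<le> 2000 * (2 * Q) * (2 * Q) * (2 * Q ^ (10 * d)) * (2 * Q ^ (10 * d))"
    using Q QN by (intro mult_mono) auto
  also have "\<dots> = 32000 * (Q ^ 2 * Q ^ (20 * d))"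
    by (simp add: power2_eq_square flip: power_add)
  also have "\<dots> \<le> Q * (Q ^ 2 * Q ^ (20 * d))"
    using Q by (intro mult_right_mono) auto
  also have "\<dots> = Q ^ (3 + 20 * d)" by (simp add: power_add power2_eq_square power3_eq_cube)
  also have "\<dots> \<le> Q ^ (21 * d)" using Q d3 by (intro power_increasing) auto
  also have "\<dots> = exp (21 * real d * ln Q)"
    using Q by (simp add: exp_of_nat_mult[of "21 * d", simplified])
  also have "\<dots> \<le> exp (2 ^ 43 * R ^ 4 * ln m)"
  proof -
    have m: "2 \<le> m" "real n \<le> m" by (simp_all add: m_def)
    \<comment> \<open>Expanded, this reads \<open>m + d \<le> m * d\<close>, which separates
      \<open>n\<close> from \<open>d\<close> under the logarithm.\<close>
    have "(m - 1) * (real d - 1) \<ge> 1 * 1" using m d32 by (intro mult_mono) auto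
    then have "Q \<le> m * real d" using m by (simp add: Q_def algebra_simps)
    moreover have "0 < Q" "0 < m" "0 < real d" using Q m d1 by auto
    ultimately have "ln Q \<le> ln (m * real d)" by (subst ln_le_cancel_iff) auto
    then have lnQ: "ln Q \<le> ln m + ln (real d)" using \<open>0 < m\<close> \<open>0 < real d\<close> by (simp add: ln_mult)
    have lm: "1 / 2 \<le> ln m"
    proof -
      have "1 / 2 \<le> ln (2 :: real)" using ln2_ge_two_thirds by simp
      also have "\<dots> \<le> ln m" using m by simp
      finally show ?thesis .
    qed
    have "ln (real d) \<le> ln (2 ^ 33 * R ^ 3)" using d_le d1 R by (subst ln_le_cancel_iff) auto
    also have "\<dots> = ln (2 ^ 33) + ln (R ^ 3)" using R by (intro ln_mult_pos) auto
    also have "\<dots> = 33 * ln 2 + 3 * ln R" using R ln_realpow[of 2 33] ln_realpow[of R 3] by linarith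
    also have "\<dots> \<le> 33 + 3 * R"
      using ln_le_minus_one[of "2::real"] ln_le_minus_one[of R] R by simp
    finally have ld: "ln (real d) \<le> 33 + 3 * R" .
    have "ln Q \<le> ln m + (33 + 3 * R)" using lnQ ld by linarith
    also have "33 + 3 * R \<le> (33 + 3 * R) * (2 * ln m)"
      using mult_left_mono[of 1 "2 * ln m" "33 + 3 * R"] lm R by simp
    finally have "ln Q \<le> (67 + 6 * R) * ln m" by (simp add: algebra_simps)
    also have "\<dots> \<le> (40 * R) * ln m" using R lm by (intro mult_right_mono) auto
    finally have "21 * real d * ln Q \<le> 21 * (2 ^ 33 * R ^ 3) * ((40 * R) * ln m)"
      using d_le Q R by (intro mult_mono) auto
    also have "\<dots> = 21 * 2 ^ 33 * 40 * (R ^ 4 * ln m)" by (simp add: eval_nat_numeral)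
    \<comment> \<open>\<open>21 * 40 = 840\<close> is below \<open>2 ^ 10\<close>.\<close>
    also have "\<dots> \<le> 2 ^ 43 * (R ^ 4 * ln m)" using R lm by (intro mult_right_mono) auto
    finally show ?thesis by (simp add: mult.assoc)
  qed
  also have "\<dots> = m powr (2 ^ 43 * R ^ 4)" by (simp add: powr_def m_def)
  finally show "real (2000 * (n + d + 1) * (d + 1) * (N + 1) * (N + 1)) \<le> real (max n 2) powr (2 ^ 43 * R ^ 4)"
    unfolding m_def .
qed

theorem corollary17:
  "\<exists>C>0.
     (\<exists>c>0. \<exists>train predict. \<forall>(n::nat) (r::real) (\<epsilon>::real) f.
        1 \<le> n \<and> 1 \<le> r \<and> 0 < \<epsilon> \<and> \<epsilon> < 1/2 \<and> boolean_function n f \<longrightarrow>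
          runs_in_time n r \<epsilon> f train predict
            (real (max n 2) powr (c * (ln (alpha C r (\<epsilon>/2)) / \<epsilon>^4))) \<and>
          measure (sample_space n) (success n r \<epsilon> f train predict) \<ge> 9/10) \<and>
     (\<exists>c>0. \<exists>k::nat. \<forall>(r::real) (\<epsilon>::real). 1 \<le> r \<and> 0 < \<epsilon> \<and> \<epsilon> < 1/2 \<longrightarrow>
        ln (alpha C r (\<epsilon>/2)) / \<epsilon>^4 \<le> c * (r^4 / \<epsilon>^6 * ln (r^4 / \<epsilon>^6) ^ k))"
proof -
  have "runs_in_time n r \<epsilon> f train_prog predict_prog (real (max n 2) powr (2 ^ 43 * (ln (alpha 1 r (\<epsilon>/2)) / \<epsilon>^4))) \<and>
      measure (sample_space n) (success n r \<epsilon> f train_prog predict_prog) \<ge> 9/10"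
    if "1 \<le> n" "1 \<le> r" "0 < \<epsilon>" "\<epsilon> < 1/2" "boolean_function n f" for n r \<epsilon> f
  proof -
    have R: "2 \<le> r / \<epsilon>" using that by (simp add: field_simps)
    have "real (max n 2) powr (2 ^ 43 * (r / \<epsilon>) ^ 4) \<le> real (max n 2) powr (2 ^ 43 * (ln (alpha 1 r (\<epsilon>/2)) / \<epsilon>^4))"
      using ln_alpha_ge[OF that(2-4)] by (intro powr_mono mult_left_mono) auto
    from learner_correct[OF that(5,1-4) time_bound(1)[OF that(1) R] order_trans[OF time_bound(2)[OF that(1) R] this]]
    show ?thesis by simp
  qed
  \<comment> \<open>The witnesses: \<open>C = 1\<close>, \<open>c = 2 ^ 43\<close> for the running
    time, and \<open>c = 64\<close> with \<open>k = 3\<close> for the comparison with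
    \<open>r^4 / \<epsilon>^6\<close>.\<close>
  moreover have "0 < (2 ^ 43 :: real)" "0 < (64 :: real)" "0 < (1 :: real)" by simp_all
  ultimately show ?thesis using ln_alpha_le by blast
qed

end
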